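(* Assume the setting and the hypotheses (H-spaces), (H-diss), (H-energy), (H-closed), (H-slope) and (H-chain-param) described in the context, with $\alpha>0$ fixed. Let $(\varepsilon_k)_k\subset(0,\infty)$ be a null sequence, let $q_{\varepsilon_k}\in \mathrm{AC}([0,T];\mathbf Q)$ be viscous solutions with parameter $\varepsilon_k$ such that $q_{\varepsilon_k}(0)\to q_0$ in $\mathbf Q$ and $\mathcal E(0,q_{\varepsilon_k}(0))\to\mathcal E(0,q_0)$ for some $q_0\in\mathrm D$, and let $\mathsf t_{\varepsilon_k}:[0,\mathsf S]\to[0,T]$ be non-decreasing, surjective, absolutely continuous time-rescalings such that $\mathsf q_{\varepsilon_k}=(\mathsf u_{\varepsilon_k},\mathsf z_{\varepsilon_k}):=q_{\varepsilon_k}\circ\mathsf t_{\varepsilon_k}$ satisfies, with $C>0$ independent of $k$, for all $k$ and a.a. $s\in(0,\mathsf S)$, $$\mathsf t_{\varepsilon_k}'(s)+\mathfrak M^\alpha_{\varepsilon_k}\big(\mathsf t_{\varepsilon_k}(s),\mathsf q_{\varepsilon_k}(s),\mathsf t_{\varepsilon_k}'(s),\mathsf q_{\varepsilon_k}'(s)\big)+\|\mathsf u_{\varepsilon_k}'(s)\|_{\mathbf U}\le C\qquad\text{and}\qquad \|\mathsf z_{\varepsilon_k}'(s)\|_{\mathbf Z}\le C .$$ Then, up to a (not relabeled) subsequence, the curves $(\mathsf t_{\varepsilon_k},\mathsf q_{\varepsilon_k})_k$ converge to an admissible parametrized curve $(\mathsf t,\mathsf q)=(\mathsf t,\mathsf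 u,\mathsf z)\in\mathscr A([0,\mathsf S];[0,T]\times\mathbf Q)$ such that: (1) $\mathsf t$ is Lipschitz from $[0,\mathsf S]$ to $[0,T]$; $\mathsf q$ is weakly continuous into $\mathbf U_{\rm e}\times\mathbf Z_{\rm e}$; $\mathsf u$ is Lipschitz into $\mathbf U$; $\mathsf z$ is Lipschitz into $\mathbf Z_{\rm ri}$ and, additionally, $\mathsf z$ is Lipschitz into $\mathbf Z$; (2) $\mathsf t_{\varepsilon_k}\to\mathsf t$ in $C^0([0,\mathsf S])$; $\mathsf u_{\varepsilon_k}\overset{*}{\rightharpoonup}\mathsf u$ in $W^{1,\infty}(0,\mathsf S;\mathbf U)$; $\mathsf z_{\varepsilon_k}\to\mathsf z$ in $C^0([0,\mathsf S];\mathbf Z)$; $\mathsf u_{\varepsilon_k}(s)\rightharpoonup\mathsf u(s)$ in $\mathbf U_{\rm e}$ and $\mathsf z_{\varepsilon_k}(s)\rightharpoonup\mathsf z(s)$ in $\mathbf Z_{\rm e}$ for all $s\in[0,\mathsf S]$; (3) $\mathcal E(\mathsf t_{\varepsilon_k}(s),\mathsf q_{\varepsilon_k}(s))\to\mathcal E(\mathsf t(s),\mathsf q(s))$ for all $s\in[0,\mathsf S]$ and $\int_{s_1}^{s_2}\mathfrak M^\alpha_{\varepsilon_k}(\mathsf t_{\varepsilon_k},\mathsf q_{\varepsilon_k},\mathsf t_{\varepsilon_k}',\mathsf q_{\varepsilon_k}')\,d\sigma\to\int_{s_1}^{s_2}\mathfrak M^\alpha_0[\mathsf t,\mathsf q,\mathsf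 t',\mathsf q'](\sigma)\,d\sigma$ for all $0\le s_1\le s_2\le\mathsf S$. In particular $(\mathsf t,\mathsf q)$ is an enhanced pBV solution.
   Context: (H-spaces) $\mathbf U,\mathbf Z$ are separable reflexive Banach spaces, $\mathbf Q=\mathbf U\times\mathbf Z$, $q=(u,z)$. $\mathbf U_{\rm e},\mathbf Z_{\rm e}$ are reflexive Banach spaces with $\mathbf U_{\rm e}\subset\mathbf U$ continuously and densely, $\mathbf Z_{\rm e}\subset\mathbf Z$ compactly and densely; $\mathbf Z_{\rm ri}$ is a separable Banach space with $\mathbf Z\subset\mathbf Z_{\rm ri}$ continuously and densely. $T>0$, $\alpha>0$. (H-diss) A dissipation potential is a convex, lower semicontinuous $[0,\infty]$-valued function vanishing at $0$; $*$ denotes Legendre–Fenchel conjugation. $\mathcal V_u:\mathbf U\to[0,\infty)$, $\mathcal V_z:\mathbf Z\to[0,\infty)$ are dissipation potentials such that $\mathcal V_u,\mathcal V_u^*,\mathcal V_z,\mathcal V_z^*$ have superlinear growth at infinity and $\lim_{\lambda\to0^+}\frac1\lambda\mathcal V_x(\lambda v)=0$ for all $v$, $x\in\{u,z\}$. $\mathcal R:\mathbf Z_{\rm ri}\to[0,\infty]$ is a dissipation potential with $\mathcal R(\lambda\eta)=\lambda\mathcal R(\eta)$ for $\lambda>0$, $\mathcal R(\eta)\le C_{\mathcal R}\|\eta\|_{\mathbf Z}$ on $\mathbf Z$ and $\mathcal R(\eta)\ge c_{\mathcal R}\|\eta\|_{\mathbf Z_{\rm ri}}$ on $\mathbf Z_{\rm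 ri}$, with $C_{\mathcal R},c_{\mathcal R}>0$. $\partial\mathcal R:\mathbf Z\rightrightarrows\mathbf Z^*$ is the convex subdifferential. Set $\mathcal W_z^*(\zeta)=\min_{\sigma\in\partial\mathcal R(0)}\mathcal V_z^*(\zeta-\sigma)$. (H-energy) $\mathcal E:[0,T]\times\mathbf Q\to(-\infty,\infty]$ has domain $[0,T]\times\mathrm D$ with $\mathrm D\subset\mathbf U_{\rm e}\times\mathbf Z_{\rm e}$; $\mathcal E(t,\cdot)$ is weakly lower semicontinuous on $\mathbf Q$; $\mathcal E\ge C_0$ on $[0,T]\times\mathrm D$ for some $C_0>0$; with $\mathfrak E(q)=\sup_{t\in[0,T]}\mathcal E(t,q)$ the map $q\mapsto\mathfrak E(q)+\|q\|_{\mathbf U\times\mathbf Z_{\rm ri}}$ has sublevels bounded in $\mathbf U_{\rm e}\times\mathbf Z_{\rm e}$; for $q\in\mathrm D$, $t\mapsto\mathcal E(t,q)$ is differentiable and $|\partial_t\mathcal E(t,q)|\le C_\#\mathcal E(t,q)$. Fréchet subdifferential: $\xi\in\partial_q\mathcal E(t,q)\subset\mathbf Q^*$ iff $\mathcal E(t,\hat q)\ge\mathcal E(t,q)+\langle\xi,\hat q-q\rangle+o(\|\hat q-q\|_{\mathbf Q})$ as $\hat q\to q$; $\mathrm{dom}(\partial_q\mathcal E)=\{(t,q):\partial_q\mathcal E(t,q)\ne\emptyset\}$. (H-closed) If $t_n\to t$, $q_n\rightharpoonup q$ in $\mathbf Q$, $\xi_n\rightharpoonup\xi$ in $\mathbf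 Q^*$, $\sup_n\mathfrak E(q_n)<\infty$, $\xi_n\in\partial_q\mathcal E(t_n,q_n)$, then $\xi\in\partial_q\mathcal E(t,q)$ and $\partial_t\mathcal E(t_n,q_n)\to\partial_t\mathcal E(t,q)$. Slopes: $\mathscr S_u(t,q)=\inf\{\mathcal V_u^*(-\mu):(\mu,\zeta)\in\partial_q\mathcal E(t,q)\}$, $\mathscr S_z(t,q)=\inf\{\mathcal W_z^*(-\zeta):(\mu,\zeta)\in\partial_q\mathcal E(t,q)\}$, $\inf\emptyset=+\infty$. (H-slope) On $\mathrm{dom}(\partial_q\mathcal E)$ both infima are attained; and if $t_n\to t$, $q_n\rightharpoonup q$ in $\mathbf Q$, $\sup_n\mathfrak E(q_n)<\infty$, then $\liminf_n\mathscr S_x(t_n,q_n)\ge\mathscr S_x(t,q)$, $x\in\{u,z\}$. Viscous solution with parameter $\varepsilon>0$: $q=(u,z)\in\mathrm{AC}([0,T];\mathbf Q)$ for which there is $(\mu,\zeta)\in L^1(0,T;\mathbf U^*\times\mathbf Z^* )$ with, for a.a. $r$, $(\mu(r),\zeta(r))\in\partial_q\mathcal E(r,q(r))$, $-\mu(r)\in\partial\mathcal V_u(\varepsilon^\alpha u'(r))$, $-\zeta(r)\in\partial\mathcal R(z'(r))+\partial\mathcal V_z(\varepsilon z'(r))$, and for all $0\le s<t\le T$ $$\mathcal E(t,q(t))+\int_s^t\Big(\tfrac1{\varepsilon^\alpha}\mathcal V_u(\varepsilon^\alpha u')+\mathcal R(z')+\tfrac1\varepsilon\mathcal V_z(\varepsilon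 z')+\tfrac1{\varepsilon^\alpha}\mathcal V_u^*(-\mu)+\tfrac1\varepsilon\mathcal W_z^*(-\zeta)\Big)dr=\mathcal E(s,q(s))+\int_s^t\partial_t\mathcal E(r,q(r))\,dr.$$ M-functions: for $\varepsilon>0$, $\mathfrak M_\varepsilon^\alpha(t,q,t',q')=\frac{t'}{\varepsilon^\alpha}\mathcal V_u(\frac{\varepsilon^\alpha}{t'}u')+\frac{t'}{\varepsilon^\alpha}\mathscr S_u(t,q)+\mathcal R(z')+\frac{t'}\varepsilon\mathcal V_z(\frac\varepsilon{t'}z')+\frac{t'}\varepsilon\mathscr S_z(t,q)$ if $t'>0$ and $\partial_q\mathcal E(t,q)\ne\emptyset$, and $=\infty$ otherwise. For a dissipation potential $\psi$ set $\mathfrak b_\psi(v,\sigma)=\inf_{\tau>0}(\tau\psi(v/\tau)+\tau\sigma)$. Define $\mathfrak M_0^{\alpha,\rm red}(t,q,0,q')$, $q'=(u',z')$: if $\partial_q\mathcal E(t,q)\neq\emptyset$ (arguments $(t,q)$ of slopes omitted): for $\alpha>1$ it is $\mathfrak b_{\mathcal V_z}(z',\mathscr S_z)$ if $\mathscr S_u=0$, $\mathfrak b_{\mathcal V_u}(u',\mathscr S_u)$ if $\mathscr S_u>0$ and $z'=0$, $\infty$ otherwise; for $\alpha=1$ it is $\inf_{\tau>0}\tau(\mathcal V_u(u'/\tau)+\mathcal V_z(z'/\tau)+\mathscr S_u+\mathscr S_z)$; for $\alpha<1$ it is $\mathfrak b_{\mathcal V_u}(u',\mathscr S_u)$ if $\mathscr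 S_z=0$, $\mathfrak b_{\mathcal V_z}(z',\mathscr S_z)$ if $\mathscr S_z>0$ and $u'=0$, $\infty$ otherwise. If $\partial_q\mathcal E(t,q)=\emptyset$: it is $0$ if $q'=0$ and there are $(t_n,q_n)\in\mathrm{dom}(\partial_q\mathcal E)$ with $(t_n,q_n)\rightharpoonup(t,q)$, $\sup_n\mathfrak E(q_n)<\infty$; otherwise $\infty$. Curves: $\mathrm{AC}([a,b];\mathbf Z_{\rm ri},\mathcal R)$ is the set of $z:[a,b]\to\mathbf Z_{\rm ri}$ with $\mathcal R(z(s_2)-z(s_1))\le\int_{s_1}^{s_2}m\,ds$ for all $s_1\le s_2$, some $0\le m\in L^1(a,b)$; $\mathcal R[z'](s)=\lim_{h\to0}\mathcal R(\frac1h(z(s+h)-z(s)))$ for a.a. $s$. For continuous $(\mathsf t,\mathsf q)$ let $\mathscr G^\alpha=\{s:\mathscr S_u(\mathsf t(s),\mathsf q(s))+\mathscr S_z(\mathsf t(s),\mathsf q(s))>0\}$ if $\alpha\ge1$ and $\mathscr G^\alpha=\{s:\mathscr S_z(\mathsf t(s),\mathsf q(s))>0\}$ if $\alpha<1$. Define $$\mathfrak M_0^\alpha[\mathsf t,\mathsf q,\mathsf t',\mathsf q'](s)=\mathcal R[\mathsf z'](s)+\mathbf 1_{\mathscr G^\alpha}(s)\,\mathfrak M_0^{\alpha,\rm red}(\mathsf t(s),\mathsf q(s),0,\mathsf q'(s)),$$ with $\mathbf 1_{\mathscr G^\alpha}$ the indicator function (value $1$ on $\mathscr G^\alpha$, $0$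 elsewhere), the second term being $0$ off $\mathscr G^\alpha$. Admissible parametrized curves $\mathscr A([a,b];[0,T]\times\mathbf Q)$: curves $(\mathsf t,\mathsf q)=(\mathsf t,\mathsf u,\mathsf z):[a,b]\to[0,T]\times\mathbf Q$ with: $\mathsf t$ non-decreasing and absolutely continuous, $\mathsf u\in\mathrm{AC}([a,b];\mathbf U)$, $\mathsf z\in\mathrm{AC}([a,b];\mathbf Z_{\rm ri},\mathcal R)$; $\mathscr S_u(\mathsf t,\mathsf q)=\mathscr S_z(\mathsf t,\mathsf q)=0$ on $\{\mathsf t'>0\}$; $\mathsf z$ locally $\mathbf Z$-absolutely continuous on the (relatively open) set $\mathscr G^\alpha$ and $\mathsf t$ constant on each connected component of $\mathscr G^\alpha$; $\sup_s\mathfrak E(\mathsf q(s))<\infty$; $\int_a^b\mathcal R[\mathsf z'](s)\,ds+\int_{\mathscr G^\alpha}\mathfrak M_0^{\alpha,\rm red}(\mathsf t(s),\mathsf q(s),0,\mathsf q'(s))\,ds<\infty$. (H-chain-param) For every admissible parametrized curve, $s\mapsto\mathcal E(\mathsf t(s),\mathsf q(s))$ is absolutely continuous and $\frac{d}{ds}\mathcal E(\mathsf t,\mathsf q)-\partial_t\mathcal E(\mathsf t,\mathsf q)\mathsf t'\ge-\mathfrak M_0^\alpha[\mathsf t,\mathsf q,\mathsf t',\mathsf q']$ a.e. pBV solution: an admissible parametrized curve with, for all $a\le s_1\le s_2\le b$, $\mathcal E(\mathsf t(s_2),\mathsf q(s_2))+\int_{s_1}^{s_2}\mathfrak M_0^\alpha[\mathsf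 t,\mathsf q,\mathsf t',\mathsf q']ds=\mathcal E(\mathsf t(s_1),\mathsf q(s_1))+\int_{s_1}^{s_2}\partial_t\mathcal E(\mathsf t,\mathsf q)\mathsf t'ds$. It is called enhanced if in addition $\mathsf z\in\mathrm{AC}([a,b];\mathbf Z)$. *)

theory Defs
  imports "HOL-Analysis.Analysis"
begin

section \<open>Functional-analytic preliminaries\<close>

type_synonym 'a dual = "'a \<Rightarrow>\<^sub>L real"

definition reflexive_space :: "'a::real_normed_vector itself \<Rightarrow> bool" where
  "reflexive_space _ \<longleftrightarrow> (\<forall>\<Phi> :: 'a dual dual. \<exists>x :: 'a. \<forall>\<phi> :: 'a dual. blinfun_apply \<Phi> \<phi> = blinfun_apply \<phi> x)"

definition weak_conv :: "(nat \<Rightarrow> 'a::real_normed_vector) \<Rightarrow> 'a \<Rightarrow> bool" where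
  "weak_conv x l \<longleftrightarrow> (\<forall>\<phi> :: 'a dual. (\<lambda>n. blinfun_apply \<phi> (x n)) \<longlonglongrightarrow> blinfun_apply \<phi> l)"

text \<open>Weak convergence and weak continuity in a smaller space embedded by \<open>i\<close>, for sequences and
  curves given in the larger space; membership in the smaller space is part of the claim.\<close>

definition weak_conv_in ::
  "('e::real_normed_vector \<Rightarrow> 'a) \<Rightarrow> (nat \<Rightarrow> 'a) \<Rightarrow> 'a \<Rightarrow> bool" where
  "weak_conv_in i x l \<longleftrightarrow> (\<exists>y m. (\<forall>n. x n = i (y n)) \<and> l = i m \<and> weak_conv y m)"

definition weakly_continuous_in ::
  "('e::real_normed_vector \<Rightarrow> 'a) \<Rightarrow> real set \<Rightarrow> (real \<Rightarrow> 'a) \<Rightarrow> bool" where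
  "weakly_continuous_in i A f \<longleftrightarrow>
     (\<exists>g. (\<forall>s\<in>A. f s = i (g s)) \<and> (\<forall>\<phi> :: 'e dual. continuous_on A (\<lambda>s. blinfun_apply \<phi> (g s))))"

definition dense_embedding :: "('a::real_normed_vector \<Rightarrow>\<^sub>L 'b::real_normed_vector) \<Rightarrow> bool" where
  "dense_embedding i \<longleftrightarrow> inj (blinfun_apply i) \<and> closure (range (blinfun_apply i)) = UNIV"

definition compact_operator :: "('a::real_normed_vector \<Rightarrow>\<^sub>L 'b::real_normed_vector) \<Rightarrow> bool" where
  "compact_operator i \<longleftrightarrow> compact (closure (blinfun_apply i ` cball 0 1))"

text \<open>The Bochner integral of the library needs a second countable codomain, which the type system
  does not provide for dual spaces.\<close>

definition strongly_measurable :: "'s measure \<Rightarrow> ('s \<Rightarrow> 'b::real_normed_vector) \<Rightarrow> bool" where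
  "strongly_measurable M f \<longleftrightarrow>
     (\<exists>\<phi>. (\<forall>i::nat. simple_function M (\<phi> i)) \<and> (AE x in M. (\<lambda>i. \<phi> i x) \<longlonglongrightarrow> f x))"

definition in_L1 :: "real \<Rightarrow> real \<Rightarrow> (real \<Rightarrow> 'b::real_normed_vector) \<Rightarrow> bool" where
  "in_L1 a b f \<longleftrightarrow> strongly_measurable (lebesgue_on {a..b}) f \<and>
     (\<integral>\<^sup>+ s. ennreal (norm (f s)) \<partial>lebesgue_on {a..b}) < \<infinity>"

definition in_Linf :: "real \<Rightarrow> real \<Rightarrow> (real \<Rightarrow> 'b::real_normed_vector) \<Rightarrow> bool" where
  "in_Linf a b f \<longleftrightarrow> strongly_measurable (lebesgue_on {a..b}) f \<and>
     (\<exists>C. AE s in lebesgue_on {a..b}. norm (f s) \<le> C)"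

text \<open>Weak-star convergence in \<open>L\<^sup>\<infinity>(a,b;X)\<close> as the dual of \<open>L\<^sup>1(a,b;X*)\<close> (\<open>X\<close> is reflexive
  wherever this is used).\<close>

definition weak_star_Linf ::
  "real \<Rightarrow> real \<Rightarrow> (nat \<Rightarrow> real \<Rightarrow> 'b::real_normed_vector) \<Rightarrow> (real \<Rightarrow> 'b) \<Rightarrow> bool" where
  "weak_star_Linf a b v w \<longleftrightarrow> (\<forall>n. in_Linf a b (v n)) \<and> in_Linf a b w \<and>
     (\<forall>g :: real \<Rightarrow> 'b dual. in_L1 a b g \<longrightarrow>
        (\<lambda>n. LINT s|lebesgue_on {a..b}. blinfun_apply (g s) (v n s)) \<longlonglongrightarrow> (LINT s|lebesgue_on {a..b}. blinfun_apply (g s) (w s)))"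

text \<open>Absolute continuity through an integrable majorant. The function \<open>d\<close> measures increments: the
  norm for the usual notion, a (possibly asymmetric) dissipation potential for
  \<open>AC([a,b];Z\<^sub>r\<^sub>i,R)\<close>.\<close>

definition ac_wrt :: "('a::real_normed_vector \<Rightarrow> ereal) \<Rightarrow> real \<Rightarrow> real \<Rightarrow> (real \<Rightarrow> 'a) \<Rightarrow> bool" where
  "ac_wrt d a b f \<longleftrightarrow>
     (\<exists>m :: real \<Rightarrow> real. (\<forall>s. 0 \<le> m s) \<and> set_integrable lebesgue {a..b} m \<and>
        (\<forall>s1 s2. a \<le> s1 \<and> s1 \<le> s2 \<and> s2 \<le> b \<longrightarrow>
           d (f s2 - f s1) \<le> ereal (LINT s:{s1..s2}|lebesgue. m s)))"

abbreviation ac_on :: "real \<Rightarrow> real \<Rightarrow> (real \<Rightarrow> 'a::real_normed_vector) \<Rightarrow> bool" where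
  "ac_on \<equiv> ac_wrt (\<lambda>x. ereal (norm x))"

definition in_W1inf :: "real \<Rightarrow> real \<Rightarrow> (real \<Rightarrow> 'b::real_normed_vector) \<Rightarrow> bool" where
  "in_W1inf a b f \<longleftrightarrow> ac_on a b f \<and> (AE s in lebesgue_on {a..b}. f differentiable (at s)) \<and>
     in_Linf a b f \<and> in_Linf a b (\<lambda>s. vector_derivative f (at s))"

definition weak_star_W1inf ::
  "real \<Rightarrow> real \<Rightarrow> (nat \<Rightarrow> real \<Rightarrow> 'b::real_normed_vector) \<Rightarrow> (real \<Rightarrow> 'b) \<Rightarrow> bool" where
  "weak_star_W1inf a b v w \<longleftrightarrow> (\<forall>n. in_W1inf a b (v n)) \<and> in_W1inf a b w \<and>
     weak_star_Linf a b v w \<and>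
     weak_star_Linf a b (\<lambda>n s. vector_derivative (v n) (at s)) (\<lambda>s. vector_derivative w (at s))"

section \<open>Convex analysis\<close>

definition dissipation_potential :: "('a::real_normed_vector \<Rightarrow> ereal) \<Rightarrow> bool" where
  "dissipation_potential \<psi> \<longleftrightarrow> (\<forall>v. 0 \<le> \<psi> v) \<and> \<psi> 0 = 0 \<and>
     (\<forall>v w. \<forall>l\<in>{0..1::real}.
        \<psi> ((1 - l) *\<^sub>R v + l *\<^sub>R w) \<le> ereal (1 - l) * \<psi> v + ereal l * \<psi> w) \<and>
     (\<forall>v. \<psi> v \<le> Liminf (at v) \<psi>)"

definition conjugate :: "('a::real_normed_vector \<Rightarrow> ereal) \<Rightarrow> 'a dual \<Rightarrow> ereal" where
  "conjugate \<psi> \<xi> = (SUP v. ereal (blinfun_apply \<xi> v) - \<psi> v)"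

definition convex_subdiff :: "('a::real_normed_vector \<Rightarrow> ereal) \<Rightarrow> 'a \<Rightarrow> 'a dual set" where
  "convex_subdiff \<psi> v = {\<xi>. \<bar>\<psi> v\<bar> \<noteq> \<infinity> \<and> (\<forall>w. \<psi> v + ereal (blinfun_apply \<xi> (w - v)) \<le> \<psi> w)}"

definition superlinear :: "('a::real_normed_vector \<Rightarrow> ereal) \<Rightarrow> bool" where
  "superlinear \<psi> \<longleftrightarrow> ((\<lambda>v. \<psi> v / ereal (norm v)) \<longlongrightarrow> \<infinity>) at_infinity"

definition viscous_potential :: "('a::real_normed_vector \<Rightarrow> ereal) \<Rightarrow> bool" where
  "viscous_potential V \<longleftrightarrow> dissipation_potential V \<and> (\<forall>v. V v \<noteq> \<infinity>) \<and>
     superlinear V \<and> superlinear (conjugate V) \<and>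
     (\<forall>v. ((\<lambda>l. V (l *\<^sub>R v) / ereal l) \<longlongrightarrow> 0) (at_right 0))"

definition bfun :: "('a::real_normed_vector \<Rightarrow> ereal) \<Rightarrow> 'a \<Rightarrow> ereal \<Rightarrow> ereal" where
  "bfun \<psi> v \<sigma> = (INF \<tau>\<in>{0<..}. ereal \<tau> * \<psi> (v /\<^sub>R \<tau>) + ereal \<tau> * \<sigma>)"

section \<open>The rate-dependent system\<close>

text \<open>Separability of \<open>U\<close>, \<open>Z\<close> and \<open>Z\<^sub>r\<^sub>i\<close> is the class constraint \<open>second_countable_topology\<close>. The
  inclusions between the spaces are explicit bounded linear embeddings. \<open>horizon\<close> is the final
  time \<open>T\<close> and \<open>expo\<close> the exponent \<open>\<alpha>\<close>; \<open>En t q\<close> is meaningful for \<open>t \<in> {0..T}\<close> only.\<close>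

record (overloaded) ('u, 'z, 'ue, 'ze, 'zri) rate_system =
  horizon :: real
  expo :: real
  embU :: "'ue::banach \<Rightarrow>\<^sub>L 'u::{banach,second_countable_topology}"
  embZ :: "'ze::banach \<Rightarrow>\<^sub>L 'z::{banach,second_countable_topology}"
  embZri :: "'z \<Rightarrow>\<^sub>L 'zri::{banach,second_countable_topology}"
  Vu :: "'u \<Rightarrow> ereal"
  Vz :: "'z \<Rightarrow> ereal"
  Rz :: "'zri \<Rightarrow> ereal"
  En :: "real \<Rightarrow> 'u \<times> 'z \<Rightarrow> ereal"
  Dom :: "('u \<times> 'z) set"

context
  fixes P :: "('u::{banach,second_countable_topology}, 'z::{banach,second_countable_topology},
               'ue::banach, 'ze::banach, 'zri::{banach,second_countable_topology}) rate_system"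
begin

definition embQ :: "'ue \<times> 'ze \<Rightarrow> 'u \<times> 'z" where
  "embQ = map_prod (blinfun_apply (embU P)) (blinfun_apply (embZ P))"

definition RZ :: "'z \<Rightarrow> ereal" where
  "RZ \<eta> = Rz P (embZri P \<eta>)"

definition Wz_conj :: "'z dual \<Rightarrow> ereal" where
  "Wz_conj \<zeta> = (INF \<sigma>\<in>convex_subdiff RZ 0. conjugate (Vz P) (\<zeta> - \<sigma>))"

definition Esup :: "'u \<times> 'z \<Rightarrow> ereal" where
  "Esup q = (SUP t\<in>{0..horizon P}. En P t q)"

definition dtE :: "real \<Rightarrow> 'u \<times> 'z \<Rightarrow> real" where
  "dtE t q = vector_derivative (\<lambda>r. real_of_ereal (En P r q)) (at t within {0..horizon P})"

text \<open>The Frechet subdifferential is empty outside the domain of the energy. Elements of the dual of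
  \<open>U \<times> Z\<close> are pairs of functionals.\<close>

definition frechet_subdiff :: "real \<Rightarrow> 'u \<times> 'z \<Rightarrow> ('u dual \<times> 'z dual) set" where
  "frechet_subdiff t q = {(\<mu>, \<zeta>). t \<in> {0..horizon P} \<and> q \<in> Dom P \<and>
     (\<forall>\<eta>>0. \<forall>\<^sub>F p in nhds q.
        En P t p \<ge> En P t q + ereal (blinfun_apply \<mu> (fst (p - q)) + blinfun_apply \<zeta> (snd (p - q))
            - \<eta> * norm (p - q)))}"

definition slope_u :: "real \<Rightarrow> 'u \<times> 'z \<Rightarrow> ereal" where
  "slope_u t q = (INF (\<mu>, \<zeta>)\<in>frechet_subdiff t q. conjugate (Vu P) (- \<mu>))"

definition slope_z :: "real \<Rightarrow> 'u \<times> 'z \<Rightarrow> ereal" where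
  "slope_z t q = (INF (\<mu>, \<zeta>)\<in>frechet_subdiff t q. Wz_conj (- \<zeta>))"

subsection \<open>Hypotheses\<close>

definition H_spaces :: bool where
  "H_spaces \<longleftrightarrow> 0 < horizon P \<and> 0 < expo P \<and>
     reflexive_space TYPE('u) \<and> reflexive_space TYPE('z) \<and>
     reflexive_space TYPE('ue) \<and> reflexive_space TYPE('ze) \<and>
     dense_embedding (embU P) \<and> dense_embedding (embZ P) \<and> compact_operator (embZ P) \<and>
     dense_embedding (embZri P)"

definition H_diss :: bool where
  "H_diss \<longleftrightarrow> viscous_potential (Vu P) \<and> viscous_potential (Vz P) \<and>
     dissipation_potential (Rz P) \<and>
     (\<forall>l>0. \<forall>\<eta>. Rz P (l *\<^sub>R \<eta>) = ereal l * Rz P \<eta>) \<and>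
     (\<exists>C>0. \<forall>\<eta>. RZ \<eta> \<le> ereal (C * norm \<eta>)) \<and>
     (\<exists>c>0. \<forall>\<eta>. Rz P \<eta> \<ge> ereal (c * norm \<eta>))"

definition H_energy :: bool where
  "H_energy \<longleftrightarrow>
     (\<forall>t\<in>{0..horizon P}. (\<forall>q. En P t q \<noteq> -\<infinity>) \<and> {q. En P t q < \<infinity>} = Dom P) \<and>
     Dom P \<subseteq> range embQ \<and>
     (\<forall>t\<in>{0..horizon P}. \<forall>x q. weak_conv x q \<longrightarrow> En P t q \<le> liminf (\<lambda>n. En P t (x n))) \<and>
     (\<exists>C0>0. \<forall>t\<in>{0..horizon P}. \<forall>q\<in>Dom P. En P t q \<ge> ereal C0) \<and>
     (\<forall>M::real. bounded {x. Esup (embQ x)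
        + ereal (norm (fst (embQ x), embZri P (snd (embQ x)))) \<le> ereal M}) \<and>
     (\<forall>q\<in>Dom P. \<forall>t\<in>{0..horizon P}.
        (\<lambda>r. real_of_ereal (En P r q)) differentiable (at t within {0..horizon P})) \<and>
     (\<exists>C>0. \<forall>q\<in>Dom P. \<forall>t\<in>{0..horizon P}. ereal \<bar>dtE t q\<bar> \<le> ereal C * En P t q)"

definition H_closed :: bool where
  "H_closed \<longleftrightarrow> (\<forall>tn t x q \<xi> l. tn \<longlonglongrightarrow> t \<and> weak_conv x q \<and> weak_conv \<xi> l \<and>
     (SUP n. Esup (x n)) < \<infinity> \<and> (\<forall>n. \<xi> n \<in> frechet_subdiff (tn n) (x n)) \<longrightarrow>
     l \<in> frechet_subdiff t q \<and> (\<lambda>n. dtE (tn n) (x n)) \<longlonglongrightarrow> dtE t q)"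

definition H_slope :: bool where
  "H_slope \<longleftrightarrow>
     (\<forall>t q. frechet_subdiff t q \<noteq> {} \<longrightarrow>
        (\<exists>(\<mu>, \<zeta>)\<in>frechet_subdiff t q. conjugate (Vu P) (- \<mu>) = slope_u t q) \<and>
        (\<exists>(\<mu>, \<zeta>)\<in>frechet_subdiff t q. Wz_conj (- \<zeta>) = slope_z t q)) \<and>
     (\<forall>tn t x q. (\<forall>n. tn n \<in> {0..horizon P}) \<and> tn \<longlonglongrightarrow> t \<and> weak_conv x q \<and>
        (SUP n. Esup (x n)) < \<infinity> \<longrightarrow>
        slope_u t q \<le> liminf (\<lambda>n. slope_u (tn n) (x n)) \<and>
        slope_z t q \<le> liminf (\<lambda>n. slope_z (tn n) (x n)))"

subsection \<open>Viscous solutions\<close>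

definition viscous_solution :: "real \<Rightarrow> (real \<Rightarrow> 'u \<times> 'z) \<Rightarrow> bool" where
  "viscous_solution \<epsilon> q \<longleftrightarrow> ac_on 0 (horizon P) q \<and>
     set_integrable lebesgue {0..horizon P} (\<lambda>r. dtE r (q r)) \<and>
     (\<exists>\<mu> \<zeta>. in_L1 0 (horizon P) (\<lambda>r. (\<mu> r, \<zeta> r)) \<and>
        (let u' = (\<lambda>r. vector_derivative (fst \<circ> q) (at r));
             z' = (\<lambda>r. vector_derivative (snd \<circ> q) (at r));
             \<delta> = \<epsilon> powr expo P
         in
          (AE r in lebesgue_on {0..horizon P}.
             (\<mu> r, \<zeta> r) \<in> frechet_subdiff r (q r) \<and>
             - \<mu> r \<in> convex_subdiff (Vu P) (\<delta> *\<^sub>R u' r) \<and>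
             (\<exists>\<sigma>\<in>convex_subdiff RZ (z' r). \<exists>\<omega>\<in>convex_subdiff (Vz P) (\<epsilon> *\<^sub>R z' r).
                - \<zeta> r = \<sigma> + \<omega>)) \<and>
          (\<forall>s t. 0 \<le> s \<and> s < t \<and> t \<le> horizon P \<longrightarrow>
             En P t (q t) + enn2ereal (\<integral>\<^sup>+ r\<in>{s..t}. e2ennreal (
                 ereal (1 / \<delta>) * Vu P (\<delta> *\<^sub>R u' r) + RZ (z' r) + ereal (1 / \<epsilon>) * Vz P (\<epsilon> *\<^sub>R z' r)
                 + ereal (1 / \<delta>) * conjugate (Vu P) (- \<mu> r)
                 + ereal (1 / \<epsilon>) * Wz_conj (- \<zeta> r)) \<partial>lebesgue)
             = En P s (q s) + ereal (LINT r:{s..t}|lebesgue. dtE r (q r)))))"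

subsection \<open>The vanishing-viscosity contact potentials\<close>

definition M_eps :: "real \<Rightarrow> real \<Rightarrow> 'u \<times> 'z \<Rightarrow> real \<Rightarrow> 'u \<times> 'z \<Rightarrow> ereal" where
  "M_eps \<epsilon> t q t' q' = (let u' = fst q'; z' = snd q'; \<delta> = \<epsilon> powr expo P in
     if t' > 0 \<and> frechet_subdiff t q \<noteq> {}
     then ereal (t' / \<delta>) * Vu P ((\<delta> / t') *\<^sub>R u') + ereal (t' / \<delta>) * slope_u t q
          + RZ z' + ereal (t' / \<epsilon>) * Vz P ((\<epsilon> / t') *\<^sub>R z') + ereal (t' / \<epsilon>) * slope_z t q
     else \<infinity>)"

definition M0_red :: "real \<Rightarrow> 'u \<times> 'z \<Rightarrow> 'u \<times> 'z \<Rightarrow> ereal" where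
  "M0_red t q q' = (let u' = fst q'; z' = snd q' in
     if frechet_subdiff t q \<noteq> {} then
       (if expo P > 1 then
          (if slope_u t q = 0 then bfun (Vz P) z' (slope_z t q)
           else if z' = 0 then bfun (Vu P) u' (slope_u t q)
           else \<infinity>)
        else if expo P = 1 then
          (INF \<tau>\<in>{0<..}. ereal \<tau> * (Vu P (u' /\<^sub>R \<tau>) + Vz P (z' /\<^sub>R \<tau>) + slope_u t q + slope_z t q))
        else
          (if slope_z t q = 0 then bfun (Vu P) u' (slope_u t q)
           else if u' = 0 then bfun (Vz P) z' (slope_z t q)
           else \<infinity>))
     else if q' = 0 \<and> (\<exists>tn x. (\<forall>n. frechet_subdiff (tn n) (x n) \<noteq> {}) \<and> tn \<longlonglongrightarrow> t \<and>
                          weak_conv x q \<and> (SUP n. Esup (x n)) < \<infinity>)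
     then 0 else \<infinity>)"

subsection \<open>Parametrized curves\<close>

text \<open>Only a.e. values matter in the next two definitions; where a limit or derivative fails to
  exist the value is arbitrary.\<close>

definition R_speed :: "(real \<Rightarrow> 'u \<times> 'z) \<Rightarrow> real \<Rightarrow> ereal" where
  "R_speed q s = Lim (at 0) (\<lambda>h. RZ ((1 / h) *\<^sub>R (snd (q (s + h)) - snd (q s))))"

definition velocity :: "(real \<Rightarrow> 'u \<times> 'z) \<Rightarrow> real \<Rightarrow> 'u \<times> 'z" where
  "velocity q s = (vector_derivative (fst \<circ> q) (at s), vector_derivative (snd \<circ> q) (at s))"

definition G_set :: "real \<Rightarrow> real \<Rightarrow> (real \<Rightarrow> real) \<Rightarrow> (real \<Rightarrow> 'u \<times> 'z) \<Rightarrow> real set" where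
  "G_set a b t q = (if expo P \<ge> 1
     then {s \<in> {a..b}. slope_u (t s) (q s) + slope_z (t s) (q s) > 0}
     else {s \<in> {a..b}. slope_z (t s) (q s) > 0})"

definition M0 :: "real \<Rightarrow> real \<Rightarrow> (real \<Rightarrow> real) \<Rightarrow> (real \<Rightarrow> 'u \<times> 'z) \<Rightarrow> real \<Rightarrow> ereal" where
  "M0 a b t q s = R_speed q s +
     (if s \<in> G_set a b t q then M0_red (t s) (q s) (velocity q s) else 0)"

text \<open>The condition on the slopes where \<open>t' > 0\<close> is imposed at every point of differentiability.
  Since \<open>t\<close> is absolutely continuous and the slopes are lower semicontinuous along the curve, this
  agrees with the almost-everywhere reading.\<close>

definition admissible_curve :: "real \<Rightarrow> real \<Rightarrow> (real \<Rightarrow> real) \<Rightarrow> (real \<Rightarrow> 'u \<times> 'z) \<Rightarrow> bool" where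
  "admissible_curve a b t q \<longleftrightarrow> a < b \<and>
     t ` {a..b} \<subseteq> {0..horizon P} \<and> mono_on {a..b} t \<and> ac_on a b t \<and>
     ac_on a b (fst \<circ> q) \<and>
     ac_wrt (Rz P) a b (\<lambda>s. embZri P (snd (q s))) \<and>
     (\<forall>s\<in>{a..b}. \<forall>d>0. (t has_real_derivative d) (at s within {a..b}) \<longrightarrow>
        slope_u (t s) (q s) = 0 \<and> slope_z (t s) (q s) = 0) \<and>
     (\<forall>c d. c \<le> d \<and> {c..d} \<subseteq> G_set a b t q \<longrightarrow> ac_on c d (snd \<circ> q)) \<and>
     (\<forall>C\<in>components (G_set a b t q). t constant_on C) \<and>
     (SUP s\<in>{a..b}. Esup (q s)) < \<infinity> \<and>
     (\<integral>\<^sup>+ s\<in>{a..b}. e2ennreal (R_speed q s) \<partial>lebesgue)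
       + (\<integral>\<^sup>+ s\<in>G_set a b t q. e2ennreal (M0_red (t s) (q s) (velocity q s)) \<partial>lebesgue) < \<infinity>"

definition H_chain_param :: bool where
  "H_chain_param \<longleftrightarrow> (\<forall>a b t q. admissible_curve a b t q \<longrightarrow>
     (let e = (\<lambda>s. real_of_ereal (En P (t s) (q s))) in
        ac_on a b e \<and>
        (AE s in lebesgue_on {a..b}.
           ereal (deriv e s - dtE (t s) (q s) * deriv t s) \<ge> - M0 a b t q s)))"

definition pBV_solution :: "real \<Rightarrow> real \<Rightarrow> (real \<Rightarrow> real) \<Rightarrow> (real \<Rightarrow> 'u \<times> 'z) \<Rightarrow> bool" where
  "pBV_solution a b t q \<longleftrightarrow> admissible_curve a b t q \<and>
     set_integrable lebesgue {a..b} (\<lambda>s. dtE (t s) (q s) * deriv t s) \<and>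
     (\<forall>s1 s2. a \<le> s1 \<and> s1 \<le> s2 \<and> s2 \<le> b \<longrightarrow>
        En P (t s2) (q s2) + enn2ereal (\<integral>\<^sup>+ s\<in>{s1..s2}. e2ennreal (M0 a b t q s) \<partial>lebesgue)
        = En P (t s1) (q s1) + ereal (LINT s:{s1..s2}|lebesgue. dtE (t s) (q s) * deriv t s))"

definition enhanced_pBV_solution ::
  "real \<Rightarrow> real \<Rightarrow> (real \<Rightarrow> real) \<Rightarrow> (real \<Rightarrow> 'u \<times> 'z) \<Rightarrow> bool" where
  "enhanced_pBV_solution a b t q \<longleftrightarrow> pBV_solution a b t q \<and> ac_on a b (snd \<circ> q)"

end

end

(* The functions F_k(s) = integral of M_eps over (0,s), the rescalings t_k and the curves u_k, z_k are
   equi-Lipschitz, which gives a convergent subsequence; z_k converges strongly because the energy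
   bounds it in the compactly embedded space.

   The lower bound M_0 <= F' is a duality argument. By Fenchel-Young, M_eps dominates
     rho(z') + xi(u') + zeta(z') + (t'/eps^alpha) (S_u - V_u^*(xi)) + (t'/eps) (S_z - V_z^*(zeta))
   for all functionals xi, zeta and all rho <= R. The slopes are lower semicontinuous, so the last two
   terms are asymptotically nonnegative as soon as V_u^*(xi) < S_u and V_z^*(zeta) < S_z at the limit,
   while the linear terms pass to the limit. By the Hahn-Banach theorem, b_psi(v,sigma) is the maximum
   of xi(v) over psi^*(xi) <= sigma. When one slope is positive and its rate dominates, the prefactor
   of the other bracket vanishes, hence that functional is unconstrained and the component is frozen.

   In the power term, where t_k' stays away from 0 the forces of the viscous solution are bounded and
   the closedness of the subdifferential identifies the limit; where t_k' is small the term is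
   negligible. The energy inequality then passes to the limit, and the chain rule provides the reverse
   inequality, so all inequalities are equalities. *)

theory Submission
  imports Defs "HOL-Library.Diagonal_Subsequence"
begin

section \<open>Functional analysis\<close>

text \<open>Velocities converge only weakly-star and slopes are only lower semicontinuous, so the
  densities \<open>M_eps\<close> have no limit that could be taken inside the integral. The remedy
  is to work at one point s0 where \<open>F\<close> and the limit curve are differentiable:
  functionals fitted to the limit velocity at s0 are kept fixed nearby and for all large k, so no
  measurable selection arises and only curve values at two parameters pass to the limit.
  Semicontinuity controls only levels strictly below the limit slope; hence the functionals are
  shrunk by a factor l < 1, and l tends to 1 at the end. If the limit subdifferential is empty, both
  slopes are infinite, every functional becomes admissible and the velocity vanishes, as
  \<open>M0_red\<close> demands.

  The preparations: reflexivity makes absolutely continuous curves differentiable almost everywhere,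
  a change of variables for monotone absolutely continuous rescalings turns the balance of the
  viscous solution into one for \<open>M_eps\<close>, and Gronwall's inequality with the sublevel
  bound keeps the curves bounded in the smaller spaces.\<close>

definition sublinear :: "('a::real_vector \<Rightarrow> real) \<Rightarrow> bool" where
  "sublinear p \<longleftrightarrow> (\<forall>x y. p (x + y) \<le> p x + p y) \<and> (\<forall>c\<ge>0. \<forall>x. p (c *\<^sub>R x) = c * p x)"

lemma sublinear_add: "sublinear p \<Longrightarrow> p (x + y) \<le> p x + p y"
  by (simp add: sublinear_def)

lemma sublinear_scale: "sublinear p \<Longrightarrow> 0 \<le> c \<Longrightarrow> p (c *\<^sub>R x) = c * p x"
  by (simp add: sublinear_def)

lemma sublinear_0: "sublinear p \<Longrightarrow> p 0 = 0"
  using sublinear_scale[of p 0 0] by simp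

lemma sublinear_minus: "sublinear p \<Longrightarrow> - p (- x) \<le> p x"
  using sublinear_add[of p x "-x"] by (simp add: sublinear_0)

text \<open>The one-sided scaling inequality used for c and for 1/c gives equality.\<close>

lemma sublinearI:
  assumes add: "\<And>x y. p (x + y) \<le> p x + p y" and zero: "p 0 = 0"
    and scale: "\<And>c x. 0 < c \<Longrightarrow> p (c *\<^sub>R x) \<le> c * p x"
  shows "sublinear p"
  unfolding sublinear_def
proof (intro conjI allI impI add)
  fix c :: real and x assume "0 \<le> c"
  show "p (c *\<^sub>R x) = c * p x"
  proof (cases "c = 0")
    case False
    then have "0 < c" using \<open>0 \<le> c\<close> by simp
    have "p x = p ((1 / c) *\<^sub>R c *\<^sub>R x)" using False by simp
    also have "\<dots> \<le> (1 / c) * p (c *\<^sub>R x)" using \<open>0 < c\<close> by (intro scale) simp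
    finally have "c * p x \<le> p (c *\<^sub>R x)" using \<open>0 < c\<close> by (simp add: field_simps)
    then show ?thesis using scale[OF \<open>0 < c\<close>, of x] by simp
  qed (simp add: zero)
qed

text \<open>A sublinear functional below \<open>p\<close> that is linear in direction \<open>v\<close>; it serves both to start
  and to conclude the minimality argument for the Hahn-Banach theorem.\<close>

lemma sublinear_shift:
  assumes p: "sublinear p"
  obtains q where "sublinear q" "\<And>x. q x \<le> p x" "q (- v) \<le> - p v"
proof -
  \<comment> \<open>Infimum over the ray in direction v: t = 0 shows q <= p, and t = 1 at -v gives
    q(-v) <= -p v.\<close>
  define q where "q x = (INF t\<in>{0..}. p (x + t *\<^sub>R v) - t * p v)" for x
  have low: "- p (- x) \<le> p (x + t *\<^sub>R v) - t * p v" if "0 \<le> t" for x t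
    using sublinear_add[OF p, of "x + t *\<^sub>R v" "- x"] sublinear_scale[OF p that, of v] by simp
  have bdd: "bdd_below ((\<lambda>t. p (x + t *\<^sub>R v) - t * p v) ` {0..})" for x
    by (rule bdd_belowI2[of _ "- p (- x)"]) (use low in auto)
  have upper: "q x \<le> p (x + t *\<^sub>R v) - t * p v" if "0 \<le> t" for x t
    unfolding q_def by (rule cINF_lower[OF bdd]) (use that in auto)
  have greatest: "c \<le> q x" if "\<And>t. 0 \<le> t \<Longrightarrow> c \<le> p (x + t *\<^sub>R v) - t * p v" for c x
    unfolding q_def by (rule cINF_greatest) (use that in auto)
  have "sublinear q"
  proof (rule sublinearI)
    fix x y
    have "q (x + y) - (p (x + s *\<^sub>R v) - s * p v) \<le> q y" if s: "0 \<le> s" for s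
    proof (rule greatest)
      fix t :: real assume t: "0 \<le> t"
      have "q (x + y) \<le> p (x + y + (s + t) *\<^sub>R v) - (s + t) * p v" using s t by (intro upper) simp
      also have "p (x + y + (s + t) *\<^sub>R v) \<le> p (x + s *\<^sub>R v) + p (y + t *\<^sub>R v)"
        using sublinear_add[OF p, of "x + s *\<^sub>R v" "y + t *\<^sub>R v"] by (simp add: algebra_simps)
      finally show "q (x + y) - (p (x + s *\<^sub>R v) - s * p v) \<le> p (y + t *\<^sub>R v) - t * p v"
        by (simp add: algebra_simps)
    qed
    then have "q (x + y) - q y \<le> q x" by (intro greatest) (simp add: algebra_simps)
    then show "q (x + y) \<le> q x + q y" by simp
  next
    show "q 0 = 0"
      using upper[of 0 0] greatest[of 0 0] by (simp add: sublinear_scale[OF p] sublinear_0[OF p])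
  next
    fix c :: real and x assume c: "0 < c"
    have "q (c *\<^sub>R x) / c \<le> q x"
    proof (rule greatest)
      fix t :: real assume t: "0 \<le> t"
      have "q (c *\<^sub>R x) \<le> p (c *\<^sub>R (x + t *\<^sub>R v)) - (c * t) * p v"
        using upper[of "c * t" "c *\<^sub>R x"] c t by (simp add: scaleR_add_right)
      also have "\<dots> = c * (p (x + t *\<^sub>R v) - t * p v)"
        using sublinear_scale[OF p, of c "x + t *\<^sub>R v"] c by (simp add: algebra_simps)
      finally show "q (c *\<^sub>R x) / c \<le> p (x + t *\<^sub>R v) - t * p v" using c by (simp add: field_simps)
    qed
    then show "q (c *\<^sub>R x) \<le> c * q x" using c by (simp add: field_simps)
  qed
  moreover have "q x \<le> p x" for x using upper[of 0 x] by simp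
  moreover have "q (- v) \<le> - p v" using upper[of 1 "- v"] by (simp add: sublinear_0[OF p])
  ultimately show thesis by (rule that)
qed

text \<open>Zorn's lemma for the reversed pointwise order. The infimum over a chain is again
  subadditive because, of two members of the chain, the smaller one serves both summands at once; it
  is finite because every member lies above -p(-x).\<close>

lemma minimal_sublinear:
  assumes p: "sublinear p"
  obtains f where "sublinear f" "\<And>x. f x \<le> p x"
    "\<And>q. sublinear q \<Longrightarrow> (\<And>x. q x \<le> f x) \<Longrightarrow> q = f"
proof -
  define A where "A = {q. sublinear q \<and> (\<forall>x. q x \<le> p x)}"
  have "\<exists>m\<in>A. \<forall>a\<in>A. a \<le> m \<longrightarrow> a = m"
  proof (rule predicate_Zorn)
    show "partial_order_on A (relation_of (\<lambda>f g. g \<le> f) A)"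
      by (rule partial_order_on_relation_ofI) auto
  next
    fix C assume C: "C \<in> Chains (relation_of (\<lambda>f g. g \<le> f) A)"
    have CA: "C \<subseteq> A" using C by (auto simp: Chains_def relation_of_def)
    have tot: "f \<le> g \<or> g \<le> f" if "f \<in> C" "g \<in> C" for f g
      using C that by (auto simp: Chains_def relation_of_def)
    show "\<exists>u\<in>A. \<forall>a\<in>C. u \<le> a"
    proof (cases "C = {}")
      case True
      then show ?thesis using p by (auto simp: A_def)
    next
      case False
      define u where "u x = (INF q\<in>C. q x)" for x
      have low: "- p (- x) \<le> q x" if "q \<in> C" for q x
      proof -
        have "sublinear q" "q (- x) \<le> p (- x)" using that CA by (auto simp: A_def)
        then show ?thesis using sublinear_minus[of q x] by linarith
      qed
      have bdd: "bdd_below ((\<lambda>q. q x) ` C)" for x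
        by (rule bdd_belowI2[of _ "- p (- x)"]) (use low in auto)
      have upper: "u x \<le> q x" if "q \<in> C" for x q
        unfolding u_def by (rule cINF_lower[OF bdd that])
      have greatest: "c \<le> u x" if "\<And>q. q \<in> C \<Longrightarrow> c \<le> q x" for c x
        unfolding u_def by (rule cINF_greatest[OF False that])
      have "sublinear u"
      proof (rule sublinearI)
        fix x y
        have "u (x + y) - q x \<le> u y" if q: "q \<in> C" for q
        proof (rule greatest)
          fix q' assume q': "q' \<in> C"
          obtain r where r: "r \<in> C" "r \<le> q" "r \<le> q'" using tot[OF q q'] q q' by auto
          have "u (x + y) \<le> r x + r y"
            using upper[OF r(1), of "x + y"] sublinear_add[of r x y] r(1) CA by (auto simp: A_def)
          also have "\<dots> \<le> q x + q' y" using r(2,3) by (intro add_mono) (auto simp: le_fun_def)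
          finally show "u (x + y) - q x \<le> q' y" by simp
        qed
        then have "u (x + y) - u y \<le> u x" by (intro greatest) (simp add: algebra_simps)
        then show "u (x + y) \<le> u x + u y" by simp
      next
        have "q 0 = 0" if "q \<in> C" for q using that CA sublinear_0 by (auto simp: A_def)
        then have "u 0 = (INF q\<in>C. (0::real))" unfolding u_def by (intro INF_cong) auto
        then show "u 0 = 0" using False by simp
      next
        fix c :: real and x assume c: "0 < c"
        have "u (c *\<^sub>R x) / c \<le> u x"
        proof (rule greatest)
          fix q assume q: "q \<in> C"
          then have "u (c *\<^sub>R x) \<le> c * q x"
            using upper[OF q, of "c *\<^sub>R x"] sublinear_scale[of q c x] CA c by (auto simp: A_def)
          then show "u (c *\<^sub>R x) / c \<le> q x" using c by (simp add: field_simps)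
        qed
        then show "u (c *\<^sub>R x) \<le> c * u x" using c by (simp add: field_simps)
      qed
      moreover have "u x \<le> p x" for x
        using False upper CA by (force simp: A_def intro: order_trans)
      ultimately have "u \<in> A" by (simp add: A_def)
      then show ?thesis using upper by (auto simp: le_fun_def)
    qed
  qed
  then obtain f where f: "f \<in> A" "\<And>a. a \<in> A \<Longrightarrow> a \<le> f \<Longrightarrow> a = f" by blast
  show thesis
  proof (rule that)
    show "sublinear f" "f x \<le> p x" for x using f(1) by (auto simp: A_def)
    fix q assume "sublinear q" "\<And>x. q x \<le> f x"
    moreover from this have "q \<in> A" using f(1) by (force simp: A_def intro: order_trans)
    ultimately show "q = f" using f(2) by (simp add: le_fun_def)
  qed
qed

text \<open>A minimal sublinear functional is odd, since otherwise \<open>sublinear_shift\<close>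
  would produce a strictly smaller one; odd and sublinear means linear. Shifting in direction v
  before minimising forces f(-v) <= -p v, hence equality at v.\<close>

theorem Hahn_Banach_sublinear:
  assumes p: "sublinear p"
  obtains f where "linear f" "\<And>x. f x \<le> p x" "f v = p v"
proof -
  obtain p1 where p1: "sublinear p1" "\<And>x. p1 x \<le> p x" "p1 (- v) \<le> - p v"
    using sublinear_shift[OF p] by blast
  obtain f where f: "sublinear f" "\<And>x. f x \<le> p1 x"
    and minimal: "\<And>q. sublinear q \<Longrightarrow> (\<And>x. q x \<le> f x) \<Longrightarrow> q = f"
    using minimal_sublinear[OF p1(1)] by metis
  have odd: "f (- w) = - f w" for w
  proof -
    obtain q where q: "sublinear q" "\<And>x. q x \<le> f x" "q (- w) \<le> - f w"
      using sublinear_shift[OF f(1)] by blast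
    then have "f (- w) \<le> - f w" using minimal[OF q(1,2)] by simp
    then show ?thesis using sublinear_minus[OF f(1), of w] by linarith
  qed
  have "linear f"
  proof (rule linearI)
    fix x y
    show "f (x + y) = f x + f y"
      using sublinear_add[OF f(1), of x y] sublinear_add[OF f(1), of "- x" "- y"]
        odd[of "x + y"] odd[of x] odd[of y] by simp
  next
    fix c x
    show "f (c *\<^sub>R x) = c *\<^sub>R f x"
    proof (cases "0 \<le> c")
      case False
      then have "f ((- c) *\<^sub>R x) = - c * f x" using sublinear_scale[OF f(1), of "- c" x] by simp
      then show ?thesis using odd[of "c *\<^sub>R x"] by simp
    qed (simp add: sublinear_scale[OF f(1)])
  qed
  moreover have le: "f x \<le> p x" for x using f(2)[of x] p1(2)[of x] by linarith
  moreover have "f v = p v"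
    using f(2)[of "- v"] p1(3) odd[of v] le[of v] by linarith
  ultimately show thesis by (rule that)
qed

text \<open>The bound by K is one-sided; used at x and at -x it yields continuity of the linear
  functional.\<close>

lemma Hahn_Banach_blinfun:
  fixes p :: "'a::real_normed_vector \<Rightarrow> real"
  assumes p: "sublinear p" and K: "\<And>x. p x \<le> K * norm x"
  obtains \<phi> :: "'a dual" where "\<And>x. blinfun_apply \<phi> x \<le> p x" "blinfun_apply \<phi> v = p v"
proof -
  obtain f where f: "linear f" "\<And>x. f x \<le> p x" "f v = p v"
    using Hahn_Banach_sublinear[OF p] by blast
  have bl: "bounded_linear f"
  proof (rule bounded_linear_intro[where K = K])
    fix x
    have "f x \<le> K * norm x" "f (- x) \<le> K * norm (- x)"
      using f(2)[of x] f(2)[of "- x"] K[of x] K[of "- x"] by linarith+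
    then show "norm (f x) \<le> norm x * K" using linear_neg[OF f(1), of x] by (simp add: abs_le_iff mult.commute)
  qed (use f(1) in \<open>auto simp: linear_add linear_scale\<close>)
  then show thesis using that[of "Blinfun f"] f by (simp add: bounded_linear_Blinfun_apply)
qed

section \<open>Norming functionals, weak limits and weak compactness\<close>

lemma norming_functional:
  obtains \<phi> :: "'a::real_normed_vector dual" where "norm \<phi> \<le> 1" "blinfun_apply \<phi> v = norm v"
proof -
  have "sublinear (norm :: 'a \<Rightarrow> real)" by (auto simp: sublinear_def norm_triangle_ineq)
  then obtain \<phi> :: "'a dual" where \<phi>: "\<And>x. blinfun_apply \<phi> x \<le> norm x" "blinfun_apply \<phi> v = norm v"
    using Hahn_Banach_blinfun[of norm 1] by (metis mult_1 order_refl)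
  have "norm (blinfun_apply \<phi> x) \<le> 1 * norm x" for x
    using \<phi>(1)[of x] \<phi>(1)[of "- x"] by (simp add: blinfun.minus_right abs_le_iff)
  then have "norm \<phi> \<le> 1" by (intro norm_blinfun_bound) auto
  then show thesis using \<phi>(2) that by blast
qed

lemma functional_zero_imp_zero:
  fixes x :: "'a::real_normed_vector"
  assumes "\<And>\<phi> :: 'a dual. blinfun_apply \<phi> x = 0" shows "x = 0"
  by (metis assms norm_eq_zero norming_functional)

lemma norm_le_functional:
  fixes x :: "'a::real_normed_vector"
  assumes "\<And>\<phi> :: 'a dual. norm \<phi> \<le> 1 \<Longrightarrow> blinfun_apply \<phi> x \<le> c" shows "norm x \<le> c"
  by (metis assms norming_functional)

lemma blinfun_le_norm: "blinfun_apply \<phi> x \<le> norm \<phi> * norm x" for \<phi> :: "'a::real_normed_vector dual"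
  using norm_blinfun[of \<phi> x] by (simp add: abs_le_iff)

text \<open>The distance to a subspace is sublinear and dominated by the norm. A linear functional
  below it vanishes on the subspace, because the distance is zero both at y and at -y.\<close>

lemma distance_functional:
  fixes v :: "'a::real_normed_vector"
  assumes Y: "subspace Y"
  obtains \<phi> :: "'a dual" where "\<And>y. y \<in> Y \<Longrightarrow> blinfun_apply \<phi> y = 0" "blinfun_apply \<phi> v = infdist v Y"
proof -
  have ne: "Y \<noteq> {}" using subspace_0[OF Y] by blast
  have near: "\<exists>y\<in>Y. dist x y < infdist x Y + e" if "0 < e" for x e
    using cINF_less_iff[of Y "dist x" "infdist x Y + e"] that ne by (auto simp: infdist_notempty)
  have "sublinear (\<lambda>x. infdist x Y)"
  proof (rule sublinearI)
    fix x x'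
    show "infdist (x + x') Y \<le> infdist x Y + infdist x' Y"
    proof (rule field_le_epsilon)
      fix e :: real assume e: "0 < e"
      then obtain y y' where y: "y \<in> Y" "y' \<in> Y" "dist x y < infdist x Y + e/2" "dist x' y' < infdist x' Y + e/2"
        using near[of "e/2"] by (meson half_gt_zero)
      have "infdist (x + x') Y \<le> dist (x + x') (y + y')" using y by (intro infdist_le subspace_add[OF Y])
      also have "\<dots> \<le> dist x y + dist x' y'" by (rule dist_triangle_add)
      finally show "infdist (x + x') Y \<le> infdist x Y + infdist x' Y + e" using y by simp
    qed
  next
    fix c :: real and x assume c: "0 < c"
    show "infdist (c *\<^sub>R x) Y \<le> c * infdist x Y"
    proof (rule field_le_epsilon)
      fix e :: real assume e: "0 < e"
      then obtain y where y: "y \<in> Y" "dist x y < infdist x Y + e / c" using near[of "e/c"] c by auto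
      have "infdist (c *\<^sub>R x) Y \<le> dist (c *\<^sub>R x) (c *\<^sub>R y)" using y by (intro infdist_le subspace_scale[OF Y])
      also have "\<dots> = c * dist x y" using c by (simp add: dist_norm flip: scaleR_diff_right)
      also have "\<dots> \<le> c * infdist x Y + e" using y(2) c by (simp add: field_simps)
      finally show "infdist (c *\<^sub>R x) Y \<le> c * infdist x Y + e" .
    qed
  qed (simp add: subspace_0[OF Y])
  moreover have "infdist x Y \<le> 1 * norm x" for x
    using infdist_le[OF subspace_0[OF Y], of x] by simp
  ultimately obtain \<phi> :: "'a dual" where \<phi>: "\<And>x. blinfun_apply \<phi> x \<le> infdist x Y" "blinfun_apply \<phi> v = infdist v Y"
    using Hahn_Banach_blinfun[of "\<lambda>x. infdist x Y" 1] by metis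
  show thesis
  proof (rule that[of \<phi>])
    fix y assume y: "y \<in> Y"
    then have "- y \<in> Y" using subspace_neg[OF Y] by blast
    then show "blinfun_apply \<phi> y = 0"
      using \<phi>(1)[of y] \<phi>(1)[of "- y"] y by (simp add: blinfun.minus_right)
  qed (rule \<phi>(2))
qed

text \<open>A functional on the dual that annihilates F is evaluation at a point by reflexivity, and
  this point is zero because F separates. Hence nothing in the dual has positive distance from the
  span of F.\<close>

lemma separating_imp_total:
  fixes F :: "'a::real_normed_vector dual set"
  assumes refl: "reflexive_space TYPE('a)"
    and sep: "\<And>x. (\<And>f. f \<in> F \<Longrightarrow> blinfun_apply f x = 0) \<Longrightarrow> x = 0"
  shows "closure (span F) = UNIV"
proof (rule ccontr)
  assume "closure (span F) \<noteq> UNIV"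
  then obtain \<phi> where \<phi>: "\<phi> \<notin> closure (span F)" by blast
  obtain \<Phi> :: "'a dual dual" where \<Phi>: "\<And>y. y \<in> span F \<Longrightarrow> blinfun_apply \<Phi> y = 0"
    "blinfun_apply \<Phi> \<phi> = infdist \<phi> (span F)"
    using distance_functional[OF subspace_span] by blast
  obtain x where x: "\<And>\<psi>. blinfun_apply \<Phi> \<psi> = blinfun_apply \<psi> x"
    using refl by (auto simp: reflexive_space_def)
  have "x = 0" using \<Phi>(1) x by (intro sep) (auto simp: span_base)
  then have "infdist \<phi> (span F) = 0" using \<Phi>(2) x by simp
  then show False using \<phi> in_closure_iff_infdist_zero[of "span F" \<phi>] span_0 by blast
qed

text \<open>Upgrades scalar convergence on a separating family to weak convergence. For bounded y
  the functionals along which y converges form a closed subspace, so a total family suffices, and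
  the limit, a bounded functional on the dual, is a point by reflexivity.\<close>

lemma weak_limit_exists:
  fixes y :: "nat \<Rightarrow> 'a::real_normed_vector" and F :: "'a dual set"
  assumes refl: "reflexive_space TYPE('a)"
    and sep: "\<And>x. (\<And>f. f \<in> F \<Longrightarrow> blinfun_apply f x = 0) \<Longrightarrow> x = 0"
    and B: "\<And>n. norm (y n) \<le> B"
    and conv: "\<And>f. f \<in> F \<Longrightarrow> convergent (\<lambda>n. blinfun_apply f (y n))"
  obtains l where "weak_conv y l" "norm l \<le> B"
proof -
  have B0: "0 \<le> B" using B[of 0] norm_ge_zero order_trans by blast
  define K where "K = {f :: 'a dual. convergent (\<lambda>n. blinfun_apply f (y n))}"
  have "subspace K"
    by (rule subspaceI) (auto simp: K_def blinfun.add_left blinfun.scaleR_left convergent_const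
        intro!: convergent_add convergent_mult)
  then have "span F \<subseteq> K" using conv by (intro span_minimal) (auto simp: K_def)
  moreover have "closed K"
    unfolding closed_sequential_limits
  proof (intro allI impI)
    fix g l assume gl: "(\<forall>n. g n \<in> K) \<and> g \<longlonglongrightarrow> l"
    have "Cauchy (\<lambda>n. blinfun_apply l (y n))"
    proof (rule metric_CauchyI)
      fix e :: real assume e: "0 < e"
      have "\<forall>\<^sub>F k in sequentially. dist (g k) l < e / (4 * (B + 1))"
        using gl e B0 by (intro tendstoD) auto
      then obtain k where k: "norm (g k - l) < e / (4 * (B + 1))"
        unfolding dist_norm by (meson eventually_sequentially order_refl)
      have "Cauchy (\<lambda>n. blinfun_apply (g k) (y n))" using gl by (auto simp: K_def convergent_Cauchy)
      then obtain N where N: "\<And>m n. m \<ge> N \<Longrightarrow> n \<ge> N \<Longrightarrow> dist (blinfun_apply (g k) (y m)) (blinfun_apply (g k) (y n)) < e/2"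
        using e unfolding Cauchy_def by (meson half_gt_zero)
      have app: "\<bar>blinfun_apply (g k) (y n) - blinfun_apply l (y n)\<bar> \<le> e/4" for n
      proof -
        have "\<bar>blinfun_apply (g k) (y n) - blinfun_apply l (y n)\<bar> \<le> norm (g k - l) * norm (y n)"
          using norm_blinfun[of "g k - l" "y n"] by (simp add: blinfun.diff_left)
        also have "\<dots> \<le> e / (4 * (B + 1)) * (B + 1)"
          using k B[of n] B0 e by (intro mult_mono) auto
        also have "\<dots> = e / 4" using B0 by (simp add: field_simps)
        finally show ?thesis .
      qed
      show "\<exists>N. \<forall>m\<ge>N. \<forall>n\<ge>N. dist (blinfun_apply l (y m)) (blinfun_apply l (y n)) < e"
      proof (intro exI[of _ N] allI impI)
        fix m n assume "N \<le> m" "N \<le> n"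
        then show "dist (blinfun_apply l (y m)) (blinfun_apply l (y n)) < e"
          using N[of m n] app[of m] app[of n] unfolding dist_real_def by linarith
      qed
    qed
    then show "l \<in> K" by (simp add: K_def Cauchy_convergent_iff)
  qed
  ultimately have "closure (span F) \<subseteq> K" by (intro closure_minimal)
  then have conv': "convergent (\<lambda>n. blinfun_apply f (y n))" for f :: "'a dual"
    by (subst (asm) separating_imp_total[OF refl sep]) (auto simp: K_def)
  define \<Lambda> where "\<Lambda> f = lim (\<lambda>n. blinfun_apply f (y n))" for f :: "'a dual"
  have \<Lambda>: "(\<lambda>n. blinfun_apply f (y n)) \<longlonglongrightarrow> \<Lambda> f" for f
    using conv'[of f] by (simp add: \<Lambda>_def convergent_LIMSEQ_iff)
  have \<Lambda>B: "norm (\<Lambda> f) \<le> norm f * B" for f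
  proof (rule tendsto_upperbound[OF tendsto_norm[OF \<Lambda>]])
    show "\<forall>\<^sub>F n in sequentially. norm (blinfun_apply f (y n)) \<le> norm f * B"
      by (rule eventuallyI) (meson norm_blinfun B mult_left_mono norm_ge_zero order_trans)
  qed simp
  have "bounded_linear \<Lambda>"
  proof (rule bounded_linear_intro[where K = B])
    fix f g :: "'a dual" and c :: real
    show "\<Lambda> (f + g) = \<Lambda> f + \<Lambda> g"
      using LIMSEQ_unique[OF \<Lambda>[of "f + g"]] tendsto_add[OF \<Lambda>[of f] \<Lambda>[of g]] by (simp add: blinfun.add_left)
    show "\<Lambda> (c *\<^sub>R f) = c *\<^sub>R \<Lambda> f"
      using LIMSEQ_unique[OF \<Lambda>[of "c *\<^sub>R f"]] tendsto_scaleR[OF tendsto_const[of c] \<Lambda>[of f]]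
      by (simp add: blinfun.scaleR_left)
  qed (rule \<Lambda>B)
  then obtain l where l: "\<And>f. \<Lambda> f = blinfun_apply f l"
    using refl unfolding reflexive_space_def by (metis bounded_linear_Blinfun_apply)
  have "weak_conv y l" using \<Lambda> l by (simp add: weak_conv_def)
  moreover have "norm l \<le> B"
  proof (rule norm_le_functional)
    fix \<phi> :: "'a dual" assume "norm \<phi> \<le> 1"
    have "blinfun_apply \<phi> l \<le> norm \<phi> * B" using \<Lambda>B[of \<phi>] l[of \<phi>] by (simp add: abs_le_iff)
    also have "\<dots> \<le> B" using \<open>norm \<phi> \<le> 1\<close> B0 by (simp add: mult_left_le_one_le)
    finally show "blinfun_apply \<phi> l \<le> B" .
  qed
  ultimately show thesis by (rule that)
qed

lemma weak_conv_unique: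
  fixes x :: "nat \<Rightarrow> 'a::real_normed_vector"
  assumes "weak_conv x l" "weak_conv x l'" shows "l = l'"
proof -
  have "blinfun_apply \<phi> (l - l') = 0" for \<phi> :: "'a dual"
    using assms LIMSEQ_unique unfolding weak_conv_def by (metis blinfun.diff_right right_minus_eq)
  then show ?thesis using functional_zero_imp_zero[of "l - l'"] by simp
qed

lemma weak_conv_subseq: "weak_conv x l \<Longrightarrow> strict_mono r \<Longrightarrow> weak_conv (x \<circ> r) l"
  using LIMSEQ_subseq_LIMSEQ unfolding weak_conv_def by (fastforce simp: comp_def)

lemma weak_conv_blinfun:
  fixes i :: "'a::real_normed_vector \<Rightarrow>\<^sub>L 'b::real_normed_vector"
  assumes "weak_conv x l" shows "weak_conv (\<lambda>n. blinfun_apply i (x n)) (blinfun_apply i l)"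
  unfolding weak_conv_def
proof
  fix \<phi> :: "'b dual"
  show "(\<lambda>n. blinfun_apply \<phi> (blinfun_apply i (x n))) \<longlonglongrightarrow> blinfun_apply \<phi> (blinfun_apply i l)"
    using assms[unfolded weak_conv_def, rule_format, of "\<phi> o\<^sub>L i"] by simp
qed

lemma LIMSEQ_imp_weak_conv: "x \<longlonglongrightarrow> l \<Longrightarrow> weak_conv x l"
  unfolding weak_conv_def by (auto intro!: tendsto_intros)

lemma blinfun_pair_split:
  fixes \<phi> :: "('a::real_normed_vector \<times> 'b::real_normed_vector) dual"
  obtains f :: "'a dual" and g :: "'b dual" where "\<And>x y. blinfun_apply \<phi> (x, y) = blinfun_apply f x + blinfun_apply g y"
proof -
  have 1: "bounded_linear (\<lambda>x::'a. (x, 0::'b))" and 2: "bounded_linear (\<lambda>y::'b. (0::'a, y))"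
    by (auto intro!: bounded_linear_intro[where K = 1] simp: norm_Pair)
  define f where "f = \<phi> o\<^sub>L Blinfun (\<lambda>x. (x, 0))"
  define g where "g = \<phi> o\<^sub>L Blinfun (\<lambda>y. (0, y))"
  have "blinfun_apply \<phi> (x, y) = blinfun_apply f x + blinfun_apply g y" for x y
    using blinfun.add_right[of \<phi> "(x, 0)" "(0, y)"]
    by (simp add: f_def g_def bounded_linear_Blinfun_apply[OF 1] bounded_linear_Blinfun_apply[OF 2])
  then show thesis by (rule that)
qed

lemma weak_conv_Pair:
  fixes a :: "'a::real_normed_vector" and b :: "'b::real_normed_vector"
  shows "weak_conv (\<lambda>n. (x n, y n)) (a, b) \<longleftrightarrow> weak_conv x a \<and> weak_conv y b"
proof
  assume *: "weak_conv (\<lambda>n. (x n, y n)) (a, b)"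
  have "weak_conv (\<lambda>n. blinfun_apply (Blinfun fst) (x n, y n)) (blinfun_apply (Blinfun fst) (a, b))"
    "weak_conv (\<lambda>n. blinfun_apply (Blinfun snd) (x n, y n)) (blinfun_apply (Blinfun snd) (a, b))"
    by (intro weak_conv_blinfun *)+
  then show "weak_conv x a \<and> weak_conv y b"
    by (simp add: bounded_linear_Blinfun_apply bounded_linear_fst bounded_linear_snd)
next
  assume *: "weak_conv x a \<and> weak_conv y b"
  show "weak_conv (\<lambda>n. (x n, y n)) (a, b)"
    unfolding weak_conv_def
  proof
    fix \<phi> :: "('a \<times> 'b) dual"
    obtain f :: "'a dual" and g :: "'b dual" where "\<And>x y. blinfun_apply \<phi> (x, y) = blinfun_apply f x + blinfun_apply g y"
      by (rule blinfun_pair_split[of \<phi>]) (rule that)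
    then show "(\<lambda>n. blinfun_apply \<phi> (x n, y n)) \<longlonglongrightarrow> blinfun_apply \<phi> (a, b)"
      using * by (auto simp: weak_conv_def intro!: tendsto_add)
  qed
qed

text \<open>Norming functionals at the points of a countable dense set. The dual ball need not be
  separable in norm, yet countably many functionals recover every norm up to e; this reduces
  measurability of vector-valued maps and the extraction of weak limits to countably many scalar
  statements.\<close>

lemma norming_sequence:
  obtains \<phi> :: "nat \<Rightarrow> 'a::{real_normed_vector,second_countable_topology} dual"
  where "\<And>n. norm (\<phi> n) \<le> 1" "\<And>x e. 0 < e \<Longrightarrow> \<exists>n. norm x - e < blinfun_apply (\<phi> n) x"
proof -
  obtain D :: "'a set" where D: "countable D" "D \<noteq> {}" "\<And>x e. 0 < e \<Longrightarrow> \<exists>d\<in>D. dist d x < e"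
  proof -
    obtain D :: "'a set" where D: "countable D" "\<And>X. open X \<Longrightarrow> X \<noteq> {} \<Longrightarrow> \<exists>d\<in>D. d \<in> X"
      using countable_dense_exists by metis
    have *: "\<exists>d\<in>D. dist d x < e" if "0 < e" for x e
      using D(2)[of "ball x e"] that by (force simp: dist_commute)
    moreover have "D \<noteq> {}" using *[of 1] by auto
    ultimately show thesis using D(1) that by blast
  qed
  have "\<forall>v :: 'a. \<exists>\<phi> :: 'a dual. norm \<phi> \<le> 1 \<and> blinfun_apply \<phi> v = norm v"
    by (meson norming_functional)
  then obtain \<psi> :: "'a \<Rightarrow> 'a dual" where \<psi>: "\<And>v. norm (\<psi> v) \<le> 1" "\<And>v. blinfun_apply (\<psi> v) v = norm v"
    by metis
  show thesis
  proof (rule that[of "\<lambda>n. \<psi> (from_nat_into D n)"])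
    fix x :: 'a and e :: real assume "0 < e"
    then obtain d where d: "d \<in> D" "dist d x < e/2" using D(3)[of "e/2" x] by auto
    then obtain n where n: "from_nat_into D n = d" using from_nat_into_surj[OF D(1)] by blast
    have "blinfun_apply (\<psi> d) (d - x) \<le> norm (\<psi> d) * norm (d - x)" by (rule blinfun_le_norm)
    also have "\<dots> \<le> norm (d - x)" using \<psi>(1)[of d] by (simp add: mult_left_le_one_le)
    finally have "norm d - norm (d - x) \<le> blinfun_apply (\<psi> d) x" by (simp add: blinfun.diff_right \<psi>(2))
    moreover have "norm x \<le> norm d + norm (d - x)" by (metis norm_minus_commute norm_triangle_sub)
    moreover have "norm (d - x) < e/2" using d by (simp add: dist_norm)
    ultimately have "norm x - e < blinfun_apply (\<psi> (from_nat_into D n)) x" unfolding n by linarith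
    then show "\<exists>n. norm x - e < blinfun_apply (\<psi> (from_nat_into D n)) x" ..
  qed (use \<psi>(1) in auto)
qed

lemma norming_imp_separating:
  assumes "\<And>x e. 0 < e \<Longrightarrow> \<exists>n. norm x - e < blinfun_apply (\<phi> n) x" and "\<And>n. blinfun_apply (\<phi> n) x = 0"
  shows "x = (0::'a::real_normed_vector)"
proof (rule ccontr)
  assume "x \<noteq> 0"
  then show False using assms(1)[of "norm x" x] assms(2) by auto
qed

text \<open>Each tail of the diagonal sequence is a subsequence of the corresponding stage, and
  convergence is inherited by subsequences.\<close>

lemma diagonal_convergent:
  fixes a :: "nat \<Rightarrow> nat \<Rightarrow> real"
  assumes "\<And>i. bounded (range (a i))"
  obtains r where "strict_mono r" "\<And>i. convergent (\<lambda>n. a i (r n))"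
proof -
  interpret subseqs "\<lambda>i s. convergent (\<lambda>n. a i (s n))"
  proof
    fix i and s :: "nat \<Rightarrow> nat"
    have "bounded (range (a i \<circ> s))" using assms[of i] by (rule bounded_subset) auto
    then obtain l r where "strict_mono r" "((a i \<circ> s) \<circ> r) \<longlonglongrightarrow> l"
      using bounded_imp_convergent_subsequence by metis
    then show "\<exists>r'. strict_mono r' \<and> convergent (\<lambda>n. a i ((s \<circ> r') n))"
      by (auto simp: convergent_def comp_def)
  qed
  have "convergent (\<lambda>n. a i ((diagseq \<circ> (+) (Suc i)) n))" for i
    by (rule diagseq_holds) (auto simp: comp_def intro: convergent_subseq_convergent[unfolded comp_def])
  then have "convergent (\<lambda>n. a i (diagseq (n + Suc i)))" for i
    unfolding comp_def by (subst add.commute)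
  then have "convergent (\<lambda>n. a i (diagseq n))" for i
    using convergent_ignore_initial_segment[of "\<lambda>n. a i (diagseq n)" "Suc i"] by blast
  then show thesis using that subseq_diagseq by blast
qed

text \<open>Separability gives a subsequence converging at every point of the space, first on a
  countable dense set. \<open>weak_conv\<close> in the dual tests against the bidual, and
  reflexivity identifies this with pointwise convergence; \<open>H_closed\<close> asks for weak
  convergence of the forces in exactly this sense.\<close>

lemma weak_compact_dual:
  fixes \<xi> :: "nat \<Rightarrow> 'a::{banach,second_countable_topology} dual"
  assumes refl: "reflexive_space TYPE('a)" and B: "\<And>n. norm (\<xi> n) \<le> B"
  obtains r l where "strict_mono r" "weak_conv (\<xi> \<circ> r) l"
proof -
  have B0: "0 \<le> B" using B[of 0] norm_ge_zero order_trans by blast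
  obtain D :: "'a set" where D: "countable D" "\<And>X. open X \<Longrightarrow> X \<noteq> {} \<Longrightarrow> \<exists>d\<in>D. d \<in> X"
    using countable_dense_exists by metis
  have dense: "\<exists>d\<in>D. dist d x < e" if "0 < e" for x e
    using D(2)[of "ball x e"] that by (force simp: dist_commute)
  then have Dne: "D \<noteq> {}" using zero_less_one by blast
  define d where "d i = from_nat_into D i" for i
  have "bounded (range (\<lambda>n. blinfun_apply (\<xi> n) (d i)))" for i
  proof (rule boundedI[of _ "B * norm (d i)"], safe)
    fix n
    show "norm (blinfun_apply (\<xi> n) (d i)) \<le> B * norm (d i)"
      by (rule order_trans[OF norm_blinfun mult_right_mono[OF B]]) simp
  qed
  then obtain r where r: "strict_mono r" "\<And>i. convergent (\<lambda>n. blinfun_apply (\<xi> (r n)) (d i))"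
    using diagonal_convergent[of "\<lambda>i n. blinfun_apply (\<xi> n) (d i)"] by metis
  have conv: "convergent (\<lambda>n. blinfun_apply (\<xi> (r n)) x)" for x
    unfolding Cauchy_convergent_iff[symmetric]
  proof (rule metric_CauchyI)
    fix e :: real assume e: "0 < e"
    then obtain v where v: "v \<in> D" "dist v x < e / (4 * (B + 1))" using dense[of "e / (4 * (B + 1))"] B0 by auto
    then obtain i where i: "v = d i" unfolding d_def using from_nat_into_surj[OF D(1)] by metis
    have "Cauchy (\<lambda>n. blinfun_apply (\<xi> (r n)) v)" using r(2) i by (simp add: convergent_Cauchy)
    then obtain N where N: "\<And>m n. m \<ge> N \<Longrightarrow> n \<ge> N \<Longrightarrow> dist (blinfun_apply (\<xi> (r m)) v) (blinfun_apply (\<xi> (r n)) v) < e/2"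
      using e unfolding Cauchy_def by (meson half_gt_zero)
    have app: "\<bar>blinfun_apply (\<xi> n) v - blinfun_apply (\<xi> n) x\<bar> \<le> e/4" for n
    proof -
      have "\<bar>blinfun_apply (\<xi> n) v - blinfun_apply (\<xi> n) x\<bar> \<le> norm (\<xi> n) * norm (v - x)"
        using norm_blinfun[of "\<xi> n" "v - x"] by (simp add: blinfun.diff_right)
      also have "\<dots> \<le> (B + 1) * (e / (4 * (B + 1)))"
        using v(2) B[of n] B0 by (intro mult_mono) (auto simp: dist_norm)
      also have "\<dots> = e / 4" using B0 by (simp add: field_simps)
      finally show ?thesis .
    qed
    show "\<exists>N. \<forall>m\<ge>N. \<forall>n\<ge>N. dist (blinfun_apply (\<xi> (r m)) x) (blinfun_apply (\<xi> (r n)) x) < e"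
    proof (intro exI[of _ N] allI impI)
      fix m n assume "N \<le> m" "N \<le> n"
      then show "dist (blinfun_apply (\<xi> (r m)) x) (blinfun_apply (\<xi> (r n)) x) < e"
        using N[of m n] app[of "r m"] app[of "r n"] unfolding dist_real_def by linarith
    qed
  qed
  define \<Lambda> where "\<Lambda> x = lim (\<lambda>n. blinfun_apply (\<xi> (r n)) x)" for x
  have \<Lambda>: "(\<lambda>n. blinfun_apply (\<xi> (r n)) x) \<longlonglongrightarrow> \<Lambda> x" for x
    using conv[of x] by (simp add: \<Lambda>_def convergent_LIMSEQ_iff)
  have "bounded_linear \<Lambda>"
  proof (rule bounded_linear_intro[where K = B])
    fix x y :: 'a and c :: real
    show "\<Lambda> (x + y) = \<Lambda> x + \<Lambda> y"
      using LIMSEQ_unique[OF \<Lambda>[of "x + y"]] tendsto_add[OF \<Lambda>[of x] \<Lambda>[of y]] by (simp add: blinfun.add_right)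
    show "\<Lambda> (c *\<^sub>R x) = c *\<^sub>R \<Lambda> x"
      using LIMSEQ_unique[OF \<Lambda>[of "c *\<^sub>R x"]] tendsto_scaleR[OF tendsto_const[of c] \<Lambda>[of x]]
      by (simp add: blinfun.scaleR_right)
    show "norm (\<Lambda> x) \<le> norm x * B"
    proof (rule tendsto_upperbound[OF tendsto_norm[OF \<Lambda>]])
      show "\<forall>\<^sub>F n in sequentially. norm (blinfun_apply (\<xi> (r n)) x) \<le> norm x * B"
        by (rule eventuallyI) (metis norm_blinfun B mult.commute mult_left_mono norm_ge_zero order_trans)
    qed simp
  qed
  then have "(\<lambda>n. blinfun_apply (\<xi> (r n)) x) \<longlonglongrightarrow> blinfun_apply (Blinfun \<Lambda>) x" for x
    using \<Lambda> by (simp add: bounded_linear_Blinfun_apply)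
  moreover obtain x where "\<And>\<Phi> \<phi>. blinfun_apply \<Phi> \<phi> = blinfun_apply \<phi> ((x :: 'a dual dual \<Rightarrow> 'a) \<Phi>)"
    using refl unfolding reflexive_space_def by metis
  ultimately have "weak_conv (\<xi> \<circ> r) (Blinfun \<Lambda>)"
    by (simp add: weak_conv_def)
  then show thesis using r(1) that by blast
qed

text \<open>A subsequence staying away from the claimed limit has, by compactness, a further
  subsequence converging in norm; its limit is also a weak limit and therefore the claimed
  one.\<close>

lemma compact_operator_weak_conv:
  fixes i :: "'a::real_normed_vector \<Rightarrow>\<^sub>L 'b::real_normed_vector"
  assumes i: "compact_operator i" and w: "weak_conv y l" and B: "\<And>n. norm (y n) \<le> B"
  shows "(\<lambda>n. blinfun_apply i (y n)) \<longlonglongrightarrow> blinfun_apply i l"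
proof (rule ccontr)
  assume "\<not> ?thesis"
  then obtain e where e: "0 < e" "\<And>N. \<exists>n\<ge>N. e \<le> dist (blinfun_apply i (y n)) (blinfun_apply i l)"
    unfolding LIMSEQ_def by (meson not_le)
  then have "\<not> (\<forall>\<^sub>F n in sequentially. dist (blinfun_apply i (y n)) (blinfun_apply i l) < e)"
    unfolding eventually_sequentially by (meson not_le)
  then obtain r :: "nat \<Rightarrow> nat" where r: "strict_mono r" "\<And>n. e \<le> dist (blinfun_apply i (y (r n))) (blinfun_apply i l)"
    using not_eventually_sequentiallyD[of "\<lambda>n. dist (blinfun_apply i (y n)) (blinfun_apply i l) < e"]
    by (auto simp: not_less)
  \<comment> \<open>Division by c brings the sequence into the unit ball, for which compactness of
    the operator is stated; the summand 1 keeps c positive.\<close>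
  define c where "c = B + 1"
  have c: "0 < c" using B[of 0] norm_ge_zero[of "y 0"] unfolding c_def by linarith
  define w where "w n = (1 / c) *\<^sub>R blinfun_apply i (y (r n))" for n
  have "w n \<in> closure (blinfun_apply i ` cball 0 1)" for n
  proof -
    have "norm ((1 / c) *\<^sub>R y (r n)) \<le> 1" using B[of "r n"] c by (simp add: c_def)
    then have "blinfun_apply i ((1 / c) *\<^sub>R y (r n)) \<in> blinfun_apply i ` cball 0 1" by simp
    then show ?thesis using closure_subset[of "blinfun_apply i ` cball 0 1"] by (simp add: w_def blinfun.scaleR_right subset_iff)
  qed
  then obtain s v where s: "strict_mono s" "(w \<circ> s) \<longlonglongrightarrow> v"
    using i unfolding compact_operator_def compact_def by metis
  have eq: "blinfun_apply i (y ((r \<circ> s) n)) = c *\<^sub>R w (s n)" for n using c by (simp add: w_def)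
  have "(\<lambda>n. c *\<^sub>R (w \<circ> s) n) \<longlonglongrightarrow> c *\<^sub>R v" by (intro tendsto_intros s)
  then have lim: "(\<lambda>n. blinfun_apply i (y ((r \<circ> s) n))) \<longlonglongrightarrow> c *\<^sub>R v" unfolding eq by (simp add: comp_def)
  have "weak_conv (\<lambda>n. blinfun_apply i (y ((r \<circ> s) n))) (blinfun_apply i l)"
    using weak_conv_blinfun[OF weak_conv_subseq[OF assms(2) strict_mono_o[OF r(1) s(1)]]] by (simp add: comp_def)
  then have "c *\<^sub>R v = blinfun_apply i l" using LIMSEQ_imp_weak_conv[OF lim] weak_conv_unique by blast
  then have "(\<lambda>n. blinfun_apply i (y ((r \<circ> s) n))) \<longlonglongrightarrow> blinfun_apply i l" using lim by simp
  then have "\<forall>\<^sub>F n in sequentially. dist (blinfun_apply i (y ((r \<circ> s) n))) (blinfun_apply i l) < e"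
    using e(1) by (rule tendstoD)
  then obtain n where "dist (blinfun_apply i (y (r (s n)))) (blinfun_apply i l) < e"
    by (auto simp: eventually_sequentially)
  then show False using r(2)[of "s n"] by simp
qed

section \<open>Absolutely continuous curves\<close>

text \<open>Restriction to subintervals and enlargement by end points become inclusions of
  negligible sets in this form.\<close>

lemma AE_lebesgue_on_iff_negligible:
  "(AE s in lebesgue_on {a..b::real}. P s) \<longleftrightarrow> negligible {s \<in> {a..b}. \<not> P s}"
proof -
  have "(AE s in lebesgue_on {a..b}. P s) \<longleftrightarrow> (AE s in lebesgue. s \<in> {a..b} \<longrightarrow> P s)"
    by (rule AE_restrict_space_iff) simp
  also have "\<dots> \<longleftrightarrow> negligible {s \<in> {a..b}. \<not> P s}"
  proof
    assume "AE s in lebesgue. s \<in> {a..b} \<longrightarrow> P s"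
    then obtain N where "{s \<in> space lebesgue. \<not> (s \<in> {a..b} \<longrightarrow> P s)} \<subseteq> N" "N \<in> null_sets lebesgue"
      by (auto simp: eventually_ae_filter)
    moreover from this have "{s \<in> {a..b}. \<not> P s} \<subseteq> N" by auto
    ultimately show "negligible {s \<in> {a..b}. \<not> P s}"
      using negligible_iff_null_sets negligible_subset by blast
  next
    assume "negligible {s \<in> {a..b}. \<not> P s}"
    then show "AE s in lebesgue. s \<in> {a..b} \<longrightarrow> P s"
      by (intro AE_I'[of "{s \<in> {a..b}. \<not> P s}"]) (auto simp: negligible_iff_null_sets)
  qed
  finally show ?thesis .
qed

lemma AE_lebesgue_onI:
  assumes "negligible N" "\<And>s. a < s \<Longrightarrow> s < b \<Longrightarrow> s \<notin> N \<Longrightarrow> P s"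
  shows "AE s in lebesgue_on {a..b::real}. P s"
  unfolding AE_lebesgue_on_iff_negligible
proof (rule negligible_subset)
  show "negligible (N \<union> {a, b})" using assms(1) by (simp add: negligible_Un)
  show "{s \<in> {a..b}. \<not> P s} \<subseteq> N \<union> {a, b}" using assms(2) by force
qed

lemma AE_lebesgue_on_subinterval:
  assumes "AE s in lebesgue_on {a..b::real}. P s" "a \<le> c" "d \<le> b"
  shows "AE s in lebesgue_on {c..d}. P s"
  using assms(1) unfolding AE_lebesgue_on_iff_negligible
  by (rule negligible_subset) (use assms(2,3) in auto)

lemma AE_lebesgue_on_interior: "AE s in lebesgue_on {a..b::real}. a < s \<and> s < b"
  by (rule AE_lebesgue_onI[of "{}"]) auto

text \<open>Lebesgue's differentiation theorem, from the Saks-Henstock lemma and a Vitali covering.\<close>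

lemma indefinite_integral_derivative_ae:
  fixes f :: "real \<Rightarrow> real"
  assumes f: "f integrable_on {a..b}"
  shows "AE x in lebesgue_on {a..b}. ((\<lambda>s. integral {a..s} f) has_real_derivative f x) (at x)"
proof -
  define F where "F s = integral {a..s} f" for s
  have F: "integral {x..y} f = F y - F x" if "a \<le> x" "x \<le> y" "y \<le> b" for x y
  proof -
    have "f integrable_on {a..y}" using f by (rule integrable_subinterval_real) (use that in auto)
    then show ?thesis using Henstock_Kurzweil_Integration.integral_combine[of a x y f] that by (simp add: F_def)
  qed
  \<comment> \<open>A bad step is one whose difference quotient misses f x by more than e.
    \<open>E e\<close> collects the points with arbitrarily small bad steps, so the derivative
    exists outside the union of these sets over e = 1/(n+1).\<close>
  define bad where "bad e x h \<longleftrightarrow> h \<noteq> 0 \<and> x + h \<in> {a..b} \<and> e * \<bar>h\<bar> < \<bar>F (x + h) - F x - f x * h\<bar>" for e x h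
  define E where "E e = {x \<in> {a<..<b}. \<forall>d>0. \<exists>h. bad e x h \<and> \<bar>h\<bar> < d}" for e
  have neg: "negligible (E e)" if e: "0 < e" for e
    unfolding negligible_outer_le
  proof (intro allI impI)
    fix \<epsilon> :: real assume \<epsilon>: "0 < \<epsilon>"
    \<comment> \<open>With tolerance \<epsilon> * e the Henstock sum over disjoint bad intervals,
      which is at least e times their total length, forces that length below \<epsilon>.\<close>
    have "f integrable_on cbox a b" "0 < \<epsilon> * e" using f \<epsilon> e by auto
    then obtain \<gamma> where \<gamma>: "gauge \<gamma>"
      and H: "\<And>p. p tagged_partial_division_of (cbox a b) \<Longrightarrow> \<gamma> fine p \<Longrightarrow>
             (\<Sum>(x,k)\<in>p. norm (measure lborel k *\<^sub>R f x - integral k f)) < \<epsilon> * e"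
      by (rule Henstock_lemma) (rule that)
    \<comment> \<open>A bad step becomes the closed interval between x and x + h, written as a ball
      around x + h/2 as the Vitali covering theorem requires, and lying in the gauge neighbourhood
      of its tag x as fineness requires.\<close>
    define I where "I = {(x, h). x \<in> E e \<and> bad e x h \<and> cball (x + h/2) (\<bar>h\<bar>/2) \<subseteq> \<gamma> x}"
    define c where "c i = fst i + snd i / 2" for i :: "real \<times> real"
    define r where "r i = \<bar>snd i\<bar> / 2" for i :: "real \<times> real"
    have fine: "\<exists>i. i \<in> I \<and> x \<in> cball (c i) (r i) \<and> r i < d" if x: "x \<in> E e" and d: "0 < d" for x d
    proof -
      have "open (\<gamma> x)" "x \<in> \<gamma> x" using \<gamma> by (auto simp: gauge_def)
      then obtain \<delta> where \<delta>: "0 < \<delta>" "ball x \<delta> \<subseteq> \<gamma> x" by (meson openE)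
      have "\<forall>d>0. \<exists>h. bad e x h \<and> \<bar>h\<bar> < d" using x by (simp add: E_def)
      moreover have "0 < min \<delta> d" using \<delta>(1) d by simp
      ultimately obtain h where h: "bad e x h" "\<bar>h\<bar> < min \<delta> d" by blast
      have "cball (x + h/2) (\<bar>h\<bar>/2) \<subseteq> ball x \<delta>"
      proof
        fix y assume "y \<in> cball (x + h/2) (\<bar>h\<bar>/2)"
        then have "\<bar>x + h/2 - y\<bar> \<le> \<bar>h\<bar>/2" by (simp add: dist_real_def)
        moreover have "\<bar>x - y\<bar> \<le> \<bar>x + h/2 - y\<bar> + \<bar>h\<bar>/2" by linarith
        ultimately show "y \<in> ball x \<delta>" using h(2) by (simp add: dist_real_def)
      qed
      then have "(x, h) \<in> I" using x h \<delta>(2) unfolding I_def by blast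
      moreover have "x \<in> cball (c (x, h)) (r (x, h))"
        by (simp add: c_def r_def dist_real_def)
      moreover have "r (x, h) < d" using h(2) d by (simp add: r_def)
      ultimately show ?thesis by blast
    qed
    have r0: "0 < r i" if "i \<in> I" for i using that by (auto simp: I_def r_def bad_def)
    obtain C where C: "countable C" "C \<subseteq> I"
      "pairwise (\<lambda>i j. disjnt (cball (c i) (r i)) (cball (c j) (r j))) C"
      "negligible (E e - (\<Union>i\<in>C. cball (c i) (r i)))"
      by (rule Vitali_covering_theorem_cballs[of I r "E e" c]) (use r0 fine in \<open>simp; fail\<close>)+
    have bound: "measure lebesgue (\<Union>i\<in>J. cball (c i) (r i)) \<le> \<epsilon>" if J: "J \<subseteq> C" "finite J" for J
    proof -
      define K where "K i = (fst i, cball (c i) (r i))" for i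
      have JI: "J \<subseteq> I" using J C by blast
      have cb: "cball (c i) (r i) = {min (fst i) (fst i + snd i)..max (fst i) (fst i + snd i)}" for i
        by (cases "0 \<le> snd i") (simp_all add: c_def r_def cball_eq_atLeastAtMost min_def max_def field_simps)
      have pos: "0 < r i" if "i \<in> J" for i using that JI by (auto simp: I_def r_def bad_def)
      have disj: "cball (c i) (r i) \<inter> cball (c j) (r j) = {}" if "i \<in> J" "j \<in> J" "i \<noteq> j" for i j
        using C(3) J(1) that by (auto simp: pairwise_def disjnt_def)
      have inj: "inj_on K J"
      proof (rule inj_onI, rule ccontr)
        fix i j assume ij: "i \<in> J" "j \<in> J" "K i = K j" "i \<noteq> j"
        then have "cball (c i) (r i) = {}" using disj[OF ij(1,2,4)] by (simp add: K_def)
        then show False using pos[OF ij(1)] by simp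
      qed
      have sub: "cball (c i) (r i) \<subseteq> {a..b}" if "i \<in> J" for i
        using that JI unfolding cb by (auto simp: I_def bad_def E_def)
      have "K ` J tagged_partial_division_of cbox a b"
        unfolding tagged_partial_division_of_def
      proof (intro conjI allI impI)
        show "finite (K ` J)" using J(2) by simp
      next
        fix x k assume "(x, k) \<in> K ` J"
        then obtain i where i: "i \<in> J" "x = fst i" "k = cball (c i) (r i)" by (auto simp: K_def)
        show "x \<in> k" unfolding i(2,3) cb by auto
        show "k \<subseteq> cbox a b" using sub[OF i(1)] i(3) by simp
        show "\<exists>u v. k = cbox u v" unfolding i(3) cb by (metis box_real(2))
      next
        fix x1 k1 x2 k2 assume *: "(x1, k1) \<in> K ` J \<and> (x2, k2) \<in> K ` J \<and> (x1, k1) \<noteq> (x2, k2)"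
        then obtain i j where ij: "i \<in> J" "j \<in> J" "i \<noteq> j" "k1 = cball (c i) (r i)" "k2 = cball (c j) (r j)"
          by (auto simp: K_def)
        then show "interior k1 \<inter> interior k2 = {}" using disj[OF ij(1,2,3)] interior_subset by blast
      qed
      moreover have "\<gamma> fine (K ` J)"
      proof -
        have "k \<subseteq> \<gamma> x" if xk: "(x, k) \<in> K ` J" for x k
        proof -
          obtain i where i: "i \<in> J" "x = fst i" "k = cball (c i) (r i)" using xk by (auto simp: K_def)
          show ?thesis using subsetD[OF JI i(1)] by (simp add: I_def c_def r_def split_beta i(2,3))
        qed
        then show ?thesis unfolding fine_def by blast
      qed
      ultimately have "(\<Sum>(x,k)\<in>K ` J. norm (measure lborel k *\<^sub>R f x - integral k f)) < \<epsilon> * e" by (rule H)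
      then have S: "(\<Sum>i\<in>J. \<bar>measure lborel (cball (c i) (r i)) * f (fst i) - integral (cball (c i) (r i)) f\<bar>) < \<epsilon> * e"
        by (subst (asm) sum.reindex[OF inj]) (simp add: K_def comp_def)
      have "e * measure lebesgue (\<Union>i\<in>J. cball (c i) (r i)) \<le> e * (\<Sum>i\<in>J. measure lebesgue (cball (c i) (r i)))"
        using e J(2) by (intro mult_left_mono measure_UNION_le) auto
      also have "\<dots> \<le> (\<Sum>i\<in>J. \<bar>measure lborel (cball (c i) (r i)) * f (fst i) - integral (cball (c i) (r i)) f\<bar>)"
        unfolding sum_distrib_left
      proof (rule sum_mono)
        fix i assume i: "i \<in> J"
        obtain x h where xh: "i = (x, h)" by (cases i)
        have b: "bad e x h" "x \<in> {a<..<b}" using i JI xh by (auto simp: I_def E_def)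
        have len: "measure lebesgue (cball (c i) (r i)) = \<bar>h\<bar>" "measure lborel (cball (c i) (r i)) = \<bar>h\<bar>"
          unfolding cb by (auto simp: xh)
        have "\<bar>\<bar>h\<bar> * f x - integral (cball (c i) (r i)) f\<bar> = \<bar>F (x + h) - F x - f x * h\<bar>"
        proof (cases "0 \<le> h")
          case True
          then have "integral (cball (c i) (r i)) f = F (x + h) - F x"
            unfolding cb using F[of x "x + h"] b by (simp add: xh bad_def)
          then show ?thesis using True by (simp add: abs_if mult.commute)
        next
          case False
          then have "integral (cball (c i) (r i)) f = F x - F (x + h)"
            unfolding cb using F[of "x + h" x] b by (simp add: xh bad_def min_def max_def)
          then show ?thesis using False by (simp add: abs_if mult.commute)
        qed
        then show "e * measure lebesgue (cball (c i) (r i)) \<le> \<bar>measure lborel (cball (c i) (r i)) * f (fst i) - integral (cball (c i) (r i)) f\<bar>"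
          using b(1) unfolding len by (simp add: xh bad_def)
      qed
      finally have "e * measure lebesgue (\<Union>i\<in>J. cball (c i) (r i)) \<le> e * \<epsilon>"
        using S by (simp add: mult.commute)
      then show ?thesis using e by simp
    qed
    have U: "(\<Union>i\<in>C. cball (c i) (r i)) \<in> lmeasurable" "measure lebesgue (\<Union>i\<in>C. cball (c i) (r i)) \<le> \<epsilon>"
      using fmeasurable_UN_bound[OF C(1) _ bound] measure_UN_bound[OF C(1) _ bound] by auto
    show "\<exists>T. E e \<subseteq> T \<and> T \<in> lmeasurable \<and> measure lebesgue T \<le> \<epsilon>"
    proof (intro exI[of _ "(\<Union>i\<in>C. cball (c i) (r i)) \<union> (E e - (\<Union>i\<in>C. cball (c i) (r i)))"] conjI)
      show "(\<Union>i\<in>C. cball (c i) (r i)) \<union> (E e - (\<Union>i\<in>C. cball (c i) (r i))) \<in> lmeasurable"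
        using U(1) C(4) by (intro fmeasurable.Un) (auto intro: negligible_imp_measurable)
      show "measure lebesgue ((\<Union>i\<in>C. cball (c i) (r i)) \<union> (E e - (\<Union>i\<in>C. cball (c i) (r i)))) \<le> \<epsilon>"
        using U C(4) by (subst measure_Un_null_set) (auto simp: negligible_iff_null_sets)
    qed auto
  qed
  have "negligible (\<Union>n. E (1 / real (Suc n)))" by (intro negligible_countable_Union) (auto intro: neg)
  then show ?thesis
  proof (rule AE_lebesgue_onI)
    fix x assume x: "a < x" "x < b" "x \<notin> (\<Union>n. E (1 / real (Suc n)))"
    have "((\<lambda>h. (F (x + h) - F x) / h) \<longlongrightarrow> f x) (at 0)"
    proof (rule tendstoI)
      fix e :: real assume "0 < e"
      then obtain n where n: "1 / real (Suc n) < e" by (metis nat_approx_posE)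
      have "\<exists>d>0. \<forall>h. bad (1 / real (Suc n)) x h \<longrightarrow> \<not> \<bar>h\<bar> < d"
        using x by (auto simp: E_def simp del: of_nat_Suc)
      then obtain d where d: "0 < d" "\<And>h. \<bar>h\<bar> < d \<Longrightarrow> \<not> bad (1 / real (Suc n)) x h"
        by blast
      have "dist ((F (x + h) - F x) / h) (f x) < e" if h: "h \<noteq> 0" "\<bar>h\<bar> < min d (min (x - a) (b - x))" for h
      proof -
        have "\<bar>F (x + h) - F x - f x * h\<bar> \<le> 1 / real (Suc n) * \<bar>h\<bar>"
          using d(2)[of h] h x by (auto simp: bad_def)
        then have "\<bar>F (x + h) - F x - f x * h\<bar> / \<bar>h\<bar> \<le> 1 / real (Suc n)" using h(1) by (simp add: pos_divide_le_eq)
        moreover have "\<bar>F (x + h) - F x - f x * h\<bar> / \<bar>h\<bar> = \<bar>(F (x + h) - F x) / h - f x\<bar>"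
          using h(1) unfolding abs_divide[symmetric] by (simp add: diff_divide_distrib)
        ultimately show ?thesis using n by (simp add: dist_real_def)
      qed
      then show "\<forall>\<^sub>F h in at 0. dist ((F (x + h) - F x) / h) (f x) < e"
        unfolding eventually_at using d(1) x
        by (intro exI[of _ "min d (min (x - a) (b - x))"]) (auto simp: dist_real_def)
    qed
    then show "((\<lambda>s. integral {a..s} f) has_real_derivative f x) (at x)"
      by (simp add: DERIV_def F_def)
  qed
qed

section \<open>Fundamental theorem of calculus for absolutely continuous functions\<close>

lemma set_integral_split:
  assumes "set_integrable lebesgue {a..b::real} (f :: real \<Rightarrow> real)" "a \<le> x" "x \<le> y" "y \<le> b"
  shows "(LINT s:{x..y}|lebesgue. f s) = integral {a..y} f - integral {a..x} f"
proof -
  have i: "f absolutely_integrable_on {u..v}" if "a \<le> u" "v \<le> b" for u v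
    using assms(1) by (rule set_integrable_subset) (use that in auto)
  have "(LINT s:{x..y}|lebesgue. f s) = integral {x..y} f"
    using i[of x y] assms by (intro set_lebesgue_integral_eq_integral(2)) auto
  also have "\<dots> = integral {a..y} f - integral {a..x} f"
    using Henstock_Kurzweil_Integration.integral_combine[of a x y f] assms
      set_lebesgue_integral_eq_integral(1)[OF i[of a y]] by simp
  finally show ?thesis .
qed

lemma indefinite_integral_has_derivative_ae:
  fixes f g :: "real \<Rightarrow> real"
  assumes g: "set_integrable lebesgue {a..b} g"
    and f: "\<And>x y. a \<le> x \<Longrightarrow> x \<le> y \<Longrightarrow> y \<le> b \<Longrightarrow> f y - f x = (LINT s:{x..y}|lebesgue. g s)"
  shows "AE x in lebesgue_on {a..b}. (f has_real_derivative g x) (at x)"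
proof -
  have eq: "f y = f a + integral {a..y} g" if "y \<in> {a<..<b}" for y
    using f[of a y] set_integral_split[OF g, of a y] that by simp
  have "g integrable_on {a..b}" using g by (rule set_lebesgue_integral_eq_integral(1))
  from indefinite_integral_derivative_ae[OF this] AE_lebesgue_on_interior
  show ?thesis
  proof eventually_elim
    case (elim x)
    have "((\<lambda>s. f a + integral {a..s} g) has_real_derivative g x) (at x)"
      using DERIV_add[OF DERIV_const elim(1)] by simp
    then show ?case
      by (rule has_field_derivative_transform_within_open[of _ _ _ "{a<..<b}"]) (use elim eq in auto)
  qed
qed

text \<open>Serves to compare two Stieltjes measures at once with a measure that has a
  density.\<close>

definition sum_measure :: "'a measure \<Rightarrow> 'a measure \<Rightarrow> 'a measure" where
  "sum_measure M N = measure_of (space M) (sets M) (\<lambda>A. emeasure M A + emeasure N A)"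

lemma sets_sum_measure [simp]: "sets (sum_measure M N) = sets M"
  by (simp add: sum_measure_def)

lemma emeasure_sum_measure:
  assumes "sets N = sets M" "A \<in> sets M"
  shows "emeasure (sum_measure M N) A = emeasure M A + emeasure N A"
  unfolding sum_measure_def
proof (rule emeasure_measure_of_sigma)
  show "positive (sets M) (\<lambda>A. emeasure M A + emeasure N A)" by (simp add: positive_def)
  show "countably_additive (sets M) (\<lambda>A. emeasure M A + emeasure N A)"
  proof (rule countably_additiveI)
    fix A :: "nat \<Rightarrow> 'a set"
    assume A: "range A \<subseteq> sets M" "disjoint_family A"
    have "(\<Sum>i. emeasure M (A i) + emeasure N (A i)) = (\<Sum>i. emeasure M (A i)) + (\<Sum>i. emeasure N (A i))"
      by (rule suminf_add[symmetric]) auto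
    also have "\<dots> = emeasure M (\<Union>i. A i) + emeasure N (\<Union>i. A i)"
      using A assms(1) by (simp add: suminf_emeasure)
    finally show "(\<Sum>i. emeasure M (A i) + emeasure N (A i)) = emeasure M (\<Union>i. A i) + emeasure N (\<Union>i. A i)" .
  qed
qed (use assms in \<open>auto intro: sets.sigma_algebra_axioms\<close>)

text \<open>A function that is constant to the right of b puts no mass beyond max x b, so the
  half-line reduces to a bounded interval.\<close>

lemma emeasure_interval_measure_greaterThan:
  assumes mono: "\<And>x y. x \<le> y \<Longrightarrow> F x \<le> F y" and cont: "continuous_on UNIV F"
    and const: "\<And>x. b \<le> x \<Longrightarrow> F x = F b"
  shows "emeasure (interval_measure F) {x<..} = ennreal (F b - F x)"
proof -
  have Ioc: "emeasure (interval_measure F) {u<..v} = ennreal (F v - F u)" if "u \<le> v" for u v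
    by (rule emeasure_interval_measure_Ioc[OF that mono])
      (use cont continuous_on_eq_continuous_at[OF open_UNIV] in \<open>auto intro: continuous_at_imp_continuous_at_within\<close>)
  define c where "c = max x b"
  have eq: "{c<..} = (\<Union>n. {c<..c + real n})"
  proof (intro set_eqI iffI)
    fix y assume "y \<in> {c<..}"
    moreover obtain n where "y - c < real n" using reals_Archimedean2 by blast
    ultimately show "y \<in> (\<Union>n. {c<..c + real n})" by (auto intro!: exI[of _ n])
  qed auto
  have 0: "emeasure (interval_measure F) {c<..} = 0"
    unfolding eq
  proof (rule emeasure_UN_eq_0)
    fix n
    have "F (c + real n) = F c" using const[of "c + real n"] const[of c] by (simp add: c_def)
    then show "emeasure (interval_measure F) {c<..c + real n} = 0" by (simp add: Ioc)
  qed auto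
  have "{x<..c} \<union> {c<..} = {x<..}" by (rule ivl_disj_un_one) (simp add: c_def)
  then have "emeasure (interval_measure F) {x<..} = emeasure (interval_measure F) ({x<..c} \<union> {c<..})" by (rule arg_cong[OF sym])
  also have "\<dots> = emeasure (interval_measure F) {x<..c} + emeasure (interval_measure F) {c<..}"
    by (rule plus_emeasure[symmetric]) auto
  also have "\<dots> = ennreal (F c - F x)"
  proof -
    have "x \<le> c" by (simp add: c_def)
    then show ?thesis by (simp add: 0 Ioc)
  qed
  also have "F c = F b" using const[of c] by (simp add: c_def)
  finally show ?thesis .
qed

lemma nn_integral_set_integrable:
  assumes "set_integrable lebesgue {x..y::real} m" "\<And>s. 0 \<le> (m s :: real)"
  shows "(\<integral>\<^sup>+ s\<in>{x..y}. ennreal (m s) \<partial>lebesgue) = ennreal (LINT s:{x..y}|lebesgue. m s)"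
proof -
  have "(\<integral>\<^sup>+ s\<in>{x..y}. ennreal (m s) \<partial>lebesgue) = (\<integral>\<^sup>+ s. ennreal (indicator {x..y} s *\<^sub>R m s) \<partial>lebesgue)"
    by (rule nn_integral_cong) (simp add: indicator_def)
  also have "\<dots> = ennreal (LINT s|lebesgue. indicator {x..y} s *\<^sub>R m s)"
    using assms by (intro nn_integral_eq_integral) (auto simp: set_integrable_def)
  finally show ?thesis by (simp add: set_lebesgue_integral_def)
qed

text \<open>With G the primitive of the majorant m, both G + f and G - f are nondecreasing, and
  their Stieltjes measures add up to 2 m ds. Hence the first is absolutely continuous, Radon-Nikodym
  provides its density, and subtracting m leaves a density for f.\<close>

lemma ac_real_representation:
  fixes f :: "real \<Rightarrow> real"
  assumes ac: "ac_on a b f" and ab: "a \<le> b"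
  obtains g where "set_integrable lebesgue {a..b} g"
    "\<And>x y. a \<le> x \<Longrightarrow> x \<le> y \<Longrightarrow> y \<le> b \<Longrightarrow> f y - f x = (LINT s:{x..y}|lebesgue. g s)"
proof -
  obtain m where m0: "\<And>s. 0 \<le> m s" and mi: "set_integrable lebesgue {a..b} m"
    and mf: "\<And>x y. a \<le> x \<Longrightarrow> x \<le> y \<Longrightarrow> y \<le> b \<Longrightarrow> \<bar>f y - f x\<bar> \<le> (LINT s:{x..y}|lebesgue. m s)"
    using ac unfolding ac_wrt_def by auto
  \<comment> \<open>Clamping extends all functions to the line as constants outside the interval, so
    the Stieltjes measures have no mass there.\<close>
  define c where "c x = max a (min b x)" for x
  have c: "a \<le> c x" "c x \<le> b" for x using ab by (auto simp: c_def)
  have c_mono: "c x \<le> c y" if "x \<le> y" for x y using that by (auto simp: c_def)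
  define G where "G x = integral {a..c x} m" for x
  have GI: "(LINT s:{c x..c y}|lebesgue. m s) = G y - G x" if "x \<le> y" for x y
    using set_integral_split[OF mi, of "c x" "c y"] c c_mono[OF that] by (simp add: G_def)
  have G: "\<bar>f (c y) - f (c x)\<bar> \<le> G y - G x" if "x \<le> y" for x y
    using mf[of "c x" "c y"] c c_mono[OF that] GI[OF that] by simp
  have contG: "continuous_on UNIV G"
  proof -
    have "continuous_on {a..b} (\<lambda>x. integral {a..x} m)"
      using set_lebesgue_integral_eq_integral(1)[OF mi] by (rule indefinite_integral_continuous_1)
    moreover have "continuous_on UNIV c" unfolding c_def by (intro continuous_intros)
    ultimately have "continuous_on UNIV (\<lambda>x. (\<lambda>x. integral {a..x} m) (c x))"
      by (rule continuous_on_compose2) (use c in auto)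
    then show ?thesis by (simp add: G_def)
  qed
  have contf: "continuous_on UNIV (\<lambda>x. f (c x))"
    unfolding continuous_on_iff
  proof (intro ballI allI impI)
    fix x e :: real assume "0 < e"
    then obtain d where d: "0 < d" "\<And>y. dist y x < d \<Longrightarrow> dist (G y) (G x) < e"
      using contG unfolding continuous_on_iff by (meson UNIV_I)
    have "\<bar>f (c y) - f (c x)\<bar> \<le> \<bar>G y - G x\<bar>" for y
      using G[of x y] G[of y x] by (cases "x \<le> y") auto
    then show "\<exists>d>0. \<forall>y\<in>UNIV. dist y x < d \<longrightarrow> dist (f (c y)) (f (c x)) < e"
      using d unfolding dist_real_def by (meson le_less_trans)
  qed
  define F where "F x = G x + f (c x)" for x
  define H where "H x = G x - f (c x)" for x
  have monoFH: "F x \<le> F y" "H x \<le> H y" if "x \<le> y" for x y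
    using G[OF that] by (auto simp: F_def H_def)
  have contFH: "continuous_on UNIV F" "continuous_on UNIV H"
    unfolding F_def H_def by (intro continuous_intros contG contf)+
  have cb: "c x = c b" if "b \<le> x" for x using that ab by (simp add: c_def)
  have constFH: "F x = F b" "H x = H b" if "b \<le> x" for x
    unfolding F_def H_def G_def cb[OF that] by (rule refl)+
  let ?\<nu> = "interval_measure F" and ?\<eta> = "interval_measure H"
  have "(\<lambda>s. indicator {a..b} s *\<^sub>R m s) \<in> borel_measurable (completion lborel)"
    using borel_measurable_integrable[OF mi[unfolded set_integrable_def]] .
  from completion_ex_borel_measurable_real[OF this]
  obtain m' where "m' \<in> borel_measurable lborel" and m'ae: "AE s in lborel. indicator {a..b} s *\<^sub>R m s = m' s" ..
  then have m': "m' \<in> borel_measurable borel" by simp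
  \<comment> \<open>Both measures are finite and agree on the half-lines {x<..}, where the
    contributions of f cancel. The density on the right has to be Borel, hence \<open>m'\<close> in
    place of m.\<close>
  have dens: "sum_measure ?\<nu> ?\<eta> = density lborel (\<lambda>s. ennreal (2 * m' s))"
  proof (rule measure_eqI_lessThan)
    fix x
    have e1: "emeasure (sum_measure ?\<nu> ?\<eta>) {x<..} = ennreal (2 * (G b - G x))"
    proof -
      have le: "0 \<le> F b - F x" "0 \<le> H b - H x"
        using monoFH[of x b] constFH[of x] by linarith+
      have "emeasure (sum_measure ?\<nu> ?\<eta>) {x<..} = ennreal (F b - F x) + ennreal (H b - H x)"
        using emeasure_interval_measure_greaterThan[OF monoFH(1) contFH(1) constFH(1)]
          emeasure_interval_measure_greaterThan[OF monoFH(2) contFH(2) constFH(2)]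
        by (subst emeasure_sum_measure) auto
      also have "\<dots> = ennreal (F b - F x + (H b - H x))" using le by (rule ennreal_plus[symmetric])
      also have "F b - F x + (H b - H x) = 2 * (G b - G x)" by (simp add: F_def H_def)
      finally show ?thesis .
    qed
    then show "emeasure (sum_measure ?\<nu> ?\<eta>) {x<..} < \<infinity>" by simp
    have "emeasure (density lborel (\<lambda>s. ennreal (2 * m' s))) {x<..} = (\<integral>\<^sup>+ s. ennreal (2 * m' s) * indicator {x<..} s \<partial>lborel)"
      using m' by (intro emeasure_density) auto
    also have "\<dots> = (\<integral>\<^sup>+ s. ennreal (2 * m' s) * indicator {x<..} s \<partial>lebesgue)"
      by (simp add: nn_integral_completion)
    also have "\<dots> = (\<integral>\<^sup>+ s\<in>{c x..c b}. ennreal (2 * m s) \<partial>lebesgue)"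
    proof (rule nn_integral_cong_AE)
      have "AE s in lebesgue. indicator {a..b} s *\<^sub>R m s = m' s" using m'ae by (rule AE_completion)
      moreover have "AE s in lebesgue. s \<noteq> x \<and> s \<noteq> c x"
        by (rule AE_I'[of "{x, c x}"]) (auto simp: negligible_iff_null_sets[symmetric])
      ultimately show "AE s in lebesgue. ennreal (2 * m' s) * indicator {x<..} s = ennreal (2 * m s) * indicator {c x..c b} s"
      proof eventually_elim
        case (elim s)
        have "c b = b" using ab by (simp add: c_def)
        then show ?case using elim ab by (auto simp: indicator_def c_def min_def max_def split: if_splits)
      qed
    qed
    also have "\<dots> = 2 * (\<integral>\<^sup>+ s\<in>{c x..c b}. ennreal (m s) \<partial>lebesgue)"
    proof -
      have "(\<lambda>s. ennreal (indicator {c x..c b} s *\<^sub>R m s)) \<in> borel_measurable lebesgue"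
        using borel_measurable_integrable[OF set_integrable_subset[OF mi, of "{c x..c b}", unfolded set_integrable_def]] c
        by auto
      then have "(\<integral>\<^sup>+ s. 2 * ennreal (indicator {c x..c b} s *\<^sub>R m s) \<partial>lebesgue) = 2 * (\<integral>\<^sup>+ s. ennreal (indicator {c x..c b} s *\<^sub>R m s) \<partial>lebesgue)"
        by (rule nn_integral_cmult)
      moreover have "(\<integral>\<^sup>+ s\<in>{c x..c b}. ennreal (2 * m s) \<partial>lebesgue) = (\<integral>\<^sup>+ s. 2 * ennreal (indicator {c x..c b} s *\<^sub>R m s) \<partial>lebesgue)"
        by (rule nn_integral_cong) (simp add: indicator_def ennreal_mult')
      moreover have "(\<integral>\<^sup>+ s\<in>{c x..c b}. ennreal (m s) \<partial>lebesgue) = (\<integral>\<^sup>+ s. ennreal (indicator {c x..c b} s *\<^sub>R m s) \<partial>lebesgue)"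
        by (rule nn_integral_cong) (simp add: indicator_def)
      ultimately show ?thesis by simp
    qed
    also have "\<dots> = 2 * ennreal (G b - G x)"
    proof -
      have "(LINT s:{c x..c b}|lebesgue. m s) = G b - G x"
      proof (cases "x \<le> b")
        case False
        then have "c x = c b" using cb[of x] by simp
        then have "G x = G b" "{c x..c b} = {c b..c b}" by (simp_all add: G_def)
        then show ?thesis using GI[of b b] by simp
      qed (rule GI)
      moreover have "set_integrable lebesgue {c x..c b} m"
        by (rule set_integrable_subset[OF mi]) (use c[of x] c[of b] in auto)
      ultimately show ?thesis using nn_integral_set_integrable[OF _ m0] by simp
    qed
    also have "\<dots> = ennreal (2 * (G b - G x))" by (subst ennreal_mult') auto
    finally show "emeasure (sum_measure ?\<nu> ?\<eta>) {x<..} = emeasure (density lborel (\<lambda>s. ennreal (2 * m' s))) {x<..}"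
      by (rule e1[THEN trans, OF sym])
  qed auto
  \<comment> \<open>The first summand is dominated by the sum, which has a density.\<close>
  have "absolutely_continuous lborel ?\<nu>"
    unfolding absolutely_continuous_def
  proof
    fix N :: "real set" assume N: "N \<in> null_sets lborel"
    then have "N \<in> null_sets (density lborel (\<lambda>s. ennreal (2 * m' s)))"
      using absolutely_continuousI_density[of "\<lambda>s. ennreal (2 * m' s)" lborel] m'
      by (auto simp: absolutely_continuous_def)
    then have "emeasure (sum_measure ?\<nu> ?\<eta>) N = 0" unfolding dens by auto
    then show "N \<in> null_sets ?\<nu>" using N by (auto simp: null_sets_def emeasure_sum_measure)
  qed
  then obtain g where g: "g \<in> borel_measurable lborel" "density lborel g = ?\<nu>"
    using sigma_finite_measure.Radon_Nikodym[OF sigma_finite_lborel, of ?\<nu>] by auto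
  have gF: "(\<integral>\<^sup>+ s. g s * indicator {x<..y} s \<partial>lborel) = ennreal (F y - F x)" if "x \<le> y" for x y
  proof -
    have "(\<integral>\<^sup>+ s. g s * indicator {x<..y} s \<partial>lborel) = emeasure ?\<nu> {x<..y}"
      using emeasure_density[of g lborel "{x<..y}"] g by simp
    also have "\<dots> = ennreal (F y - F x)"
      by (rule emeasure_interval_measure_Ioc[OF that monoFH(1)])
        (use contFH continuous_on_eq_continuous_at[OF open_UNIV] in \<open>auto intro: continuous_at_imp_continuous_at_within\<close>)
    finally show ?thesis .
  qed
  then have fin: "(\<integral>\<^sup>+ s. g s * indicator {a<..b} s \<partial>lborel) < \<infinity>" using ab by simp
  \<comment> \<open>A real version of the density, cut off outside the interval; the density is
    finite there almost everywhere because the mass of the interval is finite.\<close>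
  define g' where "g' s = indicator {a<..b} s * enn2real (g s)" for s
  have "AE s in lborel. g s * indicator {a<..b} s \<noteq> \<infinity>"
    using fin g(1) by (intro nn_integral_PInf_AE) auto
  then have gAE: "AE s in lborel. ennreal (g' s) = g s * indicator {a<..b} s"
    by eventually_elim (auto simp: g'_def indicator_def less_top)
  have g'm: "g' \<in> borel_measurable borel" using g(1) unfolding g'_def by measurable
  have g'i: "integrable lborel g'"
  proof (rule integrableI_nonneg)
    show "(\<integral>\<^sup>+ s. ennreal (g' s) \<partial>lborel) < \<infinity>" using fin nn_integral_cong_AE[OF gAE] by simp
  qed (use g'm in \<open>auto simp: g'_def\<close>)
  then have g'l: "integrable lebesgue g'" using g'm by (simp add: integrable_completion)
  have sub: "set_integrable lebesgue {x..y} g'" for x y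
    unfolding set_integrable_def using g'l by (intro integrable_mult_indicator) auto
  have repF: "F y - F x = (LINT s:{x..y}|lebesgue. g' s)" if "a \<le> x" "x \<le> y" "y \<le> b" for x y
  proof -
    have "ennreal (LINT s:{x..y}|lebesgue. g' s) = (\<integral>\<^sup>+ s\<in>{x..y}. ennreal (g' s) \<partial>lebesgue)"
      by (rule nn_integral_set_integrable[symmetric, OF sub]) (simp add: g'_def)
    also have "\<dots> = (\<integral>\<^sup>+ s\<in>{x..y}. ennreal (g' s) \<partial>lborel)" by (simp add: nn_integral_completion)
    also have "\<dots> = (\<integral>\<^sup>+ s. g s * indicator {x<..y} s \<partial>lborel)"
    proof (rule nn_integral_cong_AE)
      have "AE s in lborel. s \<noteq> x" by (rule AE_lborel_singleton)
      with gAE show "AE s in lborel. ennreal (g' s) * indicator {x..y} s = g s * indicator {x<..y} s"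
        by eventually_elim (use that in \<open>auto simp: indicator_def\<close>)
    qed
    also have "\<dots> = ennreal (F y - F x)" by (rule gF[OF that(2)])
    finally show ?thesis
      using monoFH(1)[OF that(2)]
      by (subst (asm) ennreal_inj) (auto simp: set_lebesgue_integral_def g'_def intro!: integral_nonneg_AE)
  qed
  show thesis
  proof (rule that)
    show "set_integrable lebesgue {a..b} (\<lambda>s. g' s - m s)" by (intro set_integral_diff sub mi)
    fix x y assume xy: "a \<le> x" "x \<le> y" "y \<le> b"
    then have cx: "c x = x" "c y = y" by (auto simp: c_def)
    have "f y - f x = (F y - F x) - (G y - G x)" by (simp add: F_def cx)
    also have "\<dots> = (LINT s:{x..y}|lebesgue. g' s) - (LINT s:{x..y}|lebesgue. m s)"
      using repF[OF xy] GI[OF xy(2)] cx by simp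
    also have "\<dots> = (LINT s:{x..y}|lebesgue. g' s - m s)"
      by (rule set_integral_diff(2)[symmetric, OF sub set_integrable_subset[OF mi]]) (use xy in auto)
    finally show "f y - f x = (LINT s:{x..y}|lebesgue. g' s - m s)" .
  qed
qed

lemma measurable_AE_lebesgue_on:
  assumes f: "f \<in> borel_measurable (lebesgue_on {a..b::real})" and eq: "AE s in lebesgue_on {a..b}. f s = g s"
  shows "g \<in> borel_measurable (lebesgue_on {a..b})"
proof (rule measurableI)
  fix X :: "'a set" assume X: "X \<in> sets borel"
  have sets: "A \<in> sets (lebesgue_on {a..b})" if "A \<in> sets lebesgue" "A \<subseteq> {a..b}" for A
    using that by (subst sets_restrict_space_iff) auto
  have "f -` X \<inter> {a..b} \<in> sets (lebesgue_on {a..b})" using measurable_sets[OF f X] by simp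
  then have "f -` X \<inter> {a..b} \<in> sets lebesgue" by (subst (asm) sets_restrict_space_iff) auto
  then have "g -` X \<inter> {a..b} \<in> sets lebesgue"
  proof (rule sets_negligible_symdiff)
    have "negligible {s \<in> {a..b}. f s \<noteq> g s}" using eq by (simp add: AE_lebesgue_on_iff_negligible)
    then show "negligible ((f -` X \<inter> {a..b} - g -` X \<inter> {a..b}) \<union> (g -` X \<inter> {a..b} - f -` X \<inter> {a..b}))"
      by (rule negligible_subset) auto
  qed
  then show "g -` X \<inter> space (lebesgue_on {a..b}) \<in> sets (lebesgue_on {a..b})"
    using sets[of "g -` X \<inter> {a..b}"] by simp
qed simp

text \<open>By Lebesgue's differentiation theorem the density found in
  \<open>ac_real_representation\<close> is the derivative almost everywhere, so it may be replaced
  by \<open>deriv f\<close>.\<close>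

theorem ac_real_FTC:
  fixes f :: "real \<Rightarrow> real"
  assumes ac: "ac_on a b f" and ab: "a \<le> b"
  shows "AE s in lebesgue_on {a..b}. (f has_real_derivative deriv f s) (at s)"
    and "set_integrable lebesgue {a..b} (deriv f)"
    and "\<And>x y. a \<le> x \<Longrightarrow> x \<le> y \<Longrightarrow> y \<le> b \<Longrightarrow> f y - f x = (LINT s:{x..y}|lebesgue. deriv f s)"
proof -
  obtain g where g: "set_integrable lebesgue {a..b} g"
    "\<And>x y. a \<le> x \<Longrightarrow> x \<le> y \<Longrightarrow> y \<le> b \<Longrightarrow> f y - f x = (LINT s:{x..y}|lebesgue. g s)"
    using ac_real_representation[OF assms] by blast
  have der: "AE s in lebesgue_on {a..b}. (f has_real_derivative g s) (at s)"
    by (rule indefinite_integral_has_derivative_ae[OF g])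
  then have eq: "AE s in lebesgue_on {a..b}. g s = deriv f s"
    by eventually_elim (simp add: DERIV_imp_deriv)
  from der eq show "AE s in lebesgue_on {a..b}. (f has_real_derivative deriv f s) (at s)"
    by eventually_elim simp
  have eqi: "AE s in lebesgue. indicator {x..y} s *\<^sub>R g s = indicator {x..y} s *\<^sub>R deriv f s" if "a \<le> x" "y \<le> b" for x y
  proof -
    have "AE s in lebesgue. s \<in> {a..b} \<longrightarrow> g s = deriv f s"
      using eq by (subst (asm) AE_restrict_space_iff) auto
    then show ?thesis by eventually_elim (use that in \<open>auto simp: indicator_def\<close>)
  qed
  have meas: "(\<lambda>s. indicator {x..y} s *\<^sub>R h s) \<in> borel_measurable lebesgue \<longleftrightarrow> h \<in> borel_measurable (lebesgue_on {x..y})"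
    for x y :: real and h :: "real \<Rightarrow> real"
    using borel_measurable_restrict_space_iff[of "{x..y}" lebesgue h] by simp
  have "g \<in> borel_measurable (lebesgue_on {a..b})"
    using borel_measurable_integrable[OF g(1)[unfolded set_integrable_def]] by (simp only: meas)
  then have dm: "deriv f \<in> borel_measurable (lebesgue_on {a..b})" using eq by (rule measurable_AE_lebesgue_on)
  then have dmi: "(\<lambda>s. indicator {x..y} s *\<^sub>R deriv f s) \<in> borel_measurable lebesgue" if "a \<le> x" "y \<le> b" for x y
    unfolding meas by (rule measurable_restrict_mono) (use that in auto)
  have gi: "integrable lebesgue (\<lambda>s. indicator {x..y} s *\<^sub>R g s)" if "a \<le> x" "y \<le> b" for x y
    using set_integrable_subset[OF g(1), of "{x..y}"] that by (auto simp: set_integrable_def)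
  show "set_integrable lebesgue {a..b} (deriv f)"
    unfolding set_integrable_def
    by (rule integrable_cong_AE_imp[OF gi[of a b] dmi[of a b]]) (use eqi[of a b] in \<open>auto elim: eventually_mono\<close>)
  fix x y assume xy: "a \<le> x" "x \<le> y" "y \<le> b"
  have "(LINT s:{x..y}|lebesgue. g s) = (LINT s:{x..y}|lebesgue. deriv f s)"
    unfolding set_lebesgue_integral_def
    using xy by (intro integral_cong_AE dmi eqi borel_measurable_integrable[OF gi])
  then show "f y - f x = (LINT s:{x..y}|lebesgue. deriv f s)" using g(2)[OF xy] by simp
qed

lemma set_integral_mono_AE:
  fixes f g :: "real \<Rightarrow> real"
  assumes "set_integrable lebesgue {a..b} f" "set_integrable lebesgue {a..b} g"
    and "AE s in lebesgue_on {a..b}. f s \<le> g s" and "a \<le> x" "y \<le> b"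
  shows "(LINT s:{x..y}|lebesgue. f s) \<le> (LINT s:{x..y}|lebesgue. g s)"
  unfolding set_lebesgue_integral_def
proof (rule integral_mono_AE)
  show "integrable lebesgue (\<lambda>s. indicator {x..y} s *\<^sub>R f s)" "integrable lebesgue (\<lambda>s. indicator {x..y} s *\<^sub>R g s)"
    using set_integrable_subset[OF assms(1), of "{x..y}"] set_integrable_subset[OF assms(2), of "{x..y}"] assms(4,5)
    by (simp_all add: set_integrable_def)
  have "AE s in lebesgue. s \<in> {a..b} \<longrightarrow> f s \<le> g s"
    using assms(3) by (subst (asm) AE_restrict_space_iff) auto
  then show "AE s in lebesgue. indicator {x..y} s *\<^sub>R f s \<le> indicator {x..y} s *\<^sub>R g s"
    by eventually_elim (use assms(4,5) in \<open>auto simp: indicator_def\<close>)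
qed

lemma set_integral_const_interval: "x \<le> y \<Longrightarrow> (LINT s:{x..y::real}|lebesgue. c) = (y - x) * (c::real)"
  by (simp add: set_lebesgue_integral_def)

lemma set_integrable_const_interval [simp]: "set_integrable lebesgue {x..y::real} (\<lambda>s. c::real)"
  unfolding set_integrable_def
  by (intro integrable_scaleR_left integrable_real_indicator) (auto simp: emeasure_lborel_Icc_eq)

section \<open>Absolutely continuous curves in reflexive spaces\<close>

lemma lipschitz_imp_ac_on:
  assumes "L-lipschitz_on {a..b} f"
  shows "ac_on a b f"
  unfolding ac_wrt_def
proof (intro exI[of _ "\<lambda>_. L"] conjI allI impI)
  show "0 \<le> L" using assms by (rule lipschitz_on_nonneg)
  fix x y assume xy: "a \<le> x \<and> x \<le> y \<and> y \<le> b"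
  then have "norm (f y - f x) \<le> L * \<bar>y - x\<bar>"
    using lipschitz_onD[OF assms, of y x] by (simp add: dist_norm dist_real_def)
  then show "ereal (norm (f y - f x)) \<le> ereal (LINT s:{x..y}|lebesgue. L)"
    using xy by (simp add: set_integral_const_interval mult.commute)
qed simp

lemma ac_on_blinfun:
  assumes "ac_on a b f"
  shows "ac_on a b (\<lambda>s. blinfun_apply A (f s))"
proof -
  obtain m where m: "\<And>s. 0 \<le> m s" "set_integrable lebesgue {a..b} m"
    "\<And>x y. a \<le> x \<Longrightarrow> x \<le> y \<Longrightarrow> y \<le> b \<Longrightarrow> norm (f y - f x) \<le> (LINT s:{x..y}|lebesgue. m s)"
    using assms unfolding ac_wrt_def by auto
  show ?thesis
    unfolding ac_wrt_def
  proof (intro exI[of _ "\<lambda>s. norm A * m s"] conjI allI impI)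
    show "0 \<le> norm A * m s" for s using m(1) by simp
    show "set_integrable lebesgue {a..b} (\<lambda>s. norm A * m s)" using m(2) by simp
    fix x y assume xy: "a \<le> x \<and> x \<le> y \<and> y \<le> b"
    have "norm (blinfun_apply A (f y) - blinfun_apply A (f x)) \<le> norm A * norm (f y - f x)"
      using norm_blinfun[of A "f y - f x"] by (simp add: blinfun.diff_right)
    also have "\<dots> \<le> norm A * (LINT s:{x..y}|lebesgue. m s)" using m(3)[of x y] xy by (intro mult_left_mono) auto
    finally show "ereal (norm (blinfun_apply A (f y) - blinfun_apply A (f x))) \<le> ereal (LINT s:{x..y}|lebesgue. norm A * m s)"
      by simp
  qed
qed

lemma ac_on_fst: "ac_on a b f \<Longrightarrow> ac_on a b (fst \<circ> f)"
  using ac_on_blinfun[of a b f "Blinfun fst"] by (simp add: bounded_linear_Blinfun_apply bounded_linear_fst comp_def)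

lemma ac_on_snd: "ac_on a b f \<Longrightarrow> ac_on a b (snd \<circ> f)"
  using ac_on_blinfun[of a b f "Blinfun snd"] by (simp add: bounded_linear_Blinfun_apply bounded_linear_snd comp_def)

text \<open>Every open set is a countable union of closed balls with centres in a dense set and
  rational radii.\<close>

lemma borel_measurable_separable:
  fixes g :: "'s \<Rightarrow> 'a::{metric_space,second_countable_topology}"
  assumes "\<And>x r. {s \<in> space M. dist (g s) x \<le> r} \<in> sets M"
  shows "g \<in> borel_measurable M"
proof (rule borel_measurableI)
  fix S :: "'a set" assume S: "open S"
  obtain D :: "'a set" where D: "countable D" "\<And>X. open X \<Longrightarrow> X \<noteq> {} \<Longrightarrow> \<exists>d\<in>D. d \<in> X"
    using countable_dense_exists by blast
  define I where "I = {i \<in> D \<times> \<rat>. cball (fst i) (snd i) \<subseteq> S}"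
  have "S = (\<Union>i\<in>I. cball (fst i) (snd i))"
  proof (intro set_eqI iffI)
    fix y assume "y \<in> S"
    then obtain e where e: "0 < e" "ball y e \<subseteq> S" using S openE by blast
    then obtain d where d: "d \<in> D" "d \<in> ball y (e/4)" using D(2)[of "ball y (e/4)"] by auto
    obtain q where q: "q \<in> \<rat>" "e/4 < q" "q < e/2" using e(1) Rats_dense_in_real[of "e/4" "e/2"] by auto
    have "cball d q \<subseteq> S"
    proof
      fix z assume "z \<in> cball d q"
      then have "dist y z < e" using e(1) d(2) q(3) dist_triangle[of y z d] by simp
      then show "z \<in> S" using e(2) by auto
    qed
    then show "y \<in> (\<Union>i\<in>I. cball (fst i) (snd i))"
      using d q by (intro UN_I[of "(d, q)"]) (auto simp: I_def dist_commute)
  qed (auto simp: I_def)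
  then have "g -` S \<inter> space M = (\<Union>i\<in>I. {s \<in> space M. dist (g s) (fst i) \<le> snd i})"
    by (simp only:) (force simp: dist_commute)
  moreover have "countable I" using D(1) countable_rat unfolding I_def by (intro countable_subset[OF _ countable_SIGMA[of D "\<lambda>_. \<rat>"]]) auto
  ultimately show "g -` S \<inter> space M \<in> sets M" using assms by (simp add: sets.countable_UN'')
qed

text \<open>The norm of the derivative is recovered from countably many scalar derivatives, and strong
  differentiability follows by comparing \<open>f\<close> with the linear curves of slope \<open>x\<close> for \<open>x\<close> in a
  countable dense set; no vector-valued integral is needed.\<close>

theorem ac_on_differentiable_ae:
  fixes f :: "real \<Rightarrow> 'a::{banach,second_countable_topology}"
  assumes refl: "reflexive_space TYPE('a)" and ac: "ac_on a b f" and ab: "a \<le> b"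
  shows "AE s in lebesgue_on {a..b}. (f has_vector_derivative vector_derivative f (at s)) (at s)"
    and "(\<lambda>s. vector_derivative f (at s)) \<in> borel_measurable (lebesgue_on {a..b})"
proof -
  obtain m where m: "\<And>s. 0 \<le> m s" "set_integrable lebesgue {a..b} m"
    "\<And>x y. a \<le> x \<Longrightarrow> x \<le> y \<Longrightarrow> y \<le> b \<Longrightarrow> norm (f y - f x) \<le> (LINT s:{x..y}|lebesgue. m s)"
    using ac unfolding ac_wrt_def by auto
  define M where "M x = integral {a..x} m" for x
  have Mi: "(LINT s:{x..y}|lebesgue. m s) = M y - M x" if "a \<le> x" "x \<le> y" "y \<le> b" for x y
    using set_integral_split[OF m(2) that] by (simp add: M_def)
  have dM: "AE s in lebesgue_on {a..b}. (M has_real_derivative m s) (at s)"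
    by (rule indefinite_integral_has_derivative_ae[OF m(2)]) (simp add: Mi)
  obtain \<phi> :: "nat \<Rightarrow> 'a dual" where \<phi>: "\<And>n. norm (\<phi> n) \<le> 1"
    "\<And>x e. 0 < e \<Longrightarrow> \<exists>n. norm x - e < blinfun_apply (\<phi> n) x"
    by (rule norming_sequence) (rule that)
  have norm_le: "norm x \<le> c" if "\<And>n. blinfun_apply (\<phi> n) x \<le> c" for x c
  proof (rule field_le_epsilon)
    fix e :: real assume "0 < e"
    then obtain n where "norm x - e < blinfun_apply (\<phi> n) x" using \<phi>(2) by blast
    then show "norm x \<le> c + e" using that[of n] by linarith
  qed
  have \<phi>_le: "blinfun_apply (\<phi> n) x \<le> norm x" for n x
    using blinfun_le_norm[of "\<phi> n" x] mult_right_mono[OF \<phi>(1)[of n] norm_ge_zero[of x]] by linarith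
  define d where "d n = deriv (\<lambda>s. blinfun_apply (\<phi> n) (f s))" for n
  note fn = ac_real_FTC[OF ac_on_blinfun[OF ac] ab]
  have dn: "AE s in lebesgue_on {a..b}. \<forall>n. ((\<lambda>s. blinfun_apply (\<phi> n) (f s)) has_real_derivative d n s) (at s)"
    unfolding AE_all_countable d_def using fn(1) by blast
  \<comment> \<open>Candidate for the derivative. The difference quotients along one null sequence
    are bounded by those of M and converge under every norming functional, so they have a weak
    limit.\<close>
  have weak: "AE s in lebesgue_on {a..b}. \<exists>l. (\<forall>n. blinfun_apply (\<phi> n) l = d n s) \<and> norm l \<le> m s"
    using dM dn AE_lebesgue_on_interior
  proof eventually_elim
    case (elim s)
    define h where "h k = (b - s) / real (Suc k)" for k
    have h: "0 < h k" "s + h k \<le> b" for k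
    proof -
      show "0 < h k" using elim(3) by (simp add: h_def)
      have "h k \<le> (b - s) / 1" unfolding h_def using elim(3) by (intro divide_left_mono) auto
      then show "s + h k \<le> b" by simp
    qed
    have h0: "h \<longlonglongrightarrow> 0" unfolding h_def by (rule LIMSEQ_Suc) (rule lim_const_over_n)
    then have hat: "filterlim h (at 0) sequentially"
      using h(1) by (auto simp: filterlim_at less_le)
    define y where "y k = (1 / h k) *\<^sub>R (f (s + h k) - f s)" for k
    have "((\<lambda>h. (M (s + h) - M s) / h) \<longlongrightarrow> m s) (at 0)" using elim(1) by (simp add: DERIV_def)
    from filterlim_compose[OF this hat] have Mlim: "(\<lambda>k. (M (s + h k) - M s) / h k) \<longlonglongrightarrow> m s" .
    have yM: "norm (y k) \<le> (M (s + h k) - M s) / h k" for k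
    proof -
      have "norm (f (s + h k) - f s) \<le> M (s + h k) - M s"
        using m(3)[of s "s + h k"] Mi[of s "s + h k"] h[of k] elim(3) by simp
      then show ?thesis using h(1)[of k] by (simp add: y_def divide_right_mono)
    qed
    have yd: "(\<lambda>k. blinfun_apply (\<phi> n) (y k)) \<longlonglongrightarrow> d n s" for n
    proof -
      have "((\<lambda>h. (blinfun_apply (\<phi> n) (f (s + h)) - blinfun_apply (\<phi> n) (f s)) / h) \<longlongrightarrow> d n s) (at 0)"
        using elim(2) by (simp add: DERIV_def)
      from filterlim_compose[OF this hat] show ?thesis
        by (simp add: y_def blinfun.scaleR_right blinfun.diff_right)
    qed
    obtain B where "\<And>k. (M (s + h k) - M s) / h k \<le> B"
      using convergent_imp_Bseq[OF convergentI[OF Mlim]] unfolding Bseq_def real_norm_def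
      by (metis abs_le_iff)
    then have B: "norm (y k) \<le> B" for k using yM order_trans by blast
    obtain l where l: "weak_conv y l"
    proof (rule weak_limit_exists[OF refl _ B, of "range \<phi>"])
      show "x = 0" if "\<And>f. f \<in> range \<phi> \<Longrightarrow> blinfun_apply f x = 0" for x
        using norming_imp_separating[where x = x and \<phi> = \<phi>] \<phi>(2) that by blast
      show "convergent (\<lambda>n. blinfun_apply f (y n))" if "f \<in> range \<phi>" for f
        using yd that by (auto intro: convergentI)
    qed
    have "blinfun_apply (\<phi> n) l = d n s" for n
      using l yd[of n] LIMSEQ_unique unfolding weak_conv_def by blast
    moreover have "norm l \<le> m s"
    proof (rule norm_le)
      fix n
      have "blinfun_apply (\<phi> n) (y k) \<le> (M (s + h k) - M s) / h k" for k using \<phi>_le yM order_trans by blast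
      then have "d n s \<le> m s" using LIMSEQ_le[OF yd Mlim] by blast
      then show "blinfun_apply (\<phi> n) l \<le> m s" using calculation by simp
    qed
    ultimately show ?case by blast
  qed
  define N where "N = {s \<in> {a..b}. \<not> (\<exists>l. (\<forall>n. blinfun_apply (\<phi> n) l = d n s) \<and> norm l \<le> m s)}"
  have N: "negligible N" using weak by (simp add: AE_lebesgue_on_iff_negligible N_def)
  \<comment> \<open>Putting zero on the null set N makes the scalar derivatives those of a vector at
    every s; g is then defined everywhere and its measurability can be read off from the
    \<open>d' n\<close>.\<close>
  define d' where "d' n s = (if s \<in> N then 0 else d n s)" for n s
  have dd': "AE s in lebesgue_on {a..b}. d n s = d' n s" for n
    by (rule AE_lebesgue_onI[OF N]) (simp add: d'_def)
  have dm: "d n \<in> borel_measurable (lebesgue_on {a..b})" for n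
    using borel_measurable_integrable[OF fn(2)[unfolded set_integrable_def]] borel_measurable_restrict_space_iff[of "{a..b}" lebesgue "d n"]
    by (simp add: d_def)
  have d'm: "d' n \<in> borel_measurable (lebesgue_on {a..b})" for n
    using measurable_AE_lebesgue_on[OF dm dd'] .
  have "\<exists>l. (\<forall>n. blinfun_apply (\<phi> n) l = d' n s) \<and> norm l \<le> m s" if s: "s \<in> {a..b}" for s
  proof (cases "s \<in> N")
    case True
    then show ?thesis using m(1) by (intro exI[of _ 0]) (simp add: d'_def)
  next
    case False
    then obtain l where "\<forall>n. blinfun_apply (\<phi> n) l = d n s" "norm l \<le> m s" using s unfolding N_def by blast
    then show ?thesis using False by (intro exI[of _ l]) (simp add: d'_def)
  qed
  then obtain g where g: "\<And>s n. s \<in> {a..b} \<Longrightarrow> blinfun_apply (\<phi> n) (g s) = d' n s" "\<And>s. s \<in> {a..b} \<Longrightarrow> norm (g s) \<le> m s"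
    by metis
  have gm: "g \<in> borel_measurable (lebesgue_on {a..b})"
  proof (rule borel_measurable_separable)
    fix x r
    have iff: "dist (g s) x \<le> r \<longleftrightarrow> (\<forall>n. d' n s - blinfun_apply (\<phi> n) x \<le> r)" if s: "s \<in> {a..b}" for s
    proof
      assume *: "dist (g s) x \<le> r"
      show "\<forall>n. d' n s - blinfun_apply (\<phi> n) x \<le> r"
      proof
        fix n show "d' n s - blinfun_apply (\<phi> n) x \<le> r"
          using * \<phi>_le[of n "g s - x"] g(1)[OF s] by (simp add: blinfun.diff_right dist_norm)
      qed
    next
      assume "\<forall>n. d' n s - blinfun_apply (\<phi> n) x \<le> r"
      then show "dist (g s) x \<le> r" unfolding dist_norm
        by (intro norm_le) (simp add: blinfun.diff_right g(1)[OF s])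
    qed
    have "{s \<in> space (lebesgue_on {a..b}). \<forall>n. d' n s - blinfun_apply (\<phi> n) x \<le> r} \<in> sets (lebesgue_on {a..b})"
      using d'm by measurable
    moreover have "{s \<in> space (lebesgue_on {a..b}). dist (g s) x \<le> r} = {s \<in> space (lebesgue_on {a..b}). \<forall>n. d' n s - blinfun_apply (\<phi> n) x \<le> r}"
      using iff by auto
    ultimately show "{s \<in> space (lebesgue_on {a..b}). dist (g s) x \<le> r} \<in> sets (lebesgue_on {a..b})" by simp
  qed
  obtain D :: "'a set" where D: "countable D" "\<And>X. open X \<Longrightarrow> X \<noteq> {} \<Longrightarrow> \<exists>d\<in>D. d \<in> X"
    using countable_dense_exists by blast
  define G where "G x s = norm (g s - x)" for x s
  have Gi: "set_integrable lebesgue {a..b} (G x)" for x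
  proof -
    have "G x \<in> borel_measurable (lebesgue_on {a..b})" unfolding G_def using gm by measurable
    then have Gm: "(\<lambda>s. indicator {a..b} s *\<^sub>R G x s) \<in> borel_measurable lebesgue"
      using borel_measurable_restrict_space_iff[of "{a..b}" lebesgue "G x"] by simp
    have "set_integrable lebesgue {a..b} (\<lambda>s. m s + norm x)" by (intro set_integral_add m(2)) simp
    then show ?thesis unfolding set_integrable_def
    proof (rule Bochner_Integration.integrable_bound[OF _ Gm])
      show "AE s in lebesgue. norm (indicator {a..b} s *\<^sub>R G x s) \<le> norm (indicator {a..b} s *\<^sub>R (m s + norm x))"
      proof (rule AE_I2)
        fix s
        show "norm (indicator {a..b} s *\<^sub>R G x s) \<le> norm (indicator {a..b} s *\<^sub>R (m s + norm x))"
          using g(2)[of s] norm_triangle_ineq4[of "g s" x] m(1)[of s] by (auto simp: indicator_def G_def)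
      qed
    qed
  qed
  define H where "H x y = integral {a..y} (G x)" for x y
  have Hi: "(LINT s:{u..v}|lebesgue. G x s) = H x v - H x u" if "a \<le> u" "u \<le> v" "v \<le> b" for u v x
    using set_integral_split[OF Gi that] by (simp add: H_def)
  have dH: "AE s in lebesgue_on {a..b}. \<forall>x\<in>D. (H x has_real_derivative G x s) (at s)"
    unfolding AE_ball_countable[OF D(1)]
  proof
    fix x assume "x \<in> D"
    show "AE s in lebesgue_on {a..b}. (H x has_real_derivative G x s) (at s)"
      by (rule indefinite_integral_has_derivative_ae[OF Gi]) (simp add: Hi)
  qed
  \<comment> \<open>After subtracting the line of slope x, each scalar derivative is at most the
    distance from g to x, so increments are bounded by the primitive \<open>H x\<close>.\<close>
  have key: "norm (f v - f u - (v - u) *\<^sub>R x) \<le> H x v - H x u" if uv: "a \<le> u" "u \<le> v" "v \<le> b" for u v x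
  proof (rule norm_le)
    fix n
    have "blinfun_apply (\<phi> n) (f v - f u - (v - u) *\<^sub>R x) = (LINT s:{u..v}|lebesgue. d n s) - (LINT s:{u..v}|lebesgue. blinfun_apply (\<phi> n) x)"
      using fn(3)[OF uv, of "\<phi> n"] uv
      by (simp add: blinfun.diff_right blinfun.scaleR_right set_integral_const_interval d_def)
    also have "\<dots> = (LINT s:{u..v}|lebesgue. d n s - blinfun_apply (\<phi> n) x)"
      by (rule set_integral_diff(2)[symmetric]) (use set_integrable_subset[OF fn(2), of "{u..v}"] uv in \<open>auto simp: d_def\<close>)
    also have "\<dots> \<le> (LINT s:{u..v}|lebesgue. G x s)"
    proof (rule set_integral_mono_AE[OF _ Gi _ uv(1,3)])
      show "set_integrable lebesgue {a..b} (\<lambda>s. d n s - blinfun_apply (\<phi> n) x)"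
        using fn(2) by (intro set_integral_diff) (auto simp: d_def)
      show "AE s in lebesgue_on {a..b}. d n s - blinfun_apply (\<phi> n) x \<le> G x s"
        using dd'[of n] AE_lebesgue_on_interior
      proof eventually_elim
        case (elim s)
        then have "d n s - blinfun_apply (\<phi> n) x = blinfun_apply (\<phi> n) (g s - x)"
          using g(1)[of s n] by (simp add: blinfun.diff_right)
        then show ?case using \<phi>_le[of n "g s - x"] by (simp add: G_def)
      qed
    qed
    finally show "blinfun_apply (\<phi> n) (f v - f u - (v - u) *\<^sub>R x) \<le> H x v - H x u" using Hi[OF uv] by simp
  qed
  have der: "AE s in lebesgue_on {a..b}. (f has_vector_derivative g s) (at s)"
    using dH AE_lebesgue_on_interior
  proof eventually_elim
    case (elim s)
    show "(f has_vector_derivative g s) (at s)"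
      unfolding has_vector_derivative_def has_derivative_at_alt
    proof (intro conjI allI impI)
      fix e :: real assume e: "0 < e"
      \<comment> \<open>With x within e/4 of g s, the derivative of \<open>H x\<close> at s is below
        e/4 and its quotients come within e/4 of it; together with the error of replacing g s by x
        the total is at most e/2 + e/4.\<close>
      obtain x where x: "x \<in> D" "norm (g s - x) < e/4"
        using D(2)[of "ball (g s) (e/4)"] e by (auto simp: dist_norm)
      have "((\<lambda>h. (H x (s + h) - H x s) / h) \<longlongrightarrow> G x s) (at 0)" using elim x by (simp add: DERIV_def)
      then have "\<forall>\<^sub>F h in at 0. dist ((H x (s + h) - H x s) / h) (G x s) < e/4"
        using e by (intro tendstoD) auto
      then obtain c where c: "0 < c" "\<And>h. h \<noteq> 0 \<Longrightarrow> \<bar>h\<bar> < c \<Longrightarrow> \<bar>(H x (s + h) - H x s) / h - G x s\<bar> < e/4"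
        unfolding eventually_at dist_real_def by auto
      show "\<exists>d>0. \<forall>y. norm (y - s) < d \<longrightarrow> norm (f y - f s - (y - s) *\<^sub>R g s) \<le> e * norm (y - s)"
      proof (intro exI[of _ "min c (min (s - a) (b - s))"] conjI allI impI)
        show "0 < min c (min (s - a) (b - s))" using c(1) elim(2) by simp
        fix y assume y: "norm (y - s) < min c (min (s - a) (b - s))"
        show "norm (f y - f s - (y - s) *\<^sub>R g s) \<le> e * norm (y - s)"
        proof (cases "y = s")
          case False
          define h where "h = y - s"
          have h: "h \<noteq> 0" "\<bar>h\<bar> < c" "y = s + h" using False y by (auto simp: h_def)
          have *: "\<bar>(H x y - H x s) / h\<bar> < e/2"
            using c(2)[OF h(1,2)] x(2) norm_ge_zero[of "g s - x"] unfolding G_def h(3) by linarith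
          have "norm (f y - f s - h *\<^sub>R x) \<le> \<bar>H x y - H x s\<bar>"
          proof (cases "s \<le> y")
            case True
            then show ?thesis using key[of s y x] y elim(2) by (simp add: h_def)
          next
            case False
            then have "norm (f s - f y - (s - y) *\<^sub>R x) \<le> H x s - H x y" using y elim(2) by (intro key) auto
            moreover have "f y - f s - h *\<^sub>R x = - (f s - f y - (s - y) *\<^sub>R x)" by (simp add: h_def algebra_simps)
            ultimately show ?thesis by (simp only: norm_minus_cancel)
          qed
          also have "\<dots> = \<bar>(H x y - H x s) / h\<bar> * \<bar>h\<bar>" using h(1) by (simp add: abs_divide)
          also have "\<dots> \<le> e/2 * \<bar>h\<bar>" using * by (intro mult_right_mono) auto
          finally have 1: "norm (f y - f s - h *\<^sub>R x) \<le> e/2 * \<bar>h\<bar>" .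
          have "norm (h *\<^sub>R x - h *\<^sub>R g s) = \<bar>h\<bar> * norm (g s - x)"
            by (simp add: norm_minus_commute flip: scaleR_diff_right)
          also have "\<dots> \<le> \<bar>h\<bar> * (e/4)" using x(2) by (intro mult_left_mono) auto
          finally have 2: "norm (h *\<^sub>R x - h *\<^sub>R g s) \<le> e/4 * \<bar>h\<bar>" by (simp add: mult.commute)
          have "f y - f s - h *\<^sub>R g s = (f y - f s - h *\<^sub>R x) + (h *\<^sub>R x - h *\<^sub>R g s)" by simp
          then have "norm (f y - f s - h *\<^sub>R g s) \<le> norm (f y - f s - h *\<^sub>R x) + norm (h *\<^sub>R x - h *\<^sub>R g s)"
            by (metis norm_triangle_ineq)
          also have "\<dots> \<le> e/2 * \<bar>h\<bar> + e/4 * \<bar>h\<bar>" by (intro add_mono 1 2)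
          also have "\<dots> \<le> e * \<bar>h\<bar>" using e by simp
          finally show ?thesis by (simp add: h_def)
        qed simp
      qed
    qed (rule bounded_linear_scaleR_left)
  qed
  then have eq: "AE s in lebesgue_on {a..b}. g s = vector_derivative f (at s)"
    by eventually_elim (simp add: vector_derivative_at)
  from der eq show "AE s in lebesgue_on {a..b}. (f has_vector_derivative vector_derivative f (at s)) (at s)"
    by eventually_elim simp
  show "(\<lambda>s. vector_derivative f (at s)) \<in> borel_measurable (lebesgue_on {a..b})"
    using measurable_AE_lebesgue_on[OF gm eq] .
qed

lemma has_vector_derivative_blinfun:
  fixes \<phi> :: "'a::real_normed_vector dual"
  assumes "(f has_vector_derivative v) (at s)"
  shows "((\<lambda>s. blinfun_apply \<phi> (f s)) has_real_derivative blinfun_apply \<phi> v) (at s)"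
  using bounded_linear.has_vector_derivative[OF blinfun.bounded_linear_right assms]
  by (simp add: has_real_derivative_iff_has_vector_derivative)

lemma ac_real_le:
  fixes f :: "real \<Rightarrow> real"
  assumes ac: "ac_on a b f" and le: "AE s in lebesgue_on {a..b}. deriv f s \<le> C"
    and xy: "a \<le> x" "x \<le> y" "y \<le> b"
  shows "f y - f x \<le> C * (y - x)"
proof -
  have ab: "a \<le> b" using xy by simp
  have "f y - f x = (LINT s:{x..y}|lebesgue. deriv f s)" by (rule ac_real_FTC(3)[OF ac ab xy])
  also have "\<dots> \<le> (LINT s:{x..y}|lebesgue. C)"
    by (rule set_integral_mono_AE[OF ac_real_FTC(2)[OF ac ab] _ le xy(1,3)]) simp
  finally show ?thesis using xy(2) by (simp add: set_integral_const_interval mult.commute)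
qed

text \<open>Functionals of norm at most one reduce the claim to the scalar mean-value estimate
  \<open>ac_real_le\<close>.\<close>

lemma ac_on_lipschitz:
  fixes f :: "real \<Rightarrow> 'a::{banach,second_countable_topology}"
  assumes refl: "reflexive_space TYPE('a)" and ac: "ac_on a b f" and ab: "a \<le> b" and C: "0 \<le> C"
    and le: "AE s in lebesgue_on {a..b}. norm (vector_derivative f (at s)) \<le> C"
  shows "C-lipschitz_on {a..b} f"
proof -
  have *: "norm (f y - f x) \<le> C * (y - x)" if xy: "a \<le> x" "x \<le> y" "y \<le> b" for x y
  proof (rule norm_le_functional)
    fix \<phi> :: "'a dual" assume \<phi>: "norm \<phi> \<le> 1"
    have "blinfun_apply \<phi> (f y) - blinfun_apply \<phi> (f x) \<le> C * (y - x)"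
    proof (rule ac_real_le[OF ac_on_blinfun[OF ac] _ xy])
      show "AE s in lebesgue_on {a..b}. deriv (\<lambda>s. blinfun_apply \<phi> (f s)) s \<le> C"
        using le ac_on_differentiable_ae(1)[OF refl ac ab]
      proof eventually_elim
        case (elim s)
        have "deriv (\<lambda>s. blinfun_apply \<phi> (f s)) s = blinfun_apply \<phi> (vector_derivative f (at s))"
          by (intro DERIV_imp_deriv has_vector_derivative_blinfun elim)
        also have "\<dots> \<le> norm \<phi> * norm (vector_derivative f (at s))" by (rule blinfun_le_norm)
        also have "\<dots> \<le> 1 * C" using \<phi> elim(1) by (intro mult_mono) auto
        finally show ?case by simp
      qed
    qed
    then show "blinfun_apply \<phi> (f y - f x) \<le> C * (y - x)" by (simp add: blinfun.diff_right)
  qed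
  show ?thesis
  proof (rule lipschitz_onI)
    fix x y assume "x \<in> {a..b}" "y \<in> {a..b}"
    then show "dist (f x) (f y) \<le> C * dist x y"
      using *[of x y] *[of y x] by (cases "x \<le> y") (auto simp: dist_norm norm_minus_commute abs_if)
  qed (rule C)
qed

lemma borel_measurable_imp_strongly_measurable:
  fixes f :: "'s \<Rightarrow> 'b::{real_normed_vector,second_countable_topology}"
  assumes "f \<in> borel_measurable M"
  shows "strongly_measurable M f"
proof -
  from borel_measurable_implies_sequence_metric[OF assms, of 0]
  obtain F where "\<And>i. simple_function M (F i)" "\<And>x. x \<in> space M \<Longrightarrow> (\<lambda>i. F i x) \<longlonglongrightarrow> f x"
    by blast
  then show ?thesis unfolding strongly_measurable_def by (intro exI[of _ F]) auto
qed

section \<open>Monotone time rescaling\<close>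

lemma mono_ac_deriv_nonneg:
  fixes \<tau> :: "real \<Rightarrow> real"
  assumes "mono_on {a..b} \<tau>" "ac_on a b \<tau>" "a \<le> b"
  shows "AE s in lebesgue_on {a..b}. 0 \<le> deriv \<tau> s"
  using ac_real_FTC(1)[OF assms(2,3)] AE_lebesgue_on_interior
proof eventually_elim
  case (elim s)
  then have "s \<in> interior {a..b}" by (simp add: interior_atLeastAtMost_real)
  then show ?case using mono_on_imp_deriv_nonneg[OF assms(1) elim(1)] by simp
qed

lemma ac_on_imp_continuous_on:
  assumes "ac_on a b f" shows "continuous_on {a..b} f"
proof -
  obtain m where m: "\<And>s. 0 \<le> m s" "set_integrable lebesgue {a..b} m"
    "\<And>x y. a \<le> x \<Longrightarrow> x \<le> y \<Longrightarrow> y \<le> b \<Longrightarrow> norm (f y - f x) \<le> (LINT s:{x..y}|lebesgue. m s)"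
    using assms unfolding ac_wrt_def by auto
  define M where "M x = integral {a..x} m" for x
  have c: "continuous_on {a..b} M" unfolding M_def
    using set_lebesgue_integral_eq_integral(1)[OF m(2)] by (rule indefinite_integral_continuous_1)
  have le: "norm (f y - f x) \<le> M y - M x" if "a \<le> x" "x \<le> y" "y \<le> b" for x y
    using m(3)[OF that] set_integral_split[OF m(2) that] by (simp add: M_def)
  have *: "dist (f y) (f x) \<le> dist (M y) (M x)" if "x \<in> {a..b}" "y \<in> {a..b}" for x y
    using that le[of x y] le[of y x] by (cases "x \<le> y") (auto simp: dist_norm norm_minus_commute)
  show ?thesis
    using c unfolding continuous_on_iff by (meson * le_less_trans)
qed

lemma ac_wrt_subinterval:
  assumes "ac_wrt d a b f" "a \<le> x" "y \<le> b"
  shows "ac_wrt d x y f"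
proof -
  obtain m where m: "\<And>s. 0 \<le> m s" "set_integrable lebesgue {a..b} m"
    "\<And>s1 s2. a \<le> s1 \<Longrightarrow> s1 \<le> s2 \<Longrightarrow> s2 \<le> b \<Longrightarrow> d (f s2 - f s1) \<le> ereal (LINT s:{s1..s2}|lebesgue. m s)"
    using assms(1) unfolding ac_wrt_def by auto
  show ?thesis unfolding ac_wrt_def
  proof (intro exI[of _ m] conjI allI impI m(1))
    show "set_integrable lebesgue {x..y} m" by (rule set_integrable_subset[OF m(2)]) (use assms in auto)
  qed (use m(3) assms in auto)
qed

text \<open>The push-forward of \<tau>' ds under \<tau> is Lebesgue measure on the image interval;
  this is checked on half-lines, where it is the fundamental theorem. On intervals where \<tau> is
  constant its derivative carries no mass.\<close>

lemma nn_integral_time_rescaling_borel: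
  fixes \<tau> :: "real \<Rightarrow> real"
  assumes mono: "mono_on {a..b} \<tau>" and ac: "ac_on a b \<tau>" and ab: "a \<le> b"
    and N: "N \<in> borel_measurable borel"
  shows "(\<integral>\<^sup>+ s\<in>{a..b}. N (\<tau> s) * ennreal (deriv \<tau> s) \<partial>lebesgue) = (\<integral>\<^sup>+ r\<in>{\<tau> a..\<tau> b}. N r \<partial>lebesgue)"
proof -
  note FTC = ac_real_FTC[OF ac ab]
  have cont: "continuous_on {a..b} \<tau>" using ac by (rule ac_on_imp_continuous_on)
  have tab: "\<tau> a \<le> \<tau> b" using mono ab by (auto simp: mono_on_def)
  define D where "D s = ennreal (deriv \<tau> s) * indicator {a..b} s" for s
  define \<tau>' where "\<tau>' s = \<tau> (max a (min b s))" for s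
  have cont': "continuous_on UNIV \<tau>'"
    unfolding \<tau>'_def by (rule continuous_on_compose2[OF cont]) (use ab in \<open>auto intro!: continuous_intros\<close>)
  have t'm: "\<tau>' \<in> borel_measurable borel" using cont' by (rule borel_measurable_continuous_onI)
  have t'l: "\<tau>' \<in> measurable lebesgue borel" using t'm by (simp add: measurable_completion)
  have Deq: "D s = ennreal (indicator {a..b} s *\<^sub>R deriv \<tau> s)" for s by (simp add: D_def indicator_def)
  have Dm: "D \<in> borel_measurable lebesgue"
    unfolding Deq using borel_measurable_integrable[OF FTC(2)[unfolded set_integrable_def]] by measurable
  define \<mu> where "\<mu> = distr (density lebesgue D) borel \<tau>'"
  have part: "(\<integral>\<^sup>+ s. D s * indicator {c..b} s \<partial>lebesgue) = ennreal (\<tau> b - \<tau> c)" if c: "a \<le> c" "c \<le> b" for c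
  proof -
    have nn: "AE s in lebesgue. s \<in> {a..b} \<longrightarrow> 0 \<le> deriv \<tau> s"
      using mono_ac_deriv_nonneg[OF mono ac ab] by (subst (asm) AE_restrict_space_iff) auto
    have i: "integrable lebesgue (\<lambda>s. indicator {c..b} s *\<^sub>R deriv \<tau> s)"
      using set_integrable_subset[OF FTC(2), of "{c..b}"] c by (auto simp: set_integrable_def)
    have "(\<integral>\<^sup>+ s. D s * indicator {c..b} s \<partial>lebesgue) = (\<integral>\<^sup>+ s. ennreal (indicator {c..b} s *\<^sub>R deriv \<tau> s) \<partial>lebesgue)"
      by (rule nn_integral_cong) (use c in \<open>auto simp: D_def indicator_def\<close>)
    also have "\<dots> = ennreal (LINT s|lebesgue. indicator {c..b} s *\<^sub>R deriv \<tau> s)"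
      using i by (rule nn_integral_eq_integral) (use nn in \<open>eventually_elim, use c in \<open>auto simp: indicator_def\<close>\<close>)
    also have "(LINT s|lebesgue. indicator {c..b} s *\<^sub>R deriv \<tau> s) = \<tau> b - \<tau> c"
      using FTC(3)[OF c order_refl] by (simp add: set_lebesgue_integral_def)
    finally show ?thesis .
  qed
  have "\<mu> = density lborel (indicator {\<tau> a..\<tau> b})"
  proof (rule measure_eqI_lessThan)
    fix x
    \<comment> \<open>c is the last parameter at which \<tau> equals x; it is the end point a for
      levels below the range, and b for levels from \<tau> b upwards. Up to single points, \<tau>
      exceeds x exactly after c.\<close>
    obtain c where c: "a \<le> c" "c \<le> b" "\<tau> c = max (\<tau> a) (min x (\<tau> b))"
      "\<And>s. s \<in> {a<..b} \<Longrightarrow> s \<noteq> c \<Longrightarrow> x < \<tau> s \<longleftrightarrow> c < s"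
    proof (cases "x < \<tau> a \<or> \<tau> b \<le> x")
      case True
      then show thesis
      proof
        assume x: "x < \<tau> a"
        have "x < \<tau> s" if "s \<in> {a<..b}" for s
          using mono_onD[OF mono, of a s] that ab x by simp
        then show thesis using that[of a] x ab tab by auto
      next
        assume x: "\<tau> b \<le> x"
        have "\<tau> s \<le> x" if "s \<in> {a<..b}" for s
          using mono_onD[OF mono, of s b] that ab x by simp
        then show thesis using that[of b] x ab tab by force
      qed
    next
      case False
      then have x: "\<tau> a \<le> x" "x < \<tau> b" by auto
      define K where "K = {s \<in> {a..b}. \<tau> s = x}"
      have "closed K" unfolding K_def using cont by (intro continuous_closed_preimage_constant) auto
      then have "compact K" unfolding K_def by (intro compact_eq_bounded_closed[THEN iffD2]) (auto intro: bounded_subset[OF bounded_closed_interval])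
      moreover have "K \<noteq> {}" using IVT'[OF x(1) less_imp_le[OF x(2)] ab cont] by (auto simp: K_def)
      ultimately obtain c where c: "c \<in> K" "\<And>s. s \<in> K \<Longrightarrow> s \<le> c" using compact_attains_sup by metis
      show thesis
      proof (rule that[of c])
        fix s assume s: "s \<in> {a<..b}" "s \<noteq> c"
        show "x < \<tau> s \<longleftrightarrow> c < s"
        proof
          assume "x < \<tau> s"
          then have "\<not> s \<le> c" using mono_onD[OF mono, of s c] s c(1) by (auto simp: K_def)
          then show "c < s" by simp
        next
          assume "c < s"
          moreover have "s \<notin> K" using c(2)[of s] \<open>c < s\<close> by auto
          ultimately have "\<tau> c \<le> \<tau> s" "s \<notin> K" using mono_onD[OF mono, of c s] s c(1) by (auto simp: K_def)
          then show "x < \<tau> s" using s c(1) by (auto simp: K_def)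
        qed
      qed (use c(1) x in \<open>auto simp: K_def\<close>)
    qed
    have "emeasure \<mu> {x<..} = emeasure (density lebesgue D) (\<tau>' -` {x<..} \<inter> space (density lebesgue D))"
      unfolding \<mu>_def using t'l by (intro emeasure_distr) auto
    also have "\<dots> = (\<integral>\<^sup>+ s. D s * indicator (\<tau>' -` {x<..} \<inter> space (density lebesgue D)) s \<partial>lebesgue)"
      using Dm measurable_sets[OF t'l, of "{x<..}"] by (intro emeasure_density) auto
    also have "\<dots> = (\<integral>\<^sup>+ s. D s * indicator {c..b} s \<partial>lebesgue)"
    proof (rule nn_integral_cong_AE)
      have "AE s in lebesgue. s \<noteq> a \<and> s \<noteq> c"
        by (rule AE_I'[of "{a, c}"]) (auto simp: negligible_iff_null_sets[symmetric])
      then show "AE s in lebesgue. D s * indicator (\<tau>' -` {x<..} \<inter> space (density lebesgue D)) s = D s * indicator {c..b} s"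
      proof eventually_elim
        case (elim s)
        show ?case
        proof (cases "s \<in> {a<..b}")
          case True
          then have "max a (min b s) = s" by auto
          then have "\<tau>' s = \<tau> s" by (simp add: \<tau>'_def)
          then show ?thesis using c(4)[of s] True elim by (auto simp: indicator_def)
        next
          case False
          then have "D s = 0" using elim by (auto simp: D_def indicator_def)
          then show ?thesis by simp
        qed
      qed
    qed
    also have "\<dots> = ennreal (\<tau> b - \<tau> c)" by (rule part[OF c(1,2)])
    finally have 1: "emeasure \<mu> {x<..} = ennreal (\<tau> b - \<tau> c)" .
    then show "emeasure \<mu> {x<..} < \<infinity>" by simp
    have "emeasure (density lborel (indicator {\<tau> a..\<tau> b})) {x<..} = (\<integral>\<^sup>+ r. indicator {\<tau> a..\<tau> b} r * indicator {x<..} r \<partial>lborel)"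
      by (intro emeasure_density) auto
    also have "\<dots> = (\<integral>\<^sup>+ r. indicator {\<tau> c..\<tau> b} r \<partial>lborel)"
    proof (rule nn_integral_cong_AE)
      have "AE r in lborel. r \<noteq> \<tau> c" "AE r in lborel. r \<noteq> \<tau> b" by (rule AE_lborel_singleton)+
      then show "AE r in lborel. indicator {\<tau> a..\<tau> b} r * indicator {x<..} r = (indicator {\<tau> c..\<tau> b} r :: ennreal)"
        by eventually_elim (use c(3) in \<open>auto simp: indicator_def max_def min_def split: if_splits\<close>)
    qed
    also have "\<dots> = ennreal (\<tau> b - \<tau> c)"
      using c(3) tab by (simp add: emeasure_lborel_Icc_eq max_def min_def split: if_splits)
    finally show "emeasure \<mu> {x<..} = emeasure (density lborel (indicator {\<tau> a..\<tau> b})) {x<..}" using 1 by simp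
  qed (simp_all add: \<mu>_def)
  then have "(\<integral>\<^sup>+ r. N r \<partial>\<mu>) = (\<integral>\<^sup>+ r. N r \<partial>density lborel (indicator {\<tau> a..\<tau> b}))" by simp
  moreover have "(\<integral>\<^sup>+ r. N r \<partial>\<mu>) = (\<integral>\<^sup>+ s. D s * N (\<tau>' s) \<partial>lebesgue)"
  proof -
    have "(\<integral>\<^sup>+ r. N r \<partial>\<mu>) = (\<integral>\<^sup>+ s. N (\<tau>' s) \<partial>density lebesgue D)"
      unfolding \<mu>_def using t'l N by (intro nn_integral_distr) auto
    also have "\<dots> = (\<integral>\<^sup>+ s. D s * N (\<tau>' s) \<partial>lebesgue)"
      using Dm measurable_compose[OF t'l N] by (intro nn_integral_density) auto
    finally show ?thesis .
  qed
  moreover have "(\<integral>\<^sup>+ s. D s * N (\<tau>' s) \<partial>lebesgue) = (\<integral>\<^sup>+ s\<in>{a..b}. N (\<tau> s) * ennreal (deriv \<tau> s) \<partial>lebesgue)"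
    by (rule nn_integral_cong) (auto simp: D_def indicator_def \<tau>'_def min_def max_def mult.commute)
  moreover have "(\<integral>\<^sup>+ r. N r \<partial>density lborel (indicator {\<tau> a..\<tau> b})) = (\<integral>\<^sup>+ r. indicator {\<tau> a..\<tau> b} r * N r \<partial>lborel)"
    using N by (intro nn_integral_density) auto
  moreover have "\<dots> = (\<integral>\<^sup>+ r\<in>{\<tau> a..\<tau> b}. N r \<partial>lebesgue)" by (simp add: nn_integral_completion mult.commute)
  ultimately show ?thesis by simp
qed

lemma rescaling_measurable:
  fixes \<tau> :: "real \<Rightarrow> real"
  assumes ac: "ac_on a b \<tau>" and ab: "a \<le> b" and N: "N \<in> borel_measurable borel"
  shows "(\<lambda>s. N (\<tau> s)) \<in> borel_measurable (lebesgue_on {a..b})" "deriv \<tau> \<in> borel_measurable (lebesgue_on {a..b})"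
proof -
  have "\<tau> \<in> borel_measurable (lebesgue_on {a..b})"
    by (rule continuous_imp_measurable_on_sets_lebesgue[OF ac_on_imp_continuous_on[OF ac]]) simp
  then show "(\<lambda>s. N (\<tau> s)) \<in> borel_measurable (lebesgue_on {a..b})" using N by (rule measurable_compose)
  show "deriv \<tau> \<in> borel_measurable (lebesgue_on {a..b})"
    using borel_measurable_integrable[OF ac_real_FTC(2)[OF ac ab, unfolded set_integrable_def]]
      borel_measurable_restrict_space_iff[of "{a..b}" lebesgue "deriv \<tau>"] by simp
qed

lemma nn_integral_lebesgue_on:
  "(\<integral>\<^sup>+ s\<in>{a..b::real}. f s \<partial>lebesgue) = (\<integral>\<^sup>+ s. f s \<partial>lebesgue_on {a..b})"
  by (rule nn_integral_restrict_space[symmetric]) simp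

text \<open>A null set of times has no mass under the push-forward of \<tau>' ds, so its preimage is
  null apart from the points where \<tau>' is not positive.\<close>

lemma AE_time_rescaling:
  fixes \<tau> :: "real \<Rightarrow> real"
  assumes mono: "mono_on {a..b} \<tau>" and ac: "ac_on a b \<tau>" and ab: "a \<le> b"
    and P: "AE r in lebesgue_on {\<tau> a..\<tau> b}. P r"
  shows "AE s in lebesgue_on {a..b}. 0 < deriv \<tau> s \<longrightarrow> P (\<tau> s)"
proof -
  have "AE r in lebesgue. r \<in> {\<tau> a..\<tau> b} \<longrightarrow> P r" using P by (subst (asm) AE_restrict_space_iff) auto
  then have "AE r in lborel. r \<in> {\<tau> a..\<tau> b} \<longrightarrow> P r" by (simp only: AE_completion_iff)
  then obtain B where B: "B \<in> sets borel" "emeasure lborel B = 0" "{r. \<not> (r \<in> {\<tau> a..\<tau> b} \<longrightarrow> P r)} \<subseteq> B"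
    by (auto elim!: AE_E)
  have im: "(indicator B :: real \<Rightarrow> ennreal) \<in> borel_measurable borel" using B(1) by simp
  have "(\<integral>\<^sup>+ r\<in>{\<tau> a..\<tau> b}. indicator B r \<partial>lebesgue) \<le> (\<integral>\<^sup>+ r. indicator B r \<partial>lebesgue)"
    by (rule nn_integral_mono) (auto simp: indicator_def)
  also have "\<dots> = 0" using B(1,2) by (simp add: nn_integral_completion)
  finally have "(\<integral>\<^sup>+ s\<in>{a..b}. indicator B (\<tau> s) * ennreal (deriv \<tau> s) \<partial>lebesgue) = 0"
    using nn_integral_time_rescaling_borel[OF mono ac ab im] by simp
  then have "AE s in lebesgue_on {a..b}. indicator B (\<tau> s) * ennreal (deriv \<tau> s) = 0"
    unfolding nn_integral_lebesgue_on using rescaling_measurable[OF ac ab im]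
    by (subst (asm) nn_integral_0_iff_AE) auto
  then show ?thesis using AE_lebesgue_on_interior
  proof eventually_elim
    case (elim s)
    have "\<tau> s \<in> {\<tau> a..\<tau> b}" using elim(2) ab mono by (auto simp: mono_on_def)
    then show ?case using elim(1) B(3) by (auto simp: indicator_def)
  qed
qed

text \<open>For a Lebesgue measurable N the composite with \<tau> need not be measurable. A Borel
  version of N differs from it, up to a null set of parameters, only where \<tau>' <= 0, and there
  the product with \<open>ennreal (deriv \<tau> s)\<close> is zero.\<close>

lemma nn_integral_time_rescaling:
  fixes \<tau> :: "real \<Rightarrow> real"
  assumes mono: "mono_on {a..b} \<tau>" and ac: "ac_on a b \<tau>" and ab: "a \<le> b"
    and N: "N \<in> borel_measurable (lebesgue_on {\<tau> a..\<tau> b})"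
  shows "(\<integral>\<^sup>+ s\<in>{a..b}. N (\<tau> s) * ennreal (deriv \<tau> s) \<partial>lebesgue) = (\<integral>\<^sup>+ r\<in>{\<tau> a..\<tau> b}. N r \<partial>lebesgue)"
proof -
  have "(\<lambda>r. N r * indicator {\<tau> a..\<tau> b} r) \<in> borel_measurable (completion lborel)"
    using N borel_measurable_restrict_space_iff_ennreal[of "{\<tau> a..\<tau> b}" lebesgue N] by simp
  from completion_ex_borel_measurable[OF this]
  obtain N' where "N' \<in> borel_measurable lborel" and ae: "AE r in lborel. N r * indicator {\<tau> a..\<tau> b} r = N' r" ..
  then have N': "N' \<in> borel_measurable borel" by simp
  have "AE r in lebesgue. N r * indicator {\<tau> a..\<tau> b} r = N' r" using ae by (rule AE_completion)
  then have "AE r in lebesgue. r \<in> {\<tau> a..\<tau> b} \<longrightarrow> N r = N' r" by eventually_elim (auto simp: indicator_def)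
  then have ae': "AE r in lebesgue_on {\<tau> a..\<tau> b}. N r = N' r" by (subst AE_restrict_space_iff) auto
  have "(\<integral>\<^sup>+ s. N (\<tau> s) * ennreal (deriv \<tau> s) \<partial>lebesgue_on {a..b}) = (\<integral>\<^sup>+ s. N' (\<tau> s) * ennreal (deriv \<tau> s) \<partial>lebesgue_on {a..b})"
    using AE_time_rescaling[OF mono ac ab ae']
    by (intro nn_integral_cong_AE) (auto elim!: eventually_mono simp: ennreal_neg not_less)
  also have "\<dots> = (\<integral>\<^sup>+ r. N' r \<partial>lebesgue_on {\<tau> a..\<tau> b})"
    using nn_integral_time_rescaling_borel[OF mono ac ab N'] by (simp add: nn_integral_lebesgue_on)
  also have "\<dots> = (\<integral>\<^sup>+ r. N r \<partial>lebesgue_on {\<tau> a..\<tau> b})"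
    using ae' by (intro nn_integral_cong_AE) (auto elim!: eventually_mono)
  finally show ?thesis by (simp add: nn_integral_lebesgue_on)
qed

lemma set_integrable_lebesgue_on:
  fixes f :: "real \<Rightarrow> real"
  shows "set_integrable lebesgue {a..b} f \<longleftrightarrow> integrable (lebesgue_on {a..b}) f"
  unfolding set_integrable_def by (rule integrable_restrict_space[symmetric]) simp

lemma set_integral_lebesgue_on:
  fixes f :: "real \<Rightarrow> real"
  shows "(LINT s:{a..b}|lebesgue. f s) = (LINT s|lebesgue_on {a..b}. f s)"
  unfolding set_lebesgue_integral_def by (rule integral_restrict_space[symmetric]) simp

lemma integral_time_rescaling:
  fixes \<tau> f :: "real \<Rightarrow> real"
  assumes mono: "mono_on {a..b} \<tau>" and ac: "ac_on a b \<tau>" and ab: "a \<le> b"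
    and f: "set_integrable lebesgue {\<tau> a..\<tau> b} f"
  shows "set_integrable lebesgue {a..b} (\<lambda>s. f (\<tau> s) * deriv \<tau> s)"
    and "(LINT s:{a..b}|lebesgue. f (\<tau> s) * deriv \<tau> s) = (LINT r:{\<tau> a..\<tau> b}|lebesgue. f r)"
proof -
  let ?A = "lebesgue_on {a..b}" and ?B = "lebesgue_on {\<tau> a..\<tau> b}"
  have fi: "integrable ?B f" using f by (simp add: set_integrable_lebesgue_on)
  have "(\<lambda>r. indicator {\<tau> a..\<tau> b} r *\<^sub>R f r) \<in> borel_measurable (completion lborel)"
    using borel_measurable_integrable[OF f[unfolded set_integrable_def]] .
  from completion_ex_borel_measurable_real[OF this]
  obtain g where "g \<in> borel_measurable lborel" and ae: "AE r in lborel. indicator {\<tau> a..\<tau> b} r *\<^sub>R f r = g r" ..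
  then have g: "g \<in> borel_measurable borel" by simp
  have "AE r in lebesgue. indicator {\<tau> a..\<tau> b} r *\<^sub>R f r = g r" using ae by (rule AE_completion)
  then have "AE r in lebesgue. r \<in> {\<tau> a..\<tau> b} \<longrightarrow> f r = g r" by eventually_elim (auto simp: indicator_def)
  then have ae': "AE r in ?B. f r = g r" by (subst AE_restrict_space_iff) auto
  have nonneg: "AE s in ?A. 0 \<le> deriv \<tau> s" by (rule mono_ac_deriv_nonneg[OF mono ac ab])
  have eq: "AE s in ?A. g (\<tau> s) * deriv \<tau> s = f (\<tau> s) * deriv \<tau> s"
    using AE_time_rescaling[OF mono ac ab ae'] nonneg by eventually_elim (auto simp: less_le)
  have gm: "(\<lambda>s. g (\<tau> s) * deriv \<tau> s) \<in> borel_measurable ?A"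
    using rescaling_measurable[OF ac ab g] by measurable
  then have fm: "(\<lambda>s. f (\<tau> s) * deriv \<tau> s) \<in> borel_measurable ?A" using eq by (rule measurable_AE_lebesgue_on)
  have fBm: "f \<in> borel_measurable ?B" using fi by simp
  \<comment> \<open>Taken with the absolute value for integrability, then with the identity and the
    negation for the positive and negative parts, since \<open>ennreal\<close> truncates at
    zero.\<close>
  have nn: "(\<integral>\<^sup>+ s. ennreal (h (f (\<tau> s) * deriv \<tau> s)) \<partial>?A) = (\<integral>\<^sup>+ r. ennreal (h (f r)) \<partial>?B)"
    if hm: "h \<in> borel_measurable borel" and h: "\<And>x y. 0 \<le> y \<Longrightarrow> h (x * y) = h x * y" for h :: "real \<Rightarrow> real"
  proof -
    have "(\<integral>\<^sup>+ s. ennreal (h (f (\<tau> s) * deriv \<tau> s)) \<partial>?A) = (\<integral>\<^sup>+ s. ennreal (h (f (\<tau> s))) * ennreal (deriv \<tau> s) \<partial>?A)"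
      using nonneg by (intro nn_integral_cong_AE) (auto elim!: eventually_mono simp: h ennreal_mult'')
    also have "\<dots> = (\<integral>\<^sup>+ r. ennreal (h (f r)) \<partial>?B)"
      using nn_integral_time_rescaling[OF mono ac ab, of "\<lambda>r. ennreal (h (f r))"] measurable_compose[OF fBm hm]
      by (simp add: nn_integral_lebesgue_on)
    finally show ?thesis .
  qed
  have fin: "(\<integral>\<^sup>+ s. ennreal (norm (f (\<tau> s) * deriv \<tau> s)) \<partial>?A) < \<infinity>"
    using nn[of abs] fi by (simp add: integrable_iff_bounded abs_mult)
  then have int: "integrable ?A (\<lambda>s. f (\<tau> s) * deriv \<tau> s)" using fm by (intro integrableI_bounded) auto
  then show "set_integrable lebesgue {a..b} (\<lambda>s. f (\<tau> s) * deriv \<tau> s)" by (simp add: set_integrable_lebesgue_on)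
  show "(LINT s:{a..b}|lebesgue. f (\<tau> s) * deriv \<tau> s) = (LINT r:{\<tau> a..\<tau> b}|lebesgue. f r)"
    unfolding set_integral_lebesgue_on real_lebesgue_integral_def[OF int] real_lebesgue_integral_def[OF fi]
    using nn[of "\<lambda>x. x"] nn[of uminus] by simp
qed

text \<open>A majorant of the composite is m(\<tau>) \<tau>', by the change of variables on every
  subinterval.\<close>

lemma ac_on_compose:
  assumes mono: "mono_on {a..b} \<tau>" and ac: "ac_on a b \<tau>" and f: "ac_on (\<tau> a) (\<tau> b) f"
  shows "ac_on a b (f \<circ> \<tau>)"
proof (cases "a \<le> b")
  case False
  then show ?thesis unfolding ac_wrt_def by (intro exI[of _ "\<lambda>_. 0"]) auto
next
  case ab: True
  obtain m where m: "\<And>s. 0 \<le> m s" "set_integrable lebesgue {\<tau> a..\<tau> b} m"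
    "\<And>x y. \<tau> a \<le> x \<Longrightarrow> x \<le> y \<Longrightarrow> y \<le> \<tau> b \<Longrightarrow> norm (f y - f x) \<le> (LINT s:{x..y}|lebesgue. m s)"
    using f unfolding ac_wrt_def by auto
  have nonneg: "AE s in lebesgue_on {a..b}. 0 \<le> deriv \<tau> s" by (rule mono_ac_deriv_nonneg[OF mono ac ab])
  \<comment> \<open>\<open>ac_wrt\<close> asks for a majorant that is nonnegative everywhere,
    whereas \<tau>' >= 0 holds almost everywhere only.\<close>
  define n where "n s = m (\<tau> s) * max 0 (deriv \<tau> s)" for s
  have eq: "AE s in lebesgue_on {a..b}. m (\<tau> s) * deriv \<tau> s = n s"
    using nonneg by eventually_elim (simp add: n_def)
  have i: "set_integrable lebesgue {a..b} (\<lambda>s. m (\<tau> s) * deriv \<tau> s)"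
    by (rule integral_time_rescaling(1)[OF mono ac ab m(2)])
  have ni: "set_integrable lebesgue {a..b} n"
    unfolding set_integrable_lebesgue_on
  proof (rule integrable_cong_AE_imp)
    show i': "integrable (lebesgue_on {a..b}) (\<lambda>s. m (\<tau> s) * deriv \<tau> s)" using i by (simp add: set_integrable_lebesgue_on)
    show "n \<in> borel_measurable (lebesgue_on {a..b})"
      by (rule measurable_AE_lebesgue_on[OF borel_measurable_integrable[OF i'] eq])
  qed (rule eq)
  show ?thesis
    unfolding ac_wrt_def
  proof (intro exI[of _ n] conjI allI impI ni)
    show "0 \<le> n s" for s using m(1) by (simp add: n_def)
    fix x y assume xy: "a \<le> x \<and> x \<le> y \<and> y \<le> b"
    have "mono_on {x..y} \<tau>" using xy by (intro mono_on_subset[OF mono]) auto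
    moreover have "ac_on x y \<tau>" using xy by (intro ac_wrt_subinterval[OF ac]) auto
    ultimately have sub: "mono_on {x..y} \<tau>" "ac_on x y \<tau>" .
    have t: "\<tau> a \<le> \<tau> x" "\<tau> x \<le> \<tau> y" "\<tau> y \<le> \<tau> b" using mono xy by (auto simp: mono_on_def)
    have "norm (f (\<tau> y) - f (\<tau> x)) \<le> (LINT r:{\<tau> x..\<tau> y}|lebesgue. m r)" by (rule m(3)[OF t])
    also have "\<dots> = (LINT s:{x..y}|lebesgue. m (\<tau> s) * deriv \<tau> s)"
    proof (rule integral_time_rescaling(2)[symmetric, OF sub])
      show "set_integrable lebesgue {\<tau> x..\<tau> y} m" by (rule set_integrable_subset[OF m(2)]) (use t in auto)
    qed (use xy in simp)
    also have "\<dots> \<le> (LINT s:{x..y}|lebesgue. n s)"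
      using eq xy by (intro set_integral_mono_AE[OF i ni]) (auto elim: eventually_mono)
    finally show "ereal (norm ((f \<circ> \<tau>) y - (f \<circ> \<tau>) x)) \<le> ereal (LINT s:{x..y}|lebesgue. n s)" by simp
  qed
qed

section \<open>Weak-star convergence of Lipschitz curves\<close>

text \<open>Induction from half-lines to Borel sets. Half-lines are the assumption, complements are
  differences, and for disjoint unions the bound C makes the series summable uniformly in n, so that
  limit and sum may be exchanged.\<close>

lemma integral_restrict_borel_set_tendsto:
  fixes F f :: "_ \<Rightarrow> real \<Rightarrow> real"
  assumes A: "A \<in> sets borel" and ab: "a \<le> b"
    and i: "\<And>n. set_integrable lebesgue {a..b} (f n)" and i': "set_integrable lebesgue {a..b} f'"
    and bd: "\<And>n. AE s in lebesgue_on {a..b}. \<bar>f n s\<bar> \<le> C"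
    and conv: "\<And>y. a \<le> y \<Longrightarrow> y \<le> b \<Longrightarrow> (\<lambda>n. LINT s:{a..y}|lebesgue. f n s) \<longlonglongrightarrow> (LINT s:{a..y}|lebesgue. f' s)"
  shows "(\<lambda>n. LINT s|lebesgue_on {a..b}. indicator A s * f n s) \<longlonglongrightarrow> (LINT s|lebesgue_on {a..b}. indicator A s * f' s)"
proof -
  let ?L = "lebesgue_on {a..b}"
  have I: "integrable ?L (\<lambda>s. indicator B s * g s)" if "B \<in> sets borel" "set_integrable lebesgue {a..b} g" for B and g :: "real \<Rightarrow> real"
  proof -
    have "B \<inter> {a..b} \<in> sets ?L" using that(1) by (subst sets_restrict_space_iff) auto
    then have "integrable ?L (\<lambda>s. indicator (B \<inter> {a..b}) s *\<^sub>R g s)"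
      using that(2) by (intro integrable_mult_indicator) (auto simp: set_integrable_lebesgue_on)
    then show ?thesis by (rule Bochner_Integration.integrable_cong[THEN iffD1, rotated 2]) (auto simp: indicator_def)
  qed
  have gen: "A \<in> sigma_sets UNIV (range (\<lambda>x::real. {..x}))" using A by (subst (asm) borel_eq_atMost) simp
  have stable: "Int_stable (range (\<lambda>x::real. {..x}))"
  proof -
    have "{..x} \<inter> {..y} = {..min x y}" for x y :: real by auto
    then show ?thesis by (auto simp: Int_stable_def)
  qed
  have sub: "range (\<lambda>x::real. {..x}) \<subseteq> Pow UNIV" by simp
  from stable sub gen show ?thesis
  proof (induction rule: sigma_sets_induct_disjoint)
    case (basic A)
    then obtain x where x: "A = {..x}" by blast
    have eq: "(LINT s|?L. indicator A s * g s) = (LINT s:{a..min x b}|lebesgue. g s)" for g :: "real \<Rightarrow> real"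
    proof -
      have "(LINT s|?L. indicator A s * g s) = (LINT s|lebesgue. indicator {a..b} s *\<^sub>R (indicator A s * g s))"
        by (rule integral_restrict_space) simp
      also have "\<dots> = (LINT s|lebesgue. indicator {a..min x b} s *\<^sub>R g s)"
        by (rule Bochner_Integration.integral_cong) (auto simp: indicator_def x)
      finally show ?thesis by (simp add: set_lebesgue_integral_def)
    qed
    show ?case
    proof (cases "a \<le> x")
      case True
      then show ?thesis unfolding eq using ab by (intro conv) auto
    next
      case False
      then have "{a..min x b} = {}" by auto
      then show ?thesis unfolding eq by (simp add: set_lebesgue_integral_def)
    qed
  next
    case empty
    show ?case by simp
  next
    case (compl A)
    then have A: "A \<in> sets borel" by (subst borel_eq_atMost) simp
    have eq: "(LINT s|?L. indicator (UNIV - A) s * g s) = (LINT s:{a..b}|lebesgue. g s) - (LINT s|?L. indicator A s * g s)"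
      if g: "set_integrable lebesgue {a..b} g" for g :: "real \<Rightarrow> real"
    proof -
      have "(LINT s|?L. indicator (UNIV - A) s * g s) = (LINT s|?L. g s - indicator A s * g s)"
        by (rule Bochner_Integration.integral_cong) (auto simp: indicator_def)
      also have "\<dots> = (LINT s|?L. g s) - (LINT s|?L. indicator A s * g s)"
        using I[OF A g] g by (intro Bochner_Integration.integral_diff) (auto simp: set_integrable_lebesgue_on)
      finally show ?thesis by (simp add: set_integral_lebesgue_on)
    qed
    show ?case unfolding eq[OF i] eq[OF i'] using ab by (intro tendsto_diff conv compl.IH) auto
  next
    case (union A)
    have A: "A j \<in> sets borel" for j using union.hyps(2) by (subst borel_eq_atMost) auto
    have Aj: "A j \<inter> {a..b} \<in> sets ?L" for j using A by (subst sets_restrict_space_iff) auto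
    define M where "M j = C * measure ?L (A j \<inter> {a..b})" for j
    have disj: "disjoint_family (\<lambda>j. A j \<inter> {a..b})" using union.hyps(1) by (auto simp: disjoint_family_on_def)
    have fin: "emeasure ?L (\<Union>j. A j \<inter> {a..b}) \<noteq> \<infinity>"
    proof -
      have "emeasure ?L (\<Union>j. A j \<inter> {a..b}) \<le> emeasure ?L (space ?L)" by (rule emeasure_space)
      also have "\<dots> < \<infinity>" by (subst emeasure_restrict_space) (auto simp: emeasure_lborel_Icc_eq)
      finally show ?thesis by simp
    qed
    have "summable M" unfolding M_def
      using Aj by (intro summable_mult sums_summable[OF measure_UNION[OF _ disj fin]]) auto
    have bound: "norm (LINT s|?L. indicator (A j) s * f n s) \<le> M j" for j n
    proof -
      have "norm (LINT s|?L. indicator (A j) s * f n s) \<le> (LINT s|?L. norm (indicator (A j) s * f n s))"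
        by (rule integral_norm_bound)
      also have "\<dots> \<le> (LINT s|?L. C * indicator (A j \<inter> {a..b}) s)"
      proof (rule integral_mono_AE)
        show "integrable ?L (\<lambda>s. norm (indicator (A j) s * f n s))" using I[OF A i] by (rule integrable_norm)
        have "emeasure ?L (A j \<inter> {a..b}) \<le> emeasure ?L (space ?L)" by (rule emeasure_space)
        also have "\<dots> < \<infinity>" by (subst emeasure_restrict_space) (auto simp: emeasure_lborel_Icc_eq)
        finally show "integrable ?L (\<lambda>s. C * indicator (A j \<inter> {a..b}) s)"
          using Aj[of j] by (intro integrable_mult_right integrable_real_indicator) auto
        show "AE s in ?L. norm (indicator (A j) s * f n s) \<le> C * indicator (A j \<inter> {a..b}) s"
          using bd[of n] AE_lebesgue_on_interior by eventually_elim (auto simp: indicator_def)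
      qed
      also have "\<dots> = M j" using Aj[of j] by (simp add: M_def)
      finally show ?thesis .
    qed
    have sum: "(LINT s|?L. indicator (\<Union>j. A j) s * g s) = (\<Sum>j. LINT s|?L. indicator (A j) s * g s)"
      if g: "set_integrable lebesgue {a..b} g" for g :: "real \<Rightarrow> real"
    proof -
      have 1: "(LINT s|?L. indicator (\<Union>j. A j) s * g s) = (LINT s:(\<Union>j. A j \<inter> {a..b})|?L. g s)"
        unfolding set_lebesgue_integral_def by (rule Bochner_Integration.integral_cong) (auto simp: indicator_def)
      have 2: "(LINT s|?L. indicator (A j) s * g s) = (LINT s:(A j \<inter> {a..b})|?L. g s)" for j
        unfolding set_lebesgue_integral_def by (rule Bochner_Integration.integral_cong) (auto simp: indicator_def)
      have "integrable ?L (\<lambda>s. indicator (\<Union>j. A j \<inter> {a..b}) s *\<^sub>R g s)"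
        using g Aj by (intro integrable_mult_indicator sets.countable_UN) (auto simp: set_integrable_lebesgue_on)
      then show ?thesis unfolding 1 2
        using disj by (intro lebesgue_integral_countable_add Aj) (auto simp: disjoint_family_on_def set_integrable_def)
    qed
    show ?case unfolding sum[OF i] sum[OF i']
      by (rule tannerys_theorem[THEN conjunct2, THEN conjunct2, OF union.IH _ \<open>summable M\<close>])
        (use bound in \<open>auto intro: always_eventually\<close>)
  qed
qed

section \<open>Dual-valued test functions and weak-star convergence\<close>

lemma lebesgue_set_borel_ae:
  assumes "A \<in> sets lebesgue"
  obtains B :: "real set" where "B \<in> sets borel" "AE s in lebesgue_on {a..b}. s \<in> A \<longleftrightarrow> s \<in> B"
proof -
  obtain B N N' where *: "A = B \<union> N" "N \<subseteq> N'" "N' \<in> null_sets lborel" "B \<in> sets lborel"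
    using assms by (rule sets_completionE) blast
  have "negligible N" using *(2,3) negligible_iff_null_sets null_sets_completionI negligible_subset by blast
  then have "AE s in lebesgue_on {a..b}. s \<in> A \<longleftrightarrow> s \<in> B" using *(1) by (intro AE_lebesgue_onI[of N]) auto
  then show thesis using that[of B] *(4) by simp
qed

lemma simple_blinfun_apply:
  fixes \<psi> :: "'s \<Rightarrow> 'b::real_normed_vector dual"
  assumes "simple_function M \<psi>" "s \<in> space M"
  shows "blinfun_apply (\<psi> s) x = (\<Sum>y\<in>\<psi> ` space M. indicator (\<psi> -` {y} \<inter> space M) s * blinfun_apply y x)"
proof -
  have "(\<Sum>y\<in>\<psi> ` space M. indicator (\<psi> -` {y} \<inter> space M) s * blinfun_apply y x) = (\<Sum>y\<in>\<psi> ` space M. if y = \<psi> s then blinfun_apply y x else 0)"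
    using assms(2) by (intro sum.cong) (auto simp: indicator_def)
  also have "\<dots> = blinfun_apply (\<psi> s) x"
    using simple_functionD(1)[OF assms(1)] assms(2) by simp
  finally show ?thesis by simp
qed

lemma simple_blinfun_measurable:
  fixes \<psi> :: "'s \<Rightarrow> 'b::{real_normed_vector,second_countable_topology} dual"
  assumes \<psi>: "simple_function M \<psi>" and v: "v \<in> borel_measurable M"
  shows "(\<lambda>s. blinfun_apply (\<psi> s) (v s)) \<in> borel_measurable M"
proof -
  have "(\<lambda>s. \<Sum>y\<in>\<psi> ` space M. indicator (\<psi> -` {y} \<inter> space M) s * blinfun_apply y (v s)) \<in> borel_measurable M"
  proof (intro borel_measurable_sum borel_measurable_times borel_measurable_indicator)
    show "\<psi> -` {y} \<inter> space M \<in> sets M" for y using simple_functionD(2)[OF \<psi>] .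
    show "(\<lambda>s. blinfun_apply y (v s)) \<in> borel_measurable M" for y
      using borel_measurable_continuous_onI[OF blinfun.continuous_on[OF continuous_on_const continuous_on_id], of y]
      by (rule measurable_compose[OF v])
  qed
  then show ?thesis
    by (rule measurable_cong[THEN iffD1, rotated]) (rule simple_blinfun_apply[OF \<psi>, symmetric])
qed

text \<open>The dual may be nonseparable, so measurability is passed through the simple
  approximations of g instead of a Borel structure on the dual.\<close>

lemma strongly_measurable_apply:
  fixes g :: "real \<Rightarrow> 'b::{real_normed_vector,second_countable_topology} dual"
  assumes g: "strongly_measurable (lebesgue_on {a..b}) g" and v: "v \<in> borel_measurable (lebesgue_on {a..b})"
  shows "(\<lambda>s. blinfun_apply (g s) (v s)) \<in> borel_measurable (lebesgue_on {a..b})"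
proof -
  obtain \<phi> where \<phi>: "\<And>i::nat. simple_function (lebesgue_on {a..b}) (\<phi> i)"
    and lim: "AE x in lebesgue_on {a..b}. (\<lambda>i. \<phi> i x) \<longlonglongrightarrow> g x"
    using g unfolding strongly_measurable_def by blast
  define h where "h s = lim (\<lambda>i. blinfun_apply (\<phi> i s) (v s))" for s
  have "h \<in> borel_measurable (lebesgue_on {a..b})"
    unfolding h_def by (intro borel_measurable_lim_metric simple_blinfun_measurable \<phi> v)
  moreover have "AE s in lebesgue_on {a..b}. h s = blinfun_apply (g s) (v s)"
    using lim by eventually_elim (auto simp: h_def intro!: limI tendsto_intros)
  ultimately show ?thesis by (rule measurable_AE_lebesgue_on)
qed

text \<open>The simple approximations of g converge pointwise but without a dominating function.
  They are therefore truncated at a level K, and the part where g is large is charged to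
  \<open>T K\<close>, which is small by integrability of g.\<close>

lemma in_L1_simple_approx:
  fixes g :: "real \<Rightarrow> 'b::real_normed_vector"
  assumes g: "in_L1 a b g" and e: "0 < e"
  obtains \<psi> where "simple_function (lebesgue_on {a..b}) \<psi>"
    "integrable (lebesgue_on {a..b}) (\<lambda>s. norm (g s - \<psi> s))" "(LINT s|lebesgue_on {a..b}. norm (g s - \<psi> s)) < e"
proof -
  let ?L = "lebesgue_on {a..b}"
  obtain \<phi> where \<phi>: "\<And>i::nat. simple_function ?L (\<phi> i)" and lim: "AE x in ?L. (\<lambda>i. \<phi> i x) \<longlonglongrightarrow> g x"
    using g unfolding in_L1_def strongly_measurable_def by blast
  have nm: "(\<lambda>s. norm (g s - \<psi> s)) \<in> borel_measurable ?L" if \<psi>: "simple_function ?L \<psi>" for \<psi>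
  proof -
    have "simple_function ?L (\<lambda>s. norm (\<phi> i s - \<psi> s))" for i by (rule simple_function_compose2[OF \<phi> \<psi>])
    then have "(\<lambda>s. lim (\<lambda>i. norm (\<phi> i s - \<psi> s))) \<in> borel_measurable ?L"
      by (intro borel_measurable_lim_metric borel_measurable_simple_function)
    moreover have "AE s in ?L. lim (\<lambda>i. norm (\<phi> i s - \<psi> s)) = norm (g s - \<psi> s)"
      using lim by eventually_elim (auto intro!: limI tendsto_intros)
    ultimately show ?thesis by (rule measurable_AE_lebesgue_on)
  qed
  have gm: "(\<lambda>s. norm (g s)) \<in> borel_measurable ?L" using nm[of "\<lambda>_. 0"] by simp
  have gi: "integrable ?L (\<lambda>s. norm (g s))"
    using g gm by (intro integrableI_nonneg) (auto simp: in_L1_def)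
  have ci: "integrable ?L (\<lambda>s. c)" for c :: real
    using set_integrable_const_interval[of a b c] by (simp add: set_integrable_lebesgue_on)
  \<comment> \<open>Twice the norm of g s dominates the distance to any vector of norm at most K as
    soon as g s has norm at least K.\<close>
  define T where "T K s = (if norm (g s) < real K then 0 else 2 * norm (g s))" for K s
  have Tm: "T K \<in> borel_measurable ?L" for K unfolding T_def using gm by measurable
  have "(\<lambda>K. LINT s|?L. T K s) \<longlonglongrightarrow> (LINT s|?L. 0)"
  proof (rule integral_dominated_convergence[where w = "\<lambda>s. 2 * norm (g s)"])
    show "AE s in ?L. (\<lambda>K. T K s) \<longlonglongrightarrow> 0"
    proof (rule AE_I2)
      fix s
      obtain K0 where "norm (g s) < real K0" using reals_Archimedean2 by blast
      then have "\<forall>\<^sub>F K in sequentially. T K s = 0"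
        by (intro eventually_sequentiallyI[of K0]) (auto simp: T_def)
      then show "(\<lambda>K. T K s) \<longlonglongrightarrow> 0" by (rule tendsto_eventually)
    qed
  qed (use Tm gi in \<open>auto simp: T_def\<close>)
  then have "\<forall>\<^sub>F K in sequentially. dist (LINT s|?L. T K s) 0 < e/2" using e by (intro tendstoD) auto
  then obtain K where K: "\<bar>LINT s|?L. T K s\<bar> < e/2" by (auto simp: eventually_sequentially)
  have Ti: "integrable ?L (T K)"
    by (rule Bochner_Integration.integrable_bound[OF integrable_mult_right[OF gi, of 2] Tm]) (auto simp: T_def)
  define \<psi> where "\<psi> i s = (if norm (\<phi> i s) \<le> real K then \<phi> i s else 0)" for i s
  have \<psi>: "simple_function ?L (\<psi> i)" for i
  proof -
    have "\<psi> i = (\<lambda>s. (\<lambda>x. if norm x \<le> real K then x else 0) (\<phi> i s))" by (simp add: \<psi>_def fun_eq_iff)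
    then show ?thesis using simple_function_compose1[OF \<phi>[of i], of "\<lambda>x. if norm x \<le> real K then x else 0"] by simp
  qed
  have \<psi>K: "norm (\<psi> i s) \<le> real K" for i s by (simp add: \<psi>_def)
  define d where "d i s = (if norm (g s) < real K then norm (g s - \<psi> i s) else 0)" for i s
  have dm: "d i \<in> borel_measurable ?L" for i unfolding d_def using gm nm[OF \<psi>] by measurable
  have dK: "norm (d i s) \<le> 2 * real K" for i s
    using norm_triangle_ineq4[of "g s" "\<psi> i s"] \<psi>K[of i s] by (auto simp: d_def)
  have di: "integrable ?L (d i)" for i
    by (rule Bochner_Integration.integrable_bound[OF ci[of "2 * real K"] dm]) (use dK in auto)
  have "(\<lambda>i. LINT s|?L. d i s) \<longlonglongrightarrow> (LINT s|?L. 0)"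
  proof (rule integral_dominated_convergence[where w = "\<lambda>s. 2 * real K"])
    show "AE s in ?L. (\<lambda>i. d i s) \<longlonglongrightarrow> 0"
      using lim
    proof eventually_elim
      case (elim s)
      show ?case
      proof (cases "norm (g s) < real K")
        case True
        have "\<forall>\<^sub>F i in sequentially. norm (\<phi> i s) < real K"
          using order_tendstoD(2)[OF tendsto_norm[OF elim] True] .
        then have ev: "\<forall>\<^sub>F i in sequentially. norm (g s - \<phi> i s) = d i s"
          by eventually_elim (use True in \<open>auto simp: d_def \<psi>_def\<close>)
        have "(\<lambda>i. norm (g s - \<phi> i s)) \<longlonglongrightarrow> norm (g s - g s)" by (intro tendsto_intros elim)
        then show ?thesis using tendsto_cong[OF ev] by simp
      qed (simp add: d_def)
    qed
  qed (use dm dK ci in auto)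
  then have "\<forall>\<^sub>F i in sequentially. dist (LINT s|?L. d i s) 0 < e/2" using e by (intro tendstoD) auto
  then obtain i where i: "\<bar>LINT s|?L. d i s\<bar> < e/2" by (auto simp: eventually_sequentially)
  have le: "norm (g s - \<psi> i s) \<le> d i s + T K s" for s
    using norm_triangle_ineq4[of "g s" "\<psi> i s"] \<psi>K[of i s] by (auto simp: d_def T_def)
  have int: "integrable ?L (\<lambda>s. norm (g s - \<psi> i s))"
    by (rule Bochner_Integration.integrable_bound[OF Bochner_Integration.integrable_add[OF di[of i] Ti] nm[OF \<psi>]])
      (use le in \<open>auto intro!: AE_I2 intro: order_trans[OF _ abs_ge_self]\<close>)
  have "(LINT s|?L. norm (g s - \<psi> i s)) \<le> (LINT s|?L. d i s + T K s)"
    using le by (intro integral_mono int Bochner_Integration.integrable_add di Ti) auto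
  also have "\<dots> = (LINT s|?L. d i s) + (LINT s|?L. T K s)" by (intro Bochner_Integration.integral_add di Ti)
  also have "\<dots> < e" using i K by linarith
  finally show thesis using that \<psi> int by blast
qed

lemma lipschitz_derivative_bound:
  fixes f :: "real \<Rightarrow> 'b::real_normed_vector"
  assumes lip: "C-lipschitz_on {a..b} f" and s: "a < s" "s < b" and d: "(f has_vector_derivative v) (at s)"
  shows "norm v \<le> C"
proof (rule norm_le_functional)
  fix \<phi> :: "'b dual" assume \<phi>: "norm \<phi> \<le> 1"
  have "((\<lambda>h. (blinfun_apply \<phi> (f (s + h)) - blinfun_apply \<phi> (f s)) / h) \<longlongrightarrow> blinfun_apply \<phi> v) (at 0)"
    using has_vector_derivative_blinfun[OF d] by (simp add: DERIV_def)
  moreover have "\<forall>\<^sub>F h in at 0. (blinfun_apply \<phi> (f (s + h)) - blinfun_apply \<phi> (f s)) / h \<le> C"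
    unfolding eventually_at
  proof (intro exI[of _ "min (s - a) (b - s)"] conjI ballI impI)
    fix h :: real assume h: "h \<noteq> 0 \<and> dist h 0 < min (s - a) (b - s)"
    have "norm (blinfun_apply \<phi> (f (s + h) - f s)) \<le> norm \<phi> * norm (f (s + h) - f s)" by (rule norm_blinfun)
    also have "\<dots> \<le> 1 * (C * \<bar>h\<bar>)"
    proof (intro mult_mono \<phi>)
      have "s + h \<in> {a..b}" "s \<in> {a..b}" using h s by (auto simp: dist_real_def abs_less_iff)
      then show "norm (f (s + h) - f s) \<le> C * \<bar>h\<bar>" using lipschitz_onD[OF lip, of "s + h" s] by (simp add: dist_norm)
    qed auto
    finally have "\<bar>blinfun_apply \<phi> (f (s + h)) - blinfun_apply \<phi> (f s)\<bar> / \<bar>h\<bar> \<le> C"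
      using h by (simp add: blinfun.diff_right divide_le_eq)
    then have "\<bar>(blinfun_apply \<phi> (f (s + h)) - blinfun_apply \<phi> (f s)) / h\<bar> \<le> C" by (simp only: abs_divide)
    then show "(blinfun_apply \<phi> (f (s + h)) - blinfun_apply \<phi> (f s)) / h \<le> C" by (rule abs_le_D1)
  qed (use s in auto)
  ultimately show "blinfun_apply \<phi> v \<le> C" by (intro tendsto_upperbound) auto
qed

lemma lipschitz_in_W1inf:
  fixes f :: "real \<Rightarrow> 'b::{banach,second_countable_topology}"
  assumes refl: "reflexive_space TYPE('b)" and lip: "C-lipschitz_on {a..b} f" and ab: "a \<le> b"
  shows "in_W1inf a b f" "AE s in lebesgue_on {a..b}. norm (vector_derivative f (at s)) \<le> C"
    "f \<in> borel_measurable (lebesgue_on {a..b})"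
proof -
  have ac: "ac_on a b f" using lip by (rule lipschitz_imp_ac_on)
  have d: "AE s in lebesgue_on {a..b}. (f has_vector_derivative vector_derivative f (at s)) (at s)"
    and m: "(\<lambda>s. vector_derivative f (at s)) \<in> borel_measurable (lebesgue_on {a..b})"
    using ac_on_differentiable_ae[OF refl ac ab] by blast+
  show le: "AE s in lebesgue_on {a..b}. norm (vector_derivative f (at s)) \<le> C"
    using d AE_lebesgue_on_interior by eventually_elim (use lipschitz_derivative_bound[OF lip] in blast)
  show fm: "f \<in> borel_measurable (lebesgue_on {a..b})"
    by (rule continuous_imp_measurable_on_sets_lebesgue[OF lipschitz_on_continuous_on[OF lip]]) simp
  have "norm (f s) \<le> norm (f a) + C * (b - a)" if "s \<in> {a..b}" for s
  proof -
    have "norm (f s - f a) \<le> C * (s - a)" using lipschitz_onD[OF lip, of s a] that by (simp add: dist_norm)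
    also have "\<dots> \<le> C * (b - a)" using that lipschitz_on_nonneg[OF lip] by (intro mult_left_mono) auto
    finally show ?thesis using norm_triangle_sub[of "f s" "f a"] by linarith
  qed
  then have "AE s in lebesgue_on {a..b}. norm (f s) \<le> norm (f a) + C * (b - a)" by (intro AE_I2) simp
  moreover have "AE s in lebesgue_on {a..b}. f differentiable (at s)"
    using d by eventually_elim (rule differentiableI_vector)
  ultimately show "in_W1inf a b f"
    unfolding in_W1inf_def in_Linf_def using ac le
      borel_measurable_imp_strongly_measurable[OF fm] borel_measurable_imp_strongly_measurable[OF m] by blast
qed

text \<open>Values converge by dominated convergence. For derivatives, testing with the indicator of
  an initial interval times a functional gives an increment of the curves, which converges by
  assumption; Borel sets, simple functions and integrable test functions follow, the last by the
  common bound C.\<close>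

theorem lipschitz_weak_star_W1inf:
  fixes v :: "nat \<Rightarrow> real \<Rightarrow> 'b::{banach,second_countable_topology}"
  assumes refl: "reflexive_space TYPE('b)" and ab: "a \<le> b"
    and lip: "\<And>n. C-lipschitz_on {a..b} (v n)" and lip': "C-lipschitz_on {a..b} w"
    and conv: "\<And>s. s \<in> {a..b} \<Longrightarrow> weak_conv (\<lambda>n. v n s) (w s)"
    and B: "\<And>n s. s \<in> {a..b} \<Longrightarrow> norm (v n s) \<le> B" "\<And>s. s \<in> {a..b} \<Longrightarrow> norm (w s) \<le> B"
  shows "weak_star_W1inf a b v w"
proof -
  let ?L = "lebesgue_on {a..b}"
  note W = lipschitz_in_W1inf[OF refl lip ab] and W' = lipschitz_in_W1inf[OF refl lip' ab]
  have meas: "(\<lambda>s. vector_derivative f (at s)) \<in> borel_measurable ?L" "ac_on a b f"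
    "AE s in ?L. (f has_vector_derivative vector_derivative f (at s)) (at s)"
    if "C-lipschitz_on {a..b} f" for f :: "real \<Rightarrow> 'b"
    using ac_on_differentiable_ae[OF refl lipschitz_imp_ac_on[OF that] ab] lipschitz_imp_ac_on[OF that] by blast+
  have C0: "0 \<le> C" using lip' by (rule lipschitz_on_nonneg)
  have val: "weak_star_Linf a b v w"
    unfolding weak_star_Linf_def
  proof (intro conjI allI impI)
    show "in_Linf a b (v n)" for n using W(1)[of n] by (simp add: in_W1inf_def)
    show "in_Linf a b w" using W'(1) by (simp add: in_W1inf_def)
    fix g :: "real \<Rightarrow> 'b dual" assume g: "in_L1 a b g"
    then have sm: "strongly_measurable ?L g" by (simp add: in_L1_def)
    have gm: "(\<lambda>s. norm (g s)) \<in> borel_measurable ?L"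
    proof -
      obtain \<phi> where \<phi>: "\<And>i::nat. simple_function ?L (\<phi> i)" and lim: "AE x in ?L. (\<lambda>i. \<phi> i x) \<longlonglongrightarrow> g x"
        using sm unfolding strongly_measurable_def by blast
      have "(\<lambda>s. lim (\<lambda>i. norm (\<phi> i s))) \<in> borel_measurable ?L"
        by (intro borel_measurable_lim_metric borel_measurable_simple_function simple_function_compose1[OF \<phi>, where g = norm])
      moreover have "AE s in ?L. lim (\<lambda>i. norm (\<phi> i s)) = norm (g s)"
        using lim by eventually_elim (auto intro!: limI tendsto_intros)
      ultimately show ?thesis by (rule measurable_AE_lebesgue_on)
    qed
    have gi: "integrable ?L (\<lambda>s. norm (g s))" using g gm by (intro integrableI_nonneg) (auto simp: in_L1_def)
    show "(\<lambda>n. LINT s|?L. blinfun_apply (g s) (v n s)) \<longlonglongrightarrow> (LINT s|?L. blinfun_apply (g s) (w s))"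
    proof (rule integral_dominated_convergence[where w = "\<lambda>s. norm (g s) * B"])
      show "AE s in ?L. (\<lambda>n. blinfun_apply (g s) (v n s)) \<longlonglongrightarrow> blinfun_apply (g s) (w s)"
        using conv by (intro AE_I2) (auto simp: weak_conv_def)
      show "AE s in ?L. norm (blinfun_apply (g s) (v n s)) \<le> norm (g s) * B" for n
        by (intro AE_I2 order_trans[OF norm_blinfun mult_left_mono]) (use B(1) in auto)
    qed (use gi in \<open>auto intro!: strongly_measurable_apply[OF sm] W(3) W'(3)\<close>)
  qed
  have der: "weak_star_Linf a b (\<lambda>n s. vector_derivative (v n) (at s)) (\<lambda>s. vector_derivative w (at s))"
    unfolding weak_star_Linf_def
  proof (intro conjI allI impI)
    show "in_Linf a b (\<lambda>s. vector_derivative (v n) (at s))" for n using W(1)[of n] by (simp add: in_W1inf_def)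
    show "in_Linf a b (\<lambda>s. vector_derivative w (at s))" using W'(1) by (simp add: in_W1inf_def)
    fix g :: "real \<Rightarrow> 'b dual" assume g: "in_L1 a b g"
    then have sm: "strongly_measurable ?L g" by (simp add: in_L1_def)
    have scalar: "set_integrable lebesgue {a..b} (\<lambda>s. blinfun_apply y (vector_derivative f (at s)))"
      "\<And>x. a \<le> x \<Longrightarrow> x \<le> b \<Longrightarrow> (LINT s:{a..x}|lebesgue. blinfun_apply y (vector_derivative f (at s))) = blinfun_apply y (f x) - blinfun_apply y (f a)"
      if f: "C-lipschitz_on {a..b} f" for f and y :: "'b dual"
    proof -
      note F = ac_real_FTC[OF ac_on_blinfun[OF meas(2)[OF f], of y] ab]
      have eq: "AE s in ?L. deriv (\<lambda>s. blinfun_apply y (f s)) s = blinfun_apply y (vector_derivative f (at s))"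
        using meas(3)[OF f] by eventually_elim (intro DERIV_imp_deriv has_vector_derivative_blinfun)
      have bm: "(\<lambda>s. blinfun_apply y (vector_derivative f (at s))) \<in> borel_measurable ?L"
        using F(2) by (intro measurable_AE_lebesgue_on[OF _ eq]) (auto simp: set_integrable_lebesgue_on)
      show i: "set_integrable lebesgue {a..b} (\<lambda>s. blinfun_apply y (vector_derivative f (at s)))"
        using F(2) unfolding set_integrable_lebesgue_on by (rule integrable_cong_AE_imp) (rule bm eq)+
      fix x assume x: "a \<le> x" "x \<le> b"
      have "(LINT s:{a..x}|lebesgue. blinfun_apply y (vector_derivative f (at s))) = (LINT s:{a..x}|lebesgue. deriv (\<lambda>s. blinfun_apply y (f s)) s)"
        using eq x by (intro antisym set_integral_mono_AE[OF i F(2)] set_integral_mono_AE[OF F(2) i]) (auto elim: eventually_mono)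
      then show "(LINT s:{a..x}|lebesgue. blinfun_apply y (vector_derivative f (at s))) = blinfun_apply y (f x) - blinfun_apply y (f a)"
        using F(3)[of a x] x by simp
    qed
    \<comment> \<open>Simple functions have Lebesgue measurable level sets, while the induction runs
      over Borel sets; the two differ by a null set.\<close>
    have set: "(\<lambda>n. LINT s|?L. indicator A s * blinfun_apply y (vector_derivative (v n) (at s))) \<longlonglongrightarrow> (LINT s|?L. indicator A s * blinfun_apply y (vector_derivative w (at s)))"
      if A: "A \<in> sets lebesgue" for A and y :: "'b dual"
    proof -
      obtain A' where A': "A' \<in> sets borel" and ae: "AE s in ?L. s \<in> A \<longleftrightarrow> s \<in> A'"
        using A by (rule lebesgue_set_borel_ae)
      have eq: "(LINT s|?L. indicator A s * h s) = (LINT s|?L. indicator A' s * h s)" if "h \<in> borel_measurable ?L" for h :: "real \<Rightarrow> real"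
      proof (rule integral_cong_AE)
        have "A \<inter> {a..b} \<in> sets ?L" "A' \<inter> {a..b} \<in> sets ?L" using A A' by (subst sets_restrict_space_iff; auto)+
        then have "(\<lambda>s. indicator (A \<inter> {a..b}) s * h s) \<in> borel_measurable ?L" "(\<lambda>s. indicator (A' \<inter> {a..b}) s * h s) \<in> borel_measurable ?L"
          using that by measurable
        moreover have "AE s in ?L. indicator (A \<inter> {a..b}) s * h s = indicator A s * h s" "AE s in ?L. indicator (A' \<inter> {a..b}) s * h s = indicator A' s * h s"
          by (auto intro!: AE_I2 simp: indicator_def)
        ultimately show "(\<lambda>s. indicator A s * h s) \<in> borel_measurable ?L" "(\<lambda>s. indicator A' s * h s) \<in> borel_measurable ?L"
          by (auto intro: measurable_AE_lebesgue_on)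
        show "AE s in ?L. indicator A s * h s = indicator A' s * h s"
          using ae by eventually_elim (auto simp: indicator_def)
      qed
      have ym: "(\<lambda>s. blinfun_apply y (vector_derivative f (at s))) \<in> borel_measurable ?L" if "C-lipschitz_on {a..b} f" for f
        using scalar(1)[OF that] by (auto simp: set_integrable_lebesgue_on)
      show ?thesis unfolding eq[OF ym[OF lip]] eq[OF ym[OF lip']]
      proof (rule integral_restrict_borel_set_tendsto[OF A' ab scalar(1)[OF lip] scalar(1)[OF lip']])
        show "AE s in ?L. \<bar>blinfun_apply y (vector_derivative (v n) (at s))\<bar> \<le> norm y * C" for n
          using W(2)[of n] by eventually_elim (metis norm_blinfun real_norm_def mult_left_mono norm_ge_zero order_trans)
        fix x assume x: "a \<le> x" "x \<le> b"
        have "(\<lambda>n. blinfun_apply y (v n x) - blinfun_apply y (v n a)) \<longlonglongrightarrow> blinfun_apply y (w x) - blinfun_apply y (w a)"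
          using conv[of x] conv[of a] x by (intro tendsto_diff) (auto simp: weak_conv_def)
        then show "(\<lambda>n. LINT s:{a..x}|lebesgue. blinfun_apply y (vector_derivative (v n) (at s))) \<longlonglongrightarrow> (LINT s:{a..x}|lebesgue. blinfun_apply y (vector_derivative w (at s)))"
          using scalar(2)[OF lip x] scalar(2)[OF lip' x] by simp
      qed
    qed
    have simple: "(\<lambda>n. LINT s|?L. blinfun_apply (\<psi> s) (vector_derivative (v n) (at s))) \<longlonglongrightarrow> (LINT s|?L. blinfun_apply (\<psi> s) (vector_derivative w (at s)))"
      if \<psi>: "simple_function ?L \<psi>" for \<psi> :: "real \<Rightarrow> 'b dual"
    proof -
      have S: "\<psi> -` {y} \<inter> {a..b} \<in> sets ?L" for y using simple_functionD(2)[OF \<psi>, of "{y}"] by simp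
      then have S': "\<psi> -` {y} \<inter> {a..b} \<in> sets lebesgue" for y using S[of y] by (subst (asm) sets_restrict_space_iff) auto
      have eq: "(LINT s|?L. blinfun_apply (\<psi> s) (vector_derivative f (at s))) =
          (\<Sum>y\<in>\<psi> ` {a..b}. (LINT s|?L. indicator (\<psi> -` {y} \<inter> {a..b}) s * blinfun_apply y (vector_derivative f (at s))))"
        if f: "C-lipschitz_on {a..b} f" for f
      proof -
        have "(LINT s|?L. blinfun_apply (\<psi> s) (vector_derivative f (at s))) =
          (LINT s|?L. (\<Sum>y\<in>\<psi> ` {a..b}. indicator (\<psi> -` {y} \<inter> {a..b}) s * blinfun_apply y (vector_derivative f (at s))))"
          using simple_blinfun_apply[OF \<psi>] by (intro Bochner_Integration.integral_cong) auto
        also have "\<dots> = (\<Sum>y\<in>\<psi> ` {a..b}. (LINT s|?L. indicator (\<psi> -` {y} \<inter> {a..b}) s * blinfun_apply y (vector_derivative f (at s))))"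
        proof (rule Bochner_Integration.integral_sum)
          fix y
          show "integrable ?L (\<lambda>s. indicator (\<psi> -` {y} \<inter> {a..b}) s * blinfun_apply y (vector_derivative f (at s)))"
            using integrable_mult_indicator[OF S[of y] scalar(1)[OF f, of y, unfolded set_integrable_lebesgue_on]] by simp
        qed
        finally show ?thesis .
      qed
      show ?thesis unfolding eq[OF lip] eq[OF lip'] by (intro tendsto_sum set S')
    qed
    show "(\<lambda>n. LINT s|?L. blinfun_apply (g s) (vector_derivative (v n) (at s))) \<longlonglongrightarrow> (LINT s|?L. blinfun_apply (g s) (vector_derivative w (at s)))"
    proof (rule LIMSEQ_I)
      fix e :: real assume e: "0 < e"
      \<comment> \<open>Replacing g by the simple function costs at most this distance times C,
        hence less than e/3; C + 1 makes the last inequality strict.\<close>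
      have "0 < e / (3 * (C + 1))" using e C0 by simp
      from in_L1_simple_approx[OF g this]
      obtain \<psi> where \<psi>: "simple_function ?L \<psi>" and \<psi>i: "integrable ?L (\<lambda>s. norm (g s - \<psi> s))"
        and \<psi>e: "(LINT s|?L. norm (g s - \<psi> s)) < e / (3 * (C + 1))" by blast
      have app: "\<bar>(LINT s|?L. blinfun_apply (g s) (vector_derivative f (at s))) - (LINT s|?L. blinfun_apply (\<psi> s) (vector_derivative f (at s)))\<bar> < e/3"
        if f: "C-lipschitz_on {a..b} f" for f
      proof -
        have le: "AE s in ?L. norm (blinfun_apply (g s - \<psi> s) (vector_derivative f (at s))) \<le> norm (g s - \<psi> s) * C"
          using lipschitz_in_W1inf(2)[OF refl f ab]
          by eventually_elim (meson norm_blinfun mult_left_mono norm_ge_zero order_trans)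
        have m1: "(\<lambda>s. blinfun_apply (g s) (vector_derivative f (at s))) \<in> borel_measurable ?L"
          by (rule strongly_measurable_apply[OF sm meas(1)[OF f]])
        have m2: "(\<lambda>s. blinfun_apply (\<psi> s) (vector_derivative f (at s))) \<in> borel_measurable ?L"
          by (rule simple_blinfun_measurable[OF \<psi> meas(1)[OF f]])
        have i1: "integrable ?L (\<lambda>s. blinfun_apply (g s - \<psi> s) (vector_derivative f (at s)))"
        proof (rule Bochner_Integration.integrable_bound)
          show "integrable ?L (\<lambda>s. norm (g s - \<psi> s) * C)" using \<psi>i by simp
          show "(\<lambda>s. blinfun_apply (g s - \<psi> s) (vector_derivative f (at s))) \<in> borel_measurable ?L"
            unfolding blinfun.diff_left using m1 m2 by measurable
          show "AE s in ?L. norm (blinfun_apply (g s - \<psi> s) (vector_derivative f (at s))) \<le> norm (norm (g s - \<psi> s) * C)"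
            using le by eventually_elim (use C0 in simp)
        qed
        have i2: "integrable ?L (\<lambda>s. blinfun_apply (\<psi> s) (vector_derivative f (at s)))"
        proof (rule Bochner_Integration.integrable_cong[THEN iffD2, OF HOL.refl simple_blinfun_apply[OF \<psi>]])
          show "integrable ?L (\<lambda>s. \<Sum>y\<in>\<psi> ` space ?L. indicator (\<psi> -` {y} \<inter> space ?L) s * blinfun_apply y (vector_derivative f (at s)))"
          proof (rule Bochner_Integration.integrable_sum)
            fix y
            show "integrable ?L (\<lambda>s. indicator (\<psi> -` {y} \<inter> space ?L) s * blinfun_apply y (vector_derivative f (at s)))"
              using integrable_mult_indicator[OF simple_functionD(2)[OF \<psi>, of "{y}"] scalar(1)[OF f, of y, unfolded set_integrable_lebesgue_on]] by simp
          qed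
        qed
        have "(LINT s|?L. blinfun_apply (g s) (vector_derivative f (at s))) = (LINT s|?L. blinfun_apply (g s - \<psi> s) (vector_derivative f (at s)) + blinfun_apply (\<psi> s) (vector_derivative f (at s)))"
          by (simp add: blinfun.diff_left)
        also have "\<dots> = (LINT s|?L. blinfun_apply (g s - \<psi> s) (vector_derivative f (at s))) + (LINT s|?L. blinfun_apply (\<psi> s) (vector_derivative f (at s)))"
          by (rule Bochner_Integration.integral_add[OF i1 i2])
        finally have "\<bar>(LINT s|?L. blinfun_apply (g s) (vector_derivative f (at s))) - (LINT s|?L. blinfun_apply (\<psi> s) (vector_derivative f (at s)))\<bar>
          = norm (LINT s|?L. blinfun_apply (g s - \<psi> s) (vector_derivative f (at s)))" by simp
        also have "\<dots> \<le> (LINT s|?L. norm (g s - \<psi> s) * C)"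
        proof (rule order_trans[OF integral_norm_bound])
          show "(LINT s|?L. norm (blinfun_apply (g s - \<psi> s) (vector_derivative f (at s)))) \<le> (LINT s|?L. norm (g s - \<psi> s) * C)"
            using i1 \<psi>i le by (intro integral_mono_AE) auto
        qed
        also have "\<dots> = (LINT s|?L. norm (g s - \<psi> s)) * C" by simp
        also have "\<dots> \<le> (e / (3 * (C + 1))) * C" using \<psi>e C0 by (intro mult_right_mono) auto
        also have "\<dots> < (e / (3 * (C + 1))) * (C + 1)" using e C0 by (intro mult_strict_left_mono) auto
        also have "\<dots> = e / 3" using C0 by (simp add: field_simps)
        finally show ?thesis .
      qed
      obtain N where N: "\<And>n. n \<ge> N \<Longrightarrow> norm ((LINT s|?L. blinfun_apply (\<psi> s) (vector_derivative (v n) (at s))) - (LINT s|?L. blinfun_apply (\<psi> s) (vector_derivative w (at s)))) < e/3"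
        using LIMSEQ_D[OF simple[OF \<psi>], of "e/3"] e by auto
      show "\<exists>N. \<forall>n\<ge>N. norm ((LINT s|?L. blinfun_apply (g s) (vector_derivative (v n) (at s))) - (LINT s|?L. blinfun_apply (g s) (vector_derivative w (at s)))) < e"
      proof (intro exI[of _ N] allI impI)
        fix n assume "N \<le> n"
        then show "norm ((LINT s|?L. blinfun_apply (g s) (vector_derivative (v n) (at s))) - (LINT s|?L. blinfun_apply (g s) (vector_derivative w (at s)))) < e"
          using N[of n] app[OF lip[of n]] app[OF lip'] unfolding real_norm_def by linarith
      qed
    qed
  qed
  show ?thesis unfolding weak_star_W1inf_def using W(1) W'(1) val der by blast
qed

section \<open>Dissipation potentials\<close>

lemma dissipation_closed_sublevel:
  assumes "dissipation_potential \<psi>"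
  shows "closed {v. \<psi> v \<le> c}"
proof -
  have lsc: "\<psi> v \<le> Liminf (at v) \<psi>" for v using assms by (simp add: dissipation_potential_def)
  have "open (- {v. \<psi> v \<le> c})"
    unfolding open_contains_ball
  proof
    fix v assume "v \<in> - {v. \<psi> v \<le> c}"
    then have c: "c < \<psi> v" by auto
    then have "\<forall>\<^sub>F w in at v. c < \<psi> w" using lsc[of v] by (simp add: le_Liminf_iff)
    then obtain e where e: "0 < e" "\<And>w. w \<noteq> v \<Longrightarrow> dist w v < e \<Longrightarrow> c < \<psi> w"
      unfolding eventually_at by auto
    then have "ball v e \<subseteq> - {v. \<psi> v \<le> c}" using c by (force simp: dist_commute)
    then show "\<exists>e>0. ball v e \<subseteq> - {v. \<psi> v \<le> c}" using e(1) by blast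
  qed
  then show ?thesis by (simp add: closed_def)
qed

lemma dissipation_borel:
  assumes "dissipation_potential \<psi>"
  shows "\<psi> \<in> borel_measurable borel"
  unfolding borel_measurable_iff_Iic_ereal
proof
  fix c :: ereal
  have "\<psi> -` {..c} \<inter> space borel = {v. \<psi> v \<le> c}" by auto
  then show "\<psi> -` {..c} \<inter> space borel \<in> sets borel"
    using dissipation_closed_sublevel[OF assms, of c] by simp
qed

lemma viscous_real:
  assumes V: "viscous_potential V"
  defines "f \<equiv> \<lambda>v. real_of_ereal (V v)"
  shows "\<And>v. V v = ereal (f v)" "\<And>v. 0 \<le> f v" "f 0 = 0" "convex_on UNIV f"
proof -
  have dp: "dissipation_potential V" and fin: "V v \<noteq> \<infinity>" for v using V by (auto simp: viscous_potential_def)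
  have nn: "0 \<le> V v" for v using dp by (simp add: dissipation_potential_def)
  show eq: "V v = ereal (f v)" for v using fin[of v] nn[of v] by (cases "V v") (auto simp: f_def)
  show "0 \<le> f v" for v using nn[of v] by (simp add: f_def real_of_ereal_pos)
  show "f 0 = 0" using dp by (simp add: f_def dissipation_potential_def)
  show "convex_on UNIV f"
  proof (rule convex_onI)
    fix t :: real and x y assume t: "0 < t" "t < 1"
    then have "V ((1 - t) *\<^sub>R x + t *\<^sub>R y) \<le> ereal (1 - t) * V x + ereal t * V y"
      using dp unfolding dissipation_potential_def by auto
    then show "f ((1 - t) *\<^sub>R x + t *\<^sub>R y) \<le> (1 - t) * f x + t * f y" unfolding eq by simp
  qed simp
qed

text \<open>Baire's theorem for the symmetrised closed sublevels \<open>S n\<close>, which cover the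
  space because V is finite. If \<open>S n\<close> contains a ball around x, then x + v and v - x
  both belong to the sublevel for small v, and v is their midpoint.\<close>

lemma viscous_bounded_near_0:
  fixes V :: "'a::banach \<Rightarrow> ereal"
  assumes V: "viscous_potential V"
  obtains r n where "0 < r" "\<And>v. norm v < r \<Longrightarrow> real_of_ereal (V v) \<le> n"
proof -
  define f where "f v = real_of_ereal (V v)" for v
  have dp: "dissipation_potential V" using V by (simp add: viscous_potential_def)
  note R = viscous_real[OF V, folded f_def]
  define A where "A n = {v. f v \<le> real n}" for n
  define S where "S n = A n \<inter> uminus ` A n" for n
  have "closed (A n)" for n
    using dissipation_closed_sublevel[OF dp, of "ereal (real n)"] by (simp add: A_def R(1))
  then have cl: "closed (S n)" for n unfolding S_def by (intro closed_Int closed_negations)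
  have "(\<Union>n. S n) = UNIV"
  proof (intro set_eqI iffI UNIV_I)
    fix v :: 'a
    obtain n :: nat where "max (f v) (f (- v)) \<le> real n" using real_arch_simple by blast
    then have "v \<in> S n" by (auto simp: S_def A_def intro!: image_eqI[of _ _ "- v"])
    then show "v \<in> (\<Union>n. S n)" by blast
  qed
  have "\<exists>n. interior (S n) \<noteq> {}"
  proof (rule ccontr)
    assume *: "\<nexists>n. interior (S n) \<noteq> {}"
    have "Met_TC.mtopology interior_of \<Union> (range S) = ({} :: 'a set)"
    proof (rule Met_TC.metric_Baire_category_alt)
      show "Met_TC.mcomplete TYPE('a)"
        unfolding Met_TC.mcomplete_def by (auto simp: Cauchy_convergent_iff convergent_def)
    qed (use * cl in \<open>auto simp: euclidean_interior_of\<close>)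
    then show False using \<open>(\<Union>n. S n) = UNIV\<close> by (simp add: euclidean_interior_of)
  qed
  then obtain n x where "x \<in> interior (S n)" by blast
  then obtain r where r: "0 < r" "ball x r \<subseteq> S n" by (meson interior_subset open_contains_ball open_interior subset_trans)
  have "f v \<le> real n" if v: "norm v < r" for v
  proof -
    have "x + v \<in> ball x r" "x - v \<in> ball x r" using v by (auto simp: dist_norm)
    then have S: "x + v \<in> A n" "x - v \<in> uminus ` A n" using r(2) by (auto simp: S_def)
    obtain y where "y \<in> A n" "x - v = - y" using S(2) by blast
    then have "f (x + v) \<le> real n" "f (- (x - v)) \<le> real n" using S(1) by (auto simp: A_def)
    moreover have "f ((1 - 1/2) *\<^sub>R (x + v) + (1/2) *\<^sub>R (- (x - v))) \<le> (1 - 1/2) * f (x + v) + (1/2) * f (- (x - v))"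
      using R(4) by (intro convex_onD) auto
    moreover have "(1 - 1/2) *\<^sub>R (x + v) + (1/2) *\<^sub>R (- (x - v)) = v"
      by (simp add: algebra_simps flip: scaleR_left.add)
    ultimately show ?thesis by simp
  qed
  then show thesis using that[OF r(1), of "real n"] by (simp add: f_def)
qed

section \<open>Conjugates and supporting functionals\<close>

lemma conjugate_nonneg: "dissipation_potential \<psi> \<Longrightarrow> 0 \<le> conjugate \<psi> \<xi>"
  unfolding conjugate_def
  by (rule SUP_upper2[of 0]) (auto simp: dissipation_potential_def blinfun.zero_right)

lemma conjugate_zero: "dissipation_potential \<psi> \<Longrightarrow> conjugate \<psi> 0 = 0"
proof (rule antisym[OF _ conjugate_nonneg])
  assume \<psi>: "dissipation_potential \<psi>"
  show "conjugate \<psi> 0 \<le> 0"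
    unfolding conjugate_def
  proof (rule SUP_least)
    fix v
    have "0 \<le> \<psi> v" using \<psi> by (simp add: dissipation_potential_def)
    then show "ereal (blinfun_apply 0 v) - \<psi> v \<le> 0" by (cases "\<psi> v") auto
  qed
qed

lemma conjugate_leI:
  assumes "\<And>v. V v = ereal (f v)" "\<And>v. blinfun_apply \<xi> v \<le> f v + c"
  shows "conjugate V \<xi> \<le> ereal c"
  unfolding conjugate_def by (rule SUP_least) (use assms in \<open>auto simp: algebra_simps\<close>)

lemma conjugate_ge: "ereal (blinfun_apply \<xi> v) - V v \<le> conjugate V \<xi>"
  unfolding conjugate_def by (rule SUP_upper) simp

text \<open>Superlinear growth lets V exceed the linear functional outside the ball of radius max b
  1; inside, the functional is at most its norm times that radius.\<close>

lemma conjugate_finite: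
  assumes V: "viscous_potential V"
  obtains c where "conjugate V \<xi> = ereal c" "0 \<le> c"
proof -
  have dp: "dissipation_potential V" and sl: "((\<lambda>v. V v / ereal (norm v)) \<longlongrightarrow> \<infinity>) at_infinity"
    using V by (auto simp: viscous_potential_def superlinear_def)
  note R = viscous_real[OF V]
  have "\<forall>\<^sub>F v in at_infinity. ereal (norm \<xi>) < V v / ereal (norm v)"
    using order_tendstoD(1)[OF sl, of "ereal (norm \<xi>)"] by simp
  then obtain b where b: "\<And>v. b \<le> norm v \<Longrightarrow> ereal (norm \<xi>) < V v / ereal (norm v)"
    unfolding eventually_at_infinity by blast
  have "conjugate V \<xi> \<le> ereal (norm \<xi> * max b 1)"
  proof (rule conjugate_leI[OF R(1)])
    fix v
    have app: "blinfun_apply \<xi> v \<le> norm \<xi> * norm v" by (rule blinfun_le_norm)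
    show "blinfun_apply \<xi> v \<le> real_of_ereal (V v) + norm \<xi> * max b 1"
    proof (cases "max b 1 \<le> norm v")
      case True
      then have "ereal (norm \<xi>) < ereal (real_of_ereal (V v)) / ereal (norm v)" using b[of v] R(1)[of v] by simp
      moreover have "v \<noteq> 0" "0 < norm v" using True by auto
      ultimately have "norm \<xi> * norm v < real_of_ereal (V v)" by (simp add: less_divide_eq)
      moreover have "0 \<le> norm \<xi> * max b 1" by simp
      ultimately show ?thesis using app by linarith
    next
      case False
      then have "norm \<xi> * norm v \<le> norm \<xi> * max b 1" by (intro mult_left_mono) auto
      then show ?thesis using app R(2)[of v] by linarith
    qed
  qed
  then show thesis using conjugate_nonneg[OF dp, of \<xi>] that by (cases "conjugate V \<xi>") auto
qed

text \<open>Comes from l V <= V. With l < 1 it moves the conjugate strictly below a positive limit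
  level, which is the gap that lower semicontinuity of the slopes can bridge.\<close>

lemma conjugate_scale:
  assumes V: "viscous_potential V" and l: "0 \<le> l" "l \<le> 1" and c: "conjugate V \<xi> \<le> ereal c"
  shows "conjugate V (l *\<^sub>R \<xi>) \<le> ereal (l * c)"
proof (rule conjugate_leI[OF viscous_real(1)[OF V]])
  fix v
  have "ereal (blinfun_apply \<xi> v) - ereal (real_of_ereal (V v)) \<le> ereal c"
    using order_trans[OF conjugate_ge c, of v] viscous_real(1)[OF V, of v] by simp
  then have "l * blinfun_apply \<xi> v \<le> l * (real_of_ereal (V v) + c)"
    using l by (intro mult_left_mono) auto
  also have "\<dots> \<le> real_of_ereal (V v) + l * c"
    using l viscous_real(2)[OF V, of v] by (simp add: distrib_left mult_left_le_one_le)
  finally show "blinfun_apply (l *\<^sub>R \<xi>) v \<le> real_of_ereal (V v) + l * c" by (simp add: blinfun.scaleR_left)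
qed

text \<open>The Fenchel-Young inequality at v/\<tau>, multiplied by \<tau>. Later \<tau> is the
  weight t'/eps^alpha or t'/eps.\<close>

lemma fenchel_young:
  assumes V: "viscous_potential V" and \<tau>: "0 < \<tau>" and c: "conjugate V \<xi> \<le> ereal c"
  shows "blinfun_apply \<xi> v \<le> \<tau> * real_of_ereal (V ((1 / \<tau>) *\<^sub>R v)) + \<tau> * c"
proof -
  have "ereal (blinfun_apply \<xi> ((1 / \<tau>) *\<^sub>R v)) - ereal (real_of_ereal (V ((1 / \<tau>) *\<^sub>R v))) \<le> ereal c"
    using order_trans[OF conjugate_ge c, of "(1 / \<tau>) *\<^sub>R v"] viscous_real(1)[OF V, of "(1 / \<tau>) *\<^sub>R v"] by simp
  then have "blinfun_apply \<xi> v / \<tau> \<le> real_of_ereal (V ((1 / \<tau>) *\<^sub>R v)) + c"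
    by (simp add: blinfun.scaleR_right)
  then show ?thesis using \<tau> by (simp add: divide_le_eq distrib_left mult.commute)
qed

text \<open>The infimum over \<open>\<tau>\<close> is sublinear in \<open>v\<close>, so the Hahn-Banach theorem represents it by a
  functional; testing with \<open>\<tau> = 1\<close> bounds the conjugate of that functional.\<close>

lemma perspective_functional:
  fixes f :: "'a::real_normed_vector \<Rightarrow> real"
  assumes conv: "convex_on UNIV f" and f0: "f 0 = 0" and nn: "\<And>v. 0 \<le> f v"
    and r: "0 < r" "\<And>v. norm v < r \<Longrightarrow> f v \<le> n" and \<sigma>: "0 \<le> \<sigma>"
  obtains \<xi> :: "'a dual" where "\<And>w. blinfun_apply \<xi> w \<le> f w + \<sigma>"
    "(INF \<tau>\<in>{0<..}. ereal (\<tau> * f (v /\<^sub>R \<tau>) + \<tau> * \<sigma>)) \<le> ereal (blinfun_apply \<xi> v)"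
proof -
  define p where "p v = (INF \<tau>\<in>{0<..}. \<tau> * f (v /\<^sub>R \<tau>) + \<tau> * \<sigma>)" for v
  have bdd: "bdd_below ((\<lambda>\<tau>. \<tau> * f (v /\<^sub>R \<tau>) + \<tau> * \<sigma>) ` {0<..})" for v
    by (rule bdd_belowI2[of _ 0]) (use nn \<sigma> in auto)
  have upper: "p v \<le> \<tau> * f (v /\<^sub>R \<tau>) + \<tau> * \<sigma>" if "0 < \<tau>" for v \<tau>
    unfolding p_def by (rule cINF_lower[OF bdd]) (use that in auto)
  have greatest: "c \<le> p v" if "\<And>\<tau>. 0 < \<tau> \<Longrightarrow> c \<le> \<tau> * f (v /\<^sub>R \<tau>) + \<tau> * \<sigma>" for c v
    unfolding p_def by (rule cINF_greatest) (use that in auto)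
  have p: "sublinear p"
  proof (rule sublinearI)
    fix v w
    have "p (v + w) - (\<tau> * f (v /\<^sub>R \<tau>) + \<tau> * \<sigma>) \<le> p w" if \<tau>: "0 < \<tau>" for \<tau>
    proof (rule greatest)
      fix \<rho> :: real assume \<rho>: "0 < \<rho>"
      \<comment> \<open>(v + w)/(\<tau> + \<rho>) is the convex combination of v/\<tau> and w/\<rho>
        with these weights, as in the convexity of a perspective function.\<close>
      define l where "l = \<rho> / (\<tau> + \<rho>)"
      have l: "0 \<le> l" "l \<le> 1" "(\<tau> + \<rho>) * (1 - l) = \<tau>" "(\<tau> + \<rho>) * l = \<rho>"
        using \<tau> \<rho> by (auto simp: l_def field_simps)
      have "(v + w) /\<^sub>R (\<tau> + \<rho>) = (1 - l) *\<^sub>R (v /\<^sub>R \<tau>) + l *\<^sub>R (w /\<^sub>R \<rho>)"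
        using \<tau> \<rho> by (simp add: l_def field_simps scaleR_add_right)
      then have "f ((v + w) /\<^sub>R (\<tau> + \<rho>)) \<le> (1 - l) * f (v /\<^sub>R \<tau>) + l * f (w /\<^sub>R \<rho>)"
        by (simp only:) (rule convex_onD[OF conv l(1,2) UNIV_I UNIV_I])
      then have "(\<tau> + \<rho>) * f ((v + w) /\<^sub>R (\<tau> + \<rho>)) \<le> (\<tau> + \<rho>) * ((1 - l) * f (v /\<^sub>R \<tau>) + l * f (w /\<^sub>R \<rho>))"
        using \<tau> \<rho> by (intro mult_left_mono) auto
      also have "\<dots> = ((\<tau> + \<rho>) * (1 - l)) * f (v /\<^sub>R \<tau>) + ((\<tau> + \<rho>) * l) * f (w /\<^sub>R \<rho>)" by (simp only: distrib_left mult.assoc)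
      also have "\<dots> = \<tau> * f (v /\<^sub>R \<tau>) + \<rho> * f (w /\<^sub>R \<rho>)" by (simp only: l)
      finally show "p (v + w) - (\<tau> * f (v /\<^sub>R \<tau>) + \<tau> * \<sigma>) \<le> \<rho> * f (w /\<^sub>R \<rho>) + \<rho> * \<sigma>"
        using upper[of "\<tau> + \<rho>" "v + w"] \<tau> \<rho> by (simp add: distrib_right)
    qed
    then have "p (v + w) - p w \<le> p v" by (intro greatest) (simp add: algebra_simps)
    then show "p (v + w) \<le> p v + p w" by simp
  next
    have "p 0 \<le> e" if "0 < e" for e
    proof -
      have "p 0 \<le> (e / (\<sigma> + 1)) * \<sigma>" using upper[of "e / (\<sigma> + 1)" 0] that \<sigma> by (simp add: f0)
      also have "\<dots> \<le> e" using that \<sigma> by (simp add: field_simps)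
      finally show ?thesis .
    qed
    then have "p 0 \<le> 0" by (rule field_le_epsilon[of _ 0, simplified])
    moreover have "0 \<le> p 0" using nn \<sigma> by (intro greatest) simp
    ultimately show "p 0 = 0" by simp
  next
    fix c :: real and v assume c: "0 < c"
    have "p (c *\<^sub>R v) / c \<le> p v"
    proof (rule greatest)
      fix \<tau> :: real assume \<tau>: "0 < \<tau>"
      have "p (c *\<^sub>R v) \<le> (c * \<tau>) * f ((c *\<^sub>R v) /\<^sub>R (c * \<tau>)) + (c * \<tau>) * \<sigma>" using c \<tau> by (intro upper) simp
      also have "(c *\<^sub>R v) /\<^sub>R (c * \<tau>) = v /\<^sub>R \<tau>" using c by simp
      finally show "p (c *\<^sub>R v) / c \<le> \<tau> * f (v /\<^sub>R \<tau>) + \<tau> * \<sigma>" using c by (simp add: field_simps)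
    qed
    then show "p (c *\<^sub>R v) \<le> c * p v" using c by (simp add: field_simps)
  qed
  have "p v \<le> (2 * (\<bar>n\<bar> + \<sigma>) / r) * norm v" for v
  proof (cases "v = 0")
    case True
    then show ?thesis using sublinear_0[OF p] by simp
  next
    case False
    \<comment> \<open>Puts v/\<tau> on the sphere of radius r/2, where f is bounded; the resulting
      linear bound makes the functional continuous.\<close>
    define \<tau> where "\<tau> = 2 * norm v / r"
    have \<tau>: "0 < \<tau>" using False r(1) by (simp add: \<tau>_def)
    have "norm (v /\<^sub>R \<tau>) < r" using False r(1) by (simp add: \<tau>_def)
    then have "f (v /\<^sub>R \<tau>) \<le> \<bar>n\<bar>" using r(2) by (meson abs_ge_self order_trans)
    then have "\<tau> * f (v /\<^sub>R \<tau>) \<le> \<tau> * \<bar>n\<bar>" using \<tau> by simp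
    then have "p v \<le> \<tau> * \<bar>n\<bar> + \<tau> * \<sigma>" using upper[OF \<tau>, of v] by linarith
    also have "\<dots> = \<tau> * (\<bar>n\<bar> + \<sigma>)" by (simp add: distrib_left)
    also have "\<dots> = (2 * (\<bar>n\<bar> + \<sigma>) / r) * norm v" by (simp add: \<tau>_def)
    finally show ?thesis .
  qed
  then obtain \<xi> :: "'a dual" where \<xi>: "\<And>w. blinfun_apply \<xi> w \<le> p w" "blinfun_apply \<xi> v = p v"
    by (rule Hahn_Banach_blinfun[OF p]) (rule that)
  show thesis
  proof (rule that[of \<xi>])
    show "blinfun_apply \<xi> w \<le> f w + \<sigma>" for w using \<xi>(1)[of w] upper[of 1 w] by simp
    have "ereal (p v) = (INF \<tau>\<in>{0<..}. ereal (\<tau> * f (v /\<^sub>R \<tau>) + \<tau> * \<sigma>))"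
      unfolding p_def using ereal_Inf'[OF bdd[of v]] by (simp add: image_comp comp_def)
    then show "(INF \<tau>\<in>{0<..}. ereal (\<tau> * f (v /\<^sub>R \<tau>) + \<tau> * \<sigma>)) \<le> ereal (blinfun_apply \<xi> v)"
      using \<xi>(2) by simp
  qed
qed

lemma bfun_functional:
  fixes V :: "'a::banach \<Rightarrow> ereal"
  assumes V: "viscous_potential V" and \<sigma>: "0 \<le> \<sigma>"
  obtains \<xi> where "conjugate V \<xi> \<le> ereal \<sigma>" "bfun V v (ereal \<sigma>) \<le> ereal (blinfun_apply \<xi> v)"
proof -
  note R = viscous_real[OF V]
  obtain r n where rn: "0 < r" "\<And>v. norm v < r \<Longrightarrow> real_of_ereal (V v) \<le> n"
    by (rule viscous_bounded_near_0[OF V]) (rule that)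
  obtain \<xi> :: "'a dual" where \<xi>: "\<And>w. blinfun_apply \<xi> w \<le> real_of_ereal (V w) + \<sigma>"
    "(INF \<tau>\<in>{0<..}. ereal (\<tau> * real_of_ereal (V (v /\<^sub>R \<tau>)) + \<tau> * \<sigma>)) \<le> ereal (blinfun_apply \<xi> v)"
    by (rule perspective_functional[OF R(4,3,2) rn(1) _ \<sigma>, where v = v]) (erule rn(2), rule that)
  have "conjugate V \<xi> \<le> ereal \<sigma>" by (rule conjugate_leI[OF R(1) \<xi>(1)])
  moreover have "bfun V v (ereal \<sigma>) = (INF \<tau>\<in>{0<..}. ereal (\<tau> * real_of_ereal (V (v /\<^sub>R \<tau>)) + \<tau> * \<sigma>))"
    unfolding bfun_def by (intro INF_cong refl) (subst R(1), simp)
  ultimately show thesis using \<xi>(2) that by simp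
qed

text \<open>The perspective construction for V + W on the product space. The functional splits into
  two, but only the sum of the two conjugates is controlled by \<sigma> + \<rho>; each one alone may
  exceed its own level.\<close>

lemma bfun_functional_pair:
  fixes V :: "'a::banach \<Rightarrow> ereal" and W :: "'b::banach \<Rightarrow> ereal"
  assumes V: "viscous_potential V" and W: "viscous_potential W" and \<sigma>: "0 \<le> \<sigma>" "0 \<le> \<rho>"
  obtains \<xi> \<eta> where "\<And>c d. conjugate V \<xi> = ereal c \<Longrightarrow> conjugate W \<eta> = ereal d \<Longrightarrow> c + d \<le> \<sigma> + \<rho>"
    "(INF \<tau>\<in>{0<..}. ereal \<tau> * (V (v /\<^sub>R \<tau>) + W (w /\<^sub>R \<tau>) + ereal \<sigma> + ereal \<rho>)) \<le> ereal (blinfun_apply \<xi> v + blinfun_apply \<eta> w)"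
proof -
  note RV = viscous_real[OF V] and RW = viscous_real[OF W]
  define f where "f x = real_of_ereal (V (fst x)) + real_of_ereal (W (snd x))" for x
  obtain r n where rn: "0 < r" "\<And>v. norm v < r \<Longrightarrow> real_of_ereal (V v) \<le> n"
    by (rule viscous_bounded_near_0[OF V]) (rule that)
  obtain r' n' where rn': "0 < r'" "\<And>v. norm v < r' \<Longrightarrow> real_of_ereal (W v) \<le> n'"
    by (rule viscous_bounded_near_0[OF W]) (rule that)
  have conv: "convex_on UNIV f"
  proof (rule convex_onI)
    fix t :: real and x y :: "'a \<times> 'b" assume t: "0 < t" "t < 1"
    have "real_of_ereal (V ((1 - t) *\<^sub>R fst x + t *\<^sub>R fst y)) \<le> (1 - t) * real_of_ereal (V (fst x)) + t * real_of_ereal (V (fst y))"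
      "real_of_ereal (W ((1 - t) *\<^sub>R snd x + t *\<^sub>R snd y)) \<le> (1 - t) * real_of_ereal (W (snd x)) + t * real_of_ereal (W (snd y))"
      using t by (auto intro!: convex_onD RV(4) RW(4))
    then show "f ((1 - t) *\<^sub>R x + t *\<^sub>R y) \<le> (1 - t) * f x + t * f y" by (simp add: f_def algebra_simps)
  qed simp
  have bd: "f x \<le> n + n'" if "norm x < min r r'" for x
  proof -
    obtain u v where x: "x = (u, v)" by (cases x)
    have "norm u < r" "norm v < r'"
      using that norm_fst_le[of u v] norm_snd_le[of v u] unfolding x by simp_all
    then show ?thesis using rn(2)[of u] rn'(2)[of v] by (simp add: f_def x)
  qed
  have f0: "f 0 = 0" "\<And>x. 0 \<le> f x" using RV(2,3) RW(2,3) by (auto simp: f_def)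
  have rr: "0 < min r r'" using rn(1) rn'(1) by simp
  have \<sigma>\<rho>: "0 \<le> \<sigma> + \<rho>" using \<sigma> by simp
  obtain \<Xi> :: "('a \<times> 'b) dual" where \<Xi>: "\<And>x. blinfun_apply \<Xi> x \<le> f x + (\<sigma> + \<rho>)"
    "(INF \<tau>\<in>{0<..}. ereal (\<tau> * f ((v, w) /\<^sub>R \<tau>) + \<tau> * (\<sigma> + \<rho>))) \<le> ereal (blinfun_apply \<Xi> (v, w))"
    by (rule perspective_functional[OF conv f0 rr _ \<sigma>\<rho>, where v = "(v, w)"]) (erule bd, rule that)
  obtain \<xi> :: "'a dual" and \<eta> :: "'b dual" where split: "\<And>x y. blinfun_apply \<Xi> (x, y) = blinfun_apply \<xi> x + blinfun_apply \<eta> y"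
    by (rule blinfun_pair_split[of \<Xi>]) (rule that)
  show thesis
  proof (rule that[of \<xi> \<eta>])
    fix c d assume c: "conjugate V \<xi> = ereal c" and d: "conjugate W \<eta> = ereal d"
    have *: "blinfun_apply \<xi> x + blinfun_apply \<eta> y \<le> real_of_ereal (V x) + real_of_ereal (W y) + (\<sigma> + \<rho>)" for x y
      using \<Xi>(1)[of "(x, y)"] by (simp add: split f_def)
    \<comment> \<open>The joint inequality is maximised over the second variable first and over the
      first one afterwards.\<close>
    have "d \<le> real_of_ereal (V x) - blinfun_apply \<xi> x + (\<sigma> + \<rho>)" for x
    proof -
      have "conjugate W \<eta> \<le> ereal (real_of_ereal (V x) - blinfun_apply \<xi> x + (\<sigma> + \<rho>))"
        by (rule conjugate_leI[OF RW(1)]) (use *[of x] in \<open>simp add: algebra_simps\<close>)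
      then show ?thesis using d by simp
    qed
    then have "conjugate V \<xi> \<le> ereal (\<sigma> + \<rho> - d)"
      by (intro conjugate_leI[OF RV(1)]) (simp add: algebra_simps)
    then show "c + d \<le> \<sigma> + \<rho>" using c by simp
  next
    have "(INF \<tau>\<in>{0<..}. ereal \<tau> * (V (v /\<^sub>R \<tau>) + W (w /\<^sub>R \<tau>) + ereal \<sigma> + ereal \<rho>)) = (INF \<tau>\<in>{0<..}. ereal (\<tau> * f ((v, w) /\<^sub>R \<tau>) + \<tau> * (\<sigma> + \<rho>)))"
      by (intro INF_cong refl) (subst RV(1), subst RW(1), simp add: f_def algebra_simps)
    then show "(INF \<tau>\<in>{0<..}. ereal \<tau> * (V (v /\<^sub>R \<tau>) + W (w /\<^sub>R \<tau>) + ereal \<sigma> + ereal \<rho>)) \<le> ereal (blinfun_apply \<xi> v + blinfun_apply \<eta> w)"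
      using \<Xi>(2) by (simp add: split)
  qed
qed

text \<open>At a subgradient \<xi> of a point of norm at most R the conjugate is at most R times the
  norm of \<xi>, which its superlinear growth excludes for large \<xi>.\<close>

lemma viscous_subdiff_bounded:
  assumes V: "viscous_potential V"
  obtains K where "\<And>v \<xi>. norm v \<le> R \<Longrightarrow> \<xi> \<in> convex_subdiff V v \<Longrightarrow> norm \<xi> \<le> K"
proof -
  have sl: "((\<lambda>\<xi>. conjugate V \<xi> / ereal (norm \<xi>)) \<longlongrightarrow> \<infinity>) at_infinity"
    using V by (auto simp: viscous_potential_def superlinear_def)
  have "\<forall>\<^sub>F \<xi> in at_infinity. ereal R < conjugate V \<xi> / ereal (norm \<xi>)"
    using order_tendstoD(1)[OF sl, of "ereal R"] by simp
  then obtain b where b: "\<And>\<xi>. b \<le> norm \<xi> \<Longrightarrow> ereal R < conjugate V \<xi> / ereal (norm \<xi>)"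
    unfolding eventually_at_infinity by blast
  show thesis
  proof (rule that[of "max b 1"])
    fix v \<xi> assume v: "norm v \<le> R" and \<xi>: "\<xi> \<in> convex_subdiff V v"
    show "norm \<xi> \<le> max b 1"
    proof (rule ccontr)
      assume n: "\<not> norm \<xi> \<le> max b 1"
      have "conjugate V \<xi> \<le> ereal (norm \<xi> * R)"
      proof (rule conjugate_leI[OF viscous_real(1)[OF V]])
        fix w
        have "V v + ereal (blinfun_apply \<xi> (w - v)) \<le> V w" using \<xi> by (simp add: convex_subdiff_def)
        then have "real_of_ereal (V v) + blinfun_apply \<xi> (w - v) \<le> real_of_ereal (V w)"
          by (subst (asm) (1 2) viscous_real(1)[OF V]) simp
        moreover have "blinfun_apply \<xi> v \<le> norm \<xi> * R"
          using blinfun_le_norm[of \<xi> v] mult_left_mono[OF v norm_ge_zero[of \<xi>]] by linarith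
        ultimately show "blinfun_apply \<xi> w \<le> real_of_ereal (V w) + norm \<xi> * R"
          using viscous_real(2)[OF V, of v] by (simp add: blinfun.diff_right)
      qed
      moreover obtain c where c: "conjugate V \<xi> = ereal c" by (rule conjugate_finite[OF V])
      ultimately have "c \<le> norm \<xi> * R" by simp
      moreover have \<xi>1: "1 < norm \<xi>" "b \<le> norm \<xi>" "\<xi> \<noteq> 0" using n by auto
      moreover have "R < c / norm \<xi>" using b[OF \<xi>1(2)] \<xi>1(3) c by simp
      then have "R * norm \<xi> < c" using \<xi>1(1,3) by (simp add: less_divide_eq)
      ultimately show False by (simp add: mult.commute)
    qed
  qed
qed

section \<open>The rate-dependent system\<close>

definition weakly_cont_on :: "real set \<Rightarrow> (real \<Rightarrow> 'a::real_normed_vector) \<Rightarrow> bool" where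
  "weakly_cont_on A x \<longleftrightarrow> (\<forall>\<phi> :: 'a dual. continuous_on A (\<lambda>s. blinfun_apply \<phi> (x s)))"

lemma weakly_cont_onD:
  assumes "weakly_cont_on A x" "\<And>n. s n \<in> A" "s \<longlonglongrightarrow> l" "l \<in> A"
  shows "weak_conv (\<lambda>n. x (s n)) (x l)"
  unfolding weak_conv_def
proof
  fix \<phi> :: "'a dual"
  have "continuous_on A (\<lambda>s. blinfun_apply \<phi> (x s))" using assms(1) by (simp add: weakly_cont_on_def)
  then show "(\<lambda>n. blinfun_apply \<phi> (x (s n))) \<longlonglongrightarrow> blinfun_apply \<phi> (x l)"
    by (rule continuous_on_tendsto_compose[OF _ assms(3,4)]) (use assms(2) in auto)
qed

lemma continuous_imp_weakly_cont_on: "continuous_on A x \<Longrightarrow> weakly_cont_on A x"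
  unfolding weakly_cont_on_def by (auto intro!: continuous_intros)

text \<open>Sublevels are sequentially closed within a closed interval, hence Borel.\<close>

lemma seq_lsc_measurable:
  fixes f :: "real \<Rightarrow> ereal"
  assumes lsc: "\<And>s l. (\<And>n. s n \<in> {a..b}) \<Longrightarrow> s \<longlonglongrightarrow> l \<Longrightarrow> f l \<le> liminf (\<lambda>n. f (s n))"
  shows "f \<in> borel_measurable (lebesgue_on {a..b})"
  unfolding borel_measurable_iff_Iic_ereal
proof
  fix c :: ereal
  have "closed {s \<in> {a..b}. f s \<le> c}"
    unfolding closed_sequential_limits
  proof (intro allI impI)
    fix s l assume s: "(\<forall>n. s n \<in> {s \<in> {a..b}. f s \<le> c}) \<and> s \<longlonglongrightarrow> l"
    then have l: "l \<in> {a..b}" using closed_sequentially[of "{a..b}" s l] by auto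
    have "f l \<le> liminf (\<lambda>n. f (s n))" using s by (intro lsc) auto
    also have "\<dots> \<le> liminf (\<lambda>n. c)" using s by (intro Liminf_mono) auto
    also have "\<dots> = c" by (simp add: Liminf_const)
    finally show "l \<in> {s \<in> {a..b}. f s \<le> c}" using l by simp
  qed
  then have "{s \<in> {a..b}. f s \<le> c} \<in> sets lebesgue" by (intro sets_completionI_sets) (simp add: borel_closed)
  then have "{s \<in> {a..b}. f s \<le> c} \<in> sets (lebesgue_on {a..b})" by (subst sets_restrict_space_iff) auto
  moreover have "f -` {..c} \<inter> space (lebesgue_on {a..b}) = {s \<in> {a..b}. f s \<le> c}" by auto
  ultimately show "f -` {..c} \<inter> space (lebesgue_on {a..b}) \<in> sets (lebesgue_on {a..b})" by (simp only:)
qed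

text \<open>All hypotheses on the system except the chain rule, which enters only when the limit
  curve is known to be admissible.\<close>

locale rate_setting =
  fixes P :: "('u::{banach,second_countable_topology}, 'z::{banach,second_countable_topology},
               'ue::banach, 'ze::banach, 'zri::{banach,second_countable_topology}) rate_system"
  assumes spaces: "H_spaces P" and diss: "H_diss P" and energy: "H_energy P"
    and closedness: "H_closed P" and slopes: "H_slope P"
begin

definition rz :: "'z \<Rightarrow> real" where "rz \<eta> = real_of_ereal (RZ P \<eta>)"
definition vu :: "'u \<Rightarrow> real" where "vu v = real_of_ereal (Vu P v)"
definition vz :: "'z \<Rightarrow> real" where "vz v = real_of_ereal (Vz P v)"
definition en :: "real \<Rightarrow> 'u \<times> 'z \<Rightarrow> real" where "en t q = real_of_ereal (En P t q)"
text \<open>Agrees with the slope where the subdifferential is nonempty; elsewhere the slope is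
  infinite and the default value is 0.\<close>

definition su :: "real \<Rightarrow> 'u \<times> 'z \<Rightarrow> real" where "su t q = real_of_ereal (slope_u P t q)"
definition sz :: "real \<Rightarrow> 'u \<times> 'z \<Rightarrow> real" where "sz t q = real_of_ereal (slope_z P t q)"

lemma T_pos: "0 < horizon P" using spaces by (simp add: H_spaces_def)
lemma refl_u: "reflexive_space TYPE('u)" using spaces by (simp add: H_spaces_def)
lemma refl_z: "reflexive_space TYPE('z)" using spaces by (simp add: H_spaces_def)
lemma Vu: "viscous_potential (Vu P)" using diss by (simp add: H_diss_def)
lemma Vz: "viscous_potential (Vz P)" using diss by (simp add: H_diss_def)
lemma dpVu: "dissipation_potential (Vu P)" using Vu by (simp add: viscous_potential_def)
lemma dpVz: "dissipation_potential (Vz P)" using Vz by (simp add: viscous_potential_def)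
lemmas Vu_real = viscous_real[OF Vu, folded vu_def]
lemmas Vz_real = viscous_real[OF Vz, folded vz_def]

lemma RZ_bound: obtains C where "0 < C" "\<And>\<eta>. RZ P \<eta> \<le> ereal (C * norm \<eta>)"
  using diss unfolding H_diss_def by blast

lemma RZ_nonneg: "0 \<le> RZ P \<eta>"
  using diss unfolding H_diss_def dissipation_potential_def RZ_def by blast

lemma RZ_real: "RZ P \<eta> = ereal (rz \<eta>)" "0 \<le> rz \<eta>"
proof -
  obtain C where "RZ P \<eta> \<le> ereal (C * norm \<eta>)" by (rule RZ_bound) (rule that)
  then show "RZ P \<eta> = ereal (rz \<eta>)" using RZ_nonneg[of \<eta>] by (cases "RZ P \<eta>") (auto simp: rz_def)
  show "0 \<le> rz \<eta>" using RZ_nonneg[of \<eta>] by (simp add: rz_def real_of_ereal_pos)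
qed

lemma rz_bound: obtains C where "0 < C" "\<And>\<eta>. rz \<eta> \<le> C * norm \<eta>"
proof -
  obtain C where C: "0 < C" "\<And>\<eta>. RZ P \<eta> \<le> ereal (C * norm \<eta>)" by (rule RZ_bound) (rule that)
  then show thesis using that[of C] RZ_real(1) by simp
qed

lemma rz_scale: "0 < l \<Longrightarrow> rz (l *\<^sub>R \<eta>) = l * rz \<eta>"
proof -
  assume l: "0 < l"
  then have "RZ P (l *\<^sub>R \<eta>) = ereal l * RZ P \<eta>"
    using diss unfolding H_diss_def RZ_def by (simp add: blinfun.scaleR_right)
  then show ?thesis by (simp add: RZ_real(1))
qed

text \<open>Subadditivity is convexity at weight 1/2 combined with homogeneity.\<close>

lemma rz_sublinear: "sublinear rz"
proof (rule sublinearI)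
  fix x y
  have "Rz P ((1 - 1/2) *\<^sub>R embZri P x + (1/2) *\<^sub>R embZri P y) \<le> ereal (1 - 1/2) * Rz P (embZri P x) + ereal (1/2) * Rz P (embZri P y)"
    using diss unfolding H_diss_def dissipation_potential_def by (elim conjE allE ballE[of _ _ "1/2"]) auto
  moreover have "(1 - 1/2) *\<^sub>R embZri P x + (1/2) *\<^sub>R embZri P y = embZri P ((1/2) *\<^sub>R (x + y))"
    by (simp add: blinfun.scaleR_right blinfun.add_right scaleR_add_right)
  ultimately have "RZ P ((1/2) *\<^sub>R (x + y)) \<le> ereal (1/2) * RZ P x + ereal (1/2) * RZ P y"
    by (simp add: RZ_def)
  then have "rz ((1/2) *\<^sub>R (x + y)) \<le> 1/2 * rz x + 1/2 * rz y" by (simp add: RZ_real(1))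
  then show "rz (x + y) \<le> rz x + rz y" by (subst (asm) rz_scale) auto
next
  show "rz 0 = 0" using diss unfolding H_diss_def dissipation_potential_def rz_def RZ_def
    by (simp add: blinfun.zero_right)
qed (simp add: rz_scale)

lemma rz_lipschitz: obtains C where "0 < C" "\<And>x y. \<bar>rz x - rz y\<bar> \<le> C * norm (x - y)"
proof -
  obtain C where C: "0 < C" "\<And>\<eta>. rz \<eta> \<le> C * norm \<eta>" by (rule rz_bound) (rule that)
  have "\<bar>rz x - rz y\<bar> \<le> C * norm (x - y)" for x y
    using sublinear_add[OF rz_sublinear, of y "x - y"] sublinear_add[OF rz_sublinear, of x "y - x"]
      C(2)[of "x - y"] C(2)[of "y - x"] by (simp add: norm_minus_commute)
  then show thesis using that C(1) by blast
qed

lemma rz_tendsto: "(f \<longlongrightarrow> l) F \<Longrightarrow> ((\<lambda>x. rz (f x)) \<longlongrightarrow> rz l) F"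
proof -
  assume f: "(f \<longlongrightarrow> l) F"
  obtain C where C: "0 < C" "\<And>x y. \<bar>rz x - rz y\<bar> \<le> C * norm (x - y)" by (rule rz_lipschitz) (rule that)
  have "((\<lambda>x. C * norm (f x - l)) \<longlongrightarrow> C * norm (l - l)) F" by (intro tendsto_intros f)
  then have "((\<lambda>x. C * norm (f x - l)) \<longlongrightarrow> 0) F" by simp
  then have "((\<lambda>x. rz (f x) - rz l) \<longlongrightarrow> 0) F"
    by (rule Lim_null_comparison[rotated]) (use C(2) in \<open>auto intro: always_eventually\<close>)
  then show ?thesis by (simp add: LIM_zero_iff)
qed

text \<open>Linearises the rate-independent term: R is replaced by a functional below it that is
  exact at the limit velocity.\<close>

lemma rz_support: obtains \<rho> :: "'z dual" where "\<And>w. blinfun_apply \<rho> w \<le> rz w" "blinfun_apply \<rho> \<eta> = rz \<eta>"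
proof -
  obtain C where "0 < C" and C: "\<And>\<eta>. rz \<eta> \<le> C * norm \<eta>" by (rule rz_bound) (rule that)
  show thesis by (rule Hahn_Banach_blinfun[OF rz_sublinear C]) (rule that)
qed

lemma zero_in_subdiff_RZ: "0 \<in> convex_subdiff (RZ P) 0"
  using sublinear_0[OF rz_sublinear] RZ_real by (simp add: convex_subdiff_def blinfun.zero_left)

text \<open>A subgradient at any v satisfies \<xi>(w) <= R(v + w) - R(v) <= R(w), so one bound
  serves all velocities.\<close>

lemma RZ_subdiff_bounded: obtains K where "\<And>v \<xi>. \<xi> \<in> convex_subdiff (RZ P) v \<Longrightarrow> norm \<xi> \<le> K"
proof -
  obtain C where C: "0 < C" "\<And>\<eta>. rz \<eta> \<le> C * norm \<eta>" by (rule rz_bound) (rule that)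
  show thesis
  proof (rule that[of C])
    fix v \<xi> assume \<xi>: "\<xi> \<in> convex_subdiff (RZ P) v"
    have le: "blinfun_apply \<xi> w \<le> C * norm w" for w
    proof -
      have "RZ P v + ereal (blinfun_apply \<xi> ((v + w) - v)) \<le> RZ P (v + w)" using \<xi> unfolding convex_subdiff_def by blast
      then have "rz v + blinfun_apply \<xi> w \<le> rz (v + w)" by (simp add: RZ_real(1))
      then show ?thesis using sublinear_add[OF rz_sublinear, of v w] C(2)[of w] by linarith
    qed
    show "norm \<xi> \<le> C"
    proof (rule norm_blinfun_bound)
      show "norm (blinfun_apply \<xi> w) \<le> C * norm w" for w
        using le[of w] le[of "- w"] by (simp add: blinfun.minus_right abs_le_iff)
    qed (use C in simp)
  qed
qed

text \<open>\<sigma> = 0 is an admissible competitor in the infimum, so finiteness is inherited from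
  the conjugate of \<open>Vz P\<close>.\<close>

lemma Wz_conj_real: obtains c where "Wz_conj P \<zeta> = ereal c" "0 \<le> c"
proof -
  obtain c where c: "conjugate (Vz P) \<zeta> = ereal c" by (rule conjugate_finite[OF Vz])
  have "Wz_conj P \<zeta> \<le> conjugate (Vz P) (\<zeta> - 0)"
    unfolding Wz_conj_def by (rule INF_lower[OF zero_in_subdiff_RZ])
  moreover have "0 \<le> Wz_conj P \<zeta>"
    unfolding Wz_conj_def by (intro INF_greatest conjugate_nonneg dpVz)
  ultimately show thesis using c that by (cases "Wz_conj P \<zeta>") auto
qed

lemma slope_nonneg: "0 \<le> slope_u P t q" "0 \<le> slope_z P t q"
proof -
  show "0 \<le> slope_u P t q" unfolding slope_u_def by (intro INF_greatest) (auto intro: conjugate_nonneg dpVu)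
  have "0 \<le> Wz_conj P \<zeta>" for \<zeta> by (rule Wz_conj_real[of \<zeta>]) simp
  then show "0 \<le> slope_z P t q" unfolding slope_z_def by (intro INF_greatest) auto
qed

lemma slope_le:
  assumes "(\<mu>, \<zeta>) \<in> frechet_subdiff P t q"
  shows "slope_u P t q \<le> conjugate (Vu P) (- \<mu>)" "slope_z P t q \<le> Wz_conj P (- \<zeta>)"
  unfolding slope_u_def slope_z_def using assms by (force intro: INF_lower2)+

lemma slope_infinite:
  assumes "frechet_subdiff P t q = {}" shows "slope_u P t q = \<infinity>" "slope_z P t q = \<infinity>"
  using assms by (simp_all add: slope_u_def slope_z_def top_ereal_def)

lemma slope_real:
  assumes "frechet_subdiff P t q \<noteq> {}"
  shows "slope_u P t q = ereal (su t q)" "slope_z P t q = ereal (sz t q)" "0 \<le> su t q" "0 \<le> sz t q"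
proof -
  obtain \<mu> \<zeta> where m: "(\<mu>, \<zeta>) \<in> frechet_subdiff P t q" using assms by auto
  obtain c where "conjugate (Vu P) (- \<mu>) = ereal c" by (rule conjugate_finite[OF Vu])
  then show "slope_u P t q = ereal (su t q)"
    using slope_le(1)[OF m] slope_nonneg(1)[of t q] by (cases "slope_u P t q") (auto simp: su_def)
  obtain d where "Wz_conj P (- \<zeta>) = ereal d" by (rule Wz_conj_real)
  then show "slope_z P t q = ereal (sz t q)"
    using slope_le(2)[OF m] slope_nonneg(2)[of t q] by (cases "slope_z P t q") (auto simp: sz_def)
  show "0 \<le> su t q" "0 \<le> sz t q" using slope_nonneg by (simp_all add: su_def sz_def real_of_ereal_pos)
qed

text \<open>Expresses the domain of the subdifferential through a lower semicontinuous function,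
  which makes the case distinction in \<open>M_eps\<close> measurable along curves.\<close>

lemma frechet_iff_slope: "frechet_subdiff P t q \<noteq> {} \<longleftrightarrow> slope_u P t q < \<infinity>"
  by (cases "frechet_subdiff P t q = {}") (simp_all add: slope_real(1) slope_infinite(1))

text \<open>a and b are the weights of the u- and the z-part; in this form
  \<open>fenchel_young\<close> applies with \<tau> = a and with \<tau> = b.\<close>

lemma M_eps_real:
  assumes \<epsilon>: "0 < \<epsilon>" and t': "0 < t'" and f: "frechet_subdiff P t q \<noteq> {}"
  defines "a \<equiv> t' / \<epsilon> powr expo P" and "b \<equiv> t' / \<epsilon>"
  shows "M_eps P \<epsilon> t q t' q' =
    ereal (a * vu ((1 / a) *\<^sub>R fst q') + a * su t q + rz (snd q') + b * vz ((1 / b) *\<^sub>R snd q') + b * sz t q)"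
  using t' f \<epsilon> unfolding M_eps_def Let_def a_def b_def
  by (simp add: Vu_real(1) Vz_real(1) slope_real(1,2) RZ_real(1))

lemma M_eps_finiteD:
  assumes "M_eps P \<epsilon> t q t' q' \<le> ereal C"
  shows "0 < t'" "frechet_subdiff P t q \<noteq> {}"
  using assms by (auto simp: M_eps_def Let_def split: if_splits)

lemma M_eps_nonneg: "0 < \<epsilon> \<Longrightarrow> 0 \<le> M_eps P \<epsilon> t q t' q'"
proof (cases "0 < t' \<and> frechet_subdiff P t q \<noteq> {}")
  case True
  moreover assume \<epsilon>: "0 < \<epsilon>"
  ultimately have "0 < t'" "frechet_subdiff P t q \<noteq> {}" by auto
  note M_eps_real[OF \<epsilon> this, of q'] slope_real[OF this(2)]
  then show ?thesis using \<open>0 < t'\<close> \<epsilon> Vu_real(2) Vz_real(2) RZ_real(2) by simp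
qed (auto simp: M_eps_def Let_def)

section \<open>Bounds in time and lower semicontinuity of the energy\<close>

lemma Dom_energy:
  assumes "q \<in> Dom P" "t \<in> {0..horizon P}"
  shows "En P t q = ereal (en t q)" "0 < en t q"
proof -
  obtain C0 where "0 < C0" "ereal C0 \<le> En P t q" using energy assms unfolding H_energy_def by blast
  moreover have "En P t q < \<infinity>" using energy assms unfolding H_energy_def by blast
  ultimately show "En P t q = ereal (en t q)" "0 < en t q" by (cases "En P t q"; auto simp: en_def)+
qed

lemma finite_energy_Dom: "t \<in> {0..horizon P} \<Longrightarrow> En P t q \<noteq> \<infinity> \<Longrightarrow> q \<in> Dom P"
  using energy unfolding H_energy_def by (auto simp: less_top[symmetric] top_ereal_def)

lemma energy_derivative:
  assumes "q \<in> Dom P" "t \<in> {0..horizon P}"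
  shows "((\<lambda>r. en r q) has_real_derivative dtE P t q) (at t within {0..horizon P})"
proof -
  have "(\<lambda>r. en r q) differentiable (at t within {0..horizon P})"
    using energy assms unfolding H_energy_def en_def by blast
  then have "((\<lambda>r. en r q) has_vector_derivative vector_derivative (\<lambda>r. en r q) (at t within {0..horizon P})) (at t within {0..horizon P})"
    by (simp add: vector_derivative_works)
  then show ?thesis by (simp add: dtE_def en_def has_real_derivative_iff_has_vector_derivative)
qed

lemma power_bound:
  obtains C where "0 < C" "\<And>q t. q \<in> Dom P \<Longrightarrow> t \<in> {0..horizon P} \<Longrightarrow> \<bar>dtE P t q\<bar> \<le> C * en t q"
proof -
  obtain C where C: "0 < C" "\<And>q t. q \<in> Dom P \<Longrightarrow> t \<in> {0..horizon P} \<Longrightarrow> ereal \<bar>dtE P t q\<bar> \<le> ereal C * En P t q"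
    using energy unfolding H_energy_def by blast
  then show thesis using that[of C] Dom_energy(1) by simp
qed

text \<open>Gronwall's inequality in both directions of time: by the power control the energy times
  exp(-C r) decreases in r, and the energy times exp(C r) increases. It bounds \<open>Esup\<close>
  by the energy at a single time.\<close>

lemma energy_exp:
  assumes C: "0 < C" "\<And>q t. q \<in> Dom P \<Longrightarrow> t \<in> {0..horizon P} \<Longrightarrow> \<bar>dtE P t q\<bar> \<le> C * en t q"
    and q: "q \<in> Dom P" and st: "s \<in> {0..horizon P}" "t \<in> {0..horizon P}"
  shows "en t q \<le> exp (C * horizon P) * en s q"
proof -
  let ?T = "horizon P"
  have der: "((\<lambda>r. en r q) has_real_derivative dtE P r q) (at r)" if "0 < r" "r < ?T" for r
    using energy_derivative[OF q, of r] that by (simp add: at_within_Icc_at)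
  have cont: "continuous_on {0..?T} (\<lambda>r. en r q)"
    using energy_derivative[OF q] by (rule DERIV_continuous_on)
  have gen: "en y q * exp (- C * y) \<le> en x q * exp (- C * x) \<and> en x q * exp (C * x) \<le> en y q * exp (C * y)"
    if xy: "0 \<le> x" "x < y" "y \<le> ?T" for x y
  proof
    show "en y q * exp (- C * y) \<le> en x q * exp (- C * x)"
    proof (rule DERIV_nonpos_imp_decreasing_open[OF less_imp_le[OF xy(2)]])
      fix r assume r: "x < r" "r < y"
      have "((\<lambda>r. en r q * exp (- C * r)) has_real_derivative (dtE P r q - C * en r q) * exp (- C * r)) (at r)"
        using r xy by (auto intro!: derivative_eq_intros der simp: algebra_simps)
      moreover have "(dtE P r q - C * en r q) * exp (- C * r) \<le> 0"
        using C(2)[OF q, of r] r xy by (intro mult_nonpos_nonneg) auto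
      ultimately show "\<exists>y. ((\<lambda>r. en r q * exp (- C * r)) has_real_derivative y) (at r) \<and> y \<le> 0" by blast
    qed (use xy in \<open>auto intro!: continuous_intros continuous_on_subset[OF cont]\<close>)
    show "en x q * exp (C * x) \<le> en y q * exp (C * y)"
    proof (rule DERIV_nonneg_imp_increasing_open[OF less_imp_le[OF xy(2)]])
      fix r assume r: "x < r" "r < y"
      have "((\<lambda>r. en r q * exp (C * r)) has_real_derivative (dtE P r q + C * en r q) * exp (C * r)) (at r)"
        using r xy by (auto intro!: derivative_eq_intros der simp: algebra_simps)
      moreover have "0 \<le> (dtE P r q + C * en r q) * exp (C * r)"
        using C(2)[OF q, of r] r xy by (intro mult_nonneg_nonneg) auto
      ultimately show "\<exists>y. ((\<lambda>r. en r q * exp (C * r)) has_real_derivative y) (at r) \<and> 0 \<le> y" by blast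
    qed (use xy in \<open>auto intro!: continuous_intros continuous_on_subset[OF cont]\<close>)
  qed
  have le: "exp (C * (y - x)) \<le> exp (C * ?T)" if "0 \<le> x" "x \<le> y" "y \<le> ?T" for x y
    using that C(1) by (simp add: mult_left_mono)
  have pos: "0 \<le> en s q" using Dom_energy(2)[OF q st(1)] by simp
  consider "s < t" | "s = t" | "t < s" by linarith
  then show ?thesis
  proof cases
    case 1
    then have "en t q * exp (- C * t) * exp (C * t) \<le> en s q * exp (- C * s) * exp (C * t)"
      using gen[of s t] st by (intro mult_right_mono) auto
    then have "en t q \<le> en s q * exp (C * (t - s))" by (simp add: mult.assoc algebra_simps flip: exp_add)
    also have "\<dots> \<le> en s q * exp (C * ?T)" using le[of s t] 1 st pos by (intro mult_left_mono) auto
    finally show ?thesis by (simp add: mult.commute)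
  next
    case 2
    have "1 * en s q \<le> exp (C * ?T) * en s q" using pos T_pos C(1) by (intro mult_right_mono) auto
    then show ?thesis using 2 by simp
  next
    case 3
    then have "en t q * exp (C * t) * exp (- C * t) \<le> en s q * exp (C * s) * exp (- C * t)"
      using gen[of t s] st by (intro mult_right_mono) auto
    then have "en t q \<le> en s q * exp (C * (s - t))" by (simp add: mult.assoc algebra_simps flip: exp_add)
    also have "\<dots> \<le> en s q * exp (C * ?T)" using le[of t s] 3 st pos by (intro mult_left_mono) auto
    finally show ?thesis by (simp add: mult.commute)
  qed
qed

lemma Esup_ge: "t \<in> {0..horizon P} \<Longrightarrow> En P t q \<le> Esup P q"
  unfolding Esup_def by (rule SUP_upper)

lemma Esup_Dom:
  assumes "Esup P q \<le> ereal M"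
  shows "q \<in> Dom P" "t \<in> {0..horizon P} \<Longrightarrow> en t q \<le> M"
proof -
  have le: "En P t q \<le> ereal M" if "t \<in> {0..horizon P}" for t using Esup_ge[OF that] assms order_trans by blast
  show q: "q \<in> Dom P" using le[of 0] T_pos by (intro finite_energy_Dom[of 0]) auto
  show "t \<in> {0..horizon P} \<Longrightarrow> en t q \<le> M" using le[of t] Dom_energy(1)[OF q, of t] by simp
qed

lemma energy_lipschitz:
  assumes C: "0 < C" "\<And>q t. q \<in> Dom P \<Longrightarrow> t \<in> {0..horizon P} \<Longrightarrow> \<bar>dtE P t q\<bar> \<le> C * en t q"
    and M: "Esup P q \<le> ereal M" and st: "s \<in> {0..horizon P}" "t \<in> {0..horizon P}"
  shows "\<bar>en t q - en s q\<bar> \<le> C * M * \<bar>t - s\<bar>"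
proof -
  have "norm (en t q - en s q) \<le> C * M * norm (t - s)"
  proof (rule field_differentiable_bound[where f = "\<lambda>r. en r q" and S = "{0..horizon P}"])
    fix r assume r: "r \<in> {0..horizon P}"
    show "((\<lambda>r. en r q) has_real_derivative dtE P r q) (at r within {0..horizon P})"
      using energy_derivative[OF Esup_Dom(1)[OF M] r] .
    have "\<bar>dtE P r q\<bar> \<le> C * en r q" using C(2)[OF Esup_Dom(1)[OF M] r] .
    also have "\<dots> \<le> C * M" using Esup_Dom(2)[OF M r] C(1) by (intro mult_left_mono) auto
    finally show "norm (dtE P r q) \<le> C * M" by simp
  qed (use st in auto)
  then show ?thesis by simp
qed

lemma Esup_lsc:
  assumes "weak_conv x q" "\<And>n. Esup P (x n) \<le> ereal M"
  shows "Esup P q \<le> ereal M"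
  unfolding Esup_def
proof (rule SUP_least)
  fix t assume t: "t \<in> {0..horizon P}"
  have "En P t q \<le> liminf (\<lambda>n. En P t (x n))" using energy t assms(1) unfolding H_energy_def by blast
  also have "\<dots> \<le> liminf (\<lambda>n. ereal M)"
    using assms(2) Esup_ge[OF t] by (intro Liminf_mono always_eventually allI) (rule order_trans)
  also have "\<dots> = ereal M" by (simp add: Liminf_const)
  finally show "En P t q \<le> ereal M" .
qed

text \<open>Moving the time from \<open>tn n\<close> to t costs an amount that vanishes, because
  \<open>energy_lipschitz\<close> is uniform on a sublevel of \<open>Esup\<close>; at the fixed time
  t weak lower semicontinuity applies.\<close>

lemma energy_lsc:
  assumes tn: "\<And>n. tn n \<in> {0..horizon P}" "tn \<longlonglongrightarrow> t" and x: "weak_conv x q" and M: "\<And>n. Esup P (x n) \<le> ereal M"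
  shows "En P t q \<le> liminf (\<lambda>n. En P (tn n) (x n))"
proof -
  obtain C where C: "0 < C" "\<And>q t. q \<in> Dom P \<Longrightarrow> t \<in> {0..horizon P} \<Longrightarrow> \<bar>dtE P t q\<bar> \<le> C * en t q"
    by (rule power_bound) (rule that)
  have t: "t \<in> {0..horizon P}" using closed_sequentially[of "{0..horizon P}" tn t] tn by auto
  have "En P t q \<le> liminf (\<lambda>n. En P t (x n))" using energy t x unfolding H_energy_def by blast
  also have "\<dots> \<le> liminf (\<lambda>n. En P (tn n) (x n) + ereal (C * M * \<bar>t - tn n\<bar>))"
  proof (intro Liminf_mono always_eventually allI)
    fix n
    have "\<bar>en t (x n) - en (tn n) (x n)\<bar> \<le> C * M * \<bar>t - tn n\<bar>" by (rule energy_lipschitz[OF C M tn(1) t])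
    then show "En P t (x n) \<le> En P (tn n) (x n) + ereal (C * M * \<bar>t - tn n\<bar>)"
      using Dom_energy(1)[OF Esup_Dom(1)[OF M]] t tn(1) by simp
  qed
  also have "\<dots> = liminf (\<lambda>n. ereal (C * M * \<bar>t - tn n\<bar>) + En P (tn n) (x n))" by (simp only: add.commute)
  also have "\<dots> = 0 + liminf (\<lambda>n. En P (tn n) (x n))"
  proof (rule ereal_liminf_lim_add)
    have "(\<lambda>n. C * M * \<bar>t - tn n\<bar>) \<longlonglongrightarrow> C * M * \<bar>t - t\<bar>" by (intro tendsto_intros tn(2))
    then show "(\<lambda>n. ereal (C * M * \<bar>t - tn n\<bar>)) \<longlonglongrightarrow> 0" by (simp add: zero_ereal_def)
  qed simp
  finally show ?thesis by simp
qed

section \<open>Semicontinuity and measurability along curves\<close>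

lemma bounded_SUP_finite: "(\<And>n. Esup P (x n) \<le> ereal M) \<Longrightarrow> (SUP n. Esup P (x n)) < \<infinity>"
  using SUP_least[of UNIV "\<lambda>n. Esup P (x n)" "ereal M"] by (auto intro: le_less_trans)

lemma slope_lsc:
  assumes "\<And>n. tn n \<in> {0..horizon P}" "tn \<longlonglongrightarrow> t" "weak_conv x q" "\<And>n. Esup P (x n) \<le> ereal M"
  shows "slope_u P t q \<le> liminf (\<lambda>n. slope_u P (tn n) (x n))" "slope_z P t q \<le> liminf (\<lambda>n. slope_z P (tn n) (x n))"
  using slopes assms bounded_SUP_finite[of x M] unfolding H_slope_def by blast+

lemma curve_sequence:
  assumes "continuous_on {a..b} \<tau>" "weakly_cont_on {a..b} x" "\<And>n::nat. s n \<in> {a..b}" "s \<longlonglongrightarrow> l"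
  shows "l \<in> {a..b}" "(\<lambda>n. \<tau> (s n)) \<longlonglongrightarrow> \<tau> l" "weak_conv (\<lambda>n. x (s n)) (x l)"
proof -
  show l: "l \<in> {a..b}" using closed_sequentially[of "{a..b}" s l] assms(3,4) by auto
  show "(\<lambda>n. \<tau> (s n)) \<longlonglongrightarrow> \<tau> l"
    by (rule continuous_on_tendsto_compose[OF assms(1,4) l]) (use assms(3) in auto)
  show "weak_conv (\<lambda>n. x (s n)) (x l)" by (rule weakly_cont_onD[OF assms(2,3,4) l])
qed

text \<open>Weak continuity of the curve and the bound on \<open>Esup\<close> make slopes and energy
  lower semicontinuous functions of the parameter.\<close>

lemma curve_measurable:
  assumes \<tau>: "continuous_on {a..b} \<tau>" "\<And>s. s \<in> {a..b} \<Longrightarrow> \<tau> s \<in> {0..horizon P}"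
    and x: "weakly_cont_on {a..b} x" and M: "\<And>s. s \<in> {a..b} \<Longrightarrow> Esup P (x s) \<le> ereal M"
  shows "(\<lambda>s. slope_u P (\<tau> s) (x s)) \<in> borel_measurable (lebesgue_on {a..b})"
    "(\<lambda>s. slope_z P (\<tau> s) (x s)) \<in> borel_measurable (lebesgue_on {a..b})"
    "(\<lambda>s. en (\<tau> s) (x s)) \<in> borel_measurable (lebesgue_on {a..b})"
proof -
  note seq = curve_sequence[OF \<tau>(1) x]
  show "(\<lambda>s. slope_u P (\<tau> s) (x s)) \<in> borel_measurable (lebesgue_on {a..b})"
    by (rule seq_lsc_measurable, rule slope_lsc(1)[OF _ seq(2,3)]) (use \<tau>(2) M in auto)
  show "(\<lambda>s. slope_z P (\<tau> s) (x s)) \<in> borel_measurable (lebesgue_on {a..b})"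
    by (rule seq_lsc_measurable, rule slope_lsc(2)[OF _ seq(2,3)]) (use \<tau>(2) M in auto)
  have "(\<lambda>s. En P (\<tau> s) (x s)) \<in> borel_measurable (lebesgue_on {a..b})"
    by (rule seq_lsc_measurable, rule energy_lsc[OF _ seq(2,3)]) (use \<tau>(2) M in auto)
  then show "(\<lambda>s. en (\<tau> s) (x s)) \<in> borel_measurable (lebesgue_on {a..b})" unfolding en_def by measurable
qed

text \<open>The power is a pointwise limit of difference quotients of energies, each measurable by
  \<open>curve_measurable\<close>. The increment \<open>h n s\<close> depends on s so that the
  shifted time stays in the time interval; at the final time the backward quotient with step
  \<open>c n\<close> takes its place.\<close>

lemma curve_power_measurable:
  assumes \<tau>: "continuous_on {a..b} \<tau>" "\<And>s. s \<in> {a..b} \<Longrightarrow> \<tau> s \<in> {0..horizon P}"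
    and x: "weakly_cont_on {a..b} x" and M: "\<And>s. s \<in> {a..b} \<Longrightarrow> Esup P (x s) \<le> ereal M"
  shows "(\<lambda>s. dtE P (\<tau> s) (x s)) \<in> borel_measurable (lebesgue_on {a..b})"
proof -
  let ?L = "lebesgue_on {a..b}" and ?T = "horizon P"
  define h where "h n s = (?T - \<tau> s) / real (Suc n)" for n s
  define c where "c n = ?T / real (Suc n)" for n
  have h: "0 \<le> h n s" "h n s \<le> ?T - \<tau> s" if "s \<in> {a..b}" for n s
  proof -
    have *: "0 \<le> ?T - \<tau> s" using \<tau>(2)[OF that] by simp
    then show "0 \<le> h n s" by (simp add: h_def)
    have "h n s \<le> (?T - \<tau> s) / 1" unfolding h_def using * by (intro divide_left_mono) auto
    then show "h n s \<le> ?T - \<tau> s" by simp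
  qed
  have c: "0 < c n" "c n \<le> ?T" for n using T_pos by (auto simp: c_def field_simps)
  have lim0: "(\<lambda>n. y / real (Suc n)) \<longlonglongrightarrow> 0" for y :: real by (rule LIMSEQ_Suc) (rule lim_const_over_n)
  define f where "f s = (if \<tau> s < ?T then lim (\<lambda>n. (en (\<tau> s + h n s) (x s) - en (\<tau> s) (x s)) / h n s)
    else lim (\<lambda>n. (en (?T - c n) (x s) - en ?T (x s)) / (- c n)))" for s
  have \<tau>m: "\<tau> \<in> borel_measurable ?L" using \<tau>(1) by (rule continuous_imp_measurable_on_sets_lebesgue) simp
  have hm: "h n \<in> borel_measurable ?L" for n unfolding h_def using \<tau>m by measurable
  have m1: "(\<lambda>s. en (\<tau> s + h n s) (x s)) \<in> borel_measurable ?L" for n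
  proof (rule curve_measurable(3)[OF _ _ x M])
    show "continuous_on {a..b} (\<lambda>s. \<tau> s + h n s)" unfolding h_def by (intro continuous_intros \<tau>(1)) auto
    show "\<tau> s + h n s \<in> {0..?T}" if "s \<in> {a..b}" for s using h[OF that, of n] \<tau>(2)[OF that] by auto
  qed
  have m2: "(\<lambda>s. en (\<tau> s) (x s)) \<in> borel_measurable ?L" by (rule curve_measurable(3)[OF \<tau> x M])
  have m3: "(\<lambda>s. en r (x s)) \<in> borel_measurable ?L" if "r \<in> {0..?T}" for r
    by (rule curve_measurable(3)[OF _ _ x M]) (use that in auto)
  have m3': "(\<lambda>s. en (?T - c n) (x s)) \<in> borel_measurable ?L" "(\<lambda>s. en ?T (x s)) \<in> borel_measurable ?L" for n
    using c[of n] T_pos by (auto intro!: m3)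
  have S: "{s \<in> space ?L. \<tau> s < ?T} \<in> sets ?L" using \<tau>m by measurable
  have "f \<in> borel_measurable ?L" unfolding f_def
    by (intro measurable_If S borel_measurable_lim_metric borel_measurable_divide borel_measurable_diff
        borel_measurable_uminus borel_measurable_const m1 m2 m3' hm)
  moreover have "f s = dtE P (\<tau> s) (x s)" if s: "s \<in> {a..b}" for s
  proof -
    have D: "((\<lambda>r. (en r (x s) - en t (x s)) / (r - t)) \<longlongrightarrow> dtE P t (x s)) (at t within {0..?T})" if "t \<in> {0..?T}" for t
      using energy_derivative[OF Esup_Dom(1)[OF M[OF s]] that] by (simp add: has_field_derivative_iff)
    show ?thesis
    proof (cases "\<tau> s < ?T")
      case True
      have "filterlim (\<lambda>n. \<tau> s + h n s) (at (\<tau> s) within {0..?T}) sequentially"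
        unfolding filterlim_at
      proof
        show "(\<lambda>n. \<tau> s + h n s) \<longlonglongrightarrow> \<tau> s" using tendsto_add[OF tendsto_const lim0, of "\<tau> s" "?T - \<tau> s"] by (simp add: h_def)
        show "\<forall>\<^sub>F n in sequentially. \<tau> s + h n s \<in> {0..?T} \<and> \<tau> s + h n s \<noteq> \<tau> s"
        proof (intro always_eventually allI)
          fix n
          have "h n s \<noteq> 0" using True by (simp add: h_def)
          then show "\<tau> s + h n s \<in> {0..?T} \<and> \<tau> s + h n s \<noteq> \<tau> s" using h[OF s, of n] \<tau>(2)[OF s] by auto
        qed
      qed
      from filterlim_compose[OF D[OF \<tau>(2)[OF s]] this] show ?thesis
        using True by (simp add: f_def limI)
    next
      case False
      then have T: "\<tau> s = ?T" using \<tau>(2)[OF s] by auto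
      have "filterlim (\<lambda>n. ?T - c n) (at ?T within {0..?T}) sequentially"
        unfolding filterlim_at
      proof
        show "(\<lambda>n. ?T - c n) \<longlonglongrightarrow> ?T" using tendsto_diff[OF tendsto_const lim0, of ?T ?T] by (simp add: c_def)
        show "\<forall>\<^sub>F n in sequentially. ?T - c n \<in> {0..?T} \<and> ?T - c n \<noteq> ?T"
        proof (intro always_eventually allI)
          fix n
          show "?T - c n \<in> {0..?T} \<and> ?T - c n \<noteq> ?T" using c[of n] by auto
        qed
      qed
      from filterlim_compose[OF D this] show ?thesis
        using T T_pos by (simp add: f_def limI)
    qed
  qed
  ultimately show ?thesis by (rule measurable_cong[THEN iffD1, rotated]) simp
qed

lemma M_eps_measurable:
  assumes \<epsilon>: "0 < \<epsilon>" and \<tau>: "continuous_on {a..b} \<tau>" "\<And>s. s \<in> {a..b} \<Longrightarrow> \<tau> s \<in> {0..horizon P}"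
    and x: "weakly_cont_on {a..b} x" and M: "\<And>s. s \<in> {a..b} \<Longrightarrow> Esup P (x s) \<le> ereal M"
    and t': "t' \<in> borel_measurable (lebesgue_on {a..b})"
    and u': "u' \<in> borel_measurable (lebesgue_on {a..b})" and z': "z' \<in> borel_measurable (lebesgue_on {a..b})"
  shows "(\<lambda>s. M_eps P \<epsilon> (\<tau> s) (x s) (t' s) (u' s, z' s)) \<in> borel_measurable (lebesgue_on {a..b})"
proof -
  let ?L = "lebesgue_on {a..b}" and ?\<delta> = "\<epsilon> powr expo P"
  note S = curve_measurable(1,2)[OF \<tau> x M]
  have Rm: "RZ P \<in> borel_measurable borel"
  proof -
    have "Rz P \<in> borel_measurable borel" using diss by (intro dissipation_borel) (simp add: H_diss_def)
    moreover have "blinfun_apply (embZri P) \<in> borel_measurable borel"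
      by (intro borel_measurable_continuous_onI) (intro continuous_intros)
    ultimately show ?thesis unfolding RZ_def using measurable_compose by blast
  qed
  have V1: "(\<lambda>s. Vu P ((?\<delta> / t' s) *\<^sub>R u' s)) \<in> borel_measurable ?L"
    by (rule measurable_compose[OF _ dissipation_borel[OF dpVu]]) (use t' u' in measurable)
  have V2: "(\<lambda>s. Vz P ((\<epsilon> / t' s) *\<^sub>R z' s)) \<in> borel_measurable ?L"
    by (rule measurable_compose[OF _ dissipation_borel[OF dpVz]]) (use t' z' in measurable)
  have R1: "(\<lambda>s. RZ P (z' s)) \<in> borel_measurable ?L" by (rule measurable_compose[OF z' Rm])
  have E1: "(\<lambda>s. ereal (t' s / ?\<delta>)) \<in> borel_measurable ?L" "(\<lambda>s. ereal (t' s / \<epsilon>)) \<in> borel_measurable ?L"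
    using t' by measurable
  have set: "{s \<in> space ?L. 0 < t' s \<and> slope_u P (\<tau> s) (x s) < \<infinity>} \<in> sets ?L" using t' S(1) by measurable
  have "(\<lambda>s. if 0 < t' s \<and> slope_u P (\<tau> s) (x s) < \<infinity> then
      ereal (t' s / ?\<delta>) * Vu P ((?\<delta> / t' s) *\<^sub>R u' s) + ereal (t' s / ?\<delta>) * slope_u P (\<tau> s) (x s)
          + RZ P (z' s) + ereal (t' s / \<epsilon>) * Vz P ((\<epsilon> / t' s) *\<^sub>R z' s) + ereal (t' s / \<epsilon>) * slope_z P (\<tau> s) (x s)
      else \<infinity>) \<in> borel_measurable ?L"
    by (intro measurable_If set borel_measurable_ereal_add borel_measurable_ereal_times V1 V2 R1 E1 S measurable_const) auto
  then show ?thesis unfolding M_eps_def Let_def fst_conv snd_conv frechet_iff_slope by simp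
qed

end

section \<open>Rescaled viscous solutions\<close>

lemma gronwall_integral:
  fixes G :: "real \<Rightarrow> real"
  assumes cont: "continuous_on {0..T} G" and C: "0 \<le> C"
    and le: "\<And>t. t \<in> {0..T} \<Longrightarrow> G t \<le> e0 + integral {0..t} (\<lambda>r. C * G r)" and t: "t \<in> {0..T}"
  shows "G t \<le> e0 * exp (C * t)"
proof -
  define H where "H t = e0 + integral {0..t} (\<lambda>r. C * G r)" for t
  have contCG: "continuous_on {0..T} (\<lambda>r. C * G r)" by (intro continuous_intros cont)
  have der: "(H has_real_derivative C * G r) (at r)" if "0 < r" "r < T" for r
  proof -
    have "((\<lambda>t. integral {0..t} (\<lambda>r. C * G r)) has_vector_derivative C * G r) (at r within {0..T})"
      by (rule integral_has_vector_derivative[OF contCG]) (use that in auto)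
    then have "((\<lambda>t. integral {0..t} (\<lambda>r. C * G r)) has_real_derivative C * G r) (at r)"
      using that by (simp add: at_within_Icc_at has_real_derivative_iff_has_vector_derivative)
    then show ?thesis unfolding H_def using DERIV_add[OF DERIV_const] by fastforce
  qed
  have contH: "continuous_on {0..T} H" unfolding H_def
    by (intro continuous_intros indefinite_integral_continuous_1 integrable_continuous_real contCG)
  have "H t * exp (- C * t) \<le> H 0 * exp (- C * 0)"
  proof (rule DERIV_nonpos_imp_decreasing_open[where f = "\<lambda>r. H r * exp (- C * r)" and a = 0 and b = t])
    show "0 \<le> t" using t by simp
    fix r assume r: "0 < r" "r < t"
    have "((\<lambda>r. H r * exp (- C * r)) has_real_derivative C * (G r - H r) * exp (- C * r)) (at r)"
      using r t by (auto intro!: derivative_eq_intros der simp: algebra_simps)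
    moreover have "C * (G r - H r) * exp (- C * r) \<le> 0"
      using le[of r] r t C by (intro mult_nonpos_nonneg mult_nonneg_nonpos) (auto simp: H_def)
    ultimately show "\<exists>y. ((\<lambda>r. H r * exp (- C * r)) has_real_derivative y) (at r) \<and> y \<le> 0" by blast
  next
    show "continuous_on {0..t} (\<lambda>r. H r * exp (- C * r))"
      using t by (intro continuous_intros continuous_on_subset[OF contH]) auto
  qed
  then have "H t * exp (- C * t) * exp (C * t) \<le> e0 * exp (C * t)"
    by (intro mult_right_mono) (auto simp: H_def)
  then have "H t \<le> e0 * exp (C * t)" by (simp add: mult.assoc flip: exp_add)
  then show ?thesis using le[OF t] by (simp add: H_def)
qed

text \<open>\<open>E0\<close> stands for a bound on the initial energy that a whole family will
  share, so that the resulting bound on \<open>Esup\<close> is uniform as well.\<close>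

locale rescaled_solution = rate_setting P
  for P :: "('u::{banach,second_countable_topology}, 'z::{banach,second_countable_topology},
               'ue::banach, 'ze::banach, 'zri::{banach,second_countable_topology}) rate_system" +
  fixes \<epsilon> :: real and qv :: "real \<Rightarrow> 'u \<times> 'z" and \<tau> :: "real \<Rightarrow> real" and S C E0 :: real
  assumes eps: "0 < \<epsilon>" and visc: "viscous_solution P \<epsilon> qv" and init: "En P 0 (qv 0) \<le> ereal E0"
    and S: "0 < S" and C: "0 < C"
    and mono: "mono_on {0..S} \<tau>" and surj: "\<tau> ` {0..S} = {0..horizon P}" and ac: "ac_on 0 S \<tau>"
    and bound: "AE s in lebesgue_on {0..S}. ereal (deriv \<tau> s)
       + M_eps P \<epsilon> (\<tau> s) (qv (\<tau> s)) (deriv \<tau> s) (velocity (qv \<circ> \<tau>) s)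
       + ereal (norm (fst (velocity (qv \<circ> \<tau>) s))) \<le> ereal C"
    and bound_z: "AE s in lebesgue_on {0..S}. norm (snd (velocity (qv \<circ> \<tau>) s)) \<le> C"
begin

abbreviation "x \<equiv> qv \<circ> \<tau>"

definition Mr :: "real \<Rightarrow> real" where
  "Mr s = real_of_ereal (M_eps P \<epsilon> (\<tau> s) (x s) (deriv \<tau> s) (velocity x s))"

lemma tau_ends: "\<tau> 0 = 0" "\<tau> S = horizon P"
proof -
  have in_T: "\<tau> s \<in> {0..horizon P}" if "s \<in> {0..S}" for s using surj that by blast
  have "0 \<in> \<tau> ` {0..S}" "horizon P \<in> \<tau> ` {0..S}" using surj T_pos by simp_all
  then obtain s0 s1 where s: "s0 \<in> {0..S}" "\<tau> s0 = 0" "s1 \<in> {0..S}" "\<tau> s1 = horizon P"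
    unfolding image_iff by metis
  show "\<tau> 0 = 0" using mono_onD[OF mono, of 0 s0] s S in_T[of 0] by auto
  show "\<tau> S = horizon P" using mono_onD[OF mono, of s1 S] s S in_T[of S] by auto
qed

lemma tau_in: "s \<in> {0..S} \<Longrightarrow> \<tau> s \<in> {0..horizon P}" using surj by blast

lemma tau_cont: "continuous_on {0..S} \<tau>" using ac by (rule ac_on_imp_continuous_on)

text \<open>A finite value of \<open>M_eps\<close> by itself forces \<tau>' > 0 and a nonempty
  subdifferential, since \<open>M_eps\<close> is infinite otherwise.\<close>

lemma bound_ae: "AE s in lebesgue_on {0..S}. 0 < deriv \<tau> s \<and> deriv \<tau> s \<le> C \<and>
    frechet_subdiff P (\<tau> s) (x s) \<noteq> {} \<and> M_eps P \<epsilon> (\<tau> s) (x s) (deriv \<tau> s) (velocity x s) = ereal (Mr s) \<and>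
    0 \<le> Mr s \<and> Mr s \<le> C \<and> norm (fst (velocity x s)) \<le> C"
  using bound
proof eventually_elim
  case (elim s)
  let ?M = "M_eps P \<epsilon> (\<tau> s) (x s) (deriv \<tau> s) (velocity x s)"
  have *: "ereal (deriv \<tau> s) + ?M + ereal (norm (fst (velocity x s))) \<le> ereal C" using elim by simp
  have nn: "0 \<le> ?M" by (rule M_eps_nonneg[OF eps])
  have "?M \<noteq> \<infinity>" using * by auto
  then have M: "?M = ereal (Mr s)" "0 \<le> Mr s" unfolding Mr_def using nn by (cases ?M; auto)+
  have "?M \<le> ereal (Mr s)" using M by simp
  then have "0 < deriv \<tau> s" "frechet_subdiff P (\<tau> s) (x s) \<noteq> {}" by (rule M_eps_finiteD)+
  moreover have "deriv \<tau> s + Mr s + norm (fst (velocity x s)) \<le> C" using * M(1) by simp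
  moreover from calculation have "deriv \<tau> s \<le> C" "Mr s \<le> C" "norm (fst (velocity x s)) \<le> C"
    using M(2) norm_ge_zero[of "fst (velocity x s)"] by linarith+
  ultimately show ?case using M by auto
qed

lemma ac_qv: "ac_on 0 (horizon P) qv" using visc by (simp add: viscous_solution_def)

lemma ac_x: "ac_on 0 S x"
  using ac_on_compose[OF mono ac] ac_qv by (simp add: tau_ends)

lemma tau_lipschitz: "C-lipschitz_on {0..S} \<tau>"
proof (rule lipschitz_onI)
  have le: "\<tau> y - \<tau> z \<le> C * (y - z)" if "0 \<le> z" "z \<le> y" "y \<le> S" for y z
    by (rule ac_real_le[OF ac _ that]) (use bound_ae in \<open>auto elim: eventually_mono\<close>)
  fix y z assume yz: "y \<in> {0..S}" "z \<in> {0..S}"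
  show "dist (\<tau> y) (\<tau> z) \<le> C * dist y z"
    using le[of y z] le[of z y] yz mono_onD[OF mono, of y z] mono_onD[OF mono, of z y]
    by (cases "y \<le> z") (auto simp: dist_real_def abs_if)
qed (use C in simp)

lemma u_lipschitz: "C-lipschitz_on {0..S} (fst \<circ> x)"
proof (rule ac_on_lipschitz[OF refl_u ac_on_fst[OF ac_x]])
  show "AE s in lebesgue_on {0..S}. norm (vector_derivative (fst \<circ> x) (at s)) \<le> C"
    using bound_ae by eventually_elim (simp add: velocity_def)
qed (use S C in auto)

lemma z_lipschitz: "C-lipschitz_on {0..S} (snd \<circ> x)"
proof (rule ac_on_lipschitz[OF refl_z ac_on_snd[OF ac_x]])
  show "AE s in lebesgue_on {0..S}. norm (vector_derivative (snd \<circ> x) (at s)) \<le> C"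
    using bound_z by eventually_elim (simp add: velocity_def)
qed (use S C in auto)

lemma qv_cont: "continuous_on {0..horizon P} qv" using ac_qv by (rule ac_on_imp_continuous_on)

lemma power_integrable: "set_integrable lebesgue {0..horizon P} (\<lambda>r. dtE P r (qv r))"
  using visc by (simp add: viscous_solution_def)

text \<open>The dissipation in the balance of the viscous solution, in its own time and with the
  conjugates at the forces where \<open>M_eps\<close> has the slopes.\<close>

definition dens :: "(real \<Rightarrow> 'u dual) \<Rightarrow> (real \<Rightarrow> 'z dual) \<Rightarrow> real \<Rightarrow> ereal" where
  "dens \<mu> \<zeta> r = ereal (1 / \<epsilon> powr expo P) * Vu P (\<epsilon> powr expo P *\<^sub>R fst (velocity qv r)) + RZ P (snd (velocity qv r))
     + ereal (1 / \<epsilon>) * Vz P (\<epsilon> *\<^sub>R snd (velocity qv r))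
     + ereal (1 / \<epsilon> powr expo P) * conjugate (Vu P) (- \<mu> r) + ereal (1 / \<epsilon>) * Wz_conj P (- \<zeta> r)"

lemma visc_forces: obtains \<mu> \<zeta> where
  "AE r in lebesgue_on {0..horizon P}. (\<mu> r, \<zeta> r) \<in> frechet_subdiff P r (qv r) \<and>
     - \<mu> r \<in> convex_subdiff (Vu P) (\<epsilon> powr expo P *\<^sub>R fst (velocity qv r)) \<and>
     (\<exists>\<sigma>\<in>convex_subdiff (RZ P) (snd (velocity qv r)). \<exists>\<omega>\<in>convex_subdiff (Vz P) (\<epsilon> *\<^sub>R snd (velocity qv r)). - \<zeta> r = \<sigma> + \<omega>)"
  "\<And>t. 0 < t \<Longrightarrow> t \<le> horizon P \<Longrightarrow>
     En P t (qv t) + enn2ereal (\<integral>\<^sup>+ r\<in>{0..t}. e2ennreal (dens \<mu> \<zeta> r) \<partial>lebesgue)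
     = En P 0 (qv 0) + ereal (LINT r:{0..t}|lebesgue. dtE P r (qv r))"
proof -
  from visc obtain \<mu> \<zeta> where
    1: "AE r in lebesgue_on {0..horizon P}. (\<mu> r, \<zeta> r) \<in> frechet_subdiff P r (qv r) \<and>
     - \<mu> r \<in> convex_subdiff (Vu P) (\<epsilon> powr expo P *\<^sub>R vector_derivative (fst \<circ> qv) (at r)) \<and>
     (\<exists>\<sigma>\<in>convex_subdiff (RZ P) (vector_derivative (snd \<circ> qv) (at r)).
        \<exists>\<omega>\<in>convex_subdiff (Vz P) (\<epsilon> *\<^sub>R vector_derivative (snd \<circ> qv) (at r)). - \<zeta> r = \<sigma> + \<omega>)"
    and 2: "\<forall>s t. 0 \<le> s \<and> s < t \<and> t \<le> horizon P \<longrightarrow>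
     En P t (qv t) + enn2ereal (\<integral>\<^sup>+ r\<in>{s..t}. e2ennreal (dens \<mu> \<zeta> r) \<partial>lebesgue)
     = En P s (qv s) + ereal (LINT r:{s..t}|lebesgue. dtE P r (qv r))"
    unfolding viscous_solution_def Let_def dens_def velocity_def fst_conv snd_conv by blast
  show thesis by (rule that[of \<mu> \<zeta>]) (use 1 2 in \<open>auto simp: velocity_def\<close>)
qed

text \<open>The dissipation integral is nonnegative; dropping it from the balance bounds the energy
  and shows that it stays finite.\<close>

lemma energy_upper:
  assumes t: "t \<in> {0..horizon P}"
  shows "qv t \<in> Dom P" "en t (qv t) \<le> en 0 (qv 0) + (LINT r:{0..t}|lebesgue. dtE P r (qv r))"
proof -
  have D0: "qv 0 \<in> Dom P" using init T_pos by (intro finite_energy_Dom[of 0]) auto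
  note E = Dom_energy(1)[OF D0, of 0]
  have "qv t \<in> Dom P \<and> en t (qv t) \<le> en 0 (qv 0) + (LINT r:{0..t}|lebesgue. dtE P r (qv r))"
  proof (cases "t = 0")
    case True
    have "(LINT r:{0..0::real}|lebesgue. dtE P r (qv r)) = 0"
      using set_integral_split[OF power_integrable, of 0 0] T_pos by simp
    then show ?thesis using D0 True by simp
  next
    case False
    obtain \<mu> \<zeta> where b: "\<And>t. 0 < t \<Longrightarrow> t \<le> horizon P \<Longrightarrow>
     En P t (qv t) + enn2ereal (\<integral>\<^sup>+ r\<in>{0..t}. e2ennreal (dens \<mu> \<zeta> r) \<partial>lebesgue)
     = En P 0 (qv 0) + ereal (LINT r:{0..t}|lebesgue. dtE P r (qv r))"
      by (rule visc_forces) (rule that)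
    define I where "I = enn2ereal (\<integral>\<^sup>+ r\<in>{0..t}. e2ennreal (dens \<mu> \<zeta> r) \<partial>lebesgue)"
    have I0: "0 \<le> I" by (simp add: I_def)
    have eq: "En P t (qv t) + I = ereal (en 0 (qv 0) + (LINT r:{0..t}|lebesgue. dtE P r (qv r)))"
      using b[of t] t False E T_pos by (simp add: I_def)
    then have "En P t (qv t) \<noteq> \<infinity>" using I0 by auto
    then have D: "qv t \<in> Dom P" by (rule finite_energy_Dom[OF t])
    then show ?thesis using eq Dom_energy(1)[OF D t] I0 by (cases I) auto
  qed
  then show "qv t \<in> Dom P" "en t (qv t) \<le> en 0 (qv 0) + (LINT r:{0..t}|lebesgue. dtE P r (qv r))" by auto
qed

text \<open>Gronwall's inequality for the continuous majorant \<open>G\<close> of the energy along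
  the solution produces the inner exponential factor; the outer one comes from
  \<open>energy_exp\<close>, which passes from the time t to all other times.\<close>

lemma Esup_qv:
  assumes K: "0 < K" "\<And>q t. q \<in> Dom P \<Longrightarrow> t \<in> {0..horizon P} \<Longrightarrow> \<bar>dtE P t q\<bar> \<le> K * en t q"
    and t: "t \<in> {0..horizon P}"
  shows "Esup P (qv t) \<le> ereal (exp (K * horizon P) * (exp (K * horizon P) * E0))"
proof -
  let ?T = "horizon P" and ?d = "\<lambda>r. dtE P r (qv r)"
  have dint: "?d integrable_on {0..?T}" using power_integrable by (rule set_lebesgue_integral_eq_integral(1))
  define G where "G t = en 0 (qv 0) + integral {0..t} ?d" for t
  have LI: "(LINT r:{0..t}|lebesgue. ?d r) = integral {0..t} ?d" if "t \<in> {0..?T}" for t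
    using set_integral_split[OF power_integrable, of 0 t] that by simp
  have eG: "en t (qv t) \<le> G t" if "t \<in> {0..?T}" for t using energy_upper(2)[OF that] LI[OF that] by (simp add: G_def)
  have contG: "continuous_on {0..?T} G" unfolding G_def
    by (intro continuous_intros indefinite_integral_continuous_1 dint)
  have "G t \<le> en 0 (qv 0) * exp (K * t)"
  proof (rule gronwall_integral[OF contG less_imp_le[OF K(1)] _ t])
    fix t assume t: "t \<in> {0..?T}"
    have "integral {0..t} ?d \<le> integral {0..t} (\<lambda>r. K * G r)"
    proof (rule integral_le)
      show "?d integrable_on {0..t}" using dint by (rule integrable_subinterval_real) (use t in auto)
      have "continuous_on {0..t} G" using contG by (rule continuous_on_subset) (use t in auto)
      then show "(\<lambda>r. K * G r) integrable_on {0..t}" by (intro integrable_continuous_real continuous_intros)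
      fix r assume "r \<in> {0..t}"
      then have r: "r \<in> {0..?T}" using t by auto
      have "?d r \<le> K * en r (qv r)" using K(2)[OF energy_upper(1)[OF r] r] by linarith
      also have "\<dots> \<le> K * G r" using eG[OF r] K(1) by simp
      finally show "?d r \<le> K * G r" .
    qed
    then show "G t \<le> en 0 (qv 0) + integral {0..t} (\<lambda>r. K * G r)" by (simp add: G_def)
  qed
  moreover have D0: "qv 0 \<in> Dom P" "0 \<in> {0..?T}" using energy_upper(1)[of 0] T_pos by auto
  moreover have e0: "0 < en 0 (qv 0)" "en 0 (qv 0) \<le> E0" using Dom_energy[OF D0] init by auto
  moreover have "exp (K * t) \<le> exp (K * ?T)" using t K(1) by simp
  ultimately have "en t (qv t) \<le> E0 * exp (K * ?T)"
    using eG[OF t] mult_mono[of "en 0 (qv 0)" E0 "exp (K * t)" "exp (K * ?T)"] by simp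
  then have "en t (qv t) \<le> exp (K * ?T) * E0" by (simp only: mult.commute)
  then have *: "exp (K * ?T) * en t (qv t) \<le> exp (K * ?T) * (exp (K * ?T) * E0)" by (rule mult_left_mono) simp
  show ?thesis
    unfolding Esup_def
  proof (rule SUP_least)
    fix s assume s: "s \<in> {0..?T}"
    have "en s (qv t) \<le> exp (K * ?T) * en t (qv t)" by (rule energy_exp[OF K energy_upper(1)[OF t] t s])
    then show "En P s (qv t) \<le> ereal (exp (K * ?T) * (exp (K * ?T) * E0))"
      unfolding Dom_energy(1)[OF energy_upper(1)[OF t] s] ereal_less_eq using * by (rule order_trans)
  qed
qed

lemma Esup_x_ex: obtains M where "\<And>t. t \<in> {0..horizon P} \<Longrightarrow> Esup P (qv t) \<le> ereal M"
proof -
  obtain K where "0 < K" "\<And>q t. q \<in> Dom P \<Longrightarrow> t \<in> {0..horizon P} \<Longrightarrow> \<bar>dtE P t q\<bar> \<le> K * en t q"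
    by (rule power_bound) (rule that)
  from Esup_qv[OF this] that show thesis by blast
qed

text \<open>Null sets of times pull back to null sets because \<open>\<tau>' > 0\<close> almost everywhere.\<close>

lemma velocity_chain: "AE s in lebesgue_on {0..S}. velocity x s = deriv \<tau> s *\<^sub>R velocity qv (\<tau> s)"
proof -
  have "AE r in lebesgue_on {0..horizon P}.
      ((fst \<circ> qv) has_vector_derivative vector_derivative (fst \<circ> qv) (at r)) (at r) \<and>
      ((snd \<circ> qv) has_vector_derivative vector_derivative (snd \<circ> qv) (at r)) (at r)"
    using ac_on_differentiable_ae(1)[OF refl_u ac_on_fst[OF ac_qv]] ac_on_differentiable_ae(1)[OF refl_z ac_on_snd[OF ac_qv]] T_pos
    by (simp add: AE_conj_iff)
  then have "AE r in lebesgue_on {\<tau> 0..\<tau> S}.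
      ((fst \<circ> qv) has_vector_derivative vector_derivative (fst \<circ> qv) (at r)) (at r) \<and>
      ((snd \<circ> qv) has_vector_derivative vector_derivative (snd \<circ> qv) (at r)) (at r)" by (simp only: tau_ends)
  from AE_time_rescaling[OF mono ac less_imp_le[OF S] this] ac_real_FTC(1)[OF ac less_imp_le[OF S]] bound_ae
  show ?thesis
  proof eventually_elim
    case (elim s)
    have \<tau>: "(\<tau> has_vector_derivative deriv \<tau> s) (at s)"
      using elim(2) by (simp add: has_real_derivative_iff_has_vector_derivative)
    have "(((fst \<circ> qv) \<circ> \<tau>) has_vector_derivative deriv \<tau> s *\<^sub>R vector_derivative (fst \<circ> qv) (at (\<tau> s))) (at s)"
      "(((snd \<circ> qv) \<circ> \<tau>) has_vector_derivative deriv \<tau> s *\<^sub>R vector_derivative (snd \<circ> qv) (at (\<tau> s))) (at s)"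
      using elim(1,3) by (auto intro: vector_diff_chain_at[OF \<tau>])
    then show ?case by (simp add: velocity_def comp_assoc vector_derivative_at)
  qed
qed

lemma M_eps_homogeneous:
  assumes "0 < t'" "frechet_subdiff P t q \<noteq> {}"
  shows "e2ennreal (M_eps P \<epsilon> t q t' (t' *\<^sub>R v)) = e2ennreal (M_eps P \<epsilon> t q 1 v) * ennreal t'"
proof -
  let ?\<delta> = "\<epsilon> powr expo P"
  have \<delta>: "0 < ?\<delta>" using eps by simp
  define m where "m = 1 / ?\<delta> * vu (?\<delta> *\<^sub>R fst v) + 1 / ?\<delta> * su t q + rz (snd v) + 1 / \<epsilon> * vz (\<epsilon> *\<^sub>R snd v) + 1 / \<epsilon> * sz t q"
  have m0: "0 \<le> m" using \<delta> eps Vu_real(2) Vz_real(2) RZ_real(2) slope_real(3,4)[OF assms(2)] by (simp add: m_def)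
  have 1: "M_eps P \<epsilon> t q 1 v = ereal m"
    using M_eps_real[OF eps zero_less_one assms(2), of v] by (simp add: m_def)
  have "M_eps P \<epsilon> t q t' (t' *\<^sub>R v) = ereal (t' * m)"
    unfolding M_eps_real[OF eps assms] m_def using assms(1) \<delta> eps by (simp add: rz_scale field_simps)
  then show ?thesis unfolding 1 using m0 assms(1) by (simp add: e2ennreal_ereal ennreal_mult' mult.commute ennreal_mult'')
qed

lemma velocity_measurable:
  "(\<lambda>s. fst (velocity x s)) \<in> borel_measurable (lebesgue_on {0..S})"
  "(\<lambda>s. snd (velocity x s)) \<in> borel_measurable (lebesgue_on {0..S})"
  using ac_on_differentiable_ae(2)[OF refl_u ac_on_fst[OF ac_x]] ac_on_differentiable_ae(2)[OF refl_z ac_on_snd[OF ac_x]] S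
  by (simp_all add: velocity_def)

lemma Mr_measurable: "Mr \<in> borel_measurable (lebesgue_on {0..S})"
proof -
  obtain M where M: "\<And>t. t \<in> {0..horizon P} \<Longrightarrow> Esup P (qv t) \<le> ereal M" by (rule Esup_x_ex) (rule that)
  have dm: "deriv \<tau> \<in> borel_measurable (lebesgue_on {0..S})"
    using rescaling_measurable(2)[OF ac _ borel_measurable_const] S by simp
  have "(\<lambda>s. M_eps P \<epsilon> (\<tau> s) (x s) (deriv \<tau> s) (fst (velocity x s), snd (velocity x s))) \<in> borel_measurable (lebesgue_on {0..S})"
  proof (rule M_eps_measurable[OF eps tau_cont tau_in _ _ dm velocity_measurable])
    show "weakly_cont_on {0..S} x" using ac_on_imp_continuous_on[OF ac_x] by (rule continuous_imp_weakly_cont_on)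
    show "Esup P (x s) \<le> ereal M" if "s \<in> {0..S}" for s using M tau_in[OF that] by simp
  qed
  then show ?thesis unfolding Mr_def[abs_def] by (simp add: borel_measurable_real_of_ereal)
qed

lemma Mr_integrable: "set_integrable lebesgue {0..S} Mr"
  unfolding set_integrable_lebesgue_on
proof (rule Bochner_Integration.integrable_bound[OF _ Mr_measurable])
  show "integrable (lebesgue_on {0..S}) (\<lambda>s. C)"
    using set_integrable_const_interval[of 0 S C] by (simp only: set_integrable_lebesgue_on)
  show "AE s in lebesgue_on {0..S}. norm (Mr s) \<le> norm C" using bound_ae by eventually_elim (use C in simp)
qed

lemma nn_integral_M_eps:
  assumes "0 \<le> a" "b \<le> S"
  shows "(\<integral>\<^sup>+ s\<in>{a..b}. e2ennreal (M_eps P \<epsilon> (\<tau> s) (x s) (deriv \<tau> s) (velocity x s)) \<partial>lebesgue) = ennreal (LINT s:{a..b}|lebesgue. Mr s)"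
proof -
  have ae: "AE s in lebesgue_on {a..b}. M_eps P \<epsilon> (\<tau> s) (x s) (deriv \<tau> s) (velocity x s) = ereal (Mr s) \<and> 0 \<le> Mr s"
    by (rule AE_lebesgue_on_subinterval[OF _ assms]) (use bound_ae in \<open>auto elim: eventually_mono\<close>)
  have i: "integrable (lebesgue_on {a..b}) Mr"
    using set_integrable_subset[OF Mr_integrable, of "{a..b}"] assms by (simp add: set_integrable_lebesgue_on)
  have "(\<integral>\<^sup>+ s. e2ennreal (M_eps P \<epsilon> (\<tau> s) (x s) (deriv \<tau> s) (velocity x s)) \<partial>lebesgue_on {a..b}) = (\<integral>\<^sup>+ s. ennreal (Mr s) \<partial>lebesgue_on {a..b})"
    using ae by (intro nn_integral_cong_AE) (auto elim!: eventually_mono simp: e2ennreal_ereal)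
  also have "\<dots> = ennreal (LINT s|lebesgue_on {a..b}. Mr s)"
    using i by (rule nn_integral_eq_integral) (use ae in \<open>auto elim: eventually_mono\<close>)
  finally show ?thesis by (simp add: nn_integral_lebesgue_on set_integral_lebesgue_on)
qed

lemma restrict_rescaling:
  assumes "s \<in> {0..S}" shows "mono_on {0..s} \<tau>" "ac_on 0 s \<tau>"
proof -
  show "mono_on {0..s} \<tau>" by (rule mono_on_subset[OF mono]) (use assms in auto)
  show "ac_on 0 s \<tau>" by (rule ac_wrt_subinterval[OF ac]) (use assms in auto)
qed

text \<open>The slopes are dominated by the conjugates at the forces of the viscous solution, and
  \<open>M\<^sub>\<epsilon>\<close> is one-homogeneous in \<open>(t', q')\<close>.\<close>

theorem rescaled_energy_inequality:
  assumes s: "s \<in> {0..S}"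
  shows "en (\<tau> s) (x s) + (LINT r:{0..s}|lebesgue. Mr r) \<le> en 0 (qv 0) + (LINT r:{0..s}|lebesgue. dtE P (\<tau> r) (x r) * deriv \<tau> r)"
proof (cases "\<tau> s = 0")
  case True
  \<comment> \<open>\<open>visc_forces\<close> states the balance for positive times only. If s were
    positive, \<tau> would vanish on {0..s}, against \<tau>' > 0 almost everywhere.\<close>
  have Z: "s = 0"
  proof (rule ccontr)
    assume "s \<noteq> 0"
    have z: "\<tau> r = 0" if "r \<in> {0..s}" for r
      using mono_onD[OF mono, of 0 r] mono_onD[OF mono, of r s] that s True tau_ends by auto
    have "AE r in lebesgue_on {0..s}. deriv \<tau> r = 0"
      using AE_lebesgue_on_interior
    proof eventually_elim
      case (elim r)
      have "(\<tau> has_real_derivative 0) (at r)"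
        by (rule has_field_derivative_transform_within_open[OF DERIV_const open_greaterThanLessThan[of 0 s]]) (use elim z in auto)
      then show ?case by (rule DERIV_imp_deriv)
    qed
    moreover have "AE r in lebesgue_on {0..s}. 0 < deriv \<tau> r"
      by (rule AE_lebesgue_on_subinterval[where a = 0 and b = S]) (use bound_ae s in \<open>auto elim: eventually_mono\<close>)
    ultimately have "AE r in lebesgue_on {0..s}. False" by eventually_elim simp
    then have "negligible {r \<in> {0..s}. \<not> False}" unfolding AE_lebesgue_on_iff_negligible .
    then have "negligible {0..s}" by (rule negligible_subset) auto
    then show False using s \<open>s \<noteq> 0\<close> by (simp add: negligible_interval(1)[of 0 s, simplified])
  qed
  have "(LINT r:{0..0::real}|lebesgue. f r) = 0" if "set_integrable lebesgue {0..S} f" for f :: "real \<Rightarrow> real"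
    using set_integral_split[OF that, of 0 0] S by simp
  moreover have "set_integrable lebesgue {0..S} (\<lambda>r. dtE P (\<tau> r) (x r) * deriv \<tau> r)"
    using integral_time_rescaling(1)[OF mono ac less_imp_le[OF S], of "\<lambda>r. dtE P r (qv r)"] power_integrable by (simp add: tau_ends)
  ultimately show ?thesis using Z Mr_integrable tau_ends by simp
next
  case False
  let ?t = "\<tau> s"
  have t: "0 < ?t" "?t \<le> horizon P" "?t \<in> {0..horizon P}" using tau_in[OF s] False by auto
  obtain M where M: "\<And>t. t \<in> {0..horizon P} \<Longrightarrow> Esup P (qv t) \<le> ereal M" by (rule Esup_x_ex) (rule that)
  obtain \<mu> \<zeta> where f: "AE r in lebesgue_on {0..horizon P}. (\<mu> r, \<zeta> r) \<in> frechet_subdiff P r (qv r) \<and>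
     - \<mu> r \<in> convex_subdiff (Vu P) (\<epsilon> powr expo P *\<^sub>R fst (velocity qv r)) \<and>
     (\<exists>\<sigma>\<in>convex_subdiff (RZ P) (snd (velocity qv r)). \<exists>\<omega>\<in>convex_subdiff (Vz P) (\<epsilon> *\<^sub>R snd (velocity qv r)). - \<zeta> r = \<sigma> + \<omega>)"
    and b: "\<And>t. 0 < t \<Longrightarrow> t \<le> horizon P \<Longrightarrow>
     En P t (qv t) + enn2ereal (\<integral>\<^sup>+ r\<in>{0..t}. e2ennreal (dens \<mu> \<zeta> r) \<partial>lebesgue)
     = En P 0 (qv 0) + ereal (LINT r:{0..t}|lebesgue. dtE P r (qv r))"
    by (rule visc_forces) (rule that)
  \<comment> \<open>The density \<open>M_eps\<close> in physical time, that is with t' = 1,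
    truncated to \<open>ennreal\<close> for the change of variables.\<close>
  define N where "N r = e2ennreal (M_eps P \<epsilon> r (qv r) 1 (velocity qv r))" for r
  have Nm: "N \<in> borel_measurable (lebesgue_on {0..horizon P})"
  proof -
    have "(\<lambda>r. M_eps P \<epsilon> r (qv r) 1 (fst (velocity qv r), snd (velocity qv r))) \<in> borel_measurable (lebesgue_on {0..horizon P})"
    proof (rule M_eps_measurable[OF eps, where M = M])
      show "weakly_cont_on {0..horizon P} qv" using qv_cont by (rule continuous_imp_weakly_cont_on)
      show "(\<lambda>r. fst (velocity qv r)) \<in> borel_measurable (lebesgue_on {0..horizon P})"
        "(\<lambda>r. snd (velocity qv r)) \<in> borel_measurable (lebesgue_on {0..horizon P})"
        using ac_on_differentiable_ae(2)[OF refl_u ac_on_fst[OF ac_qv]] ac_on_differentiable_ae(2)[OF refl_z ac_on_snd[OF ac_qv]] T_pos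
        by (simp_all add: velocity_def)
    qed (use M in auto)
    then show ?thesis unfolding N_def[abs_def] by simp
  qed
  have "N r \<le> e2ennreal (dens \<mu> \<zeta> r)" if fr: "(\<mu> r, \<zeta> r) \<in> frechet_subdiff P r (qv r)" for r
  proof -
    have ne: "frechet_subdiff P r (qv r) \<noteq> {}" using fr by auto
    have "M_eps P \<epsilon> r (qv r) 1 (velocity qv r) \<le> dens \<mu> \<zeta> r"
    proof -
      have "dens \<mu> \<zeta> r = ereal (1 / \<epsilon> powr expo P) * Vu P (\<epsilon> powr expo P *\<^sub>R fst (velocity qv r))
          + ereal (1 / \<epsilon> powr expo P) * conjugate (Vu P) (- \<mu> r) + RZ P (snd (velocity qv r))
          + ereal (1 / \<epsilon>) * Vz P (\<epsilon> *\<^sub>R snd (velocity qv r)) + ereal (1 / \<epsilon>) * Wz_conj P (- \<zeta> r)"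
        by (simp add: dens_def ac_simps)
      then show ?thesis
        unfolding M_eps_def Let_def using ne eps slope_le[OF fr]
        by (simp del: divide_ereal_def) (intro add_mono ereal_mult_left_mono order_refl; simp)
    qed
    then show ?thesis unfolding N_def by (rule e2ennreal_mono)
  qed
  then have "AE r in lebesgue_on {0..horizon P}. N r \<le> e2ennreal (dens \<mu> \<zeta> r)" using f by (auto elim: eventually_mono)
  then have "AE r in lebesgue_on {0..?t}. N r \<le> e2ennreal (dens \<mu> \<zeta> r)" by (rule AE_lebesgue_on_subinterval) (use t in auto)
  then have le1: "(\<integral>\<^sup>+ r\<in>{0..?t}. N r \<partial>lebesgue) \<le> (\<integral>\<^sup>+ r\<in>{0..?t}. e2ennreal (dens \<mu> \<zeta> r) \<partial>lebesgue)"
    unfolding nn_integral_lebesgue_on by (rule nn_integral_mono_AE)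
  have Nm': "N \<in> borel_measurable (lebesgue_on {\<tau> 0..\<tau> s})"
    using Nm by (rule measurable_restrict_mono) (use t tau_ends in auto)
  have s0: "0 \<le> s" using s by simp
  have eq1: "(\<integral>\<^sup>+ r\<in>{0..?t}. N r \<partial>lebesgue) = (\<integral>\<^sup>+ r\<in>{0..s}. N (\<tau> r) * ennreal (deriv \<tau> r) \<partial>lebesgue)"
    using nn_integral_time_rescaling[OF restrict_rescaling[OF s] s0 Nm'] by (simp add: tau_ends)
  have "AE r in lebesgue_on {0..S}. N (\<tau> r) * ennreal (deriv \<tau> r) = e2ennreal (M_eps P \<epsilon> (\<tau> r) (x r) (deriv \<tau> r) (velocity x r))"
    using velocity_chain bound_ae
  proof eventually_elim
    case (elim r)
    then show ?case using M_eps_homogeneous[of "deriv \<tau> r" "\<tau> r" "x r" "velocity qv (\<tau> r)"] by (simp add: N_def)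
  qed
  then have "AE r in lebesgue_on {0..s}. N (\<tau> r) * ennreal (deriv \<tau> r) = e2ennreal (M_eps P \<epsilon> (\<tau> r) (x r) (deriv \<tau> r) (velocity x r))"
    by (rule AE_lebesgue_on_subinterval) (use s in auto)
  then have eq2: "(\<integral>\<^sup>+ r\<in>{0..s}. N (\<tau> r) * ennreal (deriv \<tau> r) \<partial>lebesgue) = ennreal (LINT r:{0..s}|lebesgue. Mr r)"
    using nn_integral_M_eps[of 0 s] s unfolding nn_integral_lebesgue_on by (subst nn_integral_cong_AE) auto
  define I where "I = (\<integral>\<^sup>+ r\<in>{0..?t}. e2ennreal (dens \<mu> \<zeta> r) \<partial>lebesgue)"
  have MI: "ennreal (LINT r:{0..s}|lebesgue. Mr r) \<le> I" using le1 unfolding eq1 eq2 I_def .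
  have Mr0: "0 \<le> (LINT r:{0..s}|lebesgue. Mr r)"
  proof -
    have "(LINT r:{0..s}|lebesgue. 0) \<le> (LINT r:{0..s}|lebesgue. Mr r)"
      by (rule set_integral_mono_AE[OF _ Mr_integrable]) (use bound_ae s in \<open>auto elim: eventually_mono\<close>)
    then show ?thesis by (simp add: set_lebesgue_integral_def)
  qed
  have D0: "qv 0 \<in> Dom P" using energy_upper(1)[of 0] T_pos by simp
  have "ereal (en ?t (qv ?t)) + enn2ereal I = ereal (en 0 (qv 0) + (LINT r:{0..?t}|lebesgue. dtE P r (qv r)))"
    using b[OF t(1,2)] Dom_energy(1)[OF D0] Dom_energy(1)[OF energy_upper(1)[OF t(3)] t(3)] T_pos by (simp add: I_def)
  moreover have "ereal (LINT r:{0..s}|lebesgue. Mr r) \<le> enn2ereal I"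
    using MI Mr0 by (metis e2ennreal_enn2ereal enn2ereal_ennreal less_eq_ennreal.rep_eq)
  ultimately have "en ?t (qv ?t) + (LINT r:{0..s}|lebesgue. Mr r) \<le> en 0 (qv 0) + (LINT r:{0..?t}|lebesgue. dtE P r (qv r))"
    by (cases "enn2ereal I") auto
  moreover have "(LINT r:{0..s}|lebesgue. dtE P (\<tau> r) (qv (\<tau> r)) * deriv \<tau> r) = (LINT r:{0..?t}|lebesgue. dtE P r (qv r))"
  proof -
    have "set_integrable lebesgue {\<tau> 0..\<tau> s} (\<lambda>r. dtE P r (qv r))"
      by (rule set_integrable_subset[OF power_integrable]) (use t tau_ends in auto)
    from integral_time_rescaling(2)[OF restrict_rescaling[OF s] s0 this] show ?thesis by (simp add: tau_ends)
  qed
  ultimately show ?thesis by simp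
qed

text \<open>The physical velocity is the rescaled one divided by \<tau>'. Where \<tau>' >= \<eta>,
  the arguments of the subdifferentials therefore have norm at most eps^alpha C / \<eta> and eps C /
  \<eta>, both at most 1, and subgradients there are bounded.\<close>

lemma bounded_forces:
  assumes Ku: "\<And>v \<xi>. norm v \<le> 1 \<Longrightarrow> \<xi> \<in> convex_subdiff (Vu P) v \<Longrightarrow> norm \<xi> \<le> Ku"
    and Kz: "\<And>v \<xi>. norm v \<le> 1 \<Longrightarrow> \<xi> \<in> convex_subdiff (Vz P) v \<Longrightarrow> norm \<xi> \<le> Kz"
    and KR: "\<And>v \<xi>. \<xi> \<in> convex_subdiff (RZ P) v \<Longrightarrow> norm \<xi> \<le> KR"
    and \<eta>: "0 < \<eta>" "\<epsilon> powr expo P * C \<le> \<eta>" "\<epsilon> * C \<le> \<eta>"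
  shows "AE s in lebesgue_on {0..S}. \<eta> \<le> deriv \<tau> s \<longrightarrow>
    (\<exists>\<mu> \<zeta>. (\<mu>, \<zeta>) \<in> frechet_subdiff P (\<tau> s) (x s) \<and> norm \<mu> \<le> Ku \<and> norm \<zeta> \<le> KR + Kz)"
proof -
  let ?\<delta> = "\<epsilon> powr expo P"
  obtain \<mu> \<zeta> where f: "AE r in lebesgue_on {0..horizon P}. (\<mu> r, \<zeta> r) \<in> frechet_subdiff P r (qv r) \<and>
     - \<mu> r \<in> convex_subdiff (Vu P) (?\<delta> *\<^sub>R fst (velocity qv r)) \<and>
     (\<exists>\<sigma>\<in>convex_subdiff (RZ P) (snd (velocity qv r)). \<exists>\<omega>\<in>convex_subdiff (Vz P) (\<epsilon> *\<^sub>R snd (velocity qv r)). - \<zeta> r = \<sigma> + \<omega>)"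
    by (rule visc_forces) (rule that)
  then have f': "AE r in lebesgue_on {\<tau> 0..\<tau> S}. (\<mu> r, \<zeta> r) \<in> frechet_subdiff P r (qv r) \<and>
     - \<mu> r \<in> convex_subdiff (Vu P) (?\<delta> *\<^sub>R fst (velocity qv r)) \<and>
     (\<exists>\<sigma>\<in>convex_subdiff (RZ P) (snd (velocity qv r)). \<exists>\<omega>\<in>convex_subdiff (Vz P) (\<epsilon> *\<^sub>R snd (velocity qv r)). - \<zeta> r = \<sigma> + \<omega>)"
    by (simp only: tau_ends)
  from AE_time_rescaling[OF mono ac less_imp_le[OF S] f'] velocity_chain bound_ae bound_z
  show ?thesis
  proof eventually_elim
    case (elim s)
    show ?case
    proof
      assume le: "\<eta> \<le> deriv \<tau> s"
      let ?r = "\<tau> s"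
      have scaled: "norm (c *\<^sub>R v) \<le> 1" if "norm (deriv \<tau> s *\<^sub>R v) \<le> C" "0 < c" "c * C \<le> \<eta>" for c and v :: "'w::real_normed_vector"
      proof -
        have "\<eta> * norm (c *\<^sub>R v) \<le> deriv \<tau> s * norm (c *\<^sub>R v)" using le by (intro mult_right_mono) auto
        also have "\<dots> = c * norm (deriv \<tau> s *\<^sub>R v)" using that(2) le \<eta>(1) by simp
        also have "\<dots> \<le> c * C" using that(1,2) by (intro mult_left_mono) auto
        also have "\<dots> \<le> \<eta> * 1" using that(3) by simp
        finally show ?thesis using \<eta>(1) by simp
      qed
      have f: "(\<mu> ?r, \<zeta> ?r) \<in> frechet_subdiff P ?r (qv ?r)" "- \<mu> ?r \<in> convex_subdiff (Vu P) (?\<delta> *\<^sub>R fst (velocity qv ?r))"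
        using elim(1,3) by auto
      obtain \<sigma> \<omega> where \<sigma>\<omega>: "\<sigma> \<in> convex_subdiff (RZ P) (snd (velocity qv ?r))" "\<omega> \<in> convex_subdiff (Vz P) (\<epsilon> *\<^sub>R snd (velocity qv ?r))" "- \<zeta> ?r = \<sigma> + \<omega>"
        using elim(1,3) by auto
      have "norm (?\<delta> *\<^sub>R fst (velocity qv ?r)) \<le> 1" using elim(2,3) eps \<eta>(2) by (intro scaled) auto
      then have "norm (- \<mu> ?r) \<le> Ku" using Ku f(2) by blast
      moreover have "norm (\<epsilon> *\<^sub>R snd (velocity qv ?r)) \<le> 1" using elim(2,4) eps \<eta>(3) by (intro scaled) auto
      then have "norm \<omega> \<le> Kz" using Kz \<sigma>\<omega>(2) by blast
      moreover have "norm \<sigma> \<le> KR" using KR \<sigma>\<omega>(1) by blast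
      moreover have "norm (- \<zeta> ?r) \<le> norm \<sigma> + norm \<omega>" unfolding \<sigma>\<omega>(3) by (rule norm_triangle_ineq)
      ultimately show "\<exists>\<mu> \<zeta>. (\<mu>, \<zeta>) \<in> frechet_subdiff P (\<tau> s) (x s) \<and> norm \<mu> \<le> Ku \<and> norm \<zeta> \<le> KR + Kz"
        using f(1) by (intro exI[of _ "\<mu> ?r"] exI[of _ "\<zeta> ?r"]) auto
    qed
  qed
qed

end

section \<open>The vanishing-viscosity limit\<close>

text \<open>Makes the weak-star theorem for Lipschitz curves applicable to the scalar
  rescalings.\<close>

lemma reflexive_real: "reflexive_space TYPE(real)"
  unfolding reflexive_space_def
proof
  fix \<Phi> :: "real dual dual"
  have "blinfun_apply \<Phi> \<phi> = blinfun_apply \<phi> (blinfun_apply \<Phi> id_blinfun)" for \<phi> :: "real dual"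
  proof -
    have "\<phi> = blinfun_apply \<phi> 1 *\<^sub>R id_blinfun"
      by (rule blinfun_eqI) (metis blinfun.scaleR_left blinfun.scaleR_right id_blinfun.rep_eq mult.commute mult.right_neutral real_scaleR_def)
    then have "blinfun_apply \<Phi> \<phi> = blinfun_apply \<phi> 1 * blinfun_apply \<Phi> id_blinfun"
      by (metis blinfun.scaleR_right real_scaleR_def)
    also have "\<dots> = blinfun_apply \<phi> (blinfun_apply \<Phi> id_blinfun)"
      by (metis blinfun.scaleR_right mult.commute mult.right_neutral real_scaleR_def)
    finally show ?thesis .
  qed
  then show "\<exists>x. \<forall>\<phi>. blinfun_apply \<Phi> \<phi> = blinfun_apply \<phi> x" by blast
qed

text \<open>The common Lipschitz constant absorbs the displacement of the evaluation points.
  \<kappa> is any index sequence tending to infinity, monotone or not, as it arises from negated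
  uniform statements.\<close>

lemma lipschitz_moving_tendsto:
  fixes f :: "nat \<Rightarrow> real \<Rightarrow> 'a::metric_space"
  assumes lip: "\<And>k. L-lipschitz_on A (f k)" and pt: "(\<lambda>k. f k l) \<longlonglongrightarrow> g"
    and s: "\<And>j. s j \<in> A" "s \<longlonglongrightarrow> l" "l \<in> A" and \<kappa>: "filterlim \<kappa> sequentially sequentially"
  shows "(\<lambda>j. f (\<kappa> j) (s j)) \<longlonglongrightarrow> g"
proof -
  have "(\<lambda>j. f (\<kappa> j) l) \<longlonglongrightarrow> g" using filterlim_compose[OF pt \<kappa>] .
  moreover have "(\<lambda>j. dist (f (\<kappa> j) l) (f (\<kappa> j) (s j))) \<longlonglongrightarrow> 0"
  proof (rule Lim_null_comparison)
    have "(\<lambda>j. L * dist l (s j)) \<longlonglongrightarrow> L * dist l l" by (intro tendsto_intros s)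
    then show "(\<lambda>j. L * dist l (s j)) \<longlonglongrightarrow> 0" by simp
    show "\<forall>\<^sub>F j in sequentially. norm (dist (f (\<kappa> j) l) (f (\<kappa> j) (s j))) \<le> L * dist l (s j)"
      using lipschitz_onD[OF lip s(3,1)] by (intro always_eventually) auto
  qed
  ultimately have "(\<lambda>j. dist (f (\<kappa> j) l) (f (\<kappa> j) (s j)) + dist (f (\<kappa> j) l) g) \<longlonglongrightarrow> 0 + 0"
    by (intro tendsto_add iffD1[OF tendsto_dist_iff])
  then have lim: "(\<lambda>j. dist (f (\<kappa> j) l) (f (\<kappa> j) (s j)) + dist (f (\<kappa> j) l) g) \<longlonglongrightarrow> 0" by simp
  show ?thesis
    unfolding tendsto_dist_iff[of _ g]
    by (rule Lim_null_comparison[OF _ lim]) (intro always_eventually allI, simp add: dist_triangle3)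
qed

lemma blinfun_lipschitz:
  assumes "L-lipschitz_on A f" shows "(norm \<phi> * L)-lipschitz_on A (\<lambda>s. blinfun_apply \<phi> (f s))"
proof (rule lipschitz_onI)
  fix x y assume xy: "x \<in> A" "y \<in> A"
  have "dist (blinfun_apply \<phi> (f x)) (blinfun_apply \<phi> (f y)) \<le> norm \<phi> * dist (f x) (f y)"
    unfolding dist_norm using norm_blinfun[of \<phi> "f x - f y"] by (simp add: blinfun.diff_right)
  also have "\<dots> \<le> norm \<phi> * (L * dist x y)" by (intro mult_left_mono lipschitz_onD[OF assms] xy) auto
  finally show "dist (blinfun_apply \<phi> (f x)) (blinfun_apply \<phi> (f y)) \<le> norm \<phi> * L * dist x y" by (simp add: mult.assoc)
qed (use lipschitz_on_nonneg[OF assms] in simp)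

text \<open>Large multiples of a functional that is positive at v would violate the bound. This is
  how the vanishing of a velocity is concluded.\<close>

lemma all_functionals_bounded_imp_zero:
  fixes v :: "'a::real_normed_vector"
  assumes "\<And>\<phi> :: 'a dual. blinfun_apply \<phi> v \<le> m" shows "v = 0"
proof (rule functional_zero_imp_zero)
  have pos: "blinfun_apply \<phi> v \<le> 0" for \<phi> :: "'a dual"
  proof (rule ccontr)
    assume "\<not> ?thesis"
    then have p: "0 < blinfun_apply \<phi> v" by simp
    define n where "n = (\<bar>m\<bar> + 1) / blinfun_apply \<phi> v"
    have "blinfun_apply (n *\<^sub>R \<phi>) v = \<bar>m\<bar> + 1" using p by (simp add: n_def blinfun.scaleR_left)
    then show False using assms[of "n *\<^sub>R \<phi>"] by simp
  qed
  show "blinfun_apply \<phi> v = 0" for \<phi> :: "'a dual"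
    using pos[of \<phi>] pos[of "- \<phi>"] by (simp add: blinfun.minus_left)
qed

lemma lipschitz_limit:
  fixes f :: "nat \<Rightarrow> 'a::metric_space \<Rightarrow> 'b::metric_space"
  assumes lip: "\<And>k. c-lipschitz_on A (f k)" and pt: "\<And>s. s \<in> A \<Longrightarrow> (\<lambda>k. f k s) \<longlonglongrightarrow> g s"
  shows "c-lipschitz_on A g"
proof (rule lipschitz_onI)
  fix x y assume xy: "x \<in> A" "y \<in> A"
  show "dist (g x) (g y) \<le> c * dist x y"
    by (rule tendsto_upperbound[OF tendsto_dist[OF pt[OF xy(1)] pt[OF xy(2)]]])
      (use lipschitz_onD[OF lip xy] in \<open>auto intro: always_eventually\<close>)
qed (rule lipschitz_on_nonneg[OF lip])

lemma bounded_density_primitive: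
  fixes m :: "real \<Rightarrow> real"
  assumes i: "set_integrable lebesgue {a..b} m" and m: "AE s in lebesgue_on {a..b}. 0 \<le> m s \<and> m s \<le> c" and c: "0 \<le> c"
  defines "G \<equiv> \<lambda>x. LINT s:{a..x}|lebesgue. m s"
  shows "\<And>x y. a \<le> x \<Longrightarrow> x \<le> y \<Longrightarrow> y \<le> b \<Longrightarrow> (LINT s:{x..y}|lebesgue. m s) = G y - G x"
    and "\<And>x y. a \<le> x \<Longrightarrow> x \<le> y \<Longrightarrow> y \<le> b \<Longrightarrow> G x \<le> G y"
    and "c-lipschitz_on {a..b} G" and "a \<le> b \<Longrightarrow> G a = 0"
proof -
  show d: "(LINT s:{x..y}|lebesgue. m s) = G y - G x" if "a \<le> x" "x \<le> y" "y \<le> b" for x y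
    using set_integral_split[OF i that] set_integral_split[OF i, of a x] set_integral_split[OF i, of a y] that
    by (simp add: G_def)
  have le: "0 \<le> G y - G x" "G y - G x \<le> c * (y - x)" if xy: "a \<le> x" "x \<le> y" "y \<le> b" for x y
  proof -
    have "(LINT r:{x..y}|lebesgue. 0) \<le> (LINT r:{x..y}|lebesgue. m r)"
      by (rule set_integral_mono_AE[OF _ i _ xy(1,3)]) (use m in \<open>auto elim: eventually_mono\<close>)
    then show "0 \<le> G y - G x" using d[OF xy] by (simp add: set_lebesgue_integral_def)
    have "(LINT r:{x..y}|lebesgue. m r) \<le> (LINT r:{x..y}|lebesgue. c)"
      by (rule set_integral_mono_AE[OF i _ _ xy(1,3)]) (use m in \<open>auto elim: eventually_mono\<close>)
    then show "G y - G x \<le> c * (y - x)" using d[OF xy] xy by (simp add: set_integral_const_interval mult.commute)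
  qed
  show "a \<le> x \<Longrightarrow> x \<le> y \<Longrightarrow> y \<le> b \<Longrightarrow> G x \<le> G y" for x y using le(1) by simp
  show "c-lipschitz_on {a..b} G"
  proof (rule lipschitz_onI)
    fix x y assume "x \<in> {a..b}" "y \<in> {a..b}"
    then show "dist (G x) (G y) \<le> c * dist x y"
      using le[of x y] le[of y x] by (cases "x \<le> y") (auto simp: dist_real_def abs_if)
  qed (rule c)
  show "G a = 0" if "a \<le> b" using d[of a a] that by (simp add: G_def)
qed

text \<open>The situation after extraction of a subsequence: pointwise limits and bounds uniform in
  k. The viscous equation enters from here on through \<open>Esup_k\<close>, \<open>energy_k\<close>
  and \<open>forces\<close>.\<close>

locale limit_setting = rate_setting P
  for P :: "('u::{banach,second_countable_topology}, 'z::{banach,second_countable_topology},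
               'ue::banach, 'ze::banach, 'zri::{banach,second_countable_topology}) rate_system" +
  fixes \<epsilon> :: "nat \<Rightarrow> real" and tk :: "nat \<Rightarrow> real \<Rightarrow> real" and qk :: "nat \<Rightarrow> real \<Rightarrow> 'u \<times> 'z"
    and Mk :: "nat \<Rightarrow> real \<Rightarrow> real" and S C M :: real and t :: "real \<Rightarrow> real" and q :: "real \<Rightarrow> 'u \<times> 'z" and F :: "real \<Rightarrow> real"
  assumes chain: "H_chain_param P" and eps: "\<And>k. 0 < \<epsilon> k" "\<epsilon> \<longlonglongrightarrow> 0" and S: "0 < S" and C: "0 < C"
    and tk_mono: "\<And>k. mono_on {0..S} (tk k)" and tk_lip: "\<And>k. C-lipschitz_on {0..S} (tk k)"
    and tk_in: "\<And>k s. s \<in> {0..S} \<Longrightarrow> tk k s \<in> {0..horizon P}" and tk_0: "\<And>k. tk k 0 = 0"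
    and uk_lip: "\<And>k. C-lipschitz_on {0..S} (fst \<circ> qk k)" and zk_lip: "\<And>k. C-lipschitz_on {0..S} (snd \<circ> qk k)"
    and Esup_k: "\<And>k s. s \<in> {0..S} \<Longrightarrow> Esup P (qk k s) \<le> ereal M"
    and bound_ae: "\<And>k. AE s in lebesgue_on {0..S}. 0 < deriv (tk k) s \<and> deriv (tk k) s \<le> C \<and>
      frechet_subdiff P (tk k s) (qk k s) \<noteq> {} \<and>
      M_eps P (\<epsilon> k) (tk k s) (qk k s) (deriv (tk k) s) (velocity (qk k) s) = ereal (Mk k s) \<and> 0 \<le> Mk k s \<and> Mk k s \<le> C"
    and Mk_int: "\<And>k. set_integrable lebesgue {0..S} (Mk k)"
    and energy_k: "\<And>k s. s \<in> {0..S} \<Longrightarrow> en (tk k s) (qk k s) + (LINT r:{0..s}|lebesgue. Mk k r)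
      \<le> en 0 (qk k 0) + (LINT r:{0..s}|lebesgue. dtE P (tk k r) (qk k r) * deriv (tk k) r)"
    and forces: "\<And>\<eta>. 0 < \<eta> \<Longrightarrow> \<exists>K k0. \<forall>k\<ge>k0. AE s in lebesgue_on {0..S}. \<eta> \<le> deriv (tk k) s \<longrightarrow>
      (\<exists>\<mu> \<zeta>. (\<mu>, \<zeta>) \<in> frechet_subdiff P (tk k s) (qk k s) \<and> norm \<mu> \<le> K \<and> norm \<zeta> \<le> K)"
    and init: "(\<lambda>k. en 0 (qk k 0)) \<longlonglongrightarrow> en 0 (q 0)"
    and t_lim: "\<And>s. s \<in> {0..S} \<Longrightarrow> (\<lambda>k. tk k s) \<longlonglongrightarrow> t s"
    and u_lim: "\<And>s. s \<in> {0..S} \<Longrightarrow> weak_conv (\<lambda>k. fst (qk k s)) (fst (q s))"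
    and z_lim: "\<And>s. s \<in> {0..S} \<Longrightarrow> (\<lambda>k. snd (qk k s)) \<longlonglongrightarrow> snd (q s)"
    and F_lim: "\<And>s. s \<in> {0..S} \<Longrightarrow> (\<lambda>k. LINT r:{0..s}|lebesgue. Mk k r) \<longlonglongrightarrow> F s"
begin

abbreviation "L \<equiv> lebesgue_on {0..S}"

lemma q_lim: "s \<in> {0..S} \<Longrightarrow> weak_conv (\<lambda>k. qk k s) (q s)"
  using weak_conv_Pair[of "\<lambda>k. fst (qk k s)" "\<lambda>k. snd (qk k s)" "fst (q s)" "snd (q s)"] u_lim[of s] LIMSEQ_imp_weak_conv[OF z_lim, of s]
  by simp

lemma t_lip: "C-lipschitz_on {0..S} t" by (rule lipschitz_limit[OF tk_lip t_lim])

text \<open>The u-component converges only weakly, so the bound passes to the limit through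
  functionals of norm at most one.\<close>

lemma u_lip: "C-lipschitz_on {0..S} (fst \<circ> q)"
proof (rule lipschitz_onI)
  fix x y assume xy: "x \<in> {0..S}" "y \<in> {0..S}"
  have "norm (fst (q x) - fst (q y)) \<le> C * dist x y"
  proof (rule norm_le_functional)
    fix \<phi> :: "'u dual" assume \<phi>: "norm \<phi> \<le> 1"
    have "(\<lambda>k. blinfun_apply \<phi> (fst (qk k x)) - blinfun_apply \<phi> (fst (qk k y))) \<longlonglongrightarrow> blinfun_apply \<phi> (fst (q x)) - blinfun_apply \<phi> (fst (q y))"
      using u_lim[OF xy(1)] u_lim[OF xy(2)] by (intro tendsto_diff) (auto simp: weak_conv_def)
    then have "(\<lambda>k. blinfun_apply \<phi> (fst (qk k x) - fst (qk k y))) \<longlonglongrightarrow> blinfun_apply \<phi> (fst (q x) - fst (q y))"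
      by (simp add: blinfun.diff_right)
    moreover have "blinfun_apply \<phi> (fst (qk k x) - fst (qk k y)) \<le> C * dist x y" for k
    proof -
      have "blinfun_apply \<phi> (fst (qk k x) - fst (qk k y)) \<le> norm \<phi> * norm (fst (qk k x) - fst (qk k y))" by (rule blinfun_le_norm)
      also have "\<dots> \<le> 1 * norm (fst (qk k x) - fst (qk k y))" using \<phi> by (intro mult_right_mono) auto
      also have "\<dots> \<le> C * dist x y" using lipschitz_onD[OF uk_lip xy] by (simp add: dist_norm)
      finally show ?thesis .
    qed
    ultimately show "blinfun_apply \<phi> (fst (q x) - fst (q y)) \<le> C * dist x y"
      by (intro tendsto_upperbound) (auto intro: always_eventually)
  qed
  then show "dist ((fst \<circ> q) x) ((fst \<circ> q) y) \<le> C * dist x y" by (simp add: dist_norm)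
qed (use C in simp)

lemma z_lip: "C-lipschitz_on {0..S} (snd \<circ> q)"
  by (rule lipschitz_limit[where f = "\<lambda>k. snd \<circ> qk k", OF zk_lip]) (simp add: z_lim)

definition Fk :: "nat \<Rightarrow> real \<Rightarrow> real" where "Fk k s = (LINT r:{0..s}|lebesgue. Mk k r)"

lemma Fk_density: "AE s in L. 0 \<le> Mk k s \<and> Mk k s \<le> C" using bound_ae[of k] by (rule eventually_mono) blast

lemmas Fk_primitive = bounded_density_primitive[OF Mk_int Fk_density less_imp_le[OF C], folded Fk_def]
lemmas Fk_diff = Fk_primitive(1)

lemma F_lim': "s \<in> {0..S} \<Longrightarrow> (\<lambda>k. Fk k s) \<longlonglongrightarrow> F s" using F_lim by (simp add: Fk_def)

lemma F_incr: "0 \<le> x \<Longrightarrow> x \<le> y \<Longrightarrow> y \<le> S \<Longrightarrow> F x \<le> F y"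
  using Fk_primitive(2) by (intro LIMSEQ_le[OF F_lim' F_lim']) auto

lemma F_lip: "C-lipschitz_on {0..S} F" by (rule lipschitz_limit[OF Fk_primitive(3) F_lim'])

lemma F_0: "F 0 = 0"
proof -
  have "(\<lambda>k. 0) \<longlonglongrightarrow> F 0" using F_lim'[of 0] Fk_primitive(4) S by simp
  then show ?thesis using LIMSEQ_unique tendsto_const by blast
qed

lemma t_in: "s \<in> {0..S} \<Longrightarrow> t s \<in> {0..horizon P}"
  using closed_sequentially[of "{0..horizon P}" "\<lambda>k. tk k s" "t s"] tk_in t_lim by simp

lemma t_mono: "mono_on {0..S} t"
proof (rule mono_onI)
  fix x y assume xy: "x \<in> {0..S}" "y \<in> {0..S}" "x \<le> y"
  then show "t x \<le> t y" using mono_onD[OF tk_mono] by (intro LIMSEQ_le[OF t_lim t_lim]) auto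
qed

lemma t_0: "t 0 = 0" using t_lim[of 0] S by (simp add: tk_0 LIMSEQ_const_iff)

lemma Esup_q: "s \<in> {0..S} \<Longrightarrow> Esup P (q s) \<le> ereal M"
  using Esup_lsc[OF q_lim] Esup_k by blast

lemma weakly_cont_curve:
  assumes "C-lipschitz_on {0..S} (fst \<circ> x)" "C-lipschitz_on {0..S} (snd \<circ> x)"
  shows "weakly_cont_on {0..S} x"
proof -
  have "continuous_on {0..S} (\<lambda>s. (fst (x s), snd (x s)))"
    using lipschitz_on_continuous_on[OF assms(1)] lipschitz_on_continuous_on[OF assms(2)]
    by (intro continuous_on_Pair) (simp_all add: comp_def)
  then show ?thesis using continuous_imp_weakly_cont_on by simp
qed

lemma moving_point_limit:
  assumes s: "\<And>j. s j \<in> {0..S}" "s \<longlonglongrightarrow> l" and \<kappa>: "filterlim \<kappa> sequentially sequentially"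
  shows "(\<lambda>j. tk (\<kappa> j) (s j)) \<longlonglongrightarrow> t l" "weak_conv (\<lambda>j. qk (\<kappa> j) (s j)) (q l)"
proof -
  have l: "l \<in> {0..S}" using closed_sequentially[of "{0..S}" s l] s by auto
  show "(\<lambda>j. tk (\<kappa> j) (s j)) \<longlonglongrightarrow> t l" by (rule lipschitz_moving_tendsto[OF tk_lip t_lim[OF l] s l \<kappa>])
  have "weak_conv (\<lambda>j. fst (qk (\<kappa> j) (s j))) (fst (q l))"
    unfolding weak_conv_def
  proof
    fix \<phi> :: "'u dual"
    have "(\<lambda>j. (\<lambda>s. blinfun_apply \<phi> ((fst \<circ> qk (\<kappa> j)) s)) (s j)) \<longlonglongrightarrow> blinfun_apply \<phi> (fst (q l))"
      by (rule lipschitz_moving_tendsto[OF blinfun_lipschitz[OF uk_lip] _ s l \<kappa>])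
        (use u_lim[OF l] in \<open>simp add: weak_conv_def\<close>)
    then show "(\<lambda>j. blinfun_apply \<phi> (fst (qk (\<kappa> j) (s j)))) \<longlonglongrightarrow> blinfun_apply \<phi> (fst (q l))" by simp
  qed
  moreover have "(\<lambda>j. (snd \<circ> qk (\<kappa> j)) (s j)) \<longlonglongrightarrow> snd (q l)"
    by (rule lipschitz_moving_tendsto[OF zk_lip _ s l \<kappa>]) (use z_lim[OF l] in simp)
  then have "weak_conv (\<lambda>j. snd (qk (\<kappa> j) (s j))) (snd (q l))" using LIMSEQ_imp_weak_conv by simp
  ultimately show "weak_conv (\<lambda>j. qk (\<kappa> j) (s j)) (q l)"
    using weak_conv_Pair[of "\<lambda>j. fst (qk (\<kappa> j) (s j))" "\<lambda>j. snd (qk (\<kappa> j) (s j))" "fst (q l)" "snd (q l)"] by simp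
qed

text \<open>Turns lower semicontinuity into a lower bound that is uniform near s0 and for all large
  k: counterexamples \<open>s j\<close> at indices \<open>\<kappa> j\<close> would converge to s0,
  and \<open>moving_point_limit\<close> with \<open>sl\<close> would contradict \<sigma> lying below
  the limit slope.\<close>

lemma local_lsc:
  assumes s0: "s0 \<in> {0..S}" and \<sigma>: "\<sigma> < sl (t s0) (q s0)"
    and sl: "\<And>tn x t' q'. (\<And>n::nat. tn n \<in> {0..horizon P}) \<Longrightarrow> tn \<longlonglongrightarrow> t' \<Longrightarrow> weak_conv x q' \<Longrightarrow> (\<And>n. Esup P (x n) \<le> ereal M)
      \<Longrightarrow> sl t' q' \<le> liminf (\<lambda>n. sl (tn n) (x n))"
  shows "\<exists>d>0. \<exists>k0. \<forall>k\<ge>k0. \<forall>s\<in>{0..S}. \<bar>s - s0\<bar> < d \<longrightarrow> (\<sigma>::ereal) < sl (tk k s) (qk k s)"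
proof (rule ccontr)
  assume "\<not> ?thesis"
  then have "\<forall>d>0. \<forall>k0. \<exists>k\<ge>k0. \<exists>s\<in>{0..S}. \<bar>s - s0\<bar> < d \<and> sl (tk k s) (qk k s) \<le> \<sigma>"
    unfolding not_less[symmetric] by meson
  then have "\<exists>k s. j \<le> k \<and> s \<in> {0..S} \<and> \<bar>s - s0\<bar> < 1 / real (Suc j) \<and> sl (tk k s) (qk k s) \<le> \<sigma>" for j
    by (metis of_nat_0_less_iff zero_less_Suc zero_less_divide_1_iff)
  then obtain \<kappa> s where *: "\<And>j. j \<le> \<kappa> j" "\<And>j. s j \<in> {0..S}" "\<And>j. \<bar>s j - s0\<bar> < 1 / real (Suc j)"
    "\<And>j. sl (tk (\<kappa> j) (s j)) (qk (\<kappa> j) (s j)) \<le> \<sigma>" by metis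
  have \<kappa>: "filterlim \<kappa> sequentially sequentially"
    by (rule filterlim_at_top_mono[OF filterlim_ident]) (use *(1) in \<open>auto intro: always_eventually\<close>)
  have "(\<lambda>j. s j - s0) \<longlonglongrightarrow> 0"
    by (rule Lim_null_comparison[of _ "\<lambda>j. 1 / real (Suc j)"])
      (use *(3) LIMSEQ_Suc[OF lim_const_over_n[of 1]] in \<open>auto intro!: always_eventually less_imp_le\<close>)
  then have s: "s \<longlonglongrightarrow> s0" by (simp add: LIM_zero_iff)
  have "sl (t s0) (q s0) \<le> liminf (\<lambda>j. sl (tk (\<kappa> j) (s j)) (qk (\<kappa> j) (s j)))"
    by (rule sl[OF tk_in[OF *(2)] moving_point_limit[OF *(2) s \<kappa>] Esup_k[OF *(2)]])
  also have "\<dots> \<le> liminf (\<lambda>j::nat. \<sigma>)" using *(4) by (intro Liminf_mono always_eventually) auto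
  also have "\<dots> = \<sigma>" by (simp add: Liminf_const)
  finally show False using \<sigma> by simp
qed

lemma local_lsc_u:
  assumes "s0 \<in> {0..S}" "\<sigma> < slope_u P (t s0) (q s0)"
  shows "\<exists>d>0. \<exists>k0. \<forall>k\<ge>k0. \<forall>s\<in>{0..S}. \<bar>s - s0\<bar> < d \<longrightarrow> \<sigma> < slope_u P (tk k s) (qk k s)"
  by (rule local_lsc[where sl = "slope_u P", OF assms]) (rule slope_lsc(1))

lemma local_lsc_z:
  assumes "s0 \<in> {0..S}" "\<sigma> < slope_z P (t s0) (q s0)"
  shows "\<exists>d>0. \<exists>k0. \<forall>k\<ge>k0. \<forall>s\<in>{0..S}. \<bar>s - s0\<bar> < d \<longrightarrow> \<sigma> < slope_z P (tk k s) (qk k s)"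
  by (rule local_lsc[where sl = "slope_z P", OF assms]) (rule slope_lsc(2))

section \<open>Dual lower bounds near a point\<close>

abbreviation "\<delta> k \<equiv> \<epsilon> k powr expo P"
abbreviation "au k s \<equiv> deriv (tk k) s / \<delta> k"
abbreviation "bz k s \<equiv> deriv (tk k) s / \<epsilon> k"
abbreviation "suk k s \<equiv> su (tk k s) (qk k s)"
abbreviation "szk k s \<equiv> sz (tk k s) (qk k s)"

text \<open>Slope times weight is at most \<open>Mk\<close>, which caps a weight wherever its slope
  is bounded below. In the dual bound of the last clause the velocity enters only linearly; slopes
  and conjugates are confined to the two weighted brackets.\<close>

lemma Mk_bounds: "AE s in L. suk k s * au k s \<le> Mk k s \<and> szk k s * bz k s \<le> Mk k s \<and>
    slope_u P (tk k s) (qk k s) = ereal (suk k s) \<and> slope_z P (tk k s) (qk k s) = ereal (szk k s) \<and>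
    0 \<le> suk k s \<and> 0 \<le> szk k s \<and> 0 < au k s \<and> 0 < bz k s \<and>
    (\<forall>\<xi> \<zeta> \<rho> cu cz. conjugate (Vu P) \<xi> \<le> ereal cu \<longrightarrow> conjugate (Vz P) \<zeta> \<le> ereal cz \<longrightarrow> (\<forall>w. blinfun_apply \<rho> w \<le> rz w) \<longrightarrow>
      blinfun_apply \<xi> (fst (velocity (qk k) s)) + blinfun_apply (\<rho> + \<zeta>) (snd (velocity (qk k) s))
        + au k s * (suk k s - cu) + bz k s * (szk k s - cz) \<le> Mk k s)"
  using bound_ae[of k]
proof eventually_elim
  case (elim s)
  then have pos: "0 < deriv (tk k) s" and ne: "frechet_subdiff P (tk k s) (qk k s) \<noteq> {}" by auto
  have ab: "0 < au k s" "0 < bz k s" using pos eps(1)[of k] by simp_all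
  let ?v = "velocity (qk k) s"
  have eq: "Mk k s = au k s * vu ((1 / au k s) *\<^sub>R fst ?v) + au k s * suk k s + rz (snd ?v) + bz k s * vz ((1 / bz k s) *\<^sub>R snd ?v) + bz k s * szk k s"
    using M_eps_real[OF eps(1)[of k] pos ne, of ?v] elim by simp
  note sr = slope_real[OF ne]
  have nn: "0 \<le> au k s * vu ((1 / au k s) *\<^sub>R fst ?v)" "0 \<le> bz k s * vz ((1 / bz k s) *\<^sub>R snd ?v)" "0 \<le> rz (snd ?v)"
    "0 \<le> au k s * suk k s" "0 \<le> bz k s * szk k s"
    using mult_nonneg_nonneg[OF less_imp_le[OF ab(1)]] mult_nonneg_nonneg[OF less_imp_le[OF ab(2)]]
      Vu_real(2) Vz_real(2) RZ_real(2) sr(3,4) by blast+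
  have "blinfun_apply \<xi> (fst ?v) + blinfun_apply (\<rho> + \<zeta>) (snd ?v) + au k s * (suk k s - cu) + bz k s * (szk k s - cz) \<le> Mk k s"
    if c: "conjugate (Vu P) \<xi> \<le> ereal cu" "conjugate (Vz P) \<zeta> \<le> ereal cz" "\<forall>w. blinfun_apply \<rho> w \<le> rz w" for \<xi> \<zeta> \<rho> cu cz
    using fenchel_young[OF Vu ab(1) c(1), of "fst ?v"] fenchel_young[OF Vz ab(2) c(2), of "snd ?v"] c(3)
    unfolding eq vu_def vz_def blinfun.add_left right_diff_distrib by (smt (verit))
  moreover have "suk k s * au k s \<le> Mk k s" "szk k s * bz k s \<le> Mk k s" unfolding eq using nn by (simp_all add: mult.commute)
  ultimately show ?case using sr ab by blast
qed

text \<open>Where a slope exceeds c, \<open>Mk_bounds\<close> gives t_k' <= (C/c) eps_k^alpha for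
  the u-slope and t_k' <= (C/c) eps_k for the z-slope, so the increments of the rescalings near s0
  vanish in the limit. The sequence w stands for either rate.\<close>

lemma locally_constant:
  assumes s0: "s0 \<in> {0..S}" and pos: "0 < slope_u P (t s0) (q s0) \<or> 0 < slope_z P (t s0) (q s0)"
  obtains d where "0 < d" "\<And>s. s \<in> {0..S} \<Longrightarrow> \<bar>s - s0\<bar> < d \<Longrightarrow> t s = t s0"
proof -
  have lim\<delta>: "\<delta> \<longlonglongrightarrow> 0" using tendsto_powr'[OF eps(2) tendsto_const, of "expo P"] eps(1) spaces
    by (simp add: H_spaces_def always_eventually less_imp_le)
  obtain c d k0 w where c: "0 < c" "0 < d" "w \<longlonglongrightarrow> 0"
    and loc: "\<And>k. k \<ge> k0 \<Longrightarrow> AE s in L. \<bar>s - s0\<bar> < d \<longrightarrow> deriv (tk k) s \<le> C / c * w k"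
  proof (cases "0 < slope_u P (t s0) (q s0)")
    case True
    then obtain c where c: "0 < c" "ereal c < slope_u P (t s0) (q s0)" using ereal_dense2[of 0] by auto
    obtain d k0 where d: "0 < d" "\<forall>k\<ge>k0. \<forall>s\<in>{0..S}. \<bar>s - s0\<bar> < d \<longrightarrow> ereal c < slope_u P (tk k s) (qk k s)"
      using local_lsc_u[OF s0 c(2)] by blast
    show thesis
    proof (rule that[OF c(1) d(1) lim\<delta>])
      fix k assume k: "k0 \<le> k"
      show "AE s in L. \<bar>s - s0\<bar> < d \<longrightarrow> deriv (tk k) s \<le> C / c * \<delta> k"
        using Mk_bounds[of k] bound_ae[of k] AE_lebesgue_on_interior
      proof eventually_elim
        case (elim s)
        show ?case
        proof
          assume "\<bar>s - s0\<bar> < d"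
          then have "ereal c < slope_u P (tk k s) (qk k s)" using d(2) k elim(3) by auto
          then have "c \<le> suk k s" using elim(1) by simp
          then have "c * au k s \<le> suk k s * au k s" using elim(1) by (intro mult_right_mono) auto
          then have "c * au k s \<le> C" using elim(1,2) by linarith
          then show "deriv (tk k) s \<le> C / c * \<delta> k" using c(1) eps(1)[of k] by (simp add: field_simps)
        qed
      qed
    qed
  next
    case False
    then obtain c where c: "0 < c" "ereal c < slope_z P (t s0) (q s0)" using pos ereal_dense2[of 0] by auto
    obtain d k0 where d: "0 < d" "\<forall>k\<ge>k0. \<forall>s\<in>{0..S}. \<bar>s - s0\<bar> < d \<longrightarrow> ereal c < slope_z P (tk k s) (qk k s)"
      using local_lsc_z[OF s0 c(2)] by blast
    show thesis
    proof (rule that[OF c(1) d(1) eps(2)])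
      fix k assume k: "k0 \<le> k"
      show "AE s in L. \<bar>s - s0\<bar> < d \<longrightarrow> deriv (tk k) s \<le> C / c * \<epsilon> k"
        using Mk_bounds[of k] bound_ae[of k] AE_lebesgue_on_interior
      proof eventually_elim
        case (elim s)
        show ?case
        proof
          assume "\<bar>s - s0\<bar> < d"
          then have "ereal c < slope_z P (tk k s) (qk k s)" using d(2) k elim(3) by auto
          then have "c \<le> szk k s" using elim(1) by simp
          then have "c * bz k s \<le> szk k s * bz k s" using elim(1) by (intro mult_right_mono) auto
          then have "c * bz k s \<le> C" using elim(1,2) by linarith
          then show "deriv (tk k) s \<le> C / c * \<epsilon> k" using c(1) eps(1)[of k] by (simp add: field_simps)
        qed
      qed
    qed
  qed
  have inc: "t y - t x \<le> 0" if xy: "x \<in> {0..S}" "y \<in> {0..S}" "x \<le> y" "\<bar>x - s0\<bar> < d" "\<bar>y - s0\<bar> < d" for x y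
  proof -
    have "tk k y - tk k x \<le> C / c * w k * (y - x)" if k: "k \<ge> k0" for k
    proof (rule ac_real_le[of x y])
      show "ac_on x y (tk k)" by (rule ac_wrt_subinterval[OF lipschitz_imp_ac_on[OF tk_lip]]) (use xy in auto)
      have "AE s in lebesgue_on {x..y}. \<bar>s - s0\<bar> < d \<longrightarrow> deriv (tk k) s \<le> C / c * w k"
        by (rule AE_lebesgue_on_subinterval[OF loc[OF k]]) (use xy in auto)
      then show "AE s in lebesgue_on {x..y}. deriv (tk k) s \<le> C / c * w k"
        using AE_lebesgue_on_interior by eventually_elim (use xy in auto)
    qed (use xy in auto)
    moreover have "(\<lambda>k. C / c * w k * (y - x)) \<longlonglongrightarrow> C / c * 0 * (y - x)" by (intro tendsto_intros c)
    moreover have "(\<lambda>k. tk k y - tk k x) \<longlonglongrightarrow> t y - t x" by (intro tendsto_diff t_lim xy)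
    ultimately show ?thesis
      using LIMSEQ_le[of "\<lambda>k. tk k y - tk k x" "t y - t x" "\<lambda>k. C / c * w k * (y - x)" "C / c * 0 * (y - x)"] by auto
  qed
  show thesis
  proof (rule that[OF c(2)])
    fix s assume s: "s \<in> {0..S}" "\<bar>s - s0\<bar> < d"
    show "t s = t s0"
      using inc[OF s(1) s0] inc[OF s0 s(1)] s c(2) mono_onD[OF t_mono s(1) s0] mono_onD[OF t_mono s0 s(1)]
      by (cases "s \<le> s0") auto
  qed
qed

text \<open>By contradiction: \<open>h\<close> would be larger at some y > s0 within distance d than
  at s0, whereas integrating the assumed inequality over {s0..y} and letting k tend to infinity
  yields the opposite.\<close>

lemma lower_test:
  assumes s0: "0 < s0" "s0 < S" and dF: "(F has_real_derivative m) (at s0)"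
    and du: "((fst \<circ> q) has_vector_derivative u') (at s0)" and dz: "((snd \<circ> q) has_vector_derivative z') (at s0)"
    and d: "0 < d" and e: "e \<longlonglongrightarrow> 0"
    and le: "\<And>k. k \<ge> k0 \<Longrightarrow> AE s in L. \<bar>s - s0\<bar> < d \<longrightarrow>
       blinfun_apply \<xi> (fst (velocity (qk k) s)) + blinfun_apply \<eta> (snd (velocity (qk k) s)) - e k \<le> Mk k s"
  shows "blinfun_apply \<xi> u' + blinfun_apply \<eta> z' \<le> m"
proof (rule ccontr)
  assume neg: "\<not> ?thesis"
  define h where "h s = blinfun_apply \<xi> ((fst \<circ> q) s) + blinfun_apply \<eta> ((snd \<circ> q) s) - F s" for s
  have "(h has_real_derivative blinfun_apply \<xi> u' + blinfun_apply \<eta> z' - m) (at s0)"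
    unfolding h_def by (intro DERIV_diff DERIV_add has_vector_derivative_blinfun du dz dF)
  then obtain d' where d': "0 < d'" "\<And>r. 0 < r \<Longrightarrow> r < d' \<Longrightarrow> h s0 < h (s0 + r)"
    using DERIV_pos_inc_right neg by (metis diff_gt_0_iff_gt not_le)
  \<comment> \<open>The halves keep y strictly inside the three ranges: where h exceeds its value at
    s0, where \<open>le\<close> holds, and before S.\<close>
  define y where "y = s0 + min (d' / 2) (min (d / 2) ((S - s0) / 2))"
  have y: "s0 < y" "y < S" "y - s0 < d" "h s0 < h y"
    using d'(1) d s0 d'(2)[of "y - s0"] by (auto simp: y_def min_def field_simps)
  have ineq: "blinfun_apply \<xi> (fst (qk k y)) - blinfun_apply \<xi> (fst (qk k s0)) + (blinfun_apply \<eta> (snd (qk k y)) - blinfun_apply \<eta> (snd (qk k s0)))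
      \<le> Fk k y - Fk k s0 + e k * (y - s0)" if k: "k \<ge> k0" for k
  proof -
    have acu: "ac_on 0 S (fst \<circ> qk k)" and acz: "ac_on 0 S (snd \<circ> qk k)" using uk_lip zk_lip lipschitz_imp_ac_on by blast+
    note Fu = ac_real_FTC[OF ac_on_blinfun[OF acu, of \<xi>] less_imp_le[OF S]]
    note Fz = ac_real_FTC[OF ac_on_blinfun[OF acz, of \<eta>] less_imp_le[OF S]]
    let ?du = "deriv (\<lambda>s. blinfun_apply \<xi> ((fst \<circ> qk k) s))" and ?dz = "deriv (\<lambda>s. blinfun_apply \<eta> ((snd \<circ> qk k) s))"
    have sy: "0 \<le> s0" "s0 \<le> y" "y \<le> S" using s0 y by auto
    have sub: "set_integrable lebesgue {s0..y} ?du" "set_integrable lebesgue {s0..y} ?dz" "set_integrable lebesgue {s0..y} (Mk k)"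
      by (rule set_integrable_subset[OF Fu(2)] set_integrable_subset[OF Fz(2)] set_integrable_subset[OF Mk_int]; use sy in simp)+
    have "(LINT s:{s0..y}|lebesgue. ?du s + ?dz s) \<le> (LINT s:{s0..y}|lebesgue. Mk k s + e k)"
    proof (rule set_integral_mono_AE)
      show "set_integrable lebesgue {s0..y} (\<lambda>s. ?du s + ?dz s)" using sub by (intro set_integral_add)
      show "set_integrable lebesgue {s0..y} (\<lambda>s. Mk k s + e k)" using sub by (intro set_integral_add) simp_all
      have "AE s in L. \<bar>s - s0\<bar> < d \<longrightarrow> ?du s + ?dz s \<le> Mk k s + e k"
        using le[OF k] ac_on_differentiable_ae(1)[OF refl_u acu less_imp_le[OF S]] ac_on_differentiable_ae(1)[OF refl_z acz less_imp_le[OF S]]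
      proof eventually_elim
        case (elim s)
        have "?du s = blinfun_apply \<xi> (fst (velocity (qk k) s))" "?dz s = blinfun_apply \<eta> (snd (velocity (qk k) s))"
          using DERIV_imp_deriv[OF has_vector_derivative_blinfun[OF elim(2)]] DERIV_imp_deriv[OF has_vector_derivative_blinfun[OF elim(3)]]
          by (simp_all add: velocity_def)
        then show ?case using elim(1) by (simp only:) linarith
      qed
      then have "AE s in lebesgue_on {s0..y}. \<bar>s - s0\<bar> < d \<longrightarrow> ?du s + ?dz s \<le> Mk k s + e k"
        by (rule AE_lebesgue_on_subinterval) (use sy in auto)
      then show "AE s in lebesgue_on {s0..y}. ?du s + ?dz s \<le> Mk k s + e k"
        using AE_lebesgue_on_interior by eventually_elim (use y in auto)
    qed auto
    then show ?thesis
      using Fu(3)[OF sy] Fz(3)[OF sy] Fk_diff[OF sy, of k] sub sy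
      by (simp add: set_integral_add set_integral_const_interval mult.commute)
  qed
  have "(\<lambda>k. Fk k y - Fk k s0 + e k * (y - s0)) \<longlonglongrightarrow> F y - F s0 + 0 * (y - s0)"
    using s0 y by (intro tendsto_intros F_lim' e) auto
  moreover have "(\<lambda>k. blinfun_apply \<xi> (fst (qk k y)) - blinfun_apply \<xi> (fst (qk k s0)) + (blinfun_apply \<eta> (snd (qk k y)) - blinfun_apply \<eta> (snd (qk k s0))))
     \<longlonglongrightarrow> blinfun_apply \<xi> (fst (q y)) - blinfun_apply \<xi> (fst (q s0)) + (blinfun_apply \<eta> (snd (q y)) - blinfun_apply \<eta> (snd (q s0)))"
    using s0 y u_lim[of y] u_lim[of s0]
    by (intro tendsto_add tendsto_diff blinfun.tendsto[OF tendsto_const z_lim]) (auto simp: weak_conv_def)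
  ultimately have "blinfun_apply \<xi> (fst (q y)) - blinfun_apply \<xi> (fst (q s0)) + (blinfun_apply \<eta> (snd (q y)) - blinfun_apply \<eta> (snd (q s0))) \<le> F y - F s0 + 0 * (y - s0)"
    using ineq by (intro LIMSEQ_le) blast+
  then show False using y(4) by (simp add: h_def)
qed

end

context limit_setting
begin

text \<open>For a positive level the factor l < 1 creates the strict gap that
  \<open>local_lsc_u\<close> and \<open>local_lsc_z\<close> ask for; for the level zero the
  conclusion is nonnegativity of the slope.\<close>

lemma local_slopes:
  assumes s0: "s0 \<in> {0..S}" and \<sigma>: "0 \<le> \<sigma>" "ereal \<sigma> \<le> slope_u P (t s0) (q s0)"
    and \<rho>: "0 \<le> \<rho>" "ereal \<rho> \<le> slope_z P (t s0) (q s0)" and l: "0 < l" "l < 1"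
  obtains d k0 where "0 < d" "\<And>k. k \<ge> k0 \<Longrightarrow> AE s in L. \<bar>s - s0\<bar> < d \<longrightarrow> l * \<sigma> \<le> suk k s \<and> l * \<rho> \<le> szk k s"
proof -
  have less: "ereal (l * x) < y" if "0 < x" "ereal x \<le> y" for x y
  proof -
    have "l * x < x" using l that(1) by simp
    then show ?thesis using that(2) by (meson less_ereal.simps(1) less_le_trans)
  qed
  have "\<exists>d>0. \<exists>k0. \<forall>k\<ge>k0. \<forall>s\<in>{0..S}. \<bar>s - s0\<bar> < d \<longrightarrow> \<sigma> = 0 \<or> ereal (l * \<sigma>) < slope_u P (tk k s) (qk k s)"
  proof (cases "\<sigma> = 0")
    case False
    then show ?thesis using local_lsc_u[OF s0 less[of \<sigma>]] \<sigma> by fastforce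
  qed (auto intro: exI[of _ 1])
  then obtain d1 k1 where 1: "0 < d1" "\<And>k s. k1 \<le> k \<Longrightarrow> s \<in> {0..S} \<Longrightarrow> \<bar>s - s0\<bar> < d1 \<Longrightarrow> \<sigma> = 0 \<or> ereal (l * \<sigma>) < slope_u P (tk k s) (qk k s)"
    by metis
  have "\<exists>d>0. \<exists>k0. \<forall>k\<ge>k0. \<forall>s\<in>{0..S}. \<bar>s - s0\<bar> < d \<longrightarrow> \<rho> = 0 \<or> ereal (l * \<rho>) < slope_z P (tk k s) (qk k s)"
  proof (cases "\<rho> = 0")
    case False
    then show ?thesis using local_lsc_z[OF s0 less[of \<rho>]] \<rho> by fastforce
  qed (auto intro: exI[of _ 1])
  then obtain d2 k2 where 2: "0 < d2" "\<And>k s. k2 \<le> k \<Longrightarrow> s \<in> {0..S} \<Longrightarrow> \<bar>s - s0\<bar> < d2 \<Longrightarrow> \<rho> = 0 \<or> ereal (l * \<rho>) < slope_z P (tk k s) (qk k s)"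
    by metis
  show thesis
  proof (rule that[of "min d1 d2" "max k1 k2"])
    show "0 < min d1 d2" using 1(1) 2(1) by simp
    fix k assume "max k1 k2 \<le> k"
    then have k: "k1 \<le> k" "k2 \<le> k" by simp_all
    show "AE s in L. \<bar>s - s0\<bar> < min d1 d2 \<longrightarrow> l * \<sigma> \<le> suk k s \<and> l * \<rho> \<le> szk k s"
      using Mk_bounds[of k] AE_lebesgue_on_interior
    proof eventually_elim
      case (elim s)
      show ?case
      proof
        assume "\<bar>s - s0\<bar> < min d1 d2"
        then have "\<sigma> = 0 \<or> ereal (l * \<sigma>) < slope_u P (tk k s) (qk k s)" "\<rho> = 0 \<or> ereal (l * \<rho>) < slope_z P (tk k s) (qk k s)"
          using 1(2)[OF k(1)] 2(2)[OF k(2)] elim(2) by auto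
        moreover have "slope_u P (tk k s) (qk k s) = ereal (suk k s)" "slope_z P (tk k s) (qk k s) = ereal (szk k s)"
          "0 \<le> suk k s" "0 \<le> szk k s" using elim(1) by blast+
        ultimately show "l * \<sigma> \<le> suk k s \<and> l * \<rho> \<le> szk k s" by auto
      qed
    qed
  qed
qed

definition smooth_at :: "real \<Rightarrow> real \<Rightarrow> 'u \<Rightarrow> 'z \<Rightarrow> bool" where
  "smooth_at s m u' z' \<longleftrightarrow> 0 < s \<and> s < S \<and> (F has_real_derivative m) (at s) \<and>
     ((fst \<circ> q) has_vector_derivative u') (at s) \<and> ((snd \<circ> q) has_vector_derivative z') (at s)"

text \<open>The error e k leaves room for a negative bracket whose weight tends to zero, as in the
  two freezing arguments.\<close>

lemma lower_dual_general:
  assumes sm: "smooth_at s0 m u' z'" and e: "e \<longlonglongrightarrow> 0" and d: "0 < d"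
    and c: "conjugate (Vu P) \<xi> \<le> ereal cu" "conjugate (Vz P) \<zeta> \<le> ereal cz"
    and le: "\<And>k. k \<ge> k0 \<Longrightarrow> AE s in L. \<bar>s - s0\<bar> < d \<longrightarrow> - e k \<le> au k s * (suk k s - cu) + bz k s * (szk k s - cz)"
  shows "blinfun_apply \<xi> u' + rz z' + blinfun_apply \<zeta> z' \<le> m"
proof -
  obtain \<rho> :: "'z dual" where \<rho>: "\<And>w. blinfun_apply \<rho> w \<le> rz w" "blinfun_apply \<rho> z' = rz z'" by (rule rz_support[of z']) (rule that)
  have "blinfun_apply \<xi> u' + blinfun_apply (\<rho> + \<zeta>) z' \<le> m"
  proof (rule lower_test[OF _ _ _ _ _ d e])
    fix k assume k: "k0 \<le> k"
    show "AE s in L. \<bar>s - s0\<bar> < d \<longrightarrow>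
       blinfun_apply \<xi> (fst (velocity (qk k) s)) + blinfun_apply (\<rho> + \<zeta>) (snd (velocity (qk k) s)) - e k \<le> Mk k s"
      using le[OF k] Mk_bounds[of k]
    proof eventually_elim
      case (elim s)
      have "blinfun_apply \<xi> (fst (velocity (qk k) s)) + blinfun_apply (\<rho> + \<zeta>) (snd (velocity (qk k) s))
        + au k s * (suk k s - cu) + bz k s * (szk k s - cz) \<le> Mk k s"
        using elim(2) c \<rho>(1) by blast
      then show ?case using elim(1) by linarith
    qed
  qed (use sm in \<open>auto simp: smooth_at_def\<close>)
  then show ?thesis using \<rho>(2) by (simp add: blinfun.add_left)
qed

text \<open>Shrinking both functionals by l puts their conjugates at or below l times the slope
  levels, so both brackets are nonnegative near s0; then l tends to 1.\<close>

lemma lower_dual: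
  assumes sm: "smooth_at s0 m u' z'"
    and c: "conjugate (Vu P) \<xi> \<le> ereal cu" "conjugate (Vz P) \<zeta> \<le> ereal cz"
    and u: "0 \<le> cu" "ereal cu \<le> slope_u P (t s0) (q s0)" and z: "0 \<le> cz" "ereal cz \<le> slope_z P (t s0) (q s0)"
  shows "blinfun_apply \<xi> u' + rz z' + blinfun_apply \<zeta> z' \<le> m"
proof -
  have s0: "s0 \<in> {0..S}" using sm by (simp add: smooth_at_def)
  have "l * (blinfun_apply \<xi> u' + blinfun_apply \<zeta> z') \<le> m - rz z'" if l: "0 < l" "l < 1" for l :: real
  proof -
    obtain d k0 where d: "0 < d" "\<And>k. k \<ge> k0 \<Longrightarrow> AE s in L. \<bar>s - s0\<bar> < d \<longrightarrow> l * cu \<le> suk k s \<and> l * cz \<le> szk k s"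
      by (rule local_slopes[OF s0 u z l]) (rule that)
    have "blinfun_apply (l *\<^sub>R \<xi>) u' + rz z' + blinfun_apply (l *\<^sub>R \<zeta>) z' \<le> m"
    proof (rule lower_dual_general[OF sm tendsto_const d(1)])
      show "conjugate (Vu P) (l *\<^sub>R \<xi>) \<le> ereal (l * cu)" "conjugate (Vz P) (l *\<^sub>R \<zeta>) \<le> ereal (l * cz)"
        using conjugate_scale[OF Vu _ _ c(1)] conjugate_scale[OF Vz _ _ c(2)] l by simp_all
      fix k assume k: "k0 \<le> k"
      show "AE s in L. \<bar>s - s0\<bar> < d \<longrightarrow> - 0 \<le> au k s * (suk k s - l * cu) + bz k s * (szk k s - l * cz)"
        using d(2)[OF k] Mk_bounds[of k]
      proof eventually_elim
        case (elim s)
        have "0 < au k s" "0 < bz k s" using elim(2) by blast+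
        then show ?case using elim(1) by (auto intro!: add_nonneg_nonneg mult_nonneg_nonneg simp del: zero_le_divide_iff divide_nonneg_nonneg times_divide_eq_left)
      qed
    qed
    then show ?thesis by (simp add: blinfun.scaleR_left algebra_simps)
  qed
  then have "blinfun_apply \<xi> u' + blinfun_apply \<zeta> z' \<le> m - rz z'" by (rule field_le_mult_one_interval)
  then show ?thesis by simp
qed

text \<open>The zero functional has conjugate 0, which is below every slope, so that one component
  can be tested alone.\<close>

lemma lower_dual_u:
  assumes "smooth_at s0 m u' z'" "conjugate (Vu P) \<xi> \<le> ereal cu" "0 \<le> cu" "ereal cu \<le> slope_u P (t s0) (q s0)"
  shows "blinfun_apply \<xi> u' + rz z' \<le> m"
  using lower_dual[OF assms(1,2), of 0 0] assms(3,4) conjugate_zero[OF dpVz] slope_nonneg(2)[of "t s0" "q s0"]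
  by (simp add: blinfun.zero_left flip: zero_ereal_def)

lemma lower_dual_z:
  assumes "smooth_at s0 m u' z'" "conjugate (Vz P) \<zeta> \<le> ereal cz" "0 \<le> cz" "ereal cz \<le> slope_z P (t s0) (q s0)"
  shows "rz z' + blinfun_apply \<zeta> z' \<le> m"
  using lower_dual[OF assms(1) _ assms(2), of 0 0] assms(3,4) conjugate_zero[OF dpVu] slope_nonneg(1)[of "t s0" "q s0"]
  by (simp add: blinfun.zero_left flip: zero_ereal_def)

lemma rz_le:
  assumes "smooth_at s0 m u' z'" shows "rz z' \<le> m"
  using lower_dual_u[OF assms, of 0 0] conjugate_zero[OF dpVu] slope_nonneg(1)[of "t s0" "q s0"]
  by (simp add: blinfun.zero_left flip: zero_ereal_def)

text \<open>For \<alpha> = 1 the weights \<open>au\<close> and \<open>bz\<close> coincide. The two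
  brackets then add up, and it is enough that the sum of the conjugates stays below the sum of the
  slopes.\<close>

lemma lower_pair:
  assumes sm: "smooth_at s0 m u' z'" and \<alpha>: "expo P = 1"
    and c: "conjugate (Vu P) \<xi> = ereal cu" "conjugate (Vz P) \<zeta> = ereal cz" "cu + cz \<le> \<sigma> + \<rho>"
    and u: "0 \<le> \<sigma>" "ereal \<sigma> \<le> slope_u P (t s0) (q s0)" and z: "0 \<le> \<rho>" "ereal \<rho> \<le> slope_z P (t s0) (q s0)"
  shows "blinfun_apply \<xi> u' + rz z' + blinfun_apply \<zeta> z' \<le> m"
proof -
  have s0: "s0 \<in> {0..S}" using sm by (simp add: smooth_at_def)
  have "l * (blinfun_apply \<xi> u' + blinfun_apply \<zeta> z') \<le> m - rz z'" if l: "0 < l" "l < 1" for l :: real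
  proof -
    have alg: "b * (x - l * cu) + b * (y - l * cz) = b * (x + y - l * (cu + cz))" for b x y by (simp add: algebra_simps)
    obtain d k0 where d: "0 < d" "\<And>k. k \<ge> k0 \<Longrightarrow> AE s in L. \<bar>s - s0\<bar> < d \<longrightarrow> l * \<sigma> \<le> suk k s \<and> l * \<rho> \<le> szk k s"
      by (rule local_slopes[OF s0 u z l]) (rule that)
    have "blinfun_apply (l *\<^sub>R \<xi>) u' + rz z' + blinfun_apply (l *\<^sub>R \<zeta>) z' \<le> m"
    proof (rule lower_dual_general[OF sm tendsto_const d(1)])
      show "conjugate (Vu P) (l *\<^sub>R \<xi>) \<le> ereal (l * cu)" "conjugate (Vz P) (l *\<^sub>R \<zeta>) \<le> ereal (l * cz)"
        using conjugate_scale[OF Vu, of l \<xi> cu] conjugate_scale[OF Vz, of l \<zeta> cz] c l by simp_all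
      fix k assume k: "k0 \<le> k"
      show "AE s in L. \<bar>s - s0\<bar> < d \<longrightarrow> - 0 \<le> au k s * (suk k s - l * cu) + bz k s * (szk k s - l * cz)"
        using d(2)[OF k] Mk_bounds[of k]
      proof eventually_elim
        case (elim s)
        show ?case
        proof
          assume "\<bar>s - s0\<bar> < d"
          then have "l * \<sigma> + l * \<rho> \<le> suk k s + szk k s" using elim(1) by simp
          moreover have "l * (cu + cz) \<le> l * (\<sigma> + \<rho>)" using c(3) l by simp
          ultimately have le: "0 \<le> suk k s + szk k s - l * (cu + cz)" by (simp add: distrib_left)
          have ab: "au k s = bz k s" using \<alpha> eps(1)[of k] by simp
          have "0 < bz k s" using elim(2) by blast
          then have "0 \<le> bz k s * (suk k s + szk k s - l * (cu + cz))" using le by (rule mult_nonneg_nonneg[OF less_imp_le])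
          then show "- 0 \<le> au k s * (suk k s - l * cu) + bz k s * (szk k s - l * cz)"
            unfolding ab using alg[of "bz k s" "suk k s" "szk k s"] by linarith
        qed
      qed
    qed
    then show ?thesis by (simp add: blinfun.scaleR_left algebra_simps)
  qed
  then have "blinfun_apply \<xi> u' + blinfun_apply \<zeta> z' \<le> m - rz z'" by (rule field_le_mult_one_interval)
  then show ?thesis by simp
qed

lemma z_frozen:
  assumes sm: "smooth_at s0 m u' z'" and \<alpha>: "1 < expo P" and u: "0 < \<sigma>" "ereal \<sigma> \<le> slope_u P (t s0) (q s0)"
  shows "z' = 0"
proof (rule all_functionals_bounded_imp_zero)
  fix \<zeta> :: "'z dual"
  have s0: "s0 \<in> {0..S}" using sm by (simp add: smooth_at_def)
  obtain cz where cz: "conjugate (Vz P) \<zeta> = ereal cz" "0 \<le> cz" by (rule conjugate_finite[OF Vz])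
  obtain d k0 where d: "0 < d" "\<And>k. k \<ge> k0 \<Longrightarrow> AE s in L. \<bar>s - s0\<bar> < d \<longrightarrow> 1/2 * \<sigma> \<le> suk k s \<and> 1/2 * 0 \<le> szk k s"
    by (rule local_slopes[OF s0 _ u(2), of 0 "1/2"]) (use u slope_nonneg in \<open>auto simp flip: zero_ereal_def\<close>)
  \<comment> \<open>Near s0 the u-slope is at least \<sigma>/2, hence \<open>au\<close> <=
    2C/\<sigma>, and \<open>bz\<close> is \<open>au\<close> times eps_k^(alpha - 1). So e k bounds
    the cost of an arbitrary functional \<zeta> and tends to 0.\<close>
  define e where "e k = 2 * C / \<sigma> * \<epsilon> k powr (expo P - 1) * cz" for k
  have "(\<lambda>k. \<epsilon> k powr (expo P - 1)) \<longlonglongrightarrow> 0"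
    using tendsto_powr'[OF eps(2) tendsto_const, of "expo P - 1"] eps(1) \<alpha> by (simp add: always_eventually less_imp_le)
  then have "e \<longlonglongrightarrow> 2 * C / \<sigma> * 0 * cz" unfolding e_def by (intro tendsto_intros)
  then have e: "e \<longlonglongrightarrow> 0" by simp
  have "blinfun_apply 0 u' + rz z' + blinfun_apply \<zeta> z' \<le> m"
  proof (rule lower_dual_general[OF sm e d(1)])
    show "conjugate (Vu P) 0 \<le> ereal 0" "conjugate (Vz P) \<zeta> \<le> ereal cz" using conjugate_zero[OF dpVu] cz by (simp_all flip: zero_ereal_def)
    fix k assume k: "k0 \<le> k"
    show "AE s in L. \<bar>s - s0\<bar> < d \<longrightarrow> - e k \<le> au k s * (suk k s - 0) + bz k s * (szk k s - cz)"
      using d(2)[OF k] Mk_bounds[of k] bound_ae[of k]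
    proof eventually_elim
      case (elim s)
      show ?case
      proof
        assume "\<bar>s - s0\<bar> < d"
        then have su: "\<sigma> / 2 \<le> suk k s" using elim(1) by simp
        have ab: "0 < au k s" "0 < bz k s" "0 \<le> suk k s" "0 \<le> szk k s" "suk k s * au k s \<le> C" using elim(2,3) by (blast, blast, blast, blast, linarith)
        have "\<sigma> / 2 * au k s \<le> suk k s * au k s" using su ab(1) by (intro mult_right_mono) auto
        then have "\<sigma> / 2 * au k s \<le> C" using ab(5) by linarith
        then have "au k s \<le> 2 * C / \<sigma>" using u(1) by (simp add: field_simps)
        then have "au k s * \<epsilon> k powr (expo P - 1) \<le> 2 * C / \<sigma> * \<epsilon> k powr (expo P - 1)" by (rule mult_right_mono) simp
        moreover have "bz k s = au k s * \<epsilon> k powr (expo P - 1)"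
          using eps(1)[of k] by (simp add: powr_diff)
        ultimately have "bz k s * cz \<le> e k" unfolding e_def using cz(2) by (intro mult_right_mono) simp_all
        moreover have "0 \<le> au k s * suk k s" "0 \<le> bz k s * szk k s" 
          using mult_nonneg_nonneg[OF less_imp_le[OF ab(1)] ab(3)] mult_nonneg_nonneg[OF less_imp_le[OF ab(2)] ab(4)] by blast+
        ultimately show "- e k \<le> au k s * (suk k s - 0) + bz k s * (szk k s - cz)" unfolding right_diff_distrib by linarith
      qed
    qed
  qed
  then show "blinfun_apply \<zeta> z' \<le> m" using RZ_real(2)[of z'] by (simp add: blinfun.zero_left)
qed

lemma u_frozen:
  assumes sm: "smooth_at s0 m u' z'" and \<alpha>: "expo P < 1" and z: "0 < \<rho>" "ereal \<rho> \<le> slope_z P (t s0) (q s0)"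
  shows "u' = 0"
proof (rule all_functionals_bounded_imp_zero)
  fix \<xi> :: "'u dual"
  have s0: "s0 \<in> {0..S}" using sm by (simp add: smooth_at_def)
  obtain cu where cu: "conjugate (Vu P) \<xi> = ereal cu" "0 \<le> cu" by (rule conjugate_finite[OF Vu])
  obtain d k0 where d: "0 < d" "\<And>k. k \<ge> k0 \<Longrightarrow> AE s in L. \<bar>s - s0\<bar> < d \<longrightarrow> 1/2 * 0 \<le> suk k s \<and> 1/2 * \<rho> \<le> szk k s"
    by (rule local_slopes[OF s0 _ _ _ z(2), of 0 "1/2"]) (use z slope_nonneg in \<open>auto simp flip: zero_ereal_def\<close>)
  \<comment> \<open>The same with the rates exchanged: \<open>bz\<close> <= 2C/\<rho>, and
    \<open>au\<close> is \<open>bz\<close> times eps_k^(1 - alpha).\<close>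
  define e where "e k = 2 * C / \<rho> * \<epsilon> k powr (1 - expo P) * cu" for k
  have "(\<lambda>k. \<epsilon> k powr (1 - expo P)) \<longlonglongrightarrow> 0"
    using tendsto_powr'[OF eps(2) tendsto_const, of "1 - expo P"] eps(1) \<alpha> by (simp add: always_eventually less_imp_le)
  then have "e \<longlonglongrightarrow> 2 * C / \<rho> * 0 * cu" unfolding e_def by (intro tendsto_intros)
  then have e: "e \<longlonglongrightarrow> 0" by simp
  have "blinfun_apply \<xi> u' + rz z' + blinfun_apply 0 z' \<le> m"
  proof (rule lower_dual_general[OF sm e d(1)])
    show "conjugate (Vz P) 0 \<le> ereal 0" "conjugate (Vu P) \<xi> \<le> ereal cu" using conjugate_zero[OF dpVz] cu by (simp_all flip: zero_ereal_def)
    fix k assume k: "k0 \<le> k"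
    show "AE s in L. \<bar>s - s0\<bar> < d \<longrightarrow> - e k \<le> au k s * (suk k s - cu) + bz k s * (szk k s - 0)"
      using d(2)[OF k] Mk_bounds[of k] bound_ae[of k]
    proof eventually_elim
      case (elim s)
      show ?case
      proof
        assume "\<bar>s - s0\<bar> < d"
        then have sz: "\<rho> / 2 \<le> szk k s" using elim(1) by simp
        have ab: "0 < bz k s" "0 < au k s" "0 \<le> szk k s" "0 \<le> suk k s" "szk k s * bz k s \<le> C" using elim(2,3) by (blast, blast, blast, blast, linarith)
        have "\<rho> / 2 * bz k s \<le> szk k s * bz k s" using sz ab(1) by (intro mult_right_mono) auto
        then have "\<rho> / 2 * bz k s \<le> C" using ab(5) by linarith
        then have "bz k s \<le> 2 * C / \<rho>" using z(1) by (simp add: field_simps)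
        then have "bz k s * \<epsilon> k powr (1 - expo P) \<le> 2 * C / \<rho> * \<epsilon> k powr (1 - expo P)" by (rule mult_right_mono) simp
        moreover have "au k s = bz k s * \<epsilon> k powr (1 - expo P)"
          using eps(1)[of k] by (simp add: powr_diff)
        ultimately have "au k s * cu \<le> e k" unfolding e_def using cu(2) by (intro mult_right_mono) simp_all
        moreover have "0 \<le> au k s * suk k s" "0 \<le> bz k s * szk k s" 
          using mult_nonneg_nonneg[OF less_imp_le[OF ab(1)] ab(3)] mult_nonneg_nonneg[OF less_imp_le[OF ab(2)] ab(4)] by blast+
        ultimately show "- e k \<le> au k s * (suk k s - cu) + bz k s * (szk k s - 0)" unfolding right_diff_distrib by linarith
      qed
    qed
  qed
  then show "blinfun_apply \<xi> u' \<le> m" using RZ_real(2)[of z'] by (simp add: blinfun.zero_left)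
qed

text \<open>The symmetric difference quotients converge to z' in Z, and R is Lipschitz on Z; the
  limit in \<open>R_speed\<close> therefore exists.\<close>

lemma R_speed_eq:
  assumes "((snd \<circ> q) has_vector_derivative z') (at s)" shows "R_speed P q s = ereal (rz z')"
proof -
  have "((\<lambda>h. norm ((snd \<circ> q) (s + h) - (snd \<circ> q) s - h *\<^sub>R z') / norm h) \<longlongrightarrow> 0) (at 0)"
    using assms by (simp add: has_vector_derivative_def has_derivative_at)
  then have "((\<lambda>h. (1 / h) *\<^sub>R ((snd \<circ> q) (s + h) - (snd \<circ> q) s) - z') \<longlongrightarrow> 0) (at 0)"
  proof (rule Lim_null_comparison[rotated])
    show "\<forall>\<^sub>F h in at 0. norm ((1 / h) *\<^sub>R ((snd \<circ> q) (s + h) - (snd \<circ> q) s) - z') \<le> norm ((snd \<circ> q) (s + h) - (snd \<circ> q) s - h *\<^sub>R z') / norm h"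
      unfolding eventually_at_filter
    proof (intro always_eventually allI impI)
      fix h :: real assume h: "h \<noteq> 0"
      have "(1 / h) *\<^sub>R ((snd \<circ> q) (s + h) - (snd \<circ> q) s) - z' = (1 / h) *\<^sub>R ((snd \<circ> q) (s + h) - (snd \<circ> q) s - h *\<^sub>R z')"
        using h by (simp add: scaleR_diff_right)
      then show "norm ((1 / h) *\<^sub>R ((snd \<circ> q) (s + h) - (snd \<circ> q) s) - z') \<le> norm ((snd \<circ> q) (s + h) - (snd \<circ> q) s - h *\<^sub>R z') / norm h"
        by simp
    qed
  qed
  then have "((\<lambda>h. (1 / h) *\<^sub>R (snd (q (s + h)) - snd (q s))) \<longlongrightarrow> z') (at 0)" by (simp add: LIM_zero_iff)
  then have "((\<lambda>h. RZ P ((1 / h) *\<^sub>R (snd (q (s + h)) - snd (q s)))) \<longlongrightarrow> ereal (rz z')) (at 0)"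
    unfolding RZ_real(1) by (intro tendsto_ereal rz_tendsto)
  then show ?thesis unfolding R_speed_def by (intro tendsto_Lim) simp_all
qed

text \<open>The supporting functionals of the given velocity are inserted into
  \<open>lower_dual_u\<close>, \<open>lower_dual_z\<close> or \<open>lower_pair\<close>, while
  \<open>z_frozen\<close> and \<open>u_frozen\<close> rule out the branches in which
  \<open>M0_red\<close> is infinite.\<close>

lemma M0_red_bound:
  assumes sm: "smooth_at s0 m u' z'" and G: "s0 \<in> G_set P 0 S t q"
    and dom: "\<And>k. frechet_subdiff P (tk k s0) (qk k s0) \<noteq> {}"
  shows "ereal (rz z') + M0_red P (t s0) (q s0) (u', z') \<le> ereal m"
proof -
  let ?Su = "slope_u P (t s0) (q s0)" and ?Sz = "slope_z P (t s0) (q s0)"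
  have s0: "s0 \<in> {0..S}" using sm by (simp add: smooth_at_def)
  have add: "ereal (rz z') + x \<le> ereal m" if "x \<le> ereal y" "rz z' + y \<le> m" for x y
    using add_left_mono[OF that(1), of "ereal (rz z')"] that(2) by (auto intro: order_trans)
  show ?thesis
  proof (cases "frechet_subdiff P (t s0) (q s0) = {}")
    case True
    have u0: "u' = 0"
    proof (rule all_functionals_bounded_imp_zero)
      fix \<xi> :: "'u dual"
      obtain c where c: "conjugate (Vu P) \<xi> = ereal c" "0 \<le> c" by (rule conjugate_finite[OF Vu])
      show "blinfun_apply \<xi> u' \<le> m" using lower_dual_u[OF sm, of \<xi> c] c slope_infinite(1)[OF True] RZ_real(2)[of z'] by simp
    qed
    have z0: "z' = 0"
    proof (rule all_functionals_bounded_imp_zero)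
      fix \<zeta> :: "'z dual"
      obtain c where c: "conjugate (Vz P) \<zeta> = ereal c" "0 \<le> c" by (rule conjugate_finite[OF Vz])
      show "blinfun_apply \<zeta> z' \<le> m" using lower_dual_z[OF sm, of \<zeta> c] c slope_infinite(2)[OF True] RZ_real(2)[of z'] by simp
    qed
    \<comment> \<open>The approximating curves at the parameter s0 are themselves the sequence that
      \<open>M0_red\<close> demands where the subdifferential is empty.\<close>
    have ex: "\<exists>tn x. (\<forall>n::nat. frechet_subdiff P (tn n) (x n) \<noteq> {}) \<and> tn \<longlonglongrightarrow> t s0 \<and> weak_conv x (q s0) \<and> (SUP n. Esup P (x n)) < \<infinity>"
      by (intro exI[of _ "\<lambda>k. tk k s0"] exI[of _ "\<lambda>k. qk k s0"] conjI allI dom t_lim[OF s0] q_lim[OF s0] bounded_SUP_finite[OF Esup_k[OF s0]])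
    have "M0_red P (t s0) (q s0) (u', z') = 0"
      unfolding M0_red_def Let_def using True u0 z0 ex by (simp add: zero_prod_def)
    then show ?thesis using rz_le[OF sm] by simp
  next
    case ne: False
    note sr = slope_real[OF ne]
    let ?su = "su (t s0) (q s0)" and ?sz = "sz (t s0) (q s0)"
    have bu: "ereal (rz z') + bfun (Vu P) u' (ereal ?su) \<le> ereal m"
    proof -
      obtain \<xi> where "conjugate (Vu P) \<xi> \<le> ereal ?su" "bfun (Vu P) u' (ereal ?su) \<le> ereal (blinfun_apply \<xi> u')"
        by (rule bfun_functional[OF Vu sr(3)]) (rule that)
      then show ?thesis using lower_dual_u[OF sm, of \<xi> ?su] sr by (intro add) auto
    qed
    have bz: "ereal (rz z') + bfun (Vz P) z' (ereal ?sz) \<le> ereal m"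
    proof -
      obtain \<zeta> where "conjugate (Vz P) \<zeta> \<le> ereal ?sz" "bfun (Vz P) z' (ereal ?sz) \<le> ereal (blinfun_apply \<zeta> z')"
        by (rule bfun_functional[OF Vz sr(4)]) (rule that)
      then show ?thesis using lower_dual_z[OF sm, of \<zeta> ?sz] sr by (intro add) auto
    qed
    consider "1 < expo P" | "expo P = 1" | "expo P < 1" by linarith
    then show ?thesis
    proof cases
      case 1
      then have "?su \<noteq> 0 \<Longrightarrow> z' = 0" using z_frozen[OF sm 1, of ?su] sr by simp
      then show ?thesis using 1 ne bu bz sr by (auto simp: M0_red_def)
    next
      case 2
      obtain \<xi> \<zeta> where x: "\<And>c d. conjugate (Vu P) \<xi> = ereal c \<Longrightarrow> conjugate (Vz P) \<zeta> = ereal d \<Longrightarrow> c + d \<le> ?su + ?sz"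
        "(INF \<tau>\<in>{0<..}. ereal \<tau> * (Vu P (u' /\<^sub>R \<tau>) + Vz P (z' /\<^sub>R \<tau>) + ereal ?su + ereal ?sz)) \<le> ereal (blinfun_apply \<xi> u' + blinfun_apply \<zeta> z')"
        by (rule bfun_functional_pair[OF Vu Vz sr(3,4), where v = u' and w = z']) (rule that)
      obtain c where c: "conjugate (Vu P) \<xi> = ereal c" by (rule conjugate_finite[OF Vu])
      obtain d where d: "conjugate (Vz P) \<zeta> = ereal d" by (rule conjugate_finite[OF Vz])
      have "blinfun_apply \<xi> u' + rz z' + blinfun_apply \<zeta> z' \<le> m"
        by (rule lower_pair[OF sm 2 c d x(1)[OF c d]]) (use sr in simp_all)
      then have "ereal (rz z') + (INF \<tau>\<in>{0<..}. ereal \<tau> * (Vu P (u' /\<^sub>R \<tau>) + Vz P (z' /\<^sub>R \<tau>) + ereal ?su + ereal ?sz)) \<le> ereal m"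
        by (intro add[OF x(2)]) simp
      then show ?thesis using 2 ne sr(1,2) by (simp add: M0_red_def Let_def)
    next
      case 3
      then have "?sz \<noteq> 0 \<Longrightarrow> u' = 0" using u_frozen[OF sm 3, of ?sz] sr by simp
      then show ?thesis using 3 ne bu bz sr by (auto simp: M0_red_def)
    qed
  qed
qed

lemma smooth_ae:
  "AE s in L. smooth_at s (deriv F s) (fst (velocity q s)) (snd (velocity q s)) \<and> (\<forall>k. frechet_subdiff P (tk k s) (qk k s) \<noteq> {})"
proof -
  have "AE s in L. \<forall>k. frechet_subdiff P (tk k s) (qk k s) \<noteq> {}"
    unfolding AE_all_countable using bound_ae by (auto elim: eventually_mono)
  with AE_lebesgue_on_interior ac_real_FTC(1)[OF lipschitz_imp_ac_on[OF F_lip] less_imp_le[OF S]]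
    ac_on_differentiable_ae(1)[OF refl_u lipschitz_imp_ac_on[OF u_lip] less_imp_le[OF S]]
    ac_on_differentiable_ae(1)[OF refl_z lipschitz_imp_ac_on[OF z_lip] less_imp_le[OF S]]
  show ?thesis by eventually_elim (simp add: smooth_at_def velocity_def)
qed

lemma M0_red_nonneg: "0 \<le> M0_red P t' q' v"
proof -
  have b: "0 \<le> bfun V w \<sigma>" if "dissipation_potential V" "0 \<le> \<sigma>" for V :: "'a::real_normed_vector \<Rightarrow> ereal" and w \<sigma>
    unfolding bfun_def using that by (intro INF_greatest) (auto simp: dissipation_potential_def intro!: add_nonneg_nonneg)
  have if_nn: "0 \<le> (if c then x else y)" if "0 \<le> x" "0 \<le> y" for c and x y :: ereal using that by simp
  have V: "0 \<le> Vu P w" "0 \<le> Vz P w'" for w w' using dpVu dpVz by (auto simp: dissipation_potential_def)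
  have "0 \<le> (INF \<tau>\<in>{0<..}. ereal \<tau> * (Vu P (fst v /\<^sub>R \<tau>) + Vz P (snd v /\<^sub>R \<tau>) + slope_u P t' q' + slope_z P t' q'))"
    by (intro INF_greatest ereal_0_le_mult add_nonneg_nonneg V slope_nonneg) simp
  moreover note b[OF dpVu slope_nonneg(1)[of t' q'], of "fst v"] b[OF dpVz slope_nonneg(2)[of t' q'], of "snd v"]
  ultimately show ?thesis unfolding M0_red_def Let_def by (intro if_nn) (assumption | simp)+
qed

text \<open>The bounds by C stem from the Lipschitz constant of F and provide the finite dissipation
  required of an admissible curve.\<close>

lemma lower_bound: "AE s in L. M0 P 0 S t q s \<le> ereal (deriv F s) \<and> 0 \<le> M0 P 0 S t q s \<and> R_speed P q s \<le> ereal C \<and> 0 \<le> deriv F s \<and>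
    (s \<in> G_set P 0 S t q \<longrightarrow> M0_red P (t s) (q s) (velocity q s) \<le> ereal C)"
  using smooth_ae
proof eventually_elim
    case (elim s)
    let ?v = "velocity q s"
    have sm: "smooth_at s (deriv F s) (fst ?v) (snd ?v)" using elim by blast
    then have "norm (deriv F s) \<le> C"
      unfolding smooth_at_def has_real_derivative_iff_has_vector_derivative by (intro lipschitz_derivative_bound[OF F_lip]) auto
    then have dC: "deriv F s \<le> C" by simp
    have R: "R_speed P q s = ereal (rz (snd ?v))" using sm by (intro R_speed_eq) (simp add: smooth_at_def)
    have le: "rz (snd ?v) \<le> deriv F s" by (rule rz_le[OF sm])
    show ?case
    proof (cases "s \<in> G_set P 0 S t q")
      case True
      then have b: "ereal (rz (snd ?v)) + M0_red P (t s) (q s) ?v \<le> ereal (deriv F s)"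
        using M0_red_bound[OF sm True] elim(1) by simp
      then have "M0_red P (t s) (q s) ?v \<le> ereal (deriv F s)" "0 \<le> M0_red P (t s) (q s) ?v"
        using RZ_real(2)[of "snd ?v"] M0_red_nonneg[of "t s" "q s" ?v] by (cases "M0_red P (t s) (q s) ?v"; auto)+
      then show ?thesis using b R le dC True RZ_real(2)[of "snd ?v"]
        by (auto simp: M0_def intro!: add_nonneg_nonneg intro: order_trans)
    next
      case False
      then show ?thesis using R le dC RZ_real(2)[of "snd ?v"] by (simp add: M0_def)
    qed
qed

end

lemma vector_derivative_real: "vector_derivative (f :: real \<Rightarrow> real) (at s) = deriv f s"
  by (simp add: deriv_def vector_derivative_def has_real_derivative_iff_has_vector_derivative)

lemma lipschitz_deriv_bound:
  fixes f :: "real \<Rightarrow> real"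
  assumes "c-lipschitz_on {a..b} f" "a \<le> b"
  shows "AE s in lebesgue_on {a..b}. \<bar>deriv f s\<bar> \<le> c"
  using ac_real_FTC(1)[OF lipschitz_imp_ac_on[OF assms(1)] assms(2)] AE_lebesgue_on_interior
proof eventually_elim
  case (elim s)
  then have "norm (deriv f s) \<le> c"
    unfolding has_real_derivative_iff_has_vector_derivative by (intro lipschitz_derivative_bound[OF assms(1)]) auto
  then show ?case by simp
qed

lemma integrable_bounded_interval:
  fixes f :: "real \<Rightarrow> real"
  assumes "f \<in> borel_measurable (lebesgue_on {a..b})" "AE s in lebesgue_on {a..b}. \<bar>f s\<bar> \<le> c"
  shows "integrable (lebesgue_on {a..b}) f"
  by (rule Bochner_Integration.integrable_bound[of _ "\<lambda>_. c"])
    (use assms set_integrable_const_interval[of a b c, unfolded set_integrable_lebesgue_on] in \<open>auto elim: eventually_mono\<close>)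

lemma nn_integral_ereal_interval:
  fixes h :: "real \<Rightarrow> real"
  assumes "set_integrable lebesgue {x..y} h" and g: "AE s in lebesgue_on {x..y}. g s = ereal (h s) \<and> 0 \<le> h s"
  shows "(\<integral>\<^sup>+ s\<in>{x..y}. e2ennreal (g s) \<partial>lebesgue) = ennreal (LINT s:{x..y}|lebesgue. h s)"
proof -
  have "(\<integral>\<^sup>+ s\<in>{x..y}. e2ennreal (g s) \<partial>lebesgue) = (\<integral>\<^sup>+ s. ennreal (h s) \<partial>lebesgue_on {x..y})"
    unfolding nn_integral_lebesgue_on
  proof (rule nn_integral_cong_AE)
    show "AE s in lebesgue_on {x..y}. e2ennreal (g s) = ennreal (h s)"
      using g by eventually_elim simp
  qed
  also have "\<dots> = ennreal (LINT s|lebesgue_on {x..y}. h s)"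
    by (rule nn_integral_eq_integral) (use assms in \<open>auto elim: eventually_mono simp: set_integrable_lebesgue_on\<close>)
  finally show ?thesis by (simp add: set_integral_lebesgue_on)
qed

context limit_setting
begin

section \<open>Admissibility of the limit curve\<close>

lemma G_subset: "G_set P 0 S t q \<subseteq> {0..S}" by (auto simp: G_set_def)

lemma G_pos:
  assumes "s \<in> G_set P 0 S t q" shows "0 < slope_u P (t s) (q s) \<or> 0 < slope_z P (t s) (q s)"
proof (rule ccontr)
  assume "\<not> ?thesis"
  then have "slope_u P (t s) (q s) = 0" "slope_z P (t s) (q s) = 0" using slope_nonneg[of "t s" "q s"] by auto
  then show False using assms by (simp add: G_set_def split: if_splits)
qed

text \<open>A positive slope makes t constant near s by \<open>locally_constant\<close>, which is
  incompatible with a positive derivative within the interval.\<close>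

lemma slopes_zero:
  assumes s: "s \<in> {0..S}" and d: "0 < d" "(t has_real_derivative d) (at s within {0..S})"
  shows "slope_u P (t s) (q s) = 0 \<and> slope_z P (t s) (q s) = 0"
proof (rule ccontr)
  assume "\<not> ?thesis"
  then have "0 < slope_u P (t s) (q s) \<or> 0 < slope_z P (t s) (q s)" using slope_nonneg[of "t s" "q s"] by (auto simp: less_le)
  then obtain r where r: "0 < r" "\<And>s'. s' \<in> {0..S} \<Longrightarrow> \<bar>s' - s\<bar> < r \<Longrightarrow> t s' = t s"
    by (rule locally_constant[OF s]) (rule that)
  show False
  \<comment> \<open>At the right end point the comparison has to be made with parameters to the
    left.\<close>
  proof (cases "s < S")
    case True
    obtain e where e: "0 < e" "\<And>h. 0 < h \<Longrightarrow> s + h \<in> {0..S} \<Longrightarrow> h < e \<Longrightarrow> t s < t (s + h)"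
      using has_real_derivative_pos_inc_right[OF d(2,1)] by blast
    define h where "h = min (e / 2) (min (r / 2) (S - s))"
    have "0 < h" "h < e" "h < r" "s + h \<in> {0..S}" using e(1) r(1) True s by (auto simp: h_def min_def)
    then show False using e(2)[of h] r(2)[of "s + h"] by simp
  next
    case False
    then have "0 < s" using s S by simp
    obtain e where e: "0 < e" "\<And>h. 0 < h \<Longrightarrow> s - h \<in> {0..S} \<Longrightarrow> h < e \<Longrightarrow> t (s - h) < t s"
      using has_real_derivative_pos_inc_left[OF d(2,1)] by blast
    define h where "h = min (e / 2) (min (r / 2) s)"
    have "0 < h" "h < e" "h < r" "s - h \<in> {0..S}" using e(1) r(1) \<open>0 < s\<close> s by (auto simp: h_def min_def)
    then show False using e(2)[of h] r(2)[of "s - h"] by simp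
  qed
qed

text \<open>A positive slope makes t locally constant, and a component is connected.\<close>

lemma constant_on_components:
  assumes "A \<in> components (G_set P 0 S t q)" shows "t constant_on A"
  unfolding constant_on_def
proof (cases "A = {}")
  case False
  then obtain a where a: "a \<in> A" by blast
  have "t b = t a" if b: "b \<in> A" for b
  proof (rule connected_local_const[OF in_components_connected[OF assms] b a], rule ballI)
    fix s assume "s \<in> A"
    then have sG: "s \<in> G_set P 0 S t q" using in_components_subset[OF assms] by blast
    obtain r where r: "0 < r" "\<And>s'. s' \<in> {0..S} \<Longrightarrow> \<bar>s' - s\<bar> < r \<Longrightarrow> t s' = t s"
      by (rule locally_constant[OF subsetD[OF G_subset sG] G_pos[OF sG]]) (rule that)
    show "\<forall>\<^sub>F b in at s within A. t s = t b"
      unfolding eventually_at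
    proof (intro exI[of _ r] conjI ballI impI r(1))
      fix b assume "b \<in> A" "b \<noteq> s \<and> dist b s < r"
      then have "b \<in> {0..S}" "\<bar>b - s\<bar> < r" using in_components_subset[OF assms] G_subset by (auto simp: dist_real_def)
      then show "t s = t b" using r(2) by simp
    qed
  qed
  then show "\<exists>y. \<forall>x\<in>A. t x = y" by blast
qed simp

lemma ac_Rz: "ac_wrt (Rz P) 0 S (\<lambda>s. embZri P (snd (q s)))"
proof -
  obtain c where c: "0 < c" "\<And>\<eta>. rz \<eta> \<le> c * norm \<eta>" by (rule rz_bound) (rule that)
  have "Rz P (embZri P (snd (q y)) - embZri P (snd (q x))) \<le> ereal (LINT s:{x..y}|lebesgue. c * C)"
    if xy: "0 \<le> x" "x \<le> y" "y \<le> S" for x y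
  proof -
    have "rz (snd (q y) - snd (q x)) \<le> c * norm (snd (q y) - snd (q x))" by (rule c(2))
    also have "\<dots> \<le> c * (C * (y - x))"
      using lipschitz_onD[OF z_lip, of y x] xy c(1) by (intro mult_left_mono) (auto simp: dist_norm)
    finally show ?thesis using xy
      by (simp add: set_integral_const_interval RZ_real(1)[unfolded RZ_def] blinfun.diff_right[symmetric] mult_ac)
  qed
  then show ?thesis unfolding ac_wrt_def using c(1) C by (intro exI[of _ "\<lambda>_. c * C"]) auto
qed

lemma finite_dissipation:
  "(\<integral>\<^sup>+ s\<in>{0..S}. e2ennreal (R_speed P q s) \<partial>lebesgue)
    + (\<integral>\<^sup>+ s\<in>G_set P 0 S t q. e2ennreal (M0_red P (t s) (q s) (velocity q s)) \<partial>lebesgue) < \<infinity>"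
proof -
  have fin: "(\<integral>\<^sup>+ s. ennreal C \<partial>L) < \<infinity>"
    using C S by (simp add: emeasure_restrict_space ennreal_mult_less_top)
  have e2: "e2ennreal x \<le> ennreal C" if "x \<le> ereal C" for x using e2ennreal_mono[OF that] by simp
  have b: "AE s in L. R_speed P q s \<le> ereal C"
    "AE s in L. s \<in> G_set P 0 S t q \<longrightarrow> M0_red P (t s) (q s) (velocity q s) \<le> ereal C"
    using lower_bound by (rule eventually_mono; blast)+
  have "(\<integral>\<^sup>+ s. e2ennreal (R_speed P q s) \<partial>L) \<le> (\<integral>\<^sup>+ s. ennreal C \<partial>L)"
    by (rule nn_integral_mono_AE) (use b(1) in \<open>auto elim!: eventually_mono intro: e2\<close>)
  moreover have "(\<integral>\<^sup>+ s\<in>G_set P 0 S t q. e2ennreal (M0_red P (t s) (q s) (velocity q s)) \<partial>lebesgue)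
     = (\<integral>\<^sup>+ s\<in>{0..S}. (if s \<in> G_set P 0 S t q then e2ennreal (M0_red P (t s) (q s) (velocity q s)) else 0) \<partial>lebesgue)"
    using G_subset by (intro nn_integral_cong) (auto simp: indicator_def)
  moreover have "(\<integral>\<^sup>+ s. (if s \<in> G_set P 0 S t q then e2ennreal (M0_red P (t s) (q s) (velocity q s)) else 0) \<partial>L) \<le> (\<integral>\<^sup>+ s. ennreal C \<partial>L)"
    by (rule nn_integral_mono_AE) (use b(2) in \<open>auto elim!: eventually_mono intro: e2\<close>)
  ultimately show ?thesis using fin by (auto simp: nn_integral_lebesgue_on intro: le_less_trans)
qed

lemma admissible: "admissible_curve P 0 S t q"
proof -
  have "ac_on c d (snd \<circ> q)" if "{c..d} \<subseteq> G_set P 0 S t q" for c d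
    by (rule lipschitz_imp_ac_on[OF lipschitz_on_subset[OF z_lip]]) (use that G_subset in blast)
  moreover have "(SUP s\<in>{0..S}. Esup P (q s)) < \<infinity>"
    using SUP_least[of "{0..S}" "\<lambda>s. Esup P (q s)" "ereal M"] Esup_q by (auto intro: le_less_trans)
  ultimately show ?thesis
    unfolding admissible_curve_def
    using S t_in t_mono lipschitz_imp_ac_on[OF t_lip] lipschitz_imp_ac_on[OF u_lip] ac_Rz slopes_zero finite_dissipation constant_on_components
    by auto
qed

section \<open>Limit of the power integral\<close>

abbreviation "fk k s \<equiv> dtE P (tk k s) (qk k s)"
abbreviation "ft s \<equiv> dtE P (t s) (q s)"

text \<open>On the sublevel M of \<open>Esup\<close> the power control gives the bound K * M,
  simultaneously for the approximating curves and the limit.\<close>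

lemma power_bounded:
  obtains B where "0 \<le> B" "\<And>k s. s \<in> {0..S} \<Longrightarrow> \<bar>fk k s\<bar> \<le> B" "\<And>s. s \<in> {0..S} \<Longrightarrow> \<bar>ft s\<bar> \<le> B"
proof -
  obtain K where K: "0 < K" "\<And>q t. q \<in> Dom P \<Longrightarrow> t \<in> {0..horizon P} \<Longrightarrow> \<bar>dtE P t q\<bar> \<le> K * en t q"
    by (rule power_bound) (rule that)
  have le: "\<bar>dtE P t' q'\<bar> \<le> K * M" if "t' \<in> {0..horizon P}" "Esup P q' \<le> ereal M" for t' q'
    using K(2)[OF Esup_Dom(1)[OF that(2)] that(1)] mult_left_mono[OF Esup_Dom(2)[OF that(2,1)] less_imp_le[OF K(1)]] by linarith
  have "0 \<le> K * M" using le[OF t_in Esup_q, of 0 0] S by (auto simp: order_trans[OF abs_ge_zero])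
  then show thesis using that[of "K * M"] le[OF tk_in Esup_k] le[OF t_in Esup_q] by blast
qed

lemma power_pointwise:
  assumes s: "s \<in> {0..S}" and d: "\<And>k. 0 < deriv (tk k) s \<and> deriv (tk k) s \<le> C"
    and f: "\<And>n k. N n \<le> k \<Longrightarrow> 1 / real (Suc n) \<le> deriv (tk k) s \<Longrightarrow>
      \<exists>\<mu> \<zeta>. (\<mu>, \<zeta>) \<in> frechet_subdiff P (tk k s) (qk k s) \<and> norm \<mu> \<le> K n \<and> norm \<zeta> \<le> (K n :: real)"
  shows "(\<lambda>k. (fk k s - ft s) * deriv (tk k) s) \<longlonglongrightarrow> 0"
proof (rule ccontr)
  obtain B where B: "0 \<le> B" "\<And>k s. s \<in> {0..S} \<Longrightarrow> \<bar>fk k s\<bar> \<le> B" "\<And>s. s \<in> {0..S} \<Longrightarrow> \<bar>ft s\<bar> \<le> B"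
    by (rule power_bounded) (rule that)
  assume "\<not> ?thesis"
  then obtain e where e: "0 < e" "\<And>N. \<exists>k\<ge>N. e \<le> \<bar>fk k s - ft s\<bar> * deriv (tk k) s"
    using d by (auto simp: LIMSEQ_iff abs_mult not_less less_imp_le)
  \<comment> \<open>A product of size e with a power difference of at most 2B forces t_k' >= e/(2B +
    1), and n is chosen so that this exceeds 1/(n + 1).\<close>
  obtain n where n: "inverse (real (Suc n)) < e / (2 * B + 1)" using reals_Archimedean[of "e / (2 * B + 1)"] e(1) B(1) by auto
  define I where "I = {k. N n \<le> k \<and> e \<le> \<bar>fk k s - ft s\<bar> * deriv (tk k) s}"
  have "infinite I" unfolding infinite_nat_iff_unbounded_le
  proof
    fix m obtain k where "max m (N n) \<le> k" "e \<le> \<bar>fk k s - ft s\<bar> * deriv (tk k) s" using e(2) by blast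
    then show "\<exists>k\<ge>m. k \<in> I" unfolding I_def by auto
  qed
  from infinite_enumerate[OF this] obtain r :: "nat \<Rightarrow> nat" where r: "strict_mono r" "\<And>j. r j \<in> I" by blast
  have big: "1 / real (Suc n) \<le> deriv (tk (r j)) s" for j
  proof -
    have "e \<le> \<bar>fk (r j) s - ft s\<bar> * deriv (tk (r j)) s" using r(2) by (simp add: I_def)
    also have "\<dots> \<le> (2 * B + 1) * deriv (tk (r j)) s"
      using B(2)[OF s, of "r j"] B(3)[OF s] d[of "r j"] by (intro mult_right_mono) auto
    finally have "e / (2 * B + 1) \<le> deriv (tk (r j)) s" using B(1) by (simp add: divide_le_eq mult.commute)
    then show ?thesis using n by (simp add: inverse_eq_divide)
  qed
  have "\<exists>\<mu> \<zeta>. (\<mu>, \<zeta>) \<in> frechet_subdiff P (tk (r j) s) (qk (r j) s) \<and> norm \<mu> \<le> K n \<and> norm \<zeta> \<le> K n" for j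
    by (rule f[OF _ big]) (use r(2) in \<open>simp add: I_def\<close>)
  then obtain \<mu> \<zeta> where mz: "\<And>j. (\<mu> j, \<zeta> j) \<in> frechet_subdiff P (tk (r j) s) (qk (r j) s)" "\<And>j. norm (\<mu> j) \<le> K n" "\<And>j. norm (\<zeta> j) \<le> K n"
    by metis
  obtain r1 l1 where 1: "strict_mono r1" "weak_conv (\<mu> \<circ> r1) l1" by (rule weak_compact_dual[OF refl_u, of \<mu> "K n"]) (rule mz(2), rule that)
  have b: "norm ((\<zeta> \<circ> r1) j) \<le> K n" for j using mz(3) by simp
  obtain r2 l2 where 2: "strict_mono r2" "weak_conv ((\<zeta> \<circ> r1) \<circ> r2) l2" by (rule weak_compact_dual[OF refl_z b]) (rule that)
  define \<kappa> where "\<kappa> = r \<circ> (r1 \<circ> r2)"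
  have \<kappa>: "strict_mono \<kappa>" unfolding \<kappa>_def by (intro strict_mono_o r(1) 1(1) 2(1))
  have wc: "weak_conv (\<lambda>j. (\<mu> (r1 (r2 j)), \<zeta> (r1 (r2 j)))) (l1, l2)"
    unfolding weak_conv_Pair using weak_conv_subseq[OF 1(2) 2(1)] 2(2) by (simp add: comp_def)
  have "(\<lambda>j. fk (\<kappa> j) s) \<longlonglongrightarrow> ft s"
  proof -
    have "(\<lambda>j. tk (\<kappa> j) s) \<longlonglongrightarrow> t s" "weak_conv (\<lambda>j. qk (\<kappa> j) s) (q s)"
      using LIMSEQ_subseq_LIMSEQ[OF t_lim[OF s] \<kappa>] weak_conv_subseq[OF q_lim[OF s] \<kappa>] by (simp_all add: comp_def)
    moreover have "(SUP j. Esup P (qk (\<kappa> j) s)) < \<infinity>" by (rule bounded_SUP_finite[OF Esup_k[OF s]])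
    moreover have "\<forall>j. (\<mu> (r1 (r2 j)), \<zeta> (r1 (r2 j))) \<in> frechet_subdiff P (tk (\<kappa> j) s) (qk (\<kappa> j) s)"
      using mz(1) by (simp add: \<kappa>_def)
    ultimately show ?thesis using closedness wc unfolding H_closed_def by blast
  qed
  then have "\<forall>\<^sub>F j in sequentially. dist (fk (\<kappa> j) s) (ft s) < e / C" using e(1) C by (intro tendstoD) auto
  then obtain j where j: "\<bar>fk (\<kappa> j) s - ft s\<bar> < e / C" by (auto simp: dist_real_def eventually_sequentially)
  have "e \<le> \<bar>fk (\<kappa> j) s - ft s\<bar> * deriv (tk (\<kappa> j)) s" using r(2) by (simp add: I_def \<kappa>_def)
  also have "\<dots> \<le> \<bar>fk (\<kappa> j) s - ft s\<bar> * C" using d by (intro mult_left_mono) auto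
  finally show False using j C by (simp add: field_simps)
qed

text \<open>\<open>forces\<close> has an exceptional null set for each threshold and index;
  restricting the thresholds to 1/(n + 1) leaves countably many.\<close>

lemma power_pointwise_ae: "AE s in L. (\<lambda>k. (fk k s - ft s) * deriv (tk k) s) \<longlonglongrightarrow> 0"
proof -
  define Q where "Q n K k0 \<longleftrightarrow> (\<forall>k\<ge>k0. AE s in L. 1 / real (Suc n) \<le> deriv (tk k) s \<longrightarrow>
      (\<exists>\<mu> \<zeta>. (\<mu>, \<zeta>) \<in> frechet_subdiff P (tk k s) (qk k s) \<and> norm \<mu> \<le> K \<and> norm \<zeta> \<le> K))" for n :: nat and K :: real and k0 :: nat
  have "\<exists>K k0. Q n K k0" for n unfolding Q_def by (rule forces) simp
  then obtain K k0 where f: "\<And>n. Q n (K n) (k0 n)" by metis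
  have f': "AE s in L. k0 n \<le> k \<longrightarrow> 1 / real (Suc n) \<le> deriv (tk k) s \<longrightarrow>
      (\<exists>\<mu> \<zeta>. (\<mu>, \<zeta>) \<in> frechet_subdiff P (tk k s) (qk k s) \<and> norm \<mu> \<le> K n \<and> norm \<zeta> \<le> K n)" for n k
    using f[of n] unfolding Q_def by (cases "k0 n \<le> k") simp_all
  have "AE s in L. \<forall>n k. k0 n \<le> k \<longrightarrow> 1 / real (Suc n) \<le> deriv (tk k) s \<longrightarrow>
      (\<exists>\<mu> \<zeta>. (\<mu>, \<zeta>) \<in> frechet_subdiff P (tk k s) (qk k s) \<and> norm \<mu> \<le> K n \<and> norm \<zeta> \<le> K n)"
    unfolding AE_all_countable using f' by blast
  moreover have "AE s in L. \<forall>k. 0 < deriv (tk k) s \<and> deriv (tk k) s \<le> C"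
    unfolding AE_all_countable using bound_ae by (auto elim: eventually_mono)
  ultimately show ?thesis using AE_lebesgue_on_interior
  proof eventually_elim
    case (elim s)
    show ?case by (rule power_pointwise[where N = k0 and K = K]) (use elim in auto)
  qed
qed

lemma power_measurable:
  assumes "s \<in> {0..S}"
  shows "fk k \<in> borel_measurable (lebesgue_on {0..s})" "ft \<in> borel_measurable (lebesgue_on {0..s})"
proof -
  have sub: "{0..s} \<subseteq> {0..S}" using assms by auto
  have w: "weakly_cont_on {0..s} x" if "weakly_cont_on {0..S} x" for x :: "real \<Rightarrow> 'u \<times> 'z"
    using that unfolding weakly_cont_on_def by (blast intro: continuous_on_subset[OF _ sub])
  show "fk k \<in> borel_measurable (lebesgue_on {0..s})"
    by (rule curve_power_measurable[OF lipschitz_on_continuous_on[OF lipschitz_on_subset[OF tk_lip sub]] tk_in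
        w[OF weakly_cont_curve[OF uk_lip zk_lip]] Esup_k]) (use sub in blast)+
  show "ft \<in> borel_measurable (lebesgue_on {0..s})"
    by (rule curve_power_measurable[OF lipschitz_on_continuous_on[OF lipschitz_on_subset[OF t_lip sub]] t_in
        w[OF weakly_cont_curve[OF u_lip z_lip]] Esup_q]) (use sub in blast)+
qed

lemma lip_deriv_measurable:
  fixes g :: "real \<Rightarrow> real"
  assumes "s \<in> {0..S}" "c-lipschitz_on {0..S} g"
  shows "deriv g \<in> borel_measurable (lebesgue_on {0..s})" "AE r in lebesgue_on {0..s}. \<bar>deriv g r\<bar> \<le> c"
proof -
  have lip: "c-lipschitz_on {0..s} g" by (rule lipschitz_on_subset[OF assms(2)]) (use assms in auto)
  show "deriv g \<in> borel_measurable (lebesgue_on {0..s})"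
    using ac_real_FTC(2)[OF lipschitz_imp_ac_on[OF lip]] assms(1) by (auto simp: set_integrable_lebesgue_on)
  show "AE r in lebesgue_on {0..s}. \<bar>deriv g r\<bar> \<le> c" by (rule lipschitz_deriv_bound[OF lip]) (use assms in auto)
qed

lemma power_integrable:
  fixes h g :: "real \<Rightarrow> real"
  assumes s: "s \<in> {0..S}" and h: "h \<in> borel_measurable (lebesgue_on {0..s})" "\<And>r. r \<in> {0..S} \<Longrightarrow> \<bar>h r\<bar> \<le> B" and g: "C-lipschitz_on {0..S} g"
  shows "integrable (lebesgue_on {0..s}) (\<lambda>r. h r * deriv g r)"
proof (rule integrable_bounded_interval)
  show "(\<lambda>r. h r * deriv g r) \<in> borel_measurable (lebesgue_on {0..s})"
    using h(1) lip_deriv_measurable(1)[OF s g] by measurable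
  show "AE r in lebesgue_on {0..s}. \<bar>h r * deriv g r\<bar> \<le> B * C"
    using lip_deriv_measurable(2)[OF s g] AE_lebesgue_on_interior
  proof eventually_elim
    case (elim r)
    then show ?case using h(2)[of r] s by (auto simp: abs_mult intro!: mult_mono order_trans[OF abs_ge_zero])
  qed
qed

text \<open>The power difference times t_k' tends to zero pointwise and boundedly. In the remaining
  term the factor \<open>ft\<close> no longer depends on k and is an integrable test function for
  the weak-star convergence of t_k'.\<close>

lemma power_conv:
  assumes s: "s \<in> {0..S}"
  shows "(\<lambda>k. LINT r:{0..s}|lebesgue. fk k r * deriv (tk k) r) \<longlonglongrightarrow> (LINT r:{0..s}|lebesgue. ft r * deriv t r)"
proof -
  let ?L = "lebesgue_on {0..s}"
  obtain B where B: "0 \<le> B" "\<And>k s. s \<in> {0..S} \<Longrightarrow> \<bar>fk k s\<bar> \<le> B" "\<And>s. s \<in> {0..S} \<Longrightarrow> \<bar>ft s\<bar> \<le> B"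
    by (rule power_bounded) (rule that)
  note pm = power_measurable[OF s]
  have diff: "\<bar>fk k r - ft r\<bar> \<le> B + B" if "r \<in> {0..S}" for k r using B(2)[OF that, of k] B(3)[OF that] by linarith
  have i1: "integrable ?L (\<lambda>r. (fk k r - ft r) * deriv (tk k) r)" for k
    by (rule power_integrable[OF s borel_measurable_diff[OF pm] diff tk_lip])
  have i2: "integrable ?L (\<lambda>r. ft r * deriv (tk k) r)" for k
    by (rule power_integrable[OF s pm(2) B(3) tk_lip])
  have "(\<lambda>k. LINT r|?L. (fk k r - ft r) * deriv (tk k) r) \<longlonglongrightarrow> (LINT r|?L. 0)"
  proof (rule integral_dominated_convergence[where w = "\<lambda>_. (B + B) * C"])
    show "(\<lambda>r. (fk k r - ft r) * deriv (tk k) r) \<in> borel_measurable ?L" for k using i1 by (rule borel_measurable_integrable)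
    show "integrable ?L (\<lambda>_. (B + B) * C)" using set_integrable_const_interval[of 0 s "(B + B) * C"] by (simp only: set_integrable_lebesgue_on)
    show "AE r in ?L. (\<lambda>k. (fk k r - ft r) * deriv (tk k) r) \<longlonglongrightarrow> 0"
      by (rule AE_lebesgue_on_subinterval[OF power_pointwise_ae]) (use s in auto)
    show "AE r in ?L. norm ((fk k r - ft r) * deriv (tk k) r) \<le> (B + B) * C" for k
      using lip_deriv_measurable(2)[OF s tk_lip[of k]] AE_lebesgue_on_interior
    proof eventually_elim
      case (elim r)
      then have "\<bar>fk k r - ft r\<bar> \<le> B + B" using B(2)[of r k] B(3)[of r] s by auto
      then show ?case unfolding real_norm_def abs_mult using elim B(1) by (intro mult_mono) auto
    qed
  qed simp
  moreover have "(\<lambda>k. LINT r|?L. ft r * deriv (tk k) r) \<longlonglongrightarrow> (LINT r|?L. ft r * deriv t r)"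
  proof -
    have sub: "{0..s} \<subseteq> {0..S}" using s by auto
    have "weak_star_W1inf 0 s tk t"
    proof (rule lipschitz_weak_star_W1inf[OF reflexive_real])
      show "weak_conv (\<lambda>n. tk n r) (t r)" if "r \<in> {0..s}" for r using t_lim that s by (intro LIMSEQ_imp_weak_conv) auto
      show "norm (tk n r) \<le> horizon P" if "r \<in> {0..s}" for n r using tk_in[of r n] that sub by auto
      show "norm (t r) \<le> horizon P" if "r \<in> {0..s}" for r using t_in[of r] that sub by auto
    qed (use s lipschitz_on_subset[OF tk_lip sub] lipschitz_on_subset[OF t_lip sub] in auto)
    \<comment> \<open>The dual of the reals is spanned by the identity; the scalar \<open>ft\<close>
      becomes a dual-valued test function through it.\<close>
    moreover have "in_L1 0 s (\<lambda>r. ft r *\<^sub>R (id_blinfun :: real dual))"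
      unfolding in_L1_def
    proof
      obtain \<phi> where \<phi>: "\<And>i::nat. simple_function ?L (\<phi> i)" "AE r in ?L. (\<lambda>i. \<phi> i r) \<longlonglongrightarrow> ft r"
        using borel_measurable_imp_strongly_measurable[OF pm(2)] unfolding strongly_measurable_def by blast
      have "simple_function ?L (\<lambda>r. \<phi> i r *\<^sub>R (id_blinfun :: real dual))" for i by (intro simple_function_compose1[OF \<phi>(1)])
      moreover have "AE r in ?L. (\<lambda>i. \<phi> i r *\<^sub>R (id_blinfun :: real dual)) \<longlonglongrightarrow> ft r *\<^sub>R id_blinfun"
        using \<phi>(2) by eventually_elim (intro tendsto_intros)
      ultimately show "strongly_measurable ?L (\<lambda>r. ft r *\<^sub>R (id_blinfun :: real dual))"
        unfolding strongly_measurable_def by (intro exI[of _ "\<lambda>i r. \<phi> i r *\<^sub>R id_blinfun"]) blast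
      have "(\<integral>\<^sup>+ r. ennreal (norm (ft r *\<^sub>R (id_blinfun :: real dual))) \<partial>?L) \<le> (\<integral>\<^sup>+ r. ennreal (B * norm (id_blinfun :: real dual)) \<partial>?L)"
        using B(3) s by (intro nn_integral_mono ennreal_leI) (auto intro!: mult_right_mono)
      also have "\<dots> < \<infinity>" using s by (simp add: emeasure_restrict_space ennreal_mult_less_top)
      finally show "(\<integral>\<^sup>+ r. ennreal (norm (ft r *\<^sub>R (id_blinfun :: real dual))) \<partial>?L) < \<infinity>" .
    qed
    ultimately have "(\<lambda>n. LINT r|?L. blinfun_apply (ft r *\<^sub>R id_blinfun) (vector_derivative (tk n) (at r)))
       \<longlonglongrightarrow> (LINT r|?L. blinfun_apply (ft r *\<^sub>R id_blinfun) (vector_derivative t (at r)))"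
      unfolding weak_star_W1inf_def weak_star_Linf_def by blast
    then show ?thesis by (simp add: blinfun.scaleR_left vector_derivative_real)
  qed
  ultimately have "(\<lambda>k. (LINT r|?L. (fk k r - ft r) * deriv (tk k) r) + (LINT r|?L. ft r * deriv (tk k) r)) \<longlonglongrightarrow> (LINT r|?L. 0) + (LINT r|?L. ft r * deriv t r)"
    by (rule tendsto_add)
  moreover have "(LINT r|?L. fk k r * deriv (tk k) r) = (LINT r|?L. (fk k r - ft r) * deriv (tk k) r) + (LINT r|?L. ft r * deriv (tk k) r)" for k
    by (subst Bochner_Integration.integral_add[OF i1 i2, symmetric]) (simp add: algebra_simps)
  ultimately show ?thesis by (simp add: set_integral_lebesgue_on)
qed

section \<open>Energy balance in the limit\<close>

definition et :: "real \<Rightarrow> real" where "et s = en (t s) (q s)"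

lemma energy_k_real: "s \<in> {0..S} \<Longrightarrow> En P (tk k s) (qk k s) = ereal (en (tk k s) (qk k s))"
  by (intro Dom_energy(1) Esup_Dom(1)[OF Esup_k] tk_in)

lemma energy_q_real: "s \<in> {0..S} \<Longrightarrow> En P (t s) (q s) = ereal (et s)"
  unfolding et_def by (intro Dom_energy(1) Esup_Dom(1)[OF Esup_q] t_in)

lemma energy_liminf: "s \<in> {0..S} \<Longrightarrow> ereal (et s) \<le> liminf (\<lambda>k. En P (tk k s) (qk k s))"
  using energy_lsc[of "\<lambda>k. tk k s" "t s" "\<lambda>k. qk k s" "q s" M] tk_in t_lim q_lim Esup_k by (simp add: energy_q_real)

lemma energy_upper_conv:
  assumes s: "s \<in> {0..S}"
  shows "(\<lambda>k. en 0 (qk k 0) + (LINT r:{0..s}|lebesgue. fk k r * deriv (tk k) r) - Fk k s)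
    \<longlonglongrightarrow> et 0 + (LINT r:{0..s}|lebesgue. ft r * deriv t r) - F s"
  unfolding et_def t_0 by (intro tendsto_intros init power_conv[OF s] F_lim'[OF s])

lemma energy_upper_k:
  "s \<in> {0..S} \<Longrightarrow> En P (tk k s) (qk k s) \<le> ereal (en 0 (qk k 0) + (LINT r:{0..s}|lebesgue. fk k r * deriv (tk k) r) - Fk k s)"
  unfolding energy_k_real Fk_def using energy_k[of s k] by simp

lemma energy_le:
  assumes s: "s \<in> {0..S}" shows "et s + F s \<le> et 0 + (LINT r:{0..s}|lebesgue. ft r * deriv t r)"
proof -
  have "ereal (et s) \<le> liminf (\<lambda>k. En P (tk k s) (qk k s))" by (rule energy_liminf[OF s])
  also have "\<dots> \<le> liminf (\<lambda>k. ereal (en 0 (qk k 0) + (LINT r:{0..s}|lebesgue. fk k r * deriv (tk k) r) - Fk k s))"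
    using energy_upper_k[OF s] by (intro Liminf_mono always_eventually allI)
  also have "\<dots> = ereal (et 0 + (LINT r:{0..s}|lebesgue. ft r * deriv t r) - F s)"
    by (intro lim_imp_Liminf tendsto_ereal energy_upper_conv[OF s]) simp
  finally show ?thesis by simp
qed

lemma power_set_integrable: "set_integrable lebesgue {0..S} (\<lambda>r. ft r * deriv t r)"
proof -
  obtain B where B: "\<And>s. s \<in> {0..S} \<Longrightarrow> \<bar>ft s\<bar> \<le> B" by (rule power_bounded) (rule that)
  have S': "S \<in> {0..S}" using S by simp
  show ?thesis unfolding set_integrable_lebesgue_on by (rule power_integrable[OF S' power_measurable(2)[OF S'] B t_lip])
qed

lemma chain_rule: "ac_on 0 S et" "AE s in L. - M0 P 0 S t q s \<le> ereal (deriv et s - ft s * deriv t s)"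
  using chain admissible unfolding H_chain_param_def Let_def et_def en_def by blast+

text \<open>The chain rule bounds the excess below by F' - M0, which is nonnegative by
  \<open>lower_bound\<close>.\<close>

lemma excess_nonneg: "AE s in L. 0 \<le> deriv F s + deriv et s - ft s * deriv t s"
  using chain_rule(2) lower_bound
proof eventually_elim
  case (elim s)
  then have "M0 P 0 S t q s \<le> ereal (deriv F s)" by blast
  with elim(1) show ?case by (cases "M0 P 0 S t q s") auto
qed

lemma excess_integrable:
  assumes "0 \<le> x" "x \<le> y" "y \<le> S"
  shows "set_integrable lebesgue {x..y} (\<lambda>s. deriv F s + deriv et s - ft s * deriv t s)"
    "(LINT s:{x..y}|lebesgue. deriv F s + deriv et s - ft s * deriv t s)
      = F y - F x + (et y - et x) - (LINT s:{x..y}|lebesgue. ft s * deriv t s)"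
proof -
  note FF = ac_real_FTC[OF lipschitz_imp_ac_on[OF F_lip] less_imp_le[OF S]]
  note FE = ac_real_FTC[OF chain_rule(1) less_imp_le[OF S]]
  have sub: "set_integrable lebesgue {x..y} (deriv F)" "set_integrable lebesgue {x..y} (deriv et)" "set_integrable lebesgue {x..y} (\<lambda>s. ft s * deriv t s)"
    by (rule set_integrable_subset[OF FF(2)] set_integrable_subset[OF FE(2)] set_integrable_subset[OF power_set_integrable]; use assms in simp)+
  show "set_integrable lebesgue {x..y} (\<lambda>s. deriv F s + deriv et s - ft s * deriv t s)"
    using sub by (intro set_integral_add set_integral_diff)
  show "(LINT s:{x..y}|lebesgue. deriv F s + deriv et s - ft s * deriv t s)
      = F y - F x + (et y - et x) - (LINT s:{x..y}|lebesgue. ft s * deriv t s)"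
    unfolding FF(3)[OF assms] FE(3)[OF assms] using sub by (simp add: set_integral_add set_integral_diff)
qed

lemma chain_le:
  assumes "0 \<le> x" "x \<le> y" "y \<le> S"
  shows "(LINT s:{x..y}|lebesgue. ft s * deriv t s) \<le> F y - F x + (et y - et x)"
proof -
  have "(LINT s:{x..y}|lebesgue. 0) \<le> (LINT s:{x..y}|lebesgue. deriv F s + deriv et s - ft s * deriv t s)"
    by (rule set_integral_mono_AE[OF _ excess_integrable(1) excess_nonneg assms(1,3)]) (use S in auto)
  then show ?thesis unfolding excess_integrable(2)[OF assms] by (simp add: set_lebesgue_integral_def)
qed

text \<open>On {0..s} the inequality from lower semicontinuity and the integrated chain rule are
  opposite bounds, so equality holds there, and on other subintervals by subtraction.\<close>

lemma energy_balance:
  assumes "0 \<le> x" "x \<le> y" "y \<le> S"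
  shows "et y + (F y - F x) = et x + (LINT s:{x..y}|lebesgue. ft s * deriv t s)"
proof -
  have eq: "et s + F s = et 0 + (LINT r:{0..s}|lebesgue. ft r * deriv t r)" if "s \<in> {0..S}" for s
    using energy_le[OF that] chain_le[of 0 s] that F_0 by auto
  have "(LINT r:{0..y}|lebesgue. ft r * deriv t r) = (LINT r:{0..x}|lebesgue. ft r * deriv t r) + (LINT r:{x..y}|lebesgue. ft r * deriv t r)"
    using set_integral_split[OF power_set_integrable assms] set_integral_split[OF power_set_integrable, of 0 x] set_integral_split[OF power_set_integrable, of 0 y] assms
    by simp
  then show ?thesis using eq[of x] eq[of y] assms by simp
qed

text \<open>The excess is nonnegative with zero integral and so vanishes almost everywhere. The
  chain rule then reads -M0 <= -F', the converse of \<open>lower_bound\<close>.\<close>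

lemma M0_eq: "AE s in L. M0 P 0 S t q s = ereal (deriv F s) \<and> 0 \<le> deriv F s"
proof -
  have S': "0 \<le> (0::real)" "0 \<le> S" "S \<le> S" using S by auto
  have "(LINT s|L. deriv F s + deriv et s - ft s * deriv t s) = 0"
    using excess_integrable(2)[OF S'] energy_balance[OF S'] by (simp add: set_integral_lebesgue_on)
  then have "AE s in L. deriv F s + deriv et s - ft s * deriv t s = 0"
    using integral_nonneg_eq_0_iff_AE[OF _ excess_nonneg] excess_integrable(1)[OF S'] by (simp add: set_integrable_lebesgue_on)
  with chain_rule(2) lower_bound show ?thesis
  proof eventually_elim
    case (elim s)
    then have "deriv et s - ft s * deriv t s = - deriv F s" by simp
    with elim show ?case by (cases "M0 P 0 S t q s") auto
  qed
qed

lemma nn_integral_M0: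
  assumes "0 \<le> x" "x \<le> y" "y \<le> S"
  shows "(\<integral>\<^sup>+ s\<in>{x..y}. e2ennreal (M0 P 0 S t q s) \<partial>lebesgue) = ennreal (F y - F x)"
proof -
  note FF = ac_real_FTC[OF lipschitz_imp_ac_on[OF F_lip] less_imp_le[OF S]]
  have "set_integrable lebesgue {x..y} (deriv F)" by (rule set_integrable_subset[OF FF(2)]) (use assms in auto)
  moreover have "AE s in lebesgue_on {x..y}. M0 P 0 S t q s = ereal (deriv F s) \<and> 0 \<le> deriv F s"
    by (rule AE_lebesgue_on_subinterval[OF M0_eq assms(1,3)])
  ultimately show ?thesis unfolding FF(3)[OF assms] by (rule nn_integral_ereal_interval)
qed

text \<open>Both sides are increments of primitives, so the claim is the pointwise convergence of
  \<open>Fk\<close> to F.\<close>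

lemma nn_integral_M_eps_conv:
  assumes "0 \<le> x" "x \<le> y" "y \<le> S"
  shows "(\<lambda>k. \<integral>\<^sup>+ \<sigma>\<in>{x..y}. e2ennreal (M_eps P (\<epsilon> k) (tk k \<sigma>) (qk k \<sigma>) (deriv (tk k) \<sigma>) (velocity (qk k) \<sigma>)) \<partial>lebesgue)
    \<longlonglongrightarrow> (\<integral>\<^sup>+ \<sigma>\<in>{x..y}. e2ennreal (M0 P 0 S t q \<sigma>) \<partial>lebesgue)"
proof -
  have "(\<integral>\<^sup>+ \<sigma>\<in>{x..y}. e2ennreal (M_eps P (\<epsilon> k) (tk k \<sigma>) (qk k \<sigma>) (deriv (tk k) \<sigma>) (velocity (qk k) \<sigma>)) \<partial>lebesgue) = ennreal (Fk k y - Fk k x)" for k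
  proof -
    have "set_integrable lebesgue {x..y} (Mk k)" by (rule set_integrable_subset[OF Mk_int]) (use assms in auto)
    moreover have "AE s in lebesgue_on {x..y}. M_eps P (\<epsilon> k) (tk k s) (qk k s) (deriv (tk k) s) (velocity (qk k) s) = ereal (Mk k s) \<and> 0 \<le> Mk k s"
      by (rule AE_lebesgue_on_subinterval[OF _ assms(1,3)]) (use bound_ae[of k] in \<open>auto elim: eventually_mono\<close>)
    ultimately show ?thesis unfolding Fk_diff[OF assms, symmetric] by (rule nn_integral_ereal_interval)
  qed
  then show ?thesis unfolding nn_integral_M0[OF assms] using assms by (auto intro!: tendsto_ennrealI tendsto_diff F_lim')
qed

text \<open>The upper bounds in \<open>energy_upper_k\<close> converge exactly to
  \<open>et s\<close> because the limit balance is an equality; liminf and limsup therefore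
  agree.\<close>

lemma energy_conv:
  assumes s: "s \<in> {0..S}" shows "(\<lambda>k. En P (tk k s) (qk k s)) \<longlonglongrightarrow> En P (t s) (q s)"
proof -
  have "limsup (\<lambda>k. En P (tk k s) (qk k s)) \<le> limsup (\<lambda>k. ereal (en 0 (qk k 0) + (LINT r:{0..s}|lebesgue. fk k r * deriv (tk k) r) - Fk k s))"
    using energy_upper_k[OF s] by (intro Limsup_mono always_eventually allI)
  also have "\<dots> = ereal (et 0 + (LINT r:{0..s}|lebesgue. ft r * deriv t r) - F s)"
    by (intro lim_imp_Limsup tendsto_ereal energy_upper_conv[OF s]) simp
  also have "et 0 + (LINT r:{0..s}|lebesgue. ft r * deriv t r) - F s = et s" using energy_balance[of 0 s] s F_0 by simp
  finally have "limsup (\<lambda>k. En P (tk k s) (qk k s)) \<le> ereal (et s)" .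
  moreover note energy_liminf[OF s]
  moreover have "liminf (\<lambda>k. En P (tk k s) (qk k s)) \<le> limsup (\<lambda>k. En P (tk k s) (qk k s))" by (rule Liminf_le_Limsup) simp
  ultimately show ?thesis
    unfolding energy_q_real[OF s] by (subst tendsto_iff_Liminf_eq_Limsup) auto
qed

lemma enhanced: "enhanced_pBV_solution P 0 S t q"
proof -
  have "En P (t y) (q y) + enn2ereal (\<integral>\<^sup>+ s\<in>{x..y}. e2ennreal (M0 P 0 S t q s) \<partial>lebesgue)
        = En P (t x) (q x) + ereal (LINT s:{x..y}|lebesgue. ft s * deriv t s)" if xy: "0 \<le> x" "x \<le> y" "y \<le> S" for x y
    using energy_balance[OF xy] F_incr[OF xy] xy by (simp add: nn_integral_M0[OF xy] energy_q_real enn2ereal_ennreal)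
  then show ?thesis unfolding enhanced_pBV_solution_def pBV_solution_def
    using admissible power_set_integrable lipschitz_imp_ac_on[OF z_lip] by simp
qed

end

section \<open>Compactness\<close>

text \<open>A diagonal sequence over all pairs of a family index and a point of a countable dense
  set, enumerated by \<open>prod_decode\<close>; equicontinuity extends convergence to all points,
  with one subsequence for all i.\<close>

lemma equilipschitz_convergent:
  fixes f :: "nat \<Rightarrow> nat \<Rightarrow> real \<Rightarrow> real"
  assumes lip: "\<And>i k. (c i)-lipschitz_on A (f i k)" and B: "\<And>i k s. s \<in> A \<Longrightarrow> \<bar>f i k s\<bar> \<le> B i"
  obtains r where "strict_mono r" "\<And>i s. s \<in> A \<Longrightarrow> convergent (\<lambda>k. f i (r k) s)"
proof (cases "A = {}")
  case False
  obtain T where T: "countable T" "T \<subseteq> A" "A \<subseteq> closure T" by (rule separable[of A])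
  with False have "T \<noteq> {}" by auto
  then have R: "range (from_nat_into T) = T" using T(1) by simp
  define a where "a n k = f (fst (prod_decode n)) k (from_nat_into T (snd (prod_decode n)))" for n k
  have "bounded (range (a n))" for n
    unfolding bounded_iff
  proof (intro exI ballI)
    fix y assume "y \<in> range (a n)"
    then show "norm y \<le> B (fst (prod_decode n))" 
      by (auto simp: a_def intro!: B subsetD[OF T(2)] from_nat_into[OF \<open>T \<noteq> {}\<close>])
  qed
  then obtain r where r: "strict_mono r" "\<And>n. convergent (\<lambda>k. a n (r k))" by (rule diagonal_convergent) (rule that)
  have dense: "convergent (\<lambda>k. f i (r k) p)" if p: "p \<in> T" for i p
  proof -
    obtain m where "p = from_nat_into T m" using p R by (metis rangeE)
    then show ?thesis using r(2)[of "prod_encode (i, m)"] by (simp add: a_def)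
  qed
  show thesis
  proof (rule that[OF r(1)])
    fix i s assume s: "s \<in> A"
    have c0: "0 \<le> c i" using lipschitz_on_nonneg[OF lip] .
    have "Cauchy (\<lambda>k. f i (r k) s)"
    proof (rule metric_CauchyI)
      fix e :: real assume e: "0 < e"
      define d where "d = e / (3 * (c i + 1))"
      have d: "0 < d" "c i * d < e / 3" using e c0 by (auto simp: d_def field_simps)
      obtain p where p: "p \<in> T" "dist p s < d" using T(3) s d(1) closure_approachable by blast
      have "Cauchy (\<lambda>k. f i (r k) p)" using dense[OF p(1)] by (rule convergent_Cauchy)
      then obtain N where N: "\<And>m n. N \<le> m \<Longrightarrow> N \<le> n \<Longrightarrow> dist (f i (r m) p) (f i (r n) p) < e / 3"
        using e unfolding Cauchy_def by (metis divide_pos_pos zero_less_numeral)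
      have near: "dist (f i k s) (f i k p) < e / 3" for k
      proof -
        have "dist (f i k s) (f i k p) \<le> c i * dist s p" using lipschitz_onD[OF lip s] p(1) T(2) by blast
        also have "\<dots> \<le> c i * d" using p(2) c0 by (intro mult_left_mono) (auto simp: dist_commute)
        finally show ?thesis using d(2) by linarith
      qed
      show "\<exists>N. \<forall>m\<ge>N. \<forall>n\<ge>N. dist (f i (r m) s) (f i (r n) s) < e"
      proof (intro exI[of _ N] allI impI)
        fix m n assume "N \<le> m" "N \<le> n"
        then show "dist (f i (r m) s) (f i (r n) s) < e"
          using N[of m n] near[of "r m"] near[of "r n"] unfolding dist_real_def by linarith
      qed
    qed
    then show "convergent (\<lambda>k. f i (r k) s)" by (rule Cauchy_convergent)
  qed
qed (use that[of id] in \<open>auto simp: strict_mono_def\<close>)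

text \<open>Points at which the distance stays above e accumulate in the compact interval, and
  \<open>lipschitz_moving_tendsto\<close> gives convergence along them.\<close>

lemma equilipschitz_uniform:
  fixes f :: "nat \<Rightarrow> real \<Rightarrow> 'a::metric_space"
  assumes lip: "\<And>k. c-lipschitz_on {a..b} (f k)" and g: "c-lipschitz_on {a..b} g" and pt: "\<And>s. s \<in> {a..b} \<Longrightarrow> (\<lambda>k. f k s) \<longlonglongrightarrow> g s"
  shows "uniform_limit {a..b} f g sequentially"
proof (rule ccontr)
  assume "\<not> ?thesis"
  then obtain e where e: "0 < e" "\<And>N. \<exists>k\<ge>N. \<exists>s\<in>{a..b}. e \<le> dist (f k s) (g s)"
    unfolding uniform_limit_sequentially_iff by (meson not_less)
  then obtain \<kappa> s where *: "\<And>N. N \<le> \<kappa> N" "\<And>N. s N \<in> {a..b}" "\<And>N. e \<le> dist (f (\<kappa> N) (s N)) (g (s N))" by metis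
  obtain l \<rho> where l: "l \<in> {a..b}" "strict_mono \<rho>" "(s \<circ> \<rho>) \<longlonglongrightarrow> l"
    using compact_Icc[of a b] *(2) unfolding compact_eq_seq_compact_metric seq_compact_def by metis
  have \<kappa>: "filterlim (\<kappa> \<circ> \<rho>) sequentially sequentially"
    by (rule filterlim_at_top_mono[OF filterlim_subseq[OF l(2)]]) (use *(1) in \<open>auto intro: always_eventually\<close>)
  have "(\<lambda>j. f ((\<kappa> \<circ> \<rho>) j) ((s \<circ> \<rho>) j)) \<longlonglongrightarrow> g l"
    by (rule lipschitz_moving_tendsto[OF lip pt[OF l(1)] _ l(3,1) \<kappa>]) (use *(2) in simp)
  moreover have "(\<lambda>j. g ((s \<circ> \<rho>) j)) \<longlonglongrightarrow> g l"
    by (rule continuous_on_tendsto_compose[OF lipschitz_on_continuous_on[OF g] l(3,1)]) (use *(2) in auto)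
  ultimately have "(\<lambda>j. dist (f ((\<kappa> \<circ> \<rho>) j) ((s \<circ> \<rho>) j)) (g ((s \<circ> \<rho>) j))) \<longlonglongrightarrow> dist (g l) (g l)" by (rule tendsto_dist)
  then have "(\<lambda>j. dist (f ((\<kappa> \<circ> \<rho>) j) ((s \<circ> \<rho>) j)) (g ((s \<circ> \<rho>) j))) \<longlonglongrightarrow> 0" by simp
  then have "e \<le> 0" by (rule tendsto_lowerbound) (use *(3) in \<open>auto intro: always_eventually\<close>)
  then show False using e(1) by simp
qed

text \<open>Norming functionals of the larger space, composed with the injective embedding, separate
  the points of the smaller one, so \<open>weak_limit_exists\<close> applies there.\<close>

lemma embedded_weak_limit:
  fixes i :: "'e::real_normed_vector \<Rightarrow>\<^sub>L 'a::real_normed_vector" and y :: "nat \<Rightarrow> 'e"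
  assumes refl: "reflexive_space TYPE('e)" and inj: "inj (blinfun_apply i)"
    and \<phi>: "\<And>x e. 0 < e \<Longrightarrow> \<exists>n. norm x - e < blinfun_apply (\<phi> n) x"
    and B: "\<And>n. norm (y n) \<le> B" and conv: "\<And>j::nat. convergent (\<lambda>n. blinfun_apply (\<phi> j) (blinfun_apply i (y n)))"
  obtains l where "weak_conv y l" "norm l \<le> B"
proof (rule weak_limit_exists[OF refl, of "range (\<lambda>j. \<phi> j o\<^sub>L i)" y B])
  fix x assume x: "\<And>f. f \<in> range (\<lambda>j. \<phi> j o\<^sub>L i) \<Longrightarrow> blinfun_apply f x = 0"
  have "blinfun_apply (\<phi> j) (blinfun_apply i x) = 0" for j using x[of "\<phi> j o\<^sub>L i"] by simp
  then have "blinfun_apply i x = 0" by (rule norming_imp_separating[of \<phi>, rotated]) (erule \<phi>)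
  then show "x = 0" using injD[OF inj, of x 0] by (simp add: blinfun.zero_right)
qed (use B conv that in auto)

text \<open>The weak limit in the smaller space is identified by its image in the larger
  one.\<close>

lemma embedded_weak_conv:
  fixes i :: "'e::real_normed_vector \<Rightarrow>\<^sub>L 'a::real_normed_vector" and y :: "nat \<Rightarrow> 'e"
  assumes refl: "reflexive_space TYPE('e)" and inj: "inj (blinfun_apply i)"
    and \<phi>: "\<And>x e. 0 < e \<Longrightarrow> \<exists>n. norm x - e < blinfun_apply (\<phi> n) x"
    and B: "\<And>n. norm (y n) \<le> B"
    and conv: "\<And>j::nat. (\<lambda>n. blinfun_apply (\<phi> j) (blinfun_apply i (y n))) \<longlonglongrightarrow> blinfun_apply (\<phi> j) (blinfun_apply i l)"
  shows "weak_conv y l"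
proof -
  obtain l' where l': "weak_conv y l'" "norm l' \<le> B"
    by (rule embedded_weak_limit[where i = i and \<phi> = \<phi> and y = y and B = B, OF refl inj]) (erule \<phi>, rule B, rule convergentI[OF conv], rule that)
  have "blinfun_apply (\<phi> j) (blinfun_apply i l - blinfun_apply i l') = 0" for j
  proof -
    have "(\<lambda>n. blinfun_apply (\<phi> j) (blinfun_apply i (y n))) \<longlonglongrightarrow> blinfun_apply (\<phi> j) (blinfun_apply i l')"
      using weak_conv_blinfun[OF l'(1), of i] by (simp add: weak_conv_def)
    from LIMSEQ_unique[OF conv this] show ?thesis by (simp add: blinfun.diff_right)
  qed
  then have "blinfun_apply i l - blinfun_apply i l' = 0" by (rule norming_imp_separating[of \<phi>, rotated]) (erule \<phi>)
  then have "l = l'" using injD[OF inj] by simp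
  with l'(1) show ?thesis by simp
qed

section \<open>Uniform bounds and extraction of the limit curve\<close>

locale solution_family = rate_setting P
  for P :: "('u::{banach,second_countable_topology}, 'z::{banach,second_countable_topology},
               'ue::banach, 'ze::banach, 'zri::{banach,second_countable_topology}) rate_system" +
  fixes \<epsilon> :: "nat \<Rightarrow> real" and qv :: "nat \<Rightarrow> real \<Rightarrow> 'u \<times> 'z" and q0 :: "'u \<times> 'z" and tk :: "nat \<Rightarrow> real \<Rightarrow> real" and S C E0 :: real
  assumes chain: "H_chain_param P" and eps0: "\<epsilon> \<longlonglongrightarrow> 0"
    and sol: "\<And>k. rescaled_solution P (\<epsilon> k) (qv k) (tk k) S C E0"
    and start: "q0 \<in> Dom P" "(\<lambda>k. qv k 0) \<longlonglongrightarrow> q0" "(\<lambda>k. En P 0 (qv k 0)) \<longlonglongrightarrow> En P 0 q0"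
begin

sublocale sol: rescaled_solution P "\<epsilon> k" "qv k" "tk k" S C E0 for k by (rule sol)

abbreviation "qk k \<equiv> qv k \<circ> tk k"

lemma Esup_bound: obtains M where "\<And>k s. s \<in> {0..S} \<Longrightarrow> Esup P (qk k s) \<le> ereal M"
proof -
  obtain K where K: "0 < K" "\<And>q t. q \<in> Dom P \<Longrightarrow> t \<in> {0..horizon P} \<Longrightarrow> \<bar>dtE P t q\<bar> \<le> K * en t q"
    by (rule power_bound) (rule that)
  show thesis
    by (rule that[of "exp (K * horizon P) * (exp (K * horizon P) * E0)"])
      (unfold comp_apply, rule sol.Esup_qv[OF K sol.tau_in])
qed

text \<open>The initial values converge and are thus bounded, and the Lipschitz constant C is common
  to all k.\<close>

lemma curve_bound: obtains b where "\<And>k s. s \<in> {0..S} \<Longrightarrow> norm (fst (qk k s)) \<le> b" "\<And>k s. s \<in> {0..S} \<Longrightarrow> norm (snd (qk k s)) \<le> b"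
proof -
  have "Bseq (\<lambda>k. qv k 0)" by (rule convergent_imp_Bseq[OF convergentI[OF start(2)]])
  then obtain b0 where b0: "\<forall>k. norm (qv k 0) \<le> b0" unfolding Bseq_def by blast
  have le: "norm (f (qk k s)) \<le> b0 + C * S" if s: "s \<in> {0..S}" and lip: "C-lipschitz_on {0..S} (f \<circ> qk k)"
    and f: "\<And>x. norm (f x) \<le> norm x" for k s and f :: "'u \<times> 'z \<Rightarrow> 'b::real_normed_vector"
  proof -
    have "norm (f (qk k s)) \<le> norm (f (qk k 0)) + norm (f (qk k s) - f (qk k 0))" using norm_triangle_sub by blast
    also have "norm (f (qk k 0)) \<le> b0" using f[of "qk k 0"] b0 sol.tau_ends(1) by (simp add: order_trans)
    also have "norm (f (qk k s) - f (qk k 0)) \<le> C * \<bar>s - 0\<bar>"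
      using lipschitz_onD[OF lip s, of 0] sol.S by (simp add: dist_norm)
    also have "C * \<bar>s - 0\<bar> \<le> C * S" using s sol.C by (intro mult_left_mono) auto
    finally show ?thesis by simp
  qed
  have fs: "norm (fst x) \<le> norm x" "norm (snd x) \<le> norm x" for x :: "'u \<times> 'z"
    using norm_fst_le[of "fst x" "snd x"] norm_snd_le[of "snd x" "fst x"] by simp_all
  show thesis
    by (rule that[of "b0 + C * S"]) (erule le[OF _ sol.u_lipschitz fs(1)], erule le[OF _ sol.z_lipschitz fs(2)])
qed

text \<open>Preimages exist because \<open>Dom P\<close> lies in the range of the embedding. They
  are bounded because \<open>?R\<close> bounds \<open>Esup\<close> plus the norm in U and Z_ri, the
  quantity whose sublevels \<open>H_energy\<close> declares bounded in the smaller spaces.\<close>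

lemma lifted_curves:
  obtains y Y where "\<And>k s. s \<in> {0..S} \<Longrightarrow> qk k s = embQ P (y k s)" "\<And>k s. s \<in> {0..S} \<Longrightarrow> norm (y k s) \<le> Y"
proof -
  obtain M where M: "\<And>k s. s \<in> {0..S} \<Longrightarrow> Esup P (qk k s) \<le> ereal M" by (rule Esup_bound) (rule that)
  obtain b where b: "\<And>k s. s \<in> {0..S} \<Longrightarrow> norm (fst (qk k s)) \<le> b" "\<And>k s. s \<in> {0..S} \<Longrightarrow> norm (snd (qk k s)) \<le> b" by (rule curve_bound) (rule that)
  define y where "y k s = (SOME x. qk k s = embQ P x)" for k s
  have y: "qk k s = embQ P (y k s)" if "s \<in> {0..S}" for k s
  proof -
    have "qk k s \<in> range (embQ P)" using Esup_Dom(1)[OF M[OF that], of k] energy unfolding H_energy_def by blast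
    then have "\<exists>x. qk k s = embQ P x" by (auto simp only: image_iff)
    then show ?thesis unfolding y_def by (rule someI_ex)
  qed
  let ?R = "M + (b + norm (embZri P) * b)"
  have "bounded {x. Esup P (embQ P x) + ereal (norm (fst (embQ P x), embZri P (snd (embQ P x)))) \<le> ereal ?R}"
    using energy unfolding H_energy_def by blast
  then obtain Y where Y: "\<And>x. Esup P (embQ P x) + ereal (norm (fst (embQ P x), embZri P (snd (embQ P x)))) \<le> ereal ?R \<Longrightarrow> norm x \<le> Y"
    unfolding bounded_iff by blast
  show thesis
  proof (rule that[OF y])
    fix k s assume s: "s \<in> {0..S}"
    have "norm (fst (qk k s), embZri P (snd (qk k s))) \<le> norm (fst (qk k s)) + norm (embZri P (snd (qk k s)))" by (rule norm_Pair_le)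
    also have "norm (embZri P (snd (qk k s))) \<le> norm (embZri P) * norm (snd (qk k s))" by (rule norm_blinfun)
    also have "\<dots> \<le> norm (embZri P) * b" by (intro mult_left_mono b(2)[OF s]) simp
    finally have n: "norm (fst (qk k s), embZri P (snd (qk k s))) \<le> b + norm (embZri P) * b" using b(1)[OF s, of k] by linarith
    have "Esup P (qk k s) + ereal (norm (fst (qk k s), embZri P (snd (qk k s)))) \<le> ereal M + ereal (b + norm (embZri P) * b)"
      by (intro add_mono M[OF s]) (use n in simp)
    then show "norm (y k s) \<le> Y" using Y[of "y k s"] y[OF s, of k] by simp
  qed
qed

text \<open>For fixed \<eta> the smallness conditions of \<open>bounded_forces\<close> hold from
  some index on; the radius 1 in the subgradient bounds is the one assumed there.\<close>

lemma bounded_forces_eventually: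
  assumes \<eta>: "0 < \<eta>"
  shows "\<exists>K k0. \<forall>k\<ge>k0. AE s in lebesgue_on {0..S}. \<eta> \<le> deriv (tk k) s \<longrightarrow>
      (\<exists>\<mu> \<zeta>. (\<mu>, \<zeta>) \<in> frechet_subdiff P (tk k s) (qk k s) \<and> norm \<mu> \<le> K \<and> norm \<zeta> \<le> K)"
proof -
  obtain Ku where Ku: "\<And>v \<xi>. norm v \<le> 1 \<Longrightarrow> \<xi> \<in> convex_subdiff (Vu P) v \<Longrightarrow> norm \<xi> \<le> Ku"
    by (rule viscous_subdiff_bounded[OF Vu, of 1]) (rule that)
  obtain Kz where Kz: "\<And>v \<xi>. norm v \<le> 1 \<Longrightarrow> \<xi> \<in> convex_subdiff (Vz P) v \<Longrightarrow> norm \<xi> \<le> Kz"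
    by (rule viscous_subdiff_bounded[OF Vz, of 1]) (rule that)
  obtain KR where KR: "\<And>v \<xi>. \<xi> \<in> convex_subdiff (RZ P) v \<Longrightarrow> norm \<xi> \<le> KR" by (rule RZ_subdiff_bounded) (rule that)
  have "(\<lambda>k. \<epsilon> k powr expo P) \<longlonglongrightarrow> 0"
    using tendsto_powr'[OF eps0 tendsto_const, of "expo P"] sol.eps spaces by (simp add: H_spaces_def always_eventually less_imp_le)
  from tendsto_mult_right[OF this, of C] tendsto_mult_right[OF eps0, of C]
  have "(\<lambda>k. \<epsilon> k powr expo P * C) \<longlonglongrightarrow> 0" "(\<lambda>k. \<epsilon> k * C) \<longlonglongrightarrow> 0" by simp_all
  then have "\<forall>\<^sub>F k in sequentially. \<epsilon> k powr expo P * C < \<eta> \<and> \<epsilon> k * C < \<eta>"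
    using \<eta> by (intro eventually_conj order_tendstoD(2))
  then obtain k0 where k0: "\<And>k. k0 \<le> k \<Longrightarrow> \<epsilon> k powr expo P * C < \<eta> \<and> \<epsilon> k * C < \<eta>" unfolding eventually_sequentially by blast
  show ?thesis
  proof (intro exI[of _ "max Ku (KR + Kz)"] exI[of _ k0] allI impI)
    fix k assume "k0 \<le> k"
    then have "AE s in lebesgue_on {0..S}. \<eta> \<le> deriv (tk k) s \<longrightarrow>
      (\<exists>\<mu> \<zeta>. (\<mu>, \<zeta>) \<in> frechet_subdiff P (tk k s) (qk k s) \<and> norm \<mu> \<le> Ku \<and> norm \<zeta> \<le> KR + Kz)"
      using k0[of k] by (intro sol.bounded_forces[OF Ku Kz KR \<eta>]) auto
    then show "AE s in lebesgue_on {0..S}. \<eta> \<le> deriv (tk k) s \<longrightarrow>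
      (\<exists>\<mu> \<zeta>. (\<mu>, \<zeta>) \<in> frechet_subdiff P (tk k s) (qk k s) \<and> norm \<mu> \<le> max Ku (KR + Kz) \<and> norm \<zeta> \<le> max Ku (KR + Kz))"
      by eventually_elim (meson max.coboundedI1 max.coboundedI2)
  qed
qed

definition Fs :: "nat \<Rightarrow> real \<Rightarrow> real" where "Fs k s = (LINT r:{0..s}|lebesgue. sol.Mr k r)"

lemma Fs_density: "AE s in lebesgue_on {0..S}. 0 \<le> sol.Mr k s \<and> sol.Mr k s \<le> C"
  using sol.bound_ae[of k] by (rule eventually_mono) blast

lemmas Fs_primitive = bounded_density_primitive[OF sol.Mr_integrable Fs_density less_imp_le[OF sol.C], folded Fs_def]

text \<open>One subsequence has to work for all parameters s. It is extracted from the countable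
  scalar family \<open>f\<close>; for each s, convergence under the norming functionals and the
  bound Y on the lifts then give weak limits \<open>gu s\<close> and \<open>gz s\<close> in the
  smaller spaces, and q is defined from these.\<close>

theorem limit_curve:
  obtains r t q F M where "strict_mono r"
    "limit_setting P (\<lambda>k. \<epsilon> (r k)) (\<lambda>k. tk (r k)) (\<lambda>k. qk (r k)) (\<lambda>k. sol.Mr (r k)) S C M t q F"
    "weakly_continuous_in (embQ P) {0..S} q"
    "\<And>s. s \<in> {0..S} \<Longrightarrow> weak_conv_in (embU P) (\<lambda>k. fst (qk (r k) s)) (fst (q s))"
    "\<And>s. s \<in> {0..S} \<Longrightarrow> weak_conv_in (embZ P) (\<lambda>k. snd (qk (r k) s)) (snd (q s))"
proof -
  obtain M where M: "\<And>k s. s \<in> {0..S} \<Longrightarrow> Esup P (qk k s) \<le> ereal M" by (rule Esup_bound) (rule that)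
  obtain b where b: "\<And>k s. s \<in> {0..S} \<Longrightarrow> norm (fst (qk k s)) \<le> b" "\<And>k s. s \<in> {0..S} \<Longrightarrow> norm (snd (qk k s)) \<le> b" by (rule curve_bound) (rule that)
  obtain y Y where y: "\<And>k s. s \<in> {0..S} \<Longrightarrow> qk k s = embQ P (y k s)" "\<And>k s. s \<in> {0..S} \<Longrightarrow> norm (y k s) \<le> Y"
    by (rule lifted_curves) (rule that)
  obtain \<phi> :: "nat \<Rightarrow> 'u dual" where \<phi>: "\<And>n. norm (\<phi> n) \<le> 1" "\<And>x e. 0 < e \<Longrightarrow> \<exists>n. norm x - e < blinfun_apply (\<phi> n) x"
    by (rule norming_sequence) (rule that)
  obtain \<psi> :: "nat \<Rightarrow> 'z dual" where \<psi>: "\<And>n. norm (\<psi> n) \<le> 1" "\<And>x e. 0 < e \<Longrightarrow> \<exists>n. norm x - e < blinfun_apply (\<psi> n) x"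
    by (rule norming_sequence) (rule that)
  note S = sol.S and C = sol.C
  \<comment> \<open>The rescaling has index 0 and the primitive of the density index 1; the norming
    functionals j of the u-component sit at 2j + 2, those of the z-component at 2j + 3, whence
    \<open>i div 2 - 1\<close>. All members are C-Lipschitz.\<close>
  define f where "f i k s = (if i = 0 then tk k s else if i = 1 then Fs k s
    else if even i then blinfun_apply (\<phi> (i div 2 - 1)) ((fst \<circ> qk k) s) else blinfun_apply (\<psi> (i div 2 - 1)) ((snd \<circ> qk k) s))" for i :: nat and k s
  have one: "C-lipschitz_on A (\<lambda>s. blinfun_apply \<xi> (x s))" if "norm \<xi> \<le> 1" "C-lipschitz_on A x" for A x and \<xi> :: "'b::real_normed_vector dual"
    by (rule lipschitz_on_mono[OF blinfun_lipschitz[OF that(2)]]) (use that(1) C in \<open>auto intro: mult_left_le_one_le\<close>)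
  have f_lip: "C-lipschitz_on {0..S} (f i k)" for i k
    using sol.tau_lipschitz[of k] Fs_primitive(3)[of k] one[OF \<phi>(1) sol.u_lipschitz[of k]] one[OF \<psi>(1) sol.z_lipschitz[of k]]
    by (cases "i = 0"; cases "i = 1"; cases "even i") (simp_all add: f_def[abs_def])
  have f_0: "\<bar>f i k 0\<bar> \<le> \<bar>b\<bar>" for i k
  proof -
    have z: "(0::real) \<in> {0..S}" using S by simp
    have n: "\<bar>blinfun_apply \<xi> x\<bar> \<le> \<bar>b\<bar>" if "norm \<xi> \<le> 1" "norm x \<le> b" for \<xi> :: "'b::real_normed_vector dual" and x
    proof -
      have "norm (blinfun_apply \<xi> x) \<le> norm \<xi> * norm x" by (rule norm_blinfun)
      also have "\<dots> \<le> 1 * norm x" using that(1) by (intro mult_right_mono) auto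
      finally show ?thesis using that(2) by simp
    qed
    show ?thesis using n[OF \<phi>(1) b(1)[OF z]] n[OF \<psi>(1) b(2)[OF z]] sol.tau_ends(1) Fs_primitive(4)[OF less_imp_le[OF S]] by (auto simp: f_def)
  qed
  have f_bound: "\<bar>f i k s\<bar> \<le> \<bar>b\<bar> + C * S" if s: "s \<in> {0..S}" for i k s
  proof -
    have "\<bar>f i k s - f i k 0\<bar> \<le> C * \<bar>s - 0\<bar>" using lipschitz_onD[OF f_lip s, of 0 i k] S by (simp add: dist_real_def)
    also have "\<dots> \<le> C * S" using s C by (intro mult_left_mono) auto
    finally show ?thesis using f_0[of i k] by linarith
  qed
  obtain r where r: "strict_mono r" "\<And>i s. s \<in> {0..S} \<Longrightarrow> convergent (\<lambda>k. f i (r k) s)"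
    by (rule equilipschitz_convergent[OF f_lip f_bound]) (assumption, rule that)
  have conv_u: "convergent (\<lambda>k. blinfun_apply (\<phi> j) (fst (qk (r k) s)))" if "s \<in> {0..S}" for j s
    using r(2)[OF that, of "2 * j + 2"] by (simp add: f_def)
  have conv_z: "convergent (\<lambda>k. blinfun_apply (\<psi> j) (snd (qk (r k) s)))" if "s \<in> {0..S}" for j s
    using r(2)[OF that, of "2 * j + 3"] by (simp add: f_def)
  have yq: "fst (qk k s) = embU P (fst (y k s))" "snd (qk k s) = embZ P (snd (y k s))" if "s \<in> {0..S}" for k s
    using y(1)[OF that, of k] by (simp_all add: embQ_def prod_eq_iff)
  have yY: "norm (fst (y k s)) \<le> Y" "norm (snd (y k s)) \<le> Y" if "s \<in> {0..S}" for k s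
    
    using y(2)[OF that, of k] norm_fst_le[of "fst (y k s)" "snd (y k s)"] norm_snd_le[of "snd (y k s)" "fst (y k s)"] by simp_all
  have sp: "reflexive_space TYPE('ue)" "reflexive_space TYPE('ze)" "inj (blinfun_apply (embU P))" "inj (blinfun_apply (embZ P))" "compact_operator (embZ P)"
    using spaces by (simp_all add: H_spaces_def dense_embedding_def)
  have "\<exists>l. s \<in> {0..S} \<longrightarrow> weak_conv (\<lambda>k. fst (y (r k) s)) l \<and> norm l \<le> Y" for s
  proof (cases "s \<in> {0..S}")
    case True
    obtain l where "weak_conv (\<lambda>k. fst (y (r k) s)) l" "norm l \<le> Y"
      by (rule embedded_weak_limit[where y = "\<lambda>k. fst (y (r k) s)" and B = Y and \<phi> = \<phi>, OF sp(1,3)])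
        (erule \<phi>(2), rule yY(1)[OF True], rule conv_u[OF True, unfolded yq(1)[OF True]], rule that)
    then show ?thesis by blast
  qed auto
  then obtain gu where gu: "\<And>s. s \<in> {0..S} \<Longrightarrow> weak_conv (\<lambda>k. fst (y (r k) s)) (gu s)" "\<And>s. s \<in> {0..S} \<Longrightarrow> norm (gu s) \<le> Y" by metis
  have "\<exists>l. s \<in> {0..S} \<longrightarrow> weak_conv (\<lambda>k. snd (y (r k) s)) l \<and> norm l \<le> Y" for s
  proof (cases "s \<in> {0..S}")
    case True
    obtain l where "weak_conv (\<lambda>k. snd (y (r k) s)) l" "norm l \<le> Y"
      by (rule embedded_weak_limit[where y = "\<lambda>k. snd (y (r k) s)" and B = Y and \<phi> = \<psi>, OF sp(2,4)])
        (erule \<psi>(2), rule yY(2)[OF True], rule conv_z[OF True, unfolded yq(2)[OF True]], rule that)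
    then show ?thesis by blast
  qed auto
  then obtain gz where gz: "\<And>s. s \<in> {0..S} \<Longrightarrow> weak_conv (\<lambda>k. snd (y (r k) s)) (gz s)" "\<And>s. s \<in> {0..S} \<Longrightarrow> norm (gz s) \<le> Y" by metis
  define q where "q s = (blinfun_apply (embU P) (gu s), blinfun_apply (embZ P) (gz s))" for s
  define t where "t s = lim (\<lambda>k. tk (r k) s)" for s
  define F where "F s = lim (\<lambda>k. Fs (r k) s)" for s
  have u_lim: "weak_conv (\<lambda>k. fst (qk (r k) s)) (fst (q s))" if "s \<in> {0..S}" for s
    using weak_conv_blinfun[OF gu(1)[OF that], of "embU P"] yq(1)[OF that] by (simp add: q_def)
  have z_lim: "(\<lambda>k. snd (qk (r k) s)) \<longlonglongrightarrow> snd (q s)" if "s \<in> {0..S}" for s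
    using compact_operator_weak_conv[OF sp(5) gz(1)[OF that] yY(2)[OF that]] yq(2)[OF that] by (simp add: q_def)
  have lims: "(\<lambda>k. tk (r k) s) \<longlonglongrightarrow> t s" "(\<lambda>k. Fs (r k) s) \<longlonglongrightarrow> F s" if "s \<in> {0..S}" for s
    using r(2)[OF that, of 0] r(2)[OF that, of 1] by (simp_all add: f_def t_def F_def convergent_LIMSEQ_iff)
  \<comment> \<open>Links the limit curve to the prescribed initial datum, so that the assumed
    convergence of the initial energies becomes the assumption \<open>init\<close> for q.\<close>
  have q_0: "q 0 = q0"
  proof -
    have z: "(0::real) \<in> {0..S}" using S by simp
    have s0: "(\<lambda>k. qv (r k) 0) \<longlonglongrightarrow> q0" using LIMSEQ_subseq_LIMSEQ[OF start(2) r(1)] by (simp add: comp_def)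
    have "fst (q 0) = fst q0"
      using weak_conv_unique[OF u_lim[OF z] LIMSEQ_imp_weak_conv[of _ "fst q0"]] tendsto_fst[OF s0] sol.tau_ends(1) by simp
    moreover have "snd (q 0) = snd q0" using LIMSEQ_unique[OF z_lim[OF z]] tendsto_snd[OF s0] sol.tau_ends(1) by simp
    ultimately show ?thesis by (simp add: prod_eq_iff)
  qed
  have init: "(\<lambda>k. en 0 (qk (r k) 0)) \<longlonglongrightarrow> en 0 (q 0)"
  proof -
    have z: "0 \<in> {0..horizon P}" using T_pos by simp
    have "(\<lambda>k. En P 0 (qv (r k) 0)) \<longlonglongrightarrow> ereal (en 0 q0)"
      using LIMSEQ_subseq_LIMSEQ[OF start(3) r(1)] Dom_energy(1)[OF start(1) z] by (simp add: comp_def)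
    from lim_real_of_ereal[OF this] show ?thesis by (simp add: en_def q_0 sol.tau_ends(1))
  qed
  interpret lim: limit_setting P "\<lambda>k. \<epsilon> (r k)" "\<lambda>k. tk (r k)" "\<lambda>k. qk (r k)" "\<lambda>k. sol.Mr (r k)" S C M t q F
  proof
    show "H_chain_param P" by (rule chain)
    show "(\<lambda>k. \<epsilon> (r k)) \<longlonglongrightarrow> 0" using LIMSEQ_subseq_LIMSEQ[OF eps0 r(1)] by (simp add: comp_def)
    show "AE s in lebesgue_on {0..S}. 0 < deriv (tk (r k)) s \<and> deriv (tk (r k)) s \<le> C \<and> frechet_subdiff P (tk (r k) s) (qk (r k) s) \<noteq> {} \<and>
      M_eps P (\<epsilon> (r k)) (tk (r k) s) (qk (r k) s) (deriv (tk (r k)) s) (velocity (qk (r k)) s) = ereal (sol.Mr (r k) s) \<and> 0 \<le> sol.Mr (r k) s \<and> sol.Mr (r k) s \<le> C" for k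
      using sol.bound_ae by (rule eventually_mono) blast
    show "\<exists>K k0. \<forall>k\<ge>k0. AE s in lebesgue_on {0..S}. \<eta> \<le> deriv (tk (r k)) s \<longrightarrow>
      (\<exists>\<mu> \<zeta>. (\<mu>, \<zeta>) \<in> frechet_subdiff P (tk (r k) s) (qk (r k) s) \<and> norm \<mu> \<le> K \<and> norm \<zeta> \<le> K)" if "0 < \<eta>" for \<eta>
      using bounded_forces_eventually[OF that] order_trans[OF _ seq_suble[OF r(1)]] by meson
    show "en (tk (r k) s) (qk (r k) s) + (LINT s:{0..s}|lebesgue. sol.Mr (r k) s)
      \<le> en 0 (qk (r k) 0) + (LINT r':{0..s}|lebesgue. dtE P (tk (r k) r') (qk (r k) r') * deriv (tk (r k)) r')" if "s \<in> {0..S}" for k s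
      using sol.rescaled_energy_inequality[of s "r k"] that sol.tau_ends(1)[of "r k"] by simp
    show "(\<lambda>k. LINT r':{0..s}|lebesgue. sol.Mr (r k) r') \<longlonglongrightarrow> F s" if "s \<in> {0..S}" for s using lims(2)[OF that] by (simp add: Fs_def)
  qed (use sol.eps S C sol.mono sol.tau_lipschitz sol.tau_in sol.tau_ends(1) sol.u_lipschitz sol.z_lipschitz M sol.Mr_integrable init u_lim z_lim lims in auto)
  show thesis
  proof (rule that[OF r(1) lim.limit_setting_axioms])
    show "weak_conv_in (embU P) (\<lambda>k. fst (qk (r k) s)) (fst (q s))" if "s \<in> {0..S}" for s
      unfolding weak_conv_in_def using gu(1)[OF that] yq(1)[OF that] by (intro exI[of _ "\<lambda>k. fst (y (r k) s)"] exI[of _ "gu s"]) (simp add: q_def)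
    show "weak_conv_in (embZ P) (\<lambda>k. snd (qk (r k) s)) (snd (q s))" if "s \<in> {0..S}" for s
      unfolding weak_conv_in_def using gz(1)[OF that] yq(2)[OF that] by (intro exI[of _ "\<lambda>k. snd (y (r k) s)"] exI[of _ "gz s"]) (simp add: q_def)
    \<comment> \<open>Norm continuity of q in U and Z and the bound Y on the lifts give weak
      continuity of the lifts in the smaller spaces.\<close>
    have wc: "weak_conv (\<lambda>n. (gu (s n), gz (s n))) (gu l, gz l)" if s: "\<And>n. s n \<in> {0..S}" "l \<in> {0..S}" "s \<longlonglongrightarrow> l" for s l
      unfolding weak_conv_Pair
    proof
      have "(\<lambda>n. (fst \<circ> q) (s n)) \<longlonglongrightarrow> (fst \<circ> q) l" "(\<lambda>n. (snd \<circ> q) (s n)) \<longlonglongrightarrow> (snd \<circ> q) l"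
        using continuous_on_tendsto_compose[OF lipschitz_on_continuous_on[OF lim.u_lip] s(3,2)]
          continuous_on_tendsto_compose[OF lipschitz_on_continuous_on[OF lim.z_lip] s(3,2)] s(1) by simp_all
      then have c: "(\<lambda>n. embU P (gu (s n))) \<longlonglongrightarrow> embU P (gu l)" "(\<lambda>n. embZ P (gz (s n))) \<longlonglongrightarrow> embZ P (gz l)" by (simp_all add: q_def)
      show "weak_conv (\<lambda>n. gu (s n)) (gu l)"
        by (rule embedded_weak_conv[where \<phi> = \<phi> and B = Y, OF sp(1,3)]) (erule \<phi>(2), rule gu(2)[OF s(1)], rule blinfun.tendsto[OF tendsto_const c(1)])
      show "weak_conv (\<lambda>n. gz (s n)) (gz l)"
        by (rule embedded_weak_conv[where \<phi> = \<psi> and B = Y, OF sp(2,4)]) (erule \<psi>(2), rule gz(2)[OF s(1)], rule blinfun.tendsto[OF tendsto_const c(2)])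
    qed
    show "weakly_continuous_in (embQ P) {0..S} q"
      unfolding weakly_continuous_in_def
    proof (intro exI[of _ "\<lambda>s. (gu s, gz s)"] conjI ballI allI)
      show "q s = embQ P (gu s, gz s)" for s by (simp add: q_def embQ_def)
      show "continuous_on {0..S} (\<lambda>s. blinfun_apply \<phi>' (gu s, gz s))" for \<phi>' :: "('ue \<times> 'ze) dual"
        unfolding continuous_on_sequentially comp_def
      proof (intro allI ballI impI)
        fix s l assume s: "l \<in> {0..S}" "(\<forall>n. s n \<in> {0..S}) \<and> s \<longlonglongrightarrow> l"
        have "weak_conv (\<lambda>n. (gu (s n), gz (s n))) (gu l, gz l)" by (rule wc) (use s in auto)
        then show "(\<lambda>n. blinfun_apply \<phi>' (gu (s n), gz (s n))) \<longlonglongrightarrow> blinfun_apply \<phi>' (gu l, gz l)" unfolding weak_conv_def by (rule spec)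
      qed
    qed
  qed
qed

end

theorem theorem5p14:
  fixes P :: "('u::{banach,second_countable_topology}, 'z::{banach,second_countable_topology},
               'ue::banach, 'ze::banach, 'zri::{banach,second_countable_topology}) rate_system"
    and \<epsilon> :: "nat \<Rightarrow> real"
    and qv :: "nat \<Rightarrow> real \<Rightarrow> 'u \<times> 'z"
    and q0 :: "'u \<times> 'z"
    and tk :: "nat \<Rightarrow> real \<Rightarrow> real"
    and qk :: "nat \<Rightarrow> real \<Rightarrow> 'u \<times> 'z"
    and S C :: real
  assumes "H_spaces P" and "H_diss P" and "H_energy P" and "H_closed P" and "H_slope P"
    and "H_chain_param P"
    and "\<And>k. \<epsilon> k > 0" and "\<epsilon> \<longlonglongrightarrow> 0"
    and "\<And>k. viscous_solution P (\<epsilon> k) (qv k)"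
    and "q0 \<in> Dom P"
    and "(\<lambda>k. qv k 0) \<longlonglongrightarrow> q0"
    and "(\<lambda>k. En P 0 (qv k 0)) \<longlonglongrightarrow> En P 0 q0"
    and "S > 0" and "C > 0"
    and "\<And>k. mono_on {0..S} (tk k)"
    and "\<And>k. tk k ` {0..S} = {0..horizon P}"
    and "\<And>k. ac_on 0 S (tk k)"
    and "\<And>k. qk k = qv k \<circ> tk k"
    and "\<And>k. AE s in lebesgue_on {0..S}.
           ereal (deriv (tk k) s)
           + M_eps P (\<epsilon> k) (tk k s) (qk k s) (deriv (tk k) s) (velocity (qk k) s)
           + ereal (norm (fst (velocity (qk k) s))) \<le> ereal C"
    and "\<And>k. AE s in lebesgue_on {0..S}. norm (snd (velocity (qk k) s)) \<le> C"
  shows "\<exists>r :: nat \<Rightarrow> nat. \<exists>t q. strict_mono r \<and> admissible_curve P 0 S t q \<and>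
    (
      t ` {0..S} \<subseteq> {0..horizon P} \<and> (\<exists>L. L-lipschitz_on {0..S} t) \<and>
      weakly_continuous_in (embQ P) {0..S} q \<and>
      (\<exists>L. L-lipschitz_on {0..S} (fst \<circ> q)) \<and>
      (\<exists>L. L-lipschitz_on {0..S} (\<lambda>s. embZri P (snd (q s)))) \<and>
      (\<exists>L. L-lipschitz_on {0..S} (snd \<circ> q))) \<and>
    (
      uniform_limit {0..S} (\<lambda>k. tk (r k)) t sequentially \<and>
      weak_star_W1inf 0 S (\<lambda>k. fst \<circ> qk (r k)) (fst \<circ> q) \<and>
      uniform_limit {0..S} (\<lambda>k. snd \<circ> qk (r k)) (snd \<circ> q) sequentially \<and>
      (\<forall>s\<in>{0..S}. weak_conv_in (embU P) (\<lambda>k. fst (qk (r k) s)) (fst (q s))) \<and>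
      (\<forall>s\<in>{0..S}. weak_conv_in (embZ P) (\<lambda>k. snd (qk (r k) s)) (snd (q s)))) \<and>
    (
      (\<forall>s\<in>{0..S}. (\<lambda>k. En P (tk (r k) s) (qk (r k) s)) \<longlonglongrightarrow> En P (t s) (q s)) \<and>
      (\<forall>s1 s2. 0 \<le> s1 \<and> s1 \<le> s2 \<and> s2 \<le> S \<longrightarrow>
         (\<lambda>k. \<integral>\<^sup>+ \<sigma>\<in>{s1..s2}. e2ennreal (M_eps P (\<epsilon> (r k)) (tk (r k) \<sigma>) (qk (r k) \<sigma>)
                  (deriv (tk (r k)) \<sigma>) (velocity (qk (r k)) \<sigma>)) \<partial>lebesgue)
         \<longlonglongrightarrow> (\<integral>\<^sup>+ \<sigma>\<in>{s1..s2}. e2ennreal (M0 P 0 S t q \<sigma>) \<partial>lebesgue))) \<and>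
    enhanced_pBV_solution P 0 S t q"
proof -
  interpret rate_setting P using assms(1-5) by unfold_locales
  have "0 \<in> {0..horizon P}" using T_pos by simp
  then have "(\<lambda>k. En P 0 (qv k 0)) \<longlonglongrightarrow> ereal (en 0 q0)" using assms(12) Dom_energy(1)[OF assms(10)] by simp
  then have "\<forall>\<^sub>F k in sequentially. En P 0 (qv k 0) < ereal (en 0 q0 + 1)" by (rule order_tendstoD(2)) simp
  \<comment> \<open>Convergence bounds the initial energies by \<open>en 0 q0 + 1\<close> only from
    some index on. The first k0 curves are dropped, and the shift reappears in the final subsequence
    \<open>r k + k0\<close>.\<close>
  then obtain k0 where k0: "\<And>k. k0 \<le> k \<Longrightarrow> En P 0 (qv k 0) \<le> ereal (en 0 q0 + 1)"
    unfolding eventually_sequentially by (meson less_imp_le)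
  have sol: "rescaled_solution P (\<epsilon> k) (qv k) (tk k) S C (en 0 q0 + 1)" if "k0 \<le> k" for k
    by unfold_locales (use assms(7,9,13-17) assms(19,20)[of k] k0[OF that] in \<open>simp_all add: assms(18)\<close>)
  interpret fam: solution_family P "\<lambda>k. \<epsilon> (k + k0)" "\<lambda>k. qv (k + k0)" q0 "\<lambda>k. tk (k + k0)" S C "en 0 q0 + 1"
    by (rule solution_family.intro[OF rate_setting_axioms], rule solution_family_axioms.intro)
      (use assms(6,10) sol LIMSEQ_ignore_initial_segment[OF assms(8)] LIMSEQ_ignore_initial_segment[OF assms(11)]
        LIMSEQ_ignore_initial_segment[OF assms(12)] in simp_all)
  have qk: "qv k \<circ> tk k = qk k" for k by (simp add: assms(18))
  obtain r t q F M where r: "strict_mono r"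
    and l: "limit_setting P (\<lambda>k. \<epsilon> (r k + k0)) (\<lambda>k. tk (r k + k0)) (\<lambda>k. qk (r k + k0)) (\<lambda>k. fam.sol.Mr (r k)) S C M t q F"
    and weak: "weakly_continuous_in (embQ P) {0..S} q"
      "\<And>s. s \<in> {0..S} \<Longrightarrow> weak_conv_in (embU P) (\<lambda>k. fst (qk (r k + k0) s)) (fst (q s))"
      "\<And>s. s \<in> {0..S} \<Longrightarrow> weak_conv_in (embZ P) (\<lambda>k. snd (qk (r k + k0) s)) (snd (q s))"
    by (rule fam.limit_curve[unfolded qk]) (rule that)
  interpret lim: limit_setting P "\<lambda>k. \<epsilon> (r k + k0)" "\<lambda>k. tk (r k + k0)" "\<lambda>k. qk (r k + k0)" "\<lambda>k. fam.sol.Mr (r k)" S C M t q F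
    by (rule l)
  obtain b where b: "\<And>k s. s \<in> {0..S} \<Longrightarrow> norm (fst (qk (k + k0) s)) \<le> b"
    by (rule fam.curve_bound[unfolded qk]) (rule that)
  have b': "norm ((fst \<circ> q) s) \<le> b" if s: "s \<in> {0..S}" for s
  proof -
    have "norm (fst (q s)) \<le> b"
    proof (rule norm_le_functional)
      fix \<phi> :: "'u dual" assume \<phi>: "norm \<phi> \<le> 1"
      have le: "blinfun_apply \<phi> (fst (qk (r k + k0) s)) \<le> b" for k
      proof -
        have "blinfun_apply \<phi> (fst (qk (r k + k0) s)) \<le> norm \<phi> * norm (fst (qk (r k + k0) s))" by (rule blinfun_le_norm)
        also have "\<dots> \<le> 1 * norm (fst (qk (r k + k0) s))" using \<phi> by (intro mult_right_mono) auto
        finally show ?thesis using b[OF s, of "r k"] by simp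
      qed
      show "blinfun_apply \<phi> (fst (q s)) \<le> b"
        by (rule tendsto_upperbound[OF lim.u_lim[OF s, unfolded weak_conv_def, rule_format, of \<phi>]]) (use le in auto)
    qed
    then show ?thesis by simp
  qed
  have star: "weak_star_W1inf 0 S (\<lambda>k. fst \<circ> qk (r k + k0)) (fst \<circ> q)"
    by (rule lipschitz_weak_star_W1inf[OF refl_u less_imp_le[OF assms(13)] lim.uk_lip lim.u_lip _ _ b'])
      (use lim.u_lim b in simp_all)
  have "uniform_limit {0..S} (\<lambda>k. tk (r k + k0)) t sequentially"
    by (rule equilipschitz_uniform[OF lim.tk_lip lim.t_lip lim.t_lim])
  moreover have "uniform_limit {0..S} (\<lambda>k. snd \<circ> qk (r k + k0)) (snd \<circ> q) sequentially"
    by (rule equilipschitz_uniform[OF lim.zk_lip lim.z_lip]) (simp add: lim.z_lim)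
  moreover have "\<exists>L. L-lipschitz_on {0..S} (\<lambda>s. embZri P (snd (q s)))"
    using blinfun_lipschitz[OF lim.z_lip, of "embZri P"] by auto
  moreover have "strict_mono (\<lambda>k. r k + k0)" using r by (simp add: strict_mono_def)
  ultimately show ?thesis
    using lim.admissible lim.t_in lim.t_lip lim.u_lip lim.z_lip weak star lim.energy_conv lim.nn_integral_M_eps_conv lim.enhanced
    by (intro exI[of _ "\<lambda>k. r k + k0"] exI[of _ t] exI[of _ q]) blast
qed

end
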